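(* Let $q$ be an odd prime, $K/\mathbb{Q}_q$ the unramified quadratic extension with quadratic character $\eta_K$ of $\mathbb{Q}_q^\times$, and $\lambda$ a character of $K^\times$ of exponential conductor $m\ge2$ with $\lambda|_{\mathbb{Q}_q^\times}=\eta_K$. Let $\pi=\pi_\lambda$ be the associated (supercuspidal) representation of $\mathrm{PGL}_2(\mathbb{Q}_q)$ (of exponential conductor $2m$), and $f\in\pi$ a newform, i.e. a nonzero vector fixed by $U_0(q^{2m})=\{\begin{pmatrix}a&b\\c&d\end{pmatrix}\in\mathrm{GL}_2(\mathbb{Z}_q):q^{2m}\mid c\}$. (a) Given $\theta$, there exists $u$ such that $\gamma_{\theta,u}\ne0$. (b) Let $\ell\ne q$ be a prime, and if $m$ is odd suppose $\log_\ell(q+1)\ge5$. Then given $\theta$, there exists $u$ such that $v_\ell\big((q^2-1)\gamma_{\theta,u}\big)=0$.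
   Context: Here $\theta\in K$ is a unit with $\bar\theta=-\theta$ (bar = nontrivial automorphism of $K/\mathbb{Q}_q$; so $\theta^2\in\mathbb{Z}_q^\times$), and $u\in\mathbb{Z}_q^\times$ satisfies $u^2\theta^2-1\in\mathbb{Z}_q^{\times2}$. The embedding $\iota=\iota_{\theta,u}:K\hookrightarrow M_2(\mathbb{Q}_q)$ is the $\mathbb{Q}_q$-algebra embedding with $\iota(\theta)=\begin{pmatrix}-u\theta^2&(1-u^2\theta^2)/q^m\\ q^m\theta^2&u\theta^2\end{pmatrix}$. With $(\ ,\ )$ a $\mathrm{PGL}_2(\mathbb{Q}_q)$-invariant non-degenerate Hermitian pairing on $\pi$ and a Haar measure on $K^\times/\mathbb{Q}_q^\times$, $$\gamma_{\theta,u}=\frac{1}{\mathrm{vol}(K^\times/\mathbb{Q}_q^\times)(f,f)}\int_{K^\times/\mathbb{Q}_q^\times}(\pi(\iota(t))f,f)\,d^\times t.$$ $v_\ell$ is the $\ell$-adic valuation (values of $\lambda$ viewed in $\mathbb{C}_\ell$ via a fixed embedding). *)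

theory Defs
  imports
    "HOL-Analysis.Analysis"
    "HOL-Algebra.Coset"
    "HOL-Computational_Algebra.Polynomial"
begin

section \<open>Fields with a \<open>p\<close>-adic absolute value\<close>

text \<open>
  The absolute value of such a field is carried by its metric.
\<close>

definition absv :: "'a::{field_char_0,metric_space} \<Rightarrow> real"
  where "absv x = dist x 0"

definition padic_valued :: "nat \<Rightarrow> 'a::{field_char_0,metric_space} itself \<Rightarrow> bool"
  where "padic_valued p _ \<longleftrightarrow>
    (\<forall>x y::'a. dist x y = absv (x - y)) \<and>
    (\<forall>x y::'a. absv (x * y) = absv x * absv y) \<and>
    (\<forall>x y::'a. absv (x + y) \<le> max (absv x) (absv y)) \<and>
    absv (of_nat p :: 'a) = 1 / real p"

text \<open>
  In a complete field with a \<open>p\<close>-adic absolute value, the closure of the rational numbers is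
  the completion of the rationals at \<open>p\<close>, i.e. the field of \<open>p\<close>-adic numbers.
\<close>

definition Qp :: "'a::{field_char_0,metric_space} set"
  where "Qp = closure \<rat>"

definition Zp :: "'a::{field_char_0,metric_space} set"
  where "Zp = {x \<in> Qp. absv x \<le> 1}"

definition Zp_units :: "'a::{field_char_0,metric_space} set"
  where "Zp_units = {x \<in> Qp. absv x = 1}"

text \<open>
  The type \<open>'a\<close> is the completion of an algebraic closure of the \<open>p\<close>-adic numbers:
  complete, algebraically closed, and the elements algebraic over the \<open>p\<close>-adic numbers are dense.
\<close>

definition complex_padic :: "nat \<Rightarrow> 'a::{field_char_0,alg_closed_field,complete_space} itself \<Rightarrow> bool"
  where "complex_padic p T \<longleftrightarrow>
    padic_valued p T \<and>
    closure {x::'a. \<exists>P. P \<noteq> 0 \<and> (\<forall>i. coeff P i \<in> Qp) \<and> poly P x = 0} = UNIV"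

definition algebraic_embedding :: "(complex \<Rightarrow> 'a::field) \<Rightarrow> bool"
  where "algebraic_embedding e \<longleftrightarrow>
    e 1 = 1 \<and>
    (\<forall>x y. algebraic x \<longrightarrow> algebraic y \<longrightarrow>
       e (x + y) = e x + e y \<and> e (x * y) = e x * e y)"

text \<open>Normalised by \<open>v p = 1\<close>; extended real valued so that \<open>v 0 = \<infinity>\<close>.\<close>

definition padic_val :: "nat \<Rightarrow> 'a::{field_char_0,metric_space} \<Rightarrow> ereal"
  where "padic_val p x = (if x = 0 then \<infinity> else ereal (- log (real p) (absv x)))"


section \<open>The unramified quadratic extension\<close>

text \<open>
  The type \<open>'k\<close> is the unramified quadratic extension \<open>K\<close> of \<open>Qp\<close> (at the prime \<open>q\<close>), and \<open>bar\<close>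
  is its nontrivial automorphism. Unramified: the value group is generated by \<open>absv q\<close>.
\<close>

definition unramified_quadratic :: "nat \<Rightarrow> ('k::{field_char_0,complete_space} \<Rightarrow> 'k) \<Rightarrow> bool"
  where "unramified_quadratic q bar \<longleftrightarrow>
    padic_valued q TYPE('k) \<and>
    (\<exists>\<alpha>::'k. \<alpha> \<notin> Qp \<and> (\<forall>x. \<exists>a\<in>Qp. \<exists>b\<in>Qp. x = a + b * \<alpha>)) \<and>
    (\<forall>x::'k. x \<noteq> 0 \<longrightarrow> (\<exists>n::int. absv x = real q powi n)) \<and>
    bij bar \<and>
    (\<forall>x y. bar (x + y) = bar x + bar y \<and> bar (x * y) = bar x * bar y) \<and>
    (\<forall>x\<in>Qp. bar x = x) \<and>
    (\<exists>x. bar x \<noteq> x)"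

definition normK :: "('k \<Rightarrow> 'k) \<Rightarrow> 'k::field \<Rightarrow> 'k"
  where "normK bar x = x * bar x"

definition traceK :: "('k \<Rightarrow> 'k) \<Rightarrow> 'k::field \<Rightarrow> 'k"
  where "traceK bar x = x + bar x"

text \<open>
  The quadratic character attached to \<open>K\<close>, for \<open>x\<close> in \<open>Qp - {0}\<close>:
  its kernel is the group of norms from \<open>K\<close>, of index two.
\<close>

definition eta :: "('k \<Rightarrow> 'k) \<Rightarrow> 'k::field \<Rightarrow> complex"
  where "eta bar x = (if x \<in> normK bar ` (- {0}) then 1 else - 1)"

definition mult_character :: "('k::{field_char_0,metric_space} \<Rightarrow> complex) \<Rightarrow> bool"
  where "mult_character \<omega> \<longleftrightarrow>
    continuous_on (- {0}) \<omega> \<and>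
    (\<forall>x. x \<noteq> 0 \<longrightarrow> \<omega> x \<noteq> 0) \<and>
    (\<forall>x y. x \<noteq> 0 \<longrightarrow> y \<noteq> 0 \<longrightarrow> \<omega> (x * y) = \<omega> x * \<omega> y)"

definition unit_filtration :: "nat \<Rightarrow> nat \<Rightarrow> 'k::{field_char_0,metric_space} set"
  where "unit_filtration q n =
    (if n = 0 then {x. absv x = 1} else {1 + of_nat q ^ n * y |y. absv y \<le> 1})"

definition exp_conductor :: "nat \<Rightarrow> ('k::{field_char_0,metric_space} \<Rightarrow> complex) \<Rightarrow> nat"
  where "exp_conductor q \<omega> = (LEAST n. \<forall>x\<in>unit_filtration q n. \<omega> x = 1)"

text \<open>Additive characters of \<open>Qp\<close> with conductor \<open>Zp\<close>.\<close>

definition unramified_add_character :: "nat \<Rightarrow> ('k::{field_char_0,metric_space} \<Rightarrow> complex) \<Rightarrow> bool"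
  where "unramified_add_character q \<psi> \<longleftrightarrow>
    (\<forall>x\<in>Qp. \<forall>y\<in>Qp. \<psi> (x + y) = \<psi> x * \<psi> y) \<and>
    (\<forall>x\<in>Qp. cmod (\<psi> x) = 1) \<and>
    (\<forall>x\<in>Zp. \<psi> x = 1) \<and>
    (\<exists>x\<in>Zp. \<psi> (x / of_nat q) \<noteq> 1)"


section \<open>Haar measures\<close>

definition haar_measure :: "('a, 'b) monoid_scheme \<Rightarrow> 'a topology \<Rightarrow> 'a measure \<Rightarrow> bool"
  where "haar_measure G T M \<longleftrightarrow>
    topspace T = carrier G \<and>
    space M = topspace T \<and>
    sets M = sigma_sets (topspace T) {U. openin T U} \<and>
    (\<forall>g\<in>carrier G. \<forall>A\<in>sets M. emeasure M ((\<lambda>x. g \<otimes>\<^bsub>G\<^esub> x) ` A) = emeasure M A) \<and>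
    (\<forall>C\<in>sets M. compactin T C \<longrightarrow> emeasure M C < \<infinity>) \<and>
    (\<forall>A\<in>sets M. emeasure M A = (INF U\<in>{U. openin T U \<and> A \<subseteq> U}. emeasure M U)) \<and>
    (\<forall>U. openin T U \<longrightarrow>
       emeasure M U = (SUP C\<in>{C\<in>sets M. compactin T C \<and> C \<subseteq> U}. emeasure M C)) \<and>
    emeasure M (space M) \<noteq> 0"

definition add_group_of :: "'k::field itself \<Rightarrow> 'k monoid"
  where "add_group_of _ = \<lparr>carrier = UNIV, monoid.mult = (+), one = 0\<rparr>"

definition mult_group_of :: "'k::field itself \<Rightarrow> 'k monoid"
  where "mult_group_of _ = \<lparr>carrier = - {0}, monoid.mult = (*), one = 1\<rparr>"

definition quotient_topology :: "('a, 'b) monoid_scheme \<Rightarrow> 'a set \<Rightarrow> 'a topology \<Rightarrow> 'a set topology"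
  where "quotient_topology G H T = topology (\<lambda>A. A \<subseteq> carrier (G Mod H) \<and>
    openin T {x \<in> topspace T. H #>\<^bsub>G\<^esub> x \<in> A})"

lemma openin_quotient_topology:
  "openin (quotient_topology G H T) A \<longleftrightarrow>
    A \<subseteq> carrier (G Mod H) \<and> openin T {x \<in> topspace T. H #>\<^bsub>G\<^esub> x \<in> A}"
proof -
  let ?pre = "\<lambda>A. {x \<in> topspace T. H #>\<^bsub>G\<^esub> x \<in> A}"
  have "?pre (A \<inter> B) = ?pre A \<inter> ?pre B" "?pre (\<Union>\<A>) = (\<Union>A\<in>\<A>. ?pre A)" for A B \<A>
    by auto
  then have "istopology (\<lambda>A. A \<subseteq> carrier (G Mod H) \<and> openin T (?pre A))"
    unfolding istopology_def by (auto intro!: openin_Int openin_Union)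
  then show ?thesis
    by (simp add: quotient_topology_def topology_inverse')
qed

text \<open>
  The Haar measure on \<open>K\<close> giving the ring of integers volume one; it is self-dual for the pairing
  \<open>\<psi> (Tr (x * bar y))\<close> when \<open>\<psi>\<close> has conductor \<open>Zp\<close> and \<open>K\<close> is unramified.
\<close>

definition normalized_add_haar :: "'k::{field_char_0,metric_space} measure \<Rightarrow> bool"
  where "normalized_add_haar \<mu> \<longleftrightarrow>
    haar_measure (add_group_of TYPE('k)) euclidean \<mu> \<and> emeasure \<mu> {x. absv x \<le> 1} = 1"

definition torus_haar :: "'k::{field_char_0,metric_space} set measure \<Rightarrow> bool"
  where "torus_haar \<nu> \<longleftrightarrow>
    haar_measure (mult_group_of TYPE('k) Mod (Qp - {0}))
      (quotient_topology (mult_group_of TYPE('k)) (Qp - {0}) (subtopology euclidean (- {0}))) \<nu>"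


section \<open>The representation attached to a character of \<open>K\<close>\<close>

definition GL2_Qp :: "('k::{field_char_0,metric_space}^2^2) set"
  where "GL2_Qp = {g. (\<forall>i j. g $ i $ j \<in> Qp) \<and> det g \<noteq> 0}"

definition U0 :: "nat \<Rightarrow> nat \<Rightarrow> ('k::{field_char_0,metric_space}^2^2) set"
  where "U0 q n = {g. (\<forall>i j. g $ i $ j \<in> Zp) \<and> det g \<in> Zp_units \<and>
                      (\<exists>z\<in>Zp. g $ 2 $ 1 = of_nat q ^ n * z)}"

definition schwartz_bruhat :: "('k::metric_space \<Rightarrow> complex) \<Rightarrow> bool"
  where "schwartz_bruhat \<Phi> \<longleftrightarrow>
    (\<forall>x. \<exists>U. open U \<and> x \<in> U \<and> (\<forall>y\<in>U. \<Phi> y = \<Phi> x)) \<and>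
    compact (closure {x. \<Phi> x \<noteq> 0})"

text \<open>
  The Weil representation of \<open>GL2(Qp)\<close> for the quadratic space \<open>(K, normK)\<close>, on functions
  \<open>\<phi> x u\<close> with \<open>x\<close> in \<open>K\<close> and \<open>u\<close> in \<open>Qp - {0}\<close> (extended by zero to all \<open>u\<close>). On generators:

  \<^item> \<open>diag(1, d)\<close> sends \<open>\<phi>\<close> to \<open>|d|^(-1/2) \<phi>(x, u/d)\<close>;
  \<^item> \<open>diag(a, 1/a)\<close> sends \<open>\<phi>\<close> to \<open>eta(a) |a| \<phi>(a x, u)\<close>;
  \<^item> \<open>(1, b; 0, 1)\<close> sends \<open>\<phi>\<close> to \<open>\<psi>(b u N(x)) \<phi>(x, u)\<close>;
  \<^item> \<open>(0, 1; -1, 0)\<close> sends \<open>\<phi>\<close> to \<open>eta(u) |u| \<integral> \<psi>(u Tr(x bar(y))) \<phi>(y, u) dy\<close>,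
    where \<open>eta(u)\<close> is the Weil index of the quadratic form \<open>u N\<close> (the Weil index of \<open>N\<close> is one,
    as \<open>K\<close> is unramified and \<open>\<psi>\<close> has conductor \<open>Zp\<close>) and \<open>|u| dy\<close> is self-dual for \<open>u N\<close>.

  The closed formula below results from \<open>g = g1 diag(1, det g)\<close> and, for \<open>g1 = (a, b; c, d)\<close> of
  determinant one with \<open>c\<close> nonzero, from
  \<open>g1 = (1, a/c; 0, 1) diag(-1/c, -c) (0, 1; -1, 0) (1, d/c; 0, 1)\<close>.
\<close>

definition weil_rep ::
  "('k \<Rightarrow> 'k) \<Rightarrow> ('k \<Rightarrow> complex) \<Rightarrow> 'k measure \<Rightarrow> 'k^2^2 \<Rightarrow> ('k \<Rightarrow> 'k \<Rightarrow> complex) \<Rightarrow>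
    'k::{field_char_0,metric_space} \<Rightarrow> 'k \<Rightarrow> complex"
  where "weil_rep bar \<psi> \<mu> g \<phi> x u =
    (let a = g $ 1 $ 1; b = g $ 1 $ 2; c = g $ 2 $ 1; d = g $ 2 $ 2; D = det g in
     if u \<notin> Qp - {0} then 0
     else if c = 0 then
       eta bar a * of_real (absv a * absv D powr (- 1 / 2)) *
         \<psi> (u * b / d * normK bar x) * \<phi> (a * x) (u / D)
     else
       eta bar (c * u) * of_real (absv u / absv c * absv D powr (- 1 / 2)) *
         (\<integral>y. \<psi> (u * (a * normK bar x - traceK bar (x * bar y) + d / D * normK bar y) / c)
               * \<phi> y (u / D) \<partial>\<mu>))"

text \<open>
  The space of \<open>\<pi>\<^sub>\<lambda>\<close>: the part of the Weil representation on which \<open>K - {0}\<close>, acting by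
  \<open>(t \<phi>) x u = \<phi> (x / t) (N(t) u)\<close>, acts through \<open>\<lambda>\<close>. Restriction to \<open>u = 1\<close> and to one further
  representative of \<open>u\<close> modulo norms identifies it with the representation of \<open>GL2(Qp)\<close> induced
  from the elements whose determinant is a norm, which is the Jacquet-Langlands construction of the
  representation with Langlands parameter induced from \<open>\<lambda>\<close> and central character
  \<open>\<lambda>\<close> restricted to \<open>Qp - {0}\<close> times \<open>eta\<close>.
\<close>

definition pi_space ::
  "('k \<Rightarrow> 'k) \<Rightarrow> ('k \<Rightarrow> complex) \<Rightarrow> ('k::{field_char_0,metric_space} \<Rightarrow> 'k \<Rightarrow> complex) set"
  where "pi_space bar lam =
    {\<phi>. (\<forall>u. schwartz_bruhat (\<lambda>x. \<phi> x u)) \<and>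
        (\<forall>x u. u \<notin> Qp - {0} \<longrightarrow> \<phi> x u = 0) \<and>
        (\<forall>t x u. t \<noteq> 0 \<longrightarrow> u \<in> Qp - {0} \<longrightarrow> \<phi> (x / t) (normK bar t * u) = lam t * \<phi> x u)}"

text \<open>
  The action of \<open>GL2(Qp)\<close> on \<open>pi_space bar lam\<close> is by \<open>weil_rep bar \<psi> \<mu>\<close>; up to isomorphism
  it does not depend on \<open>\<psi>\<close>. It is trivial on the centre if \<open>lam\<close> restricts to \<open>eta\<close>.
\<close>

definition newform ::
  "nat \<Rightarrow> nat \<Rightarrow> ('k \<Rightarrow> 'k) \<Rightarrow> ('k \<Rightarrow> complex) \<Rightarrow> 'k measure \<Rightarrow> ('k \<Rightarrow> complex) \<Rightarrow>
    ('k::{field_char_0,metric_space} \<Rightarrow> 'k \<Rightarrow> complex) \<Rightarrow> bool"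
  where "newform q n bar \<psi> \<mu> lam f \<longleftrightarrow>
    f \<in> pi_space bar lam \<and> f \<noteq> (\<lambda>x u. 0) \<and> (\<forall>g\<in>U0 q n. weil_rep bar \<psi> \<mu> g f = f)"

definition invariant_hermitian ::
  "('k \<Rightarrow> 'k) \<Rightarrow> ('k \<Rightarrow> complex) \<Rightarrow> 'k measure \<Rightarrow> ('k \<Rightarrow> complex) \<Rightarrow>
    (('k::{field_char_0,metric_space} \<Rightarrow> 'k \<Rightarrow> complex) \<Rightarrow> ('k \<Rightarrow> 'k \<Rightarrow> complex) \<Rightarrow> complex) \<Rightarrow> bool"
  where "invariant_hermitian bar \<psi> \<mu> lam B \<longleftrightarrow>
    (let V = pi_space bar lam in
     (\<forall>f\<in>V. \<forall>g\<in>V. \<forall>h\<in>V. B (\<lambda>x u. f x u + g x u) h = B f h + B g h) \<and>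
     (\<forall>f\<in>V. \<forall>h\<in>V. \<forall>c. B (\<lambda>x u. c * f x u) h = c * B f h) \<and>
     (\<forall>f\<in>V. \<forall>h\<in>V. B h f = cnj (B f h)) \<and>
     (\<forall>f\<in>V. (\<forall>h\<in>V. B f h = 0) \<longrightarrow> f = (\<lambda>x u. 0)) \<and>
     (\<forall>s\<in>GL2_Qp. \<forall>f\<in>V. \<forall>h\<in>V. B (weil_rep bar \<psi> \<mu> s f) (weil_rep bar \<psi> \<mu> s h) = B f h))"


section \<open>The embedding and the toric period\<close>

definition Qp_algebra_embedding :: "('k::{field_char_0,metric_space} \<Rightarrow> 'k^2^2) \<Rightarrow> bool"
  where "Qp_algebra_embedding j \<longleftrightarrow>
    inj j \<and>
    (\<forall>t i k. j t $ i $ k \<in> Qp) \<and>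
    (\<forall>s t. j (s + t) = j s + j t \<and> j (s * t) = j s ** j t) \<and>
    (\<forall>a\<in>Qp. j a = mat a)"

definition iota_matrix :: "nat \<Rightarrow> nat \<Rightarrow> 'k \<Rightarrow> 'k \<Rightarrow> 'k::field_char_0^2^2"
  where "iota_matrix q m \<theta> u =
    vector [vector [- u * \<theta>\<^sup>2, (1 - u\<^sup>2 * \<theta>\<^sup>2) / of_nat q ^ m],
            vector [of_nat q ^ m * \<theta>\<^sup>2, u * \<theta>\<^sup>2]]"

definition iota :: "nat \<Rightarrow> nat \<Rightarrow> 'k \<Rightarrow> 'k \<Rightarrow> 'k::{field_char_0,metric_space} \<Rightarrow> 'k^2^2"
  where "iota q m \<theta> u = (THE j. Qp_algebra_embedding j \<and> j \<theta> = iota_matrix q m \<theta> u)"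

definition admissible_u :: "'k \<Rightarrow> 'k::{field_char_0,metric_space} \<Rightarrow> bool"
  where "admissible_u \<theta> u \<longleftrightarrow> u \<in> Zp_units \<and> (\<exists>w\<in>Zp_units. u\<^sup>2 * \<theta>\<^sup>2 - 1 = w\<^sup>2)"

text \<open>
  The integrand depends only on the class \<open>C\<close> of \<open>t\<close> modulo \<open>Qp - {0}\<close>, so its image of \<open>C\<close> is
  a singleton.
\<close>

definition gamma_period ::
  "nat \<Rightarrow> nat \<Rightarrow> ('k \<Rightarrow> 'k) \<Rightarrow> ('k \<Rightarrow> complex) \<Rightarrow> 'k measure \<Rightarrow>
    (('k \<Rightarrow> 'k \<Rightarrow> complex) \<Rightarrow> ('k \<Rightarrow> 'k \<Rightarrow> complex) \<Rightarrow> complex) \<Rightarrow> 'k set measure \<Rightarrow>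
    ('k \<Rightarrow> 'k \<Rightarrow> complex) \<Rightarrow> 'k \<Rightarrow> 'k::{field_char_0,metric_space} \<Rightarrow> complex"
  where "gamma_period q m bar \<psi> \<mu> B \<nu> f \<theta> u =
    1 / (of_real (measure \<nu> (space \<nu>)) * B f f) *
    (\<integral>C. the_elem ((\<lambda>t. B (weil_rep bar \<psi> \<mu> (iota q m \<theta> u t) f) f) ` C) \<partial>\<nu>)"

end

theory Submission
  imports Defs
begin

text \<open>
  The newform is explicit: \<open>f x u = C / \<lambda>(x)\<close> if \<open>|N(x) u| = 1\<close>, and \<open>0\<close> otherwise; pairing with \<open>f\<close>
  averages \<open>h 1 v\<close> over units \<open>v\<close>. Hence the matrix coefficient of \<open>f\<close> at \<open>\<iota>(t)\<close>, for a unit \<open>t\<close> with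
  \<open>v(im t) = m - n < m\<close>, is up to a factor the sum of \<open>\<lambda>(t) / \<lambda>(t + z im(t) \<theta>)\<close> over \<open>z\<close> modulo \<open>q^n\<close> with
  \<open>N z = - w\<^sup>2\<close>, where \<open>w\<^sup>2 = u\<^sup>2 \<theta>\<^sup>2 - 1\<close>, and the period is the average of these sums over \<open>q^m + q^(m-1)\<close>
  classes of \<open>t\<close>.

  The classes \<open>t = 1 + \<beta> \<theta>\<close> contribute \<open>2 q / (q - 1)\<close> in total. On the classes \<open>t = q b + \<theta>\<close> stationary
  phase leaves two conjugate critical points, where the phase is a nondegenerate quadratic form. The result is
  \<open>(q\<^sup>2 - 1) \<gamma> = q^(2-m) (1 + y) (1 + cnj y)\<close> with \<open>y = (-1)^m g / \<lambda>(\<theta> (w + u \<theta>))\<close>, where \<open>g = 1\<close> for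
  even \<open>m\<close> and \<open>g\<close> is the square of a Gauss sum divided by \<open>q\<close> for odd \<open>m\<close>; in particular \<open>|y| = 1\<close>.

  Multiplying \<open>w + u \<theta>\<close>, an element of norm \<open>-1\<close>, by \<open>(1 + q^(m-1) \<theta>) / (1 - q^(m-1) \<theta>)\<close> changes \<open>y\<close> by a
  nontrivial \<open>q\<close>-th root of unity \<open>\<zeta>\<close>. As \<open>1 - \<zeta>\<close> divides \<open>q\<close>, it is an \<open>l\<close>-adic unit, so for one of the two
  choices of \<open>u\<close> the number \<open>1 + y\<close> is nonzero, respectively an \<open>l\<close>-adic unit.
\<close>

section \<open>Absolute values\<close>

text \<open>The pairing and the Haar measures enter only through their axioms, so every object is
  pinned down by explicit group elements: \<open>f\<close> by unipotent and diagonal elements of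
  \<open>U0\<close>, and the values \<open>B h f\<close> by averaging \<open>h\<close> over upper
  unipotent and diagonal elements until it becomes a multiple of \<open>f\<close>.

  The condition on \<open>u\<close> says that \<open>w + u * \<theta>\<close> has norm -1. It is
  also what puts the critical points into K: the critical equations are \<open>N z = - w^2\<close>
  and \<open>re z = - N z\<close>, so \<open>\<theta>^2 (im z)^2 = w^2 (w^2 + 1)\<close>, and
  \<open>w^2 + 1 = (u \<theta>)^2\<close> yields \<open>im z = u w\<close> or
  \<open>im z = - u w\<close>.

  The classes near 1 supply the constant 2 next to \<open>y + cnj y\<close>, and |y| = 1 is what
  makes \<open>2 + y + cnj y\<close> a product. Since \<open>1 + cnj y = cnj y * (1 + y)\<close>, a
  single factor has to be controlled.

  An embedding into the l-adic numbers respects sums and products of algebraic numbers only. All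
  values are therefore kept inside \<open>cyc q\<close>, the ring generated by roots of unity and
  1/q: its elements are algebraic, and their l-integrality is an induction over the ring
  operations.\<close>

locale padic_abs =
  fixes p :: nat and T :: "'a::{field_char_0,metric_space} itself"
  assumes prime_p: "prime p" and valued: "padic_valued p T"
begin

lemma dist_absv: "dist (x::'a) y = absv (x - y)"
  using valued by (auto simp: padic_valued_def)

lemma absv_mult: "absv ((x::'a) * y) = absv x * absv y"
  using valued by (auto simp: padic_valued_def)

lemma absv_add: "absv ((x::'a) + y) \<le> max (absv x) (absv y)"
  using valued by (auto simp: padic_valued_def)

lemma absv_p: "absv (of_nat p :: 'a) = 1 / real p"
  using valued by (auto simp: padic_valued_def)

lemma p_gt_1: "real p > 1"
  using prime_p prime_gt_1_nat of_nat_1 of_nat_less_iff by metis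

lemma p_gt_0 [simp]: "real p > 0" "p > 0" "of_nat p \<noteq> (0::'a)"
  using p_gt_1 by auto

lemma absv_zero [simp]: "absv (0::'a) = 0"
  by (simp add: absv_def)

lemma absv_eq_0_iff [simp]: "absv (x::'a) = 0 \<longleftrightarrow> x = 0"
  by (simp add: absv_def)

lemma absv_nonneg [simp]: "absv (x::'a) \<ge> 0"
  by (simp add: absv_def)

lemma absv_pos_iff [simp]: "absv (x::'a) > 0 \<longleftrightarrow> x \<noteq> 0"
  by (simp add: absv_def)

lemma absv_one [simp]: "absv (1::'a) = 1"
proof -
  have "absv (1::'a) * absv (1::'a) = absv (1::'a)"
    by (metis absv_mult mult_1)
  then show ?thesis by simp
qed

lemma absv_minus [simp]: "absv (- x::'a) = absv x"
proof -
  have "absv (-1::'a) * absv (-1::'a) = 1"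
    by (metis absv_mult absv_one mult_minus1 minus_minus)
  then have "absv (-1::'a) = 1"
    by (metis abs_1 abs_of_nonneg absv_nonneg power2_eq_iff_nonneg power2_eq_square one_power2 zero_le_one)
  then show ?thesis
    using absv_mult[of "-1" x] by simp
qed

lemma absv_diff: "absv ((x::'a) - y) \<le> max (absv x) (absv y)"
  using absv_add[of x "- y"] by simp

lemma absv_inverse: "absv (inverse (x::'a)) = inverse (absv x)"
proof (cases "x = 0")
  case False
  then have "absv x * absv (inverse x) = 1"
    by (metis absv_mult absv_one right_inverse)
  then show ?thesis
    by (metis inverse_unique)
qed simp

lemma absv_divide: "absv ((x::'a) / y) = absv x / absv y"
  by (simp add: divide_inverse absv_mult absv_inverse)

lemma absv_power: "absv ((x::'a) ^ n) = absv x ^ n"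
  by (induction n) (auto simp: absv_mult)

lemma absv_p_power: "absv (of_nat p ^ n :: 'a) = 1 / real p ^ n"
  by (simp add: absv_power absv_p power_divide)

lemma absv_add_eq: "absv (y::'a) < absv x \<Longrightarrow> absv (x + y) = absv x"
  using absv_add[of x y] absv_diff[of "x + y" y] by (auto simp: max_def split: if_splits)

lemma absv_diff_commute: "absv ((x::'a) - y) = absv (y - x)"
  by (metis absv_minus minus_diff_eq)

lemma absv_diff_trans: "absv ((x::'a) - y) \<le> r \<Longrightarrow> absv (y - z) \<le> r \<Longrightarrow> absv (x - z) \<le> r"
  using absv_add[of "x - y" "y - z"] by auto

lemma absv_of_nat_le_1: "absv (of_nat n :: 'a) \<le> 1"
proof (induction n)
  case (Suc n)
  then show ?case using absv_add[of 1 "of_nat n"] by auto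
qed simp

lemma absv_of_int_le_1: "absv (of_int k :: 'a) \<le> 1"
  by (cases k rule: int_cases2) (simp_all add: absv_of_nat_le_1)

text \<open>\<open>dv n x\<close> expresses divisibility of \<open>x\<close> by \<open>p^n\<close> in the ring of integers.\<close>

definition dv :: "nat \<Rightarrow> 'a \<Rightarrow> bool"
  where "dv n x \<longleftrightarrow> absv x \<le> 1 / real p ^ n"

lemma dv_0_iff: "dv 0 x \<longleftrightarrow> absv x \<le> 1"
  by (simp add: dv_def)

lemma dv_zero [simp]: "dv n 0"
  by (simp add: dv_def)

lemma dv_one [simp]: "dv 0 1"
  by (simp add: dv_def)

lemma dv_minus_iff [simp]: "dv n (- x) \<longleftrightarrow> dv n x"
  by (simp add: dv_def)

lemma dv_add: "dv n x \<Longrightarrow> dv n y \<Longrightarrow> dv n (x + y)"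
  using absv_add[of x y] by (auto simp: dv_def)

lemma dv_diff: "dv n x \<Longrightarrow> dv n y \<Longrightarrow> dv n (x - y)"
  using absv_diff[of x y] by (auto simp: dv_def)

lemma dv_diff_commute: "dv n (x - y) \<longleftrightarrow> dv n (y - x)"
  by (simp add: dv_def absv_diff_commute)

lemma dv_mult: "dv a x \<Longrightarrow> dv b y \<Longrightarrow> dv (a + b) (x * y)"
  unfolding dv_def absv_mult power_add
  using mult_mono[of "absv x" "1 / real p ^ a" "absv y" "1 / real p ^ b"] by simp

lemma dv_mult_right: "dv n x \<Longrightarrow> dv 0 y \<Longrightarrow> dv n (x * y)"
  using dv_mult[of n x 0 y] by simp

lemma dv_mult_left: "dv 0 x \<Longrightarrow> dv n y \<Longrightarrow> dv n (x * y)"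
  using dv_mult[of 0 x n y] by simp

lemma dv_mono: "dv n x \<Longrightarrow> k \<le> n \<Longrightarrow> dv k x"
proof -
  assume a: "dv n x" "k \<le> n"
  have "1 / real p ^ n \<le> 1 / real p ^ k"
    using a(2) p_gt_1 by (intro divide_left_mono power_increasing) auto
  then show ?thesis using a(1) by (auto simp: dv_def)
qed

lemma dv_power: "dv a x \<Longrightarrow> dv (a * n) (x ^ n)"
proof (induction n)
  case (Suc n)
  then show ?case using dv_mult[of a x "a * n" "x ^ n"] by (simp add: algebra_simps)
qed simp

lemma dv_0_power: "dv 0 x \<Longrightarrow> dv 0 (x ^ n)"
  using dv_power[of 0 x n] by simp

lemma dv_p_power [simp]: "dv n (of_nat p ^ n)"
  by (simp add: dv_def absv_p_power)

lemma dv_p_mult_iff: "dv (n + k) (of_nat p ^ n * x) \<longleftrightarrow> dv k x"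
  by (simp add: dv_def absv_mult absv_p_power power_add field_simps)

lemma dvE:
  assumes "dv n x"
  obtains y where "dv 0 y" "x = of_nat p ^ n * y"
proof
  show "x = of_nat p ^ n * (x / of_nat p ^ n)" by simp
  show "dv 0 (x / of_nat p ^ n)"
    using assms by (simp add: dv_def absv_divide absv_p_power divide_simps)
qed

lemma dv_of_nat [simp]: "dv 0 (of_nat n)" and dv_of_int [simp]: "dv 0 (of_int k)"
  by (auto simp: dv_def absv_of_nat_le_1 absv_of_int_le_1)

lemma dv_numeral [simp]: "dv 0 (numeral k)"
  using dv_of_nat[of "numeral k"] by simp

lemma dv_p_power_0 [simp]: "dv 0 (of_nat p ^ n)"
  using dv_mono[OF dv_p_power] by blast

lemma absv_eq_1_not_dv: "absv x = 1 \<Longrightarrow> \<not> dv (Suc n) x"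
proof
  assume "absv x = 1" "dv (Suc n) x"
  then have "real p ^ Suc n \<le> 1" by (simp add: dv_def)
  moreover have "real p ^ Suc n > 1" by (intro one_less_power p_gt_1) simp
  ultimately show False by simp
qed

lemma unit_dv_0: "absv x = 1 \<Longrightarrow> dv 0 x"
  by (simp add: dv_def)

lemma dv_mult_unit_iff: "absv x = 1 \<Longrightarrow> dv n (x * y) \<longleftrightarrow> dv n y"
  "absv x = 1 \<Longrightarrow> dv n (y * x) \<longleftrightarrow> dv n y"
  by (auto simp: dv_def absv_mult)

lemma dv_divide_unit_iff: "absv x = 1 \<Longrightarrow> dv n (y / x) \<longleftrightarrow> dv n y"
  by (auto simp: dv_def absv_divide)

lemma unit_cong:
  assumes "absv x = 1" "dv (Suc n) (x - y)"
  shows "absv y = 1"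
proof -
  have "1 / real p < 1" using p_gt_1 by simp
  then have "absv (y - x) < absv x"
    using dv_mono[OF assms(2), of 1] assms(1) by (auto simp: dv_def absv_diff_commute simp del: divide_less_eq_1_pos)
  then show ?thesis using absv_add_eq[of "y - x" x] assms(1) by simp
qed

text \<open>Bezout writes 1 as a p + b k. The first term is smaller than 1, so the ultrametric
  inequality forces b k, and hence k, to have absolute value at least 1.\<close>

lemma absv_of_int_coprime:
  assumes "\<not> int p dvd k"
  shows "absv (of_int k :: 'a) = 1"
proof -
  have "coprime (int p) k"
    using assms prime_p by (simp add: prime_imp_coprime)
  then obtain a b where "a * int p + b * k = 1"
    using bezout_int[of "int p" k] by auto
  then have "of_int a * of_nat p + of_int b * of_int k = (1::'a)"
    by (metis of_int_1 of_int_add of_int_mult of_int_of_nat_eq)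
  then have *: "1 \<le> max (absv (of_int a * of_nat p :: 'a)) (absv (of_int b * of_int k :: 'a))"
    by (metis absv_add absv_one)
  have "absv (of_int a * of_nat p :: 'a) \<le> 1 / real p"
    unfolding absv_mult absv_p using absv_of_int_le_1[of a] p_gt_1
    by (simp add: divide_simps)
  also have "\<dots> < 1" using p_gt_1 by simp
  finally have "1 \<le> absv (of_int b * of_int k :: 'a)" using * by auto
  also have "\<dots> \<le> absv (of_int k :: 'a)"
    unfolding absv_mult using absv_of_int_le_1[of b] by (simp add: mult_left_le_one_le)
  finally show ?thesis using absv_of_int_le_1[of k] by simp
qed

lemma dv_of_int_iff: "dv n (of_int k) \<longleftrightarrow> int p ^ n dvd k"
proof
  show "int p ^ n dvd k \<Longrightarrow> dv n (of_int k)"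
  proof (elim dvdE)
    fix j assume "k = int p ^ n * j"
    then show "dv n (of_int k)"
      using dv_mult_right[OF dv_p_power dv_of_int, of n j] by simp
  qed
  show "dv n (of_int k) \<Longrightarrow> int p ^ n dvd k"
  proof (induction n)
    case (Suc n)
    then obtain j where j: "k = int p ^ n * j" by (meson dvdE dv_mono le_SucI order_refl)
    then have "dv (n + 1) (of_nat p ^ n * of_int j)" using Suc.prems by simp
    then have "dv 1 (of_int j)" by (simp only: dv_p_mult_iff)
    then have "int p dvd j" using absv_of_int_coprime absv_eq_1_not_dv by (metis One_nat_def)
    then show ?case by (simp add: j mult.commute mult_dvd_mono)
  qed simp
qed

lemma dv_of_nat_diff_iff: "dv n (of_nat i - of_nat j) \<longleftrightarrow> i mod p ^ n = j mod p ^ n"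
proof -
  have "dv n (of_nat i - of_nat j) \<longleftrightarrow> int p ^ n dvd int i - int j"
    using dv_of_int_iff[of n "int i - int j"] by simp
  also have "\<dots> \<longleftrightarrow> i mod p ^ n = j mod p ^ n"
    by (metis mod_eq_dvd_iff of_nat_eq_iff of_nat_power zmod_int)
  finally show ?thesis .
qed

section \<open>The closure of the rationals is a field, approximated by integers\<close>

lemma Qp_rat: "x \<in> \<rat> \<Longrightarrow> x \<in> (Qp :: 'a set)"
  unfolding Qp_def using closure_subset by auto

lemma Qp_of_nat [simp]: "of_nat n \<in> (Qp :: 'a set)" and Qp_of_int [simp]: "of_int k \<in> (Qp :: 'a set)"
  and Qp_0 [simp]: "0 \<in> (Qp :: 'a set)" and Qp_1 [simp]: "1 \<in> (Qp :: 'a set)"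
  and Qp_numeral [simp]: "numeral j \<in> (Qp :: 'a set)"
  by (auto intro: Qp_rat)

lemma Qp_approx:
  assumes "(x::'a) \<in> Qp" "e > 0"
  obtains r where "r \<in> \<rat>" "absv (x - r) < e"
  using assms unfolding Qp_def closure_approachable by (metis dist_absv absv_diff_commute)

lemma Qp_I: "(\<And>e. e > 0 \<Longrightarrow> \<exists>r\<in>Qp. absv ((x::'a) - r) < e) \<Longrightarrow> x \<in> Qp"
proof -
  assume "\<And>e. e > 0 \<Longrightarrow> \<exists>r\<in>Qp. absv ((x::'a) - r) < e"
  then have "x \<in> closure (Qp :: 'a set)"
    unfolding closure_approachable by (metis dist_absv absv_diff_commute)
  then show ?thesis by (simp add: Qp_def)
qed

lemma Qp_add [intro]: 
  assumes "(x::'a) \<in> Qp" "y \<in> Qp"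
  shows "x + y \<in> Qp"
proof (rule Qp_I)
  fix e :: real assume "e > 0"
  obtain r where r: "r \<in> \<rat>" "absv (x - r) < e" using Qp_approx[OF assms(1) \<open>e > 0\<close>] .
  obtain s where s: "s \<in> \<rat>" "absv (y - s) < e" using Qp_approx[OF assms(2) \<open>e > 0\<close>] .
  have "absv (x + y - (r + s)) < e"
    using absv_add[of "x - r" "y - s"] r s by (simp add: algebra_simps)
  then show "\<exists>r\<in>Qp. absv (x + y - r) < e" using r s Qp_rat by (meson Rats_add)
qed

lemma Qp_minus [intro]:
  assumes "(x::'a) \<in> Qp"
  shows "- x \<in> Qp"
proof (rule Qp_I)
  fix e :: real assume "e > 0"
  obtain r where r: "r \<in> \<rat>" "absv (x - r) < e" using Qp_approx[OF assms(1) \<open>e > 0\<close>] .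
  have "- x - - r = - (x - r)" by simp
  then have "absv (- x - - r) < e" by (metis absv_minus r(2))
  then show "\<exists>r\<in>Qp. absv (- x - r) < e" using r Qp_rat by (metis Rats_minus_iff)
qed

lemma Qp_diff [intro]: "(x::'a) \<in> Qp \<Longrightarrow> y \<in> Qp \<Longrightarrow> x - y \<in> Qp"
  using Qp_add[of x "- y"] by auto

lemma Qp_mult [intro]:
  assumes "(x::'a) \<in> Qp" "y \<in> Qp"
  shows "x * y \<in> Qp"
proof (rule Qp_I)
  fix e :: real assume "e > 0"
  \<comment> \<open>The two tolerances are chosen one after the other: the one for \<open>y\<close>
    depends on the approximation \<open>r\<close> already fixed for \<open>x\<close>. Adding 1
    avoids a division by zero.\<close>
  define d where "d = e / (absv y + 1)"
  have d: "d > 0" using \<open>e > 0\<close> by (simp add: d_def add_nonneg_pos)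
  obtain r where r: "r \<in> \<rat>" "absv (x - r) < d" using Qp_approx[OF assms(1) d] .
  define d' where "d' = e / (absv r + 1)"
  have d': "d' > 0" using \<open>e > 0\<close> by (simp add: d'_def add_nonneg_pos)
  obtain s where s: "s \<in> \<rat>" "absv (y - s) < d'" using Qp_approx[OF assms(2) d'] .
  have "absv ((x - r) * y) \<le> d * absv y"
    unfolding absv_mult using r by (intro mult_right_mono) auto
  also have "\<dots> < e"
    using \<open>e > 0\<close> by (simp add: d_def divide_simps add_nonneg_pos)
  finally have 1: "absv ((x - r) * y) < e" .
  have "absv (r * (y - s)) \<le> absv r * d'"
    unfolding absv_mult using s by (intro mult_left_mono) auto
  also have "\<dots> < e"
    using \<open>e > 0\<close> by (simp add: d'_def divide_simps add_nonneg_pos)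
  finally have "absv (r * (y - s)) < e" .
  moreover have "x * y - r * s = (x - r) * y + r * (y - s)" by (simp add: algebra_simps)
  ultimately have "absv (x * y - r * s) < e"
    using 1 absv_add[of "(x - r) * y" "r * (y - s)"] by simp
  then show "\<exists>r\<in>Qp. absv (x * y - r) < e" using r s Qp_rat by (meson Rats_mult)
qed

lemma Qp_inverse [intro]:
  assumes "(x::'a) \<in> Qp"
  shows "inverse x \<in> Qp"
proof (cases "x = 0")
  case False
  show ?thesis
  proof (rule Qp_I)
    fix e :: real assume "e > 0"
    \<comment> \<open>The first bound forces \<open>absv r = absv x\<close>, so that
      \<open>r\<close> is nonzero; the second then controls
      \<open>(r - x) / (x * r)\<close>.\<close>
    define d where "d = min (absv x) (e * absv x * absv x)"
    have "d > 0" using False \<open>e > 0\<close> by (simp add: d_def)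
    then obtain r where r: "r \<in> \<rat>" "absv (x - r) < d" using Qp_approx[OF assms(1)] by blast
    have rx: "absv r = absv x"
      using absv_add_eq[of "r - x" x] r(2) by (simp add: d_def absv_diff_commute)
    then have "r \<noteq> 0" using False by auto
    have "inverse x - inverse r = (r - x) / (x * r)"
      using False \<open>r \<noteq> 0\<close> by (simp add: field_simps)
    then have "absv (inverse x - inverse r) = absv (x - r) / (absv x * absv x)"
      by (simp add: absv_divide absv_mult rx absv_diff_commute)
    also have "\<dots> < e" using r(2) False by (simp add: d_def divide_simps mult.assoc)
    finally show "\<exists>r\<in>Qp. absv (inverse x - r) < e" using r Qp_rat by (meson Rats_inverse)
  qed
qed simp

lemma Qp_divide [intro]: "(x::'a) \<in> Qp \<Longrightarrow> y \<in> Qp \<Longrightarrow> x / y \<in> Qp"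
  unfolding divide_inverse by auto

lemma Qp_power [intro]: "(x::'a) \<in> Qp \<Longrightarrow> x ^ n \<in> Qp"
  by (induction n) auto

lemma Zp_iff: "x \<in> (Zp :: 'a set) \<longleftrightarrow> x \<in> Qp \<and> dv 0 x"
  by (simp add: Zp_def dv_0_iff)

text \<open>An integral rational in lowest terms has a denominator prime to \<open>p\<close>; that
  denominator is invertible modulo \<open>p^n\<close> by Bezout, and multiplying the numerator by
  the inverse gives the integer.\<close>

lemma rat_approx_int:
  assumes "(r::'a) \<in> \<rat>" "dv 0 r"
  obtains k :: int where "dv n (r - of_int k)"
proof -
  obtain a b where ab: "r = of_int a / of_int b" "b > 0" "coprime a b"
    using assms(1) by (auto elim!: Rats_cases')
  have "\<not> int p dvd b"
  proof
    assume b: "int p dvd b"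
    then have "\<not> int p dvd a"
      using ab(3) prime_p by (meson coprime_common_divisor not_prime_unit prime_nat_int_transfer)
    then have "absv (of_int a :: 'a) = 1" by (rule absv_of_int_coprime)
    moreover have "dv 1 (of_int b)" using b dv_of_int_iff[of 1 b] by simp
    moreover have "of_int a = r * of_int b" using ab by simp
    ultimately show False
      using dv_mult_left[OF assms(2), of 1 "of_int b"] absv_eq_1_not_dv[of "of_int a" 0] by simp
  qed
  then have b1: "absv (of_int b :: 'a) = 1" by (rule absv_of_int_coprime)
  have "coprime (int p ^ n) b"
    using \<open>\<not> int p dvd b\<close> prime_p by (simp add: prime_imp_coprime)
  then obtain x y where "x * int p ^ n + y * b = 1"
    using bezout_int[of "int p ^ n" b] by auto
  then have "a - b * (y * a) = int p ^ n * (x * a)"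
    by (metis add_diff_cancel_right' mult.assoc mult.commute mult_1 left_diff_distrib')
  then have "dv n (of_int (a - b * (y * a)))" by (simp only: dv_of_int_iff dvd_triv_left)
  moreover have "r - of_int (y * a) = of_int (a - b * (y * a)) / of_int b"
    using ab by (simp add: field_simps)
  ultimately have "dv n (r - of_int (y * a))"
    using b1 by (simp add: dv_divide_unit_iff)
  then show ?thesis using that by blast
qed

text \<open>Source of the concrete residue systems 0, ..., p^n - 1 over which all later sums run: a
  rational close to \<open>x\<close> is integral, hence close to an integer, which is then reduced
  modulo \<open>p^n\<close>.\<close>

lemma Zp_approx_nat:
  assumes "(x::'a) \<in> Zp"
  obtains i where "i < p ^ n" "dv n (x - of_nat i)"
proof -
  have x: "x \<in> Qp" "dv 0 x" using assms by (auto simp: Zp_iff)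
  obtain r where r: "r \<in> \<rat>" "absv (x - r) < 1 / real p ^ n"
    using Qp_approx[OF x(1), of "1 / real p ^ n"] by auto
  then have xr: "dv n (x - r)" by (simp add: dv_def)
  have "dv 0 r" using dv_diff[OF x(2) dv_mono[OF xr le0]] by simp
  then obtain k where k: "dv n (r - of_int k)" using rat_approx_int[OF r(1)] by auto
  define i where "i = nat (k mod (int p ^ n))"
  have i: "int i = k mod (int p ^ n)" by (simp add: i_def)
  have "dv n (of_int (k - int i))"
    unfolding i dv_of_int_iff by (rule dvd_minus_mod)
  then have "dv n (of_int k - of_int (int i))" by simp
  then have "dv n (x - of_nat i)"
    using dv_add[OF dv_add[OF xr k], of "of_int k - of_int (int i)"] by simp
  moreover have "i < p ^ n"
    using i pos_mod_bound[of "int p ^ n" k] by (metis of_nat_less_iff of_nat_power p_gt_0(2) of_nat_0_less_iff zero_less_power)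
  ultimately show ?thesis using that by blast
qed

end

section \<open>The unramified quadratic extension\<close>

locale unram_quad = padic_abs q T
    for q :: nat and T :: "'k::{field_char_0,complete_space} itself" +
  fixes bar :: "'k \<Rightarrow> 'k" and \<theta> :: 'k
  assumes odd_q: "odd q" and unr: "unramified_quadratic q bar"
    and absv_theta [simp]: "absv \<theta> = 1" and bar_theta [simp]: "bar \<theta> = - \<theta>"
begin

lemmas Qp_intros = Qp_add Qp_minus Qp_diff Qp_mult Qp_inverse Qp_divide Qp_power
  Qp_of_nat Qp_of_int Qp_0 Qp_1 Qp_numeral

lemma absv_value: "x \<noteq> 0 \<Longrightarrow> \<exists>n::int. absv (x::'k) = real q powi n"
  using unr by (auto simp: unramified_quadratic_def)

lemma bar_add [simp]: "bar (x + y) = bar x + bar y" and bar_mult [simp]: "bar (x * y) = bar x * bar y"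
  using unr by (auto simp: unramified_quadratic_def)

lemma bar_Qp: "x \<in> Qp \<Longrightarrow> bar x = x"
  using unr by (auto simp: unramified_quadratic_def)

lemma theta_nonzero [simp]: "\<theta> \<noteq> 0"
  using absv_theta by fastforce

lemma theta_notin_Qp: "\<theta> \<notin> Qp"
proof
  assume "\<theta> \<in> Qp"
  then have "- \<theta> = \<theta>" using bar_Qp bar_theta by metis
  then have "2 * \<theta> = 0" by (metis mult_2 add.left_inverse)
  then show False by simp
qed

lemma q_ge_3: "q \<ge> 3"
  using odd_q prime_p prime_ge_2_nat[of q] by (cases "q = 2") auto

lemma absv_two [simp]: "absv (2::'k) = 1"
proof -
  have "\<not> int q dvd 2" using q_ge_3 zdvd_imp_le[of "int q" 2] by auto
  then show ?thesis using absv_of_int_coprime[of 2] by simp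
qed

text \<open>The definition of K provides some generator \<alpha>. As \<theta> is not in
  \<open>Qp\<close>, its coefficient at \<alpha> is nonzero, and \<theta> can replace \<alpha> in
  the basis.\<close>

lemma Qp_decomp: "\<exists>a\<in>Qp. \<exists>b\<in>Qp. x = a + b * \<theta>"
proof -
  have "\<exists>\<alpha>::'k. \<alpha> \<notin> Qp \<and> (\<forall>x. \<exists>a\<in>Qp. \<exists>b\<in>Qp. x = a + b * \<alpha>)"
    using unr unfolding unramified_quadratic_def by (elim conjE)
  then obtain \<alpha> :: 'k where al: "\<alpha> \<notin> Qp" "\<And>x. \<exists>a\<in>Qp. \<exists>b\<in>Qp. x = a + b * \<alpha>"
    by metis
  obtain a b where ab: "a \<in> Qp" "b \<in> Qp" "\<theta> = a + b * \<alpha>" using al(2) by blast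
  obtain c d where cd: "c \<in> Qp" "d \<in> Qp" "x = c + d * \<alpha>" using al(2) by blast
  have b: "b \<noteq> 0" using ab theta_notin_Qp by auto
  have "x = (c - d * a / b) + (d / b) * \<theta>" using b ab(3) cd(3) by (simp add: field_simps)
  then show ?thesis using ab cd by blast
qed

lemma bar_0 [simp]: "bar 0 = 0" and bar_1 [simp]: "bar 1 = 1"
  and bar_of_nat [simp]: "bar (of_nat n) = of_nat n"
  and bar_numeral [simp]: "bar (numeral k) = numeral k"
  by (auto simp: bar_Qp)

lemma bar_minus [simp]: "bar (- x) = - bar x"
proof -
  have "bar (- x) + bar x = 0" by (metis bar_add bar_0 add.left_inverse)
  then show ?thesis by (simp add: eq_neg_iff_add_eq_0)
qed

lemma bar_diff [simp]: "bar (x - y) = bar x - bar y"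
  using bar_add[of x "- y"] by simp

lemma bar_bar [simp]: "bar (bar x) = x"
  using Qp_decomp[of x] by (auto simp: bar_Qp)

lemma bar_eq_0_iff [simp]: "bar x = 0 \<longleftrightarrow> x = 0"
  by (metis bar_0 bar_bar)

lemma bar_inverse [simp]: "bar (inverse x) = inverse (bar x)"
proof (cases "x = 0")
  case False
  then have "bar x * bar (inverse x) = 1" by (metis bar_mult bar_1 right_inverse)
  then show ?thesis by (metis inverse_unique)
qed simp

lemma bar_divide [simp]: "bar (x / y) = bar x / bar y"
  by (simp add: divide_inverse)

lemma bar_power [simp]: "bar (x ^ n) = bar x ^ n"
  by (induction n) auto

definition re :: "'k \<Rightarrow> 'k" where "re x = (x + bar x) / 2"
definition im :: "'k \<Rightarrow> 'k" where "im x = (x - bar x) / (2 * \<theta>)"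

lemma re_im: "x = re x + im x * \<theta>"
  by (simp add: re_def im_def field_simps)

lemma re_im_Qp [simp]: 
  assumes "a \<in> Qp" "b \<in> Qp"
  shows "re (a + b * \<theta>) = a" "im (a + b * \<theta>) = b"
  using assms by (auto simp: re_def im_def bar_Qp)

lemma re_im_in_Qp [simp]: "re x \<in> Qp" "im x \<in> Qp"
  using Qp_decomp[of x] by auto

lemma Qp_iff_bar: "x \<in> Qp \<longleftrightarrow> bar x = x"
proof
  assume "bar x = x"
  then have "x = re x" by (simp add: re_def)
  then show "x \<in> Qp" by (metis re_im_in_Qp(1))
qed (simp add: bar_Qp)

lemma re_add: "re (x + y) = re x + re y" and im_add: "im (x + y) = im x + im y"
  and re_diff: "re (x - y) = re x - re y" and im_diff: "im (x - y) = im x - im y"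
  and re_minus: "re (- x) = - re x" and im_minus: "im (- x) = - im x"
  and re_mult_Qp: "c \<in> Qp \<Longrightarrow> re (c * x) = c * re x"
  and im_mult_Qp: "c \<in> Qp \<Longrightarrow> im (c * x) = c * im x"
  by (auto simp: re_def im_def field_simps bar_Qp)

lemma theta_sq_Qp [simp]: "\<theta>\<^sup>2 \<in> Qp"
  by (simp add: Qp_iff_bar)

lemma dv_theta [simp]: "dv 0 \<theta>"
  by (simp add: dv_def)

text \<open>Unramifiedness enters here: all values are powers of \<open>q\<close>, so nothing lies
  strictly between 1/q and 1.\<close>

lemma absv_eq_1_or_dv: "dv 0 (x::'k) \<Longrightarrow> absv x = 1 \<or> dv 1 x"
proof (cases "x = 0")
  case False
  assume x: "dv 0 x"
  obtain n where n: "absv x = real q powi n" using absv_value[OF False] by blast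
  show ?thesis
  proof (cases "n \<ge> 0")
    case True
    then have "absv x \<ge> 1" using n p_gt_1 by (simp add: power_int_def)
    then show ?thesis using x by (simp add: dv_def)
  next
    case False
    then have "absv x \<le> real q powi (-1)" unfolding n using p_gt_1 by (intro power_int_increasing) auto
    then show ?thesis by (simp add: dv_def divide_inverse)
  qed
qed simp

lemma absv_eq_of_dv: "dv n (x::'k) \<Longrightarrow> \<not> dv (Suc n) x \<Longrightarrow> absv x = 1 / real q ^ n"
proof -
  assume a: "dv n x" "\<not> dv (Suc n) x"
  obtain y where y: "dv 0 y" "x = of_nat q ^ n * y" using a(1) by (rule dvE)
  have "\<not> dv 1 y" using a(2) y(2) dv_p_mult_iff[of n 1 y] by simp
  then have "absv y = 1" using absv_eq_1_or_dv y(1) by blast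
  then show ?thesis by (simp add: y(2) absv_mult absv_p_power)
qed

lemma unit_iff: "absv (x::'k) = 1 \<longleftrightarrow> dv 0 x \<and> \<not> dv 1 x"
  using absv_eq_1_or_dv absv_eq_1_not_dv unit_dv_0 by (metis One_nat_def)

lemma dv_1_multD: "dv 1 (x * y) \<Longrightarrow> dv 0 x \<Longrightarrow> dv 0 y \<Longrightarrow> dv 1 (x::'k) \<or> dv 1 y"
  using unit_iff[of x] unit_iff[of y] unit_iff[of "x * y"] by (auto simp: absv_mult)

lemma closed_Qp: "closed (Qp :: 'k set)"
  by (simp add: Qp_def)

text \<open>Hensel's lemma for square roots, as a fixed point of \<open>x - (x\<^sup>2 - a) / (2 r)\<close>.\<close>

lemma Qp_sqrt:
  assumes "a \<in> Qp" "r \<in> Qp" "absv r = 1" "dv (Suc n) (a - r\<^sup>2)"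
  obtains s where "s \<in> Qp" "s\<^sup>2 = a" "dv (Suc n) (s - r)" "absv (s::'k) = 1"
proof -
  define S where "S = Qp \<inter> cball r (1 / real q ^ Suc n)"
  define f where "f x = x - (x\<^sup>2 - a) / (2 * r)" for x :: 'k
  have S: "x \<in> S \<longleftrightarrow> x \<in> Qp \<and> dv (Suc n) (x - r)" for x
    by (auto simp: S_def dist_absv dv_def absv_diff_commute)
  have r0: "r \<noteq> 0" "absv (2 * r) = 1" using assms(3) by (auto simp: absv_mult)
  have "complete S" unfolding complete_eq_closed S_def by (intro closed_Int closed_Qp) simp
  moreover have "r \<in> S" using assms by (simp add: S)
  moreover have "f ` S \<subseteq> S"
  proof safe
    fix x assume x: "x \<in> S"
    have "x\<^sup>2 - a = (x - r) * ((x - r) + 2 * r) - (a - r\<^sup>2)" by (simp add: power2_eq_square algebra_simps)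
    moreover have "dv 0 ((x - r) + 2 * r)"
      using x assms(3) by (intro dv_add dv_mono[of "Suc n" "x - r" 0]) (auto simp: S unit_dv_0 absv_mult)
    then have "dv (Suc n) ((x - r) * ((x - r) + 2 * r) - (a - r\<^sup>2))"
      using x dv_diff[OF dv_mult_right[of "Suc n" "x - r" "(x - r) + 2 * r"] assms(4)] by (simp add: S)
    ultimately have "dv (Suc n) (x\<^sup>2 - a)" by (simp only:)
    then have "dv (Suc n) ((x - r) - (x\<^sup>2 - a) / (2 * r))"
      using x r0 by (rule_tac dv_diff) (auto simp: S dv_divide_unit_iff)
    moreover have "(x - r) - (x\<^sup>2 - a) / (2 * r) = f x - r" by (simp add: f_def)
    moreover have "f x \<in> Qp" unfolding f_def using x assms by (intro Qp_intros) (auto simp: S)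
    ultimately show "f x \<in> S" by (simp add: S)
  qed
  moreover have "dist (f x) (f y) \<le> (1 / real q) * dist x y" if "x \<in> S" "y \<in> S" for x y
  proof -
    \<comment> \<open>Both \<open>r - x\<close> and \<open>r - y\<close> are divisible by q and
      \<open>2 * r\<close> is a unit, which gives the contraction factor 1/q.\<close>
    have "f x - f y = (x - y) * (((r - x) + (r - y)) / (2 * r))"
      using r0 by (simp add: f_def field_simps power2_eq_square)
    moreover have "dv 1 (((r - x) + (r - y)) / (2 * r))"
      using that r0 dv_add[of 1 "r - x" "r - y"] dv_mono[of "Suc n" "r - x" 1] dv_mono[of "Suc n" "r - y" 1]
      by (simp add: S dv_divide_unit_iff dv_diff_commute[of _ r])
    then have "absv (x - y) * absv (((r - x) + (r - y)) / (2 * r)) \<le> absv (x - y) * (1 / real q)"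
      by (intro mult_left_mono) (simp_all add: dv_def)
    ultimately show ?thesis unfolding dist_absv by (simp only: absv_mult mult.commute)
  qed
  ultimately obtain s where s: "s \<in> S" "f s = s"
    using Banach_fix[of S "1 / real q" f] p_gt_1 by auto
  then have "s\<^sup>2 = a" using r0 by (auto simp: f_def)
  moreover have "dv (Suc n) (r - s)" using s by (simp add: S dv_diff_commute)
  ultimately show ?thesis
    using that s unit_cong[OF assms(3), of n s] by (auto simp: S)
qed

text \<open>The integers of K are exactly the combinations of 1 and \<theta> with coefficients in
  \<open>Zp\<close>. Only coordinates of equal size could cancel, and cancellation would make
  \<theta> congruent modulo q to a unit of \<open>Qp\<close>; Hensel would then give \<theta>^2 a
  square root in \<open>Qp\<close>, that is, put \<theta> into \<open>Qp\<close>.\<close>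

lemma absv_re_im: "absv x = max (absv (re x)) (absv (im x))"
proof -
  define a where "a = re x"
  define b where "b = im x"
  have ab: "a \<in> Qp" "b \<in> Qp" "x = a + b * \<theta>" using re_im by (auto simp: a_def b_def)
  have bt: "absv (b * \<theta>) = absv b" by (simp add: absv_mult)
  have "absv x = max (absv a) (absv b)"
  proof (cases "absv a = absv b")
    case False
    then show ?thesis
      using absv_add_eq[of "b * \<theta>" a] absv_add_eq[of a "b * \<theta>"] ab bt
      by (cases "absv a < absv b") (auto simp: max_def add.commute)
  next
    case True
    show ?thesis
    proof (cases "b = 0")
      case False
      define r where "r = - a / b"
      have r: "r \<in> Qp" "absv r = 1" using ab True False by (auto simp: r_def absv_divide)
      have xr: "x = b * (\<theta> - r)" using False ab by (simp add: r_def field_simps)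
      have "absv (\<theta> - r) = 1"
      proof (rule ccontr)
        assume c: "absv (\<theta> - r) \<noteq> 1"
        have "dv 0 (\<theta> - r)" "dv 0 (\<theta> + r)" using r dv_diff[OF dv_theta unit_dv_0] dv_add[OF dv_theta unit_dv_0] by auto
        then have "dv (Suc 0) ((\<theta> - r) * (\<theta> + r))" using c absv_eq_1_or_dv[of "\<theta> - r"] dv_mult_right[of "Suc 0"] by simp
        then have "dv (Suc 0) (\<theta>\<^sup>2 - r\<^sup>2)" by (simp add: algebra_simps power2_eq_square)
        then obtain s where s: "s \<in> Qp" "s\<^sup>2 = \<theta>\<^sup>2" using Qp_sqrt[OF theta_sq_Qp r] by metis
        then have "s = \<theta> \<or> s = - \<theta>" by (simp add: power2_eq_iff)
        then show False using s(1) theta_notin_Qp Qp_minus[of s] by auto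
      qed
      then show ?thesis using True by (simp add: xr absv_mult)
    qed (use True ab in auto)
  qed
  then show ?thesis by (simp add: a_def b_def)
qed

lemma dv_re_im_iff: "dv n x \<longleftrightarrow> dv n (re x) \<and> dv n (im x)"
  by (simp add: dv_def absv_re_im[of x])

lemma dv_re: "dv n x \<Longrightarrow> dv n (re x)" and dv_im: "dv n x \<Longrightarrow> dv n (im x)"
  using dv_re_im_iff by blast+

lemma re_im_Zp: "dv 0 x \<Longrightarrow> re x \<in> Zp" "dv 0 x \<Longrightarrow> im x \<in> Zp"
  by (auto simp: Zp_iff dv_re dv_im)

lemma absv_bar [simp]: "absv (bar x) = absv x"
proof -
  have "bar x = re x + (- im x) * \<theta>" by (simp add: re_def im_def field_simps)
  then have "re (bar x) = re x" "im (bar x) = - im x" 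
    using re_im_Qp[OF re_im_in_Qp(1)[of x] Qp_minus[OF re_im_in_Qp(2)[of x]]] by auto
  then show ?thesis by (simp add: absv_re_im[of x] absv_re_im[of "bar x"])
qed

lemma dv_bar [simp]: "dv n (bar x) \<longleftrightarrow> dv n x"
  by (simp add: dv_def)

section \<open>The norm: surjectivity on units, and the quadratic character\<close>

lemma normK_Qp [simp]: "normK bar x \<in> Qp" and traceK_Qp [simp]: "traceK bar x \<in> Qp"
  by (auto simp: Qp_iff_bar normK_def traceK_def algebra_simps)

lemma absv_normK [simp]: "absv (normK bar x) = (absv x)\<^sup>2"
  by (simp add: normK_def absv_mult power2_eq_square)

lemma normK_mult: "normK bar (x * y) = normK bar x * normK bar y"
  by (simp add: normK_def)

lemma normK_eq_0_iff [simp]: "normK bar x = 0 \<longleftrightarrow> x = 0"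
  by (auto simp: normK_def)

lemma normK_re_im: "normK bar x = (re x)\<^sup>2 - \<theta>\<^sup>2 * (im x)\<^sup>2"
proof -
  have "bar x = re x - im x * \<theta>" by (simp add: re_def im_def field_simps)
  then have "normK bar x = (re x + im x * \<theta>) * (re x - im x * \<theta>)"
    unfolding normK_def using re_im[of x] by metis
  then show ?thesis by (simp add: algebra_simps power2_eq_square)
qed

lemma normK_Qp_theta: "a \<in> Qp \<Longrightarrow> b \<in> Qp \<Longrightarrow> normK bar (a + b * \<theta>) = a\<^sup>2 - \<theta>\<^sup>2 * b\<^sup>2"
  by (simp add: normK_re_im)

text \<open>Pigeonhole: for x and y in 0, ..., (q-1)/2 the squares x^2 and the values a + \<theta>^2
  y^2 each take (q+1)/2 different residues modulo q, so they share one. The numbers c and d are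
  residues of a and of \<theta>^2.\<close>

lemma norm_approx:
  assumes "a \<in> Zp"
  shows "\<exists>x y::nat. dv 1 ((of_nat x)\<^sup>2 - \<theta>\<^sup>2 * (of_nat y)\<^sup>2 - a)"
proof -
  have t: "\<theta>\<^sup>2 \<in> Zp" by (simp add: Zp_iff dv_0_power)
  obtain d where d: "dv 1 (\<theta>\<^sup>2 - of_nat d)" using Zp_approx_nat[OF t] by metis
  obtain c where c: "dv 1 (a - of_nat c)" using Zp_approx_nat[OF assms] by metis
  have d1: "absv (of_nat d :: 'k) = 1"
    using unit_cong[of "\<theta>\<^sup>2" 0 "of_nat d"] d by (simp add: absv_power)
  define h where "h = (q - 1) div 2"
  have h: "q = 2 * h + 1" using odd_q by (auto simp: h_def elim!: oddE)
  have key: "x = y" if "x \<le> h" "y \<le> h" "dv 1 ((of_nat x)\<^sup>2 - (of_nat y)\<^sup>2)" for x y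
  proof -
    have "dv 1 ((of_nat x - of_nat y) * (of_nat x + of_nat y))"
      using that(3) by (simp add: algebra_simps power2_eq_square)
    then have "dv 1 (of_nat x - of_nat y) \<or> dv 1 (of_nat (x + y))"
      using dv_1_multD[of "of_nat x - of_nat y" "of_nat (x + y)"]
        dv_diff[OF dv_of_nat dv_of_nat, of x y] dv_of_nat[of "x + y"] by simp
    then have "x mod q = y mod q \<or> (x + y) mod q = 0"
      using dv_of_nat_diff_iff[of 1 x y] dv_of_nat_diff_iff[of 1 "x + y" 0] by auto
    moreover have "x mod q = x" "y mod q = y" "(x + y) mod q = x + y" using that h by auto
    ultimately show ?thesis by auto
  qed
  define F where "F x = x\<^sup>2 mod q" for x
  define G where "G y = (c + d * y\<^sup>2) mod q" for y
  have "inj_on F {..h}"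
  proof (rule inj_onI)
    fix x y assume "x \<in> {..h}" "y \<in> {..h}" "F x = F y"
    then show "x = y" using key[of x y] dv_of_nat_diff_iff[of 1 "x\<^sup>2" "y\<^sup>2"] by (auto simp: F_def)
  qed
  then have cF: "card (F ` {..h}) = h + 1" by (simp add: card_image)
  have "inj_on G {..h}"
  proof (rule inj_onI)
    fix x y assume xy: "x \<in> {..h}" "y \<in> {..h}" "G x = G y"
    then have "dv 1 (of_nat (c + d * x\<^sup>2) - of_nat (c + d * y\<^sup>2))"
      unfolding dv_of_nat_diff_iff G_def by simp
    then have "dv 1 (of_nat d * ((of_nat x)\<^sup>2 - (of_nat y)\<^sup>2))" by (simp add: algebra_simps)
    then show "x = y" using key xy d1 by (auto simp: dv_mult_unit_iff)
  qed
  then have cG: "card (G ` {..h}) = h + 1" by (simp add: card_image)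
  have "F ` {..h} \<inter> G ` {..h} \<noteq> {}"
  proof
    assume e: "F ` {..h} \<inter> G ` {..h} = {}"
    have "card (F ` {..h} \<union> G ` {..h}) = (h + 1) + (h + 1)"
      using cF cG card_Un_disjoint[OF _ _ e] by simp
    moreover have "F ` {..h} \<union> G ` {..h} \<subseteq> {..<q}" by (auto simp: F_def G_def)
    then have "card (F ` {..h} \<union> G ` {..h}) \<le> q" using card_mono[of "{..<q}"] by fastforce
    ultimately show False using h by simp
  qed
  then obtain x y where "x\<^sup>2 mod q = (c + d * y\<^sup>2) mod q" by (auto simp: F_def G_def)
  then have "dv 1 (of_nat (x\<^sup>2) - of_nat (c + d * y\<^sup>2))"
    unfolding dv_of_nat_diff_iff by simp
  then have "dv 1 ((of_nat (x\<^sup>2) - of_nat (c + d * y\<^sup>2)) - (a - of_nat c) - (\<theta>\<^sup>2 - of_nat d) * (of_nat y)\<^sup>2)"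
    using c d by (rule_tac dv_diff[OF dv_diff dv_mult_right[OF _ dv_0_power]]) auto
  then show ?thesis by (intro exI[of _ x] exI[of _ y]) (simp add: algebra_simps)
qed

text \<open>The solution modulo q is lifted by Hensel in a coordinate that is a unit: if
  \<open>x\<close> is divisible by q then \<open>y\<close> is not, because the value
  \<open>a\<close> is a unit.\<close>

lemma normK_surj_unit:
  assumes "a \<in> Qp" "absv a = 1"
  obtains x where "absv x = 1" "normK bar x = a"
proof -
  obtain x y :: nat where xy: "dv 1 ((of_nat x)\<^sup>2 - \<theta>\<^sup>2 * (of_nat y)\<^sup>2 - a)"
    using norm_approx[of a] assms by (auto simp: Zp_iff unit_dv_0)
  have t: "absv (\<theta>\<^sup>2) = 1" by (simp add: absv_power)
  have *: "\<exists>z. normK bar z = a"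
  proof (cases "absv (of_nat x :: 'k) = 1")
    case True
    have "dv (Suc 0) ((a + \<theta>\<^sup>2 * (of_nat y)\<^sup>2) - (of_nat x)\<^sup>2)"
      using xy dv_diff_commute[of 1 "(of_nat x)\<^sup>2" "a + \<theta>\<^sup>2 * (of_nat y)\<^sup>2"] by (simp add: algebra_simps)
    then obtain s where "s \<in> Qp" "s\<^sup>2 = a + \<theta>\<^sup>2 * (of_nat y)\<^sup>2"
      using Qp_sqrt[of "a + \<theta>\<^sup>2 * (of_nat y)\<^sup>2" "of_nat x" 0] assms True by (metis Qp_add Qp_mult Qp_of_nat Qp_power theta_sq_Qp)
    then have "normK bar (s + of_nat y * \<theta>) = a" by (simp add: normK_Qp_theta)
    then show ?thesis by blast
  next
    case False
    then have x1: "dv 1 (of_nat x :: 'k)" using absv_eq_1_or_dv[OF dv_of_nat] by auto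
    have "dv 1 ((of_nat x)\<^sup>2 - \<theta>\<^sup>2 * (of_nat y)\<^sup>2 - a - (of_nat x)\<^sup>2)"
      using dv_diff[OF xy, of "(of_nat x)\<^sup>2"] dv_mult_right[OF x1, of "of_nat x"]
      by (simp add: power2_eq_square)
    then have "dv 1 (a - (- (\<theta>\<^sup>2 * (of_nat y)\<^sup>2)))"
      using dv_minus_iff[of 1 "(of_nat x)\<^sup>2 - \<theta>\<^sup>2 * (of_nat y)\<^sup>2 - a - (of_nat x)\<^sup>2"] by (simp add: algebra_simps)
    then have "absv (- (\<theta>\<^sup>2 * (of_nat y)\<^sup>2)) = 1" using unit_cong[OF assms(2), of 0 "- (\<theta>\<^sup>2 * (of_nat y)\<^sup>2)"] by simp
    then have y1: "absv (of_nat y :: 'k) = 1"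
      using power2_eq_iff_nonneg[of "absv (of_nat y :: 'k)" 1] by (simp add: absv_mult t absv_power)
    have "((of_nat x)\<^sup>2 - a) / \<theta>\<^sup>2 - (of_nat y)\<^sup>2 = ((of_nat x)\<^sup>2 - \<theta>\<^sup>2 * (of_nat y)\<^sup>2 - a) / \<theta>\<^sup>2"
      by (simp add: field_simps)
    then have "dv (Suc 0) (((of_nat x)\<^sup>2 - a) / \<theta>\<^sup>2 - (of_nat y)\<^sup>2)"
      using xy t by (simp add: dv_divide_unit_iff)
    then obtain s where "s \<in> Qp" "s\<^sup>2 = ((of_nat x)\<^sup>2 - a) / \<theta>\<^sup>2"
      using Qp_sqrt[of "((of_nat x)\<^sup>2 - a) / \<theta>\<^sup>2" "of_nat y" 0] assms y1
      by (metis Qp_divide Qp_diff Qp_of_nat Qp_power theta_sq_Qp)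
    then have "normK bar (of_nat x + s * \<theta>) = a" by (simp add: normK_Qp_theta)
    then show ?thesis by blast
  qed
  then obtain z where z: "normK bar z = a" by blast
  then have "(absv z)\<^sup>2 = 1" using absv_normK assms by metis
  then show ?thesis using that z power2_eq_iff_nonneg[of "absv z" 1] by auto
qed

lemma eta_unit: "x \<in> Qp \<Longrightarrow> absv x = 1 \<Longrightarrow> eta bar x = 1"
proof -
  assume "x \<in> Qp" "absv x = 1"
  then obtain z where "absv z = 1" "normK bar z = x" by (rule normK_surj_unit)
  then show ?thesis unfolding eta_def by (force simp: image_iff)
qed

text \<open>Norms from an unramified quadratic extension have even valuation.\<close>

lemma eta_q: "eta bar (of_nat q) = -1"
proof -
  have False if z: "of_nat q = normK bar z" "z \<noteq> 0" for z
  proof -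
    obtain n where "absv z = real q powi n" using absv_value[OF z(2)] by blast
    then have "1 / real q = (real q powi n)\<^sup>2" using z(1) absv_p absv_normK by metis
    then have "real q powi (-1) = real q powi (n * 2)"
      by (simp add: power_int_mult divide_inverse)
    then have "-1 = n * 2" using p_gt_1 power_int_strict_increasing[of "-1" "n * 2" "real q"]
        power_int_strict_increasing[of "n * 2" "-1" "real q"] by (smt (verit))
    then show False by presburger
  qed
  then show ?thesis by (auto simp: eta_def)
qed

lemma eta_normK_mult: 
  assumes "t \<noteq> 0"
  shows "eta bar (normK bar t * u) = eta bar u"
proof -
  have "u \<in> normK bar ` (- {0})" if u: "normK bar t * u \<in> normK bar ` (- {0})"
  proof -
    obtain x where x: "normK bar t * u = normK bar x" "x \<noteq> 0" using u by auto
    then have "u = normK bar (x / t)" using assms by (simp add: normK_def field_simps)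
    then show ?thesis using x assms by auto
  qed
  moreover have "normK bar t * u \<in> normK bar ` (- {0})" if u: "u \<in> normK bar ` (- {0})"
  proof -
    obtain x where x: "u = normK bar x" "x \<noteq> 0" using u by auto
    then have "normK bar t * u = normK bar (t * x)" by (simp add: normK_mult)
    then show ?thesis using x assms by simp
  qed
  ultimately have "normK bar t * u \<in> normK bar ` (- {0}) \<longleftrightarrow> u \<in> normK bar ` (- {0})" by blast
  then show ?thesis by (simp add: eta_def)
qed

section \<open>Sums over residue systems\<close>

lemma q_nonzero [simp]: "q \<noteq> 0"
  using p_gt_0(2) by (metis less_numeral_extra(3))

text \<open>Kept abstract in \<open>A\<close> and \<open>R\<close> so that the same reindexing
  lemmas serve \<open>Zp\<close>, the integers of K, and maps between the two.\<close>

definition rep_system :: "nat \<Rightarrow> 'k set \<Rightarrow> 'k set \<Rightarrow> bool"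
  where "rep_system n A R \<longleftrightarrow> finite R \<and> R \<subseteq> A \<and> (\<forall>x\<in>A. \<exists>y\<in>R. dv n (x - y)) \<and>
    (\<forall>x\<in>R. \<forall>y\<in>R. dv n (x - y) \<longrightarrow> x = y)"

lemma dv_trans: "dv n (x - y) \<Longrightarrow> dv n (y - z) \<Longrightarrow> dv n ((x::'k) - z)"
  using dv_add[of n "x - y" "y - z"] by simp

text \<open>Change of variables between residue systems of possibly different level. The hypothesis
  \<open>surj\<close> is asked only where \<open>g\<close> does not vanish, so it is enough that
  \<tau> hits the support of \<open>g\<close>; the inclusion of \<open>Zp\<close> into K, twisted by
  the Cayley transform, is used in this way.\<close>

lemma sum_class_reindex:
  fixes g :: "'k \<Rightarrow> 'c::comm_monoid_add"
  assumes R: "rep_system n1 A1 R1" "rep_system n2 A2 R2"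
    and T: "\<And>x. x \<in> A1 \<Longrightarrow> \<tau> x \<in> A2"
    and cong: "\<And>x y. x \<in> A1 \<Longrightarrow> y \<in> A1 \<Longrightarrow> dv n1 (x - y) \<Longrightarrow> dv n2 (\<tau> x - \<tau> y)"
    and inj: "\<And>x y. x \<in> A1 \<Longrightarrow> y \<in> A1 \<Longrightarrow> dv n2 (\<tau> x - \<tau> y) \<Longrightarrow> dv n1 (x - y)"
    and surj: "\<And>y. y \<in> A2 \<Longrightarrow> g y \<noteq> 0 \<Longrightarrow> \<exists>x\<in>A1. dv n2 (\<tau> x - y)"
    and g: "\<And>x y. x \<in> A2 \<Longrightarrow> y \<in> A2 \<Longrightarrow> dv n2 (x - y) \<Longrightarrow> g x = g y"
  shows "(\<Sum>x\<in>R1. g (\<tau> x)) = (\<Sum>x\<in>R2. g x)"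
proof -
  note R' = R[unfolded rep_system_def]
  obtain \<rho> where \<rho>: "\<And>x. x \<in> A2 \<Longrightarrow> \<rho> x \<in> R2 \<and> dv n2 (x - \<rho> x)"
    using R'(2) by metis
  have A: "x \<in> A1" if "x \<in> R1" for x using that R' by auto
  have A2: "x \<in> A2" if "x \<in> R2" for x using that R' by auto
  have inj': "inj_on (\<lambda>x. \<rho> (\<tau> x)) R1"
  proof (rule inj_onI)
    fix x y assume xy: "x \<in> R1" "y \<in> R1" "\<rho> (\<tau> x) = \<rho> (\<tau> y)"
    have "dv n2 (\<tau> x - \<tau> y)"
      using dv_trans[of n2 "\<tau> x" "\<rho> (\<tau> x)" "\<tau> y"] \<rho>[OF T[OF A[OF xy(1)]]] \<rho>[OF T[OF A[OF xy(2)]]] xy(3)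
      by (simp add: dv_diff_commute[of _ "\<tau> y"])
    then show "x = y" using inj A xy R' by blast
  qed
  have "(\<Sum>x\<in>R1. g (\<tau> x)) = (\<Sum>x\<in>R1. g (\<rho> (\<tau> x)))"
    using \<rho> T A A2 g by (intro sum.cong refl) blast
  also have "\<dots> = sum g ((\<lambda>x. \<rho> (\<tau> x)) ` R1)"
    using inj' by (simp add: sum.reindex)
  also have "\<dots> = sum g R2"
  proof (rule sum.mono_neutral_left)
    show "(\<lambda>x. \<rho> (\<tau> x)) ` R1 \<subseteq> R2" using \<rho> T A by blast
    show "\<forall>y\<in>R2 - (\<lambda>x. \<rho> (\<tau> x)) ` R1. g y = 0"
    proof (rule ballI, rule ccontr)
      fix y assume y: "y \<in> R2 - (\<lambda>x. \<rho> (\<tau> x)) ` R1" "g y \<noteq> 0"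
      then obtain x where x: "x \<in> A1" "dv n2 (\<tau> x - y)" using surj A2 by blast
      obtain x' where x': "x' \<in> R1" "dv n1 (x - x')" using R'(1) x(1) by blast
      have "dv n2 (\<tau> x' - \<tau> x)" using cong[OF x(1) A[OF x'(1)] x'(2)] by (simp add: dv_diff_commute)
      then have 1: "dv n2 (\<tau> x' - y)" using x(2) dv_trans by blast
      have "dv n2 (\<rho> (\<tau> x') - y)"
        using dv_trans[OF _ 1, of "\<rho> (\<tau> x')"] \<rho>[OF T[OF A[OF x'(1)]]] by (simp add: dv_diff_commute)
      then have "\<rho> (\<tau> x') = y" using R'(2) \<rho>[OF T[OF A[OF x'(1)]]] y(1) by blast
      then show False using y(1) x'(1) by blast
    qed
  qed (use R' in auto)
  finally show ?thesis .
qed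

lemma sum_isometry_reindex:
  fixes g :: "'k \<Rightarrow> 'c::comm_monoid_add"
  assumes R: "rep_system n A R"
    and T: "\<And>x. x \<in> A \<Longrightarrow> \<tau> x \<in> A"
    and inj: "\<And>x y. x \<in> A \<Longrightarrow> y \<in> A \<Longrightarrow> dv n (\<tau> x - \<tau> y) \<Longrightarrow> dv n (x - y)"
    and g: "\<And>x y. x \<in> A \<Longrightarrow> y \<in> A \<Longrightarrow> dv n (x - y) \<Longrightarrow> g x = g y"
  shows "(\<Sum>x\<in>R. g (\<tau> x)) = (\<Sum>x\<in>R. g x)"
proof -
  note R' = R[unfolded rep_system_def]
  obtain \<rho> where \<rho>: "\<And>x. x \<in> A \<Longrightarrow> \<rho> x \<in> R \<and> dv n (x - \<rho> x)"
    using R' by metis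
  have A: "x \<in> A" if "x \<in> R" for x using that R' by auto
  have inj': "inj_on (\<lambda>x. \<rho> (\<tau> x)) R"
  proof (rule inj_onI)
    fix x y assume xy: "x \<in> R" "y \<in> R" "\<rho> (\<tau> x) = \<rho> (\<tau> y)"
    have "dv n (\<tau> x - \<tau> y)"
      using dv_trans[of n "\<tau> x" "\<rho> (\<tau> x)" "\<tau> y"] \<rho>[OF T[OF A[OF xy(1)]]] \<rho>[OF T[OF A[OF xy(2)]]] xy(3)
      by (simp add: dv_diff_commute[of _ "\<tau> y"])
    then show "x = y" using inj A xy R' by blast
  qed
  have "(\<lambda>x. \<rho> (\<tau> x)) ` R \<subseteq> R" using \<rho> T A by blast
  then have im: "(\<lambda>x. \<rho> (\<tau> x)) ` R = R" using inj' R' by (simp add: endo_inj_surj)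
  have "(\<Sum>x\<in>R. g (\<tau> x)) = (\<Sum>x\<in>R. g (\<rho> (\<tau> x)))"
    using \<rho> T A g by (intro sum.cong refl) blast
  also have "\<dots> = sum g ((\<lambda>x. \<rho> (\<tau> x)) ` R)"
    using inj' by (simp add: sum.reindex)
  finally show ?thesis by (simp only: im)
qed

definition zreps :: "nat \<Rightarrow> 'k set"
  where "zreps n = of_nat ` {..<q ^ n}"

definition oreps :: "nat \<Rightarrow> 'k set"
  where "oreps n = (\<lambda>(i, j). of_nat i + of_nat j * \<theta>) ` ({..<q ^ n} \<times> {..<q ^ n})"

abbreviation OK :: "'k set" where "OK \<equiv> {x. dv 0 x}"

lemma zreps_rep_system: "rep_system n Zp (zreps n)"
  unfolding rep_system_def
proof (intro conjI ballI impI)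
  show "zreps n \<subseteq> Zp" by (auto simp: zreps_def Zp_iff)
  show "\<exists>y\<in>zreps n. dv n (x - y)" if "x \<in> Zp" for x
    using Zp_approx_nat[OF that, of n] by (auto simp: zreps_def)
  show "x = y" if "x \<in> zreps n" "y \<in> zreps n" "dv n (x - y)" for x y
    using that by (auto simp: zreps_def dv_of_nat_diff_iff)
qed (simp add: zreps_def)

lemma card_zreps [simp]: "card (zreps n) = q ^ n"
  by (simp add: zreps_def card_image inj_on_def)

lemma finite_zreps [simp]: "finite (zreps n)" and finite_oreps [simp]: "finite (oreps n)"
  by (auto simp: zreps_def oreps_def)

lemma zreps_Zp: "x \<in> zreps n \<Longrightarrow> x \<in> Zp"
  by (auto simp: zreps_def Zp_iff)

lemma oreps_OK: "x \<in> oreps n \<Longrightarrow> dv 0 x"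
  by (auto simp: oreps_def intro!: dv_add dv_mult_right)

lemma oreps_rep_system: "rep_system n OK (oreps n)"
  unfolding rep_system_def
proof (intro conjI ballI impI)
  show "oreps n \<subseteq> OK" using oreps_OK by auto
  show "\<exists>y\<in>oreps n. dv n (x - y)" if "x \<in> OK" for x
  proof -
    have x: "dv 0 x" using that by simp
    obtain i where i: "i < q ^ n" "dv n (re x - of_nat i)" using Zp_approx_nat[OF re_im_Zp(1)[OF x]] .
    obtain j where j: "j < q ^ n" "dv n (im x - of_nat j)" using Zp_approx_nat[OF re_im_Zp(2)[OF x]] .
    have "x - (of_nat i + of_nat j * \<theta>) = (re x - of_nat i) + (im x - of_nat j) * \<theta>"
      using re_im[of x] by (simp add: algebra_simps)
    then have "dv n (x - (of_nat i + of_nat j * \<theta>))"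
      using dv_add[OF i(2) dv_mult_right[OF j(2) dv_theta]] by (simp only:)
    then show ?thesis using i j by (auto simp: oreps_def)
  qed
  show "x = y" if xy: "x \<in> oreps n" "y \<in> oreps n" "dv n (x - y)" for x y
  proof -
    obtain i j where ij: "i < q ^ n" "j < q ^ n" "x = of_nat i + of_nat j * \<theta>" using xy by (auto simp: oreps_def)
    obtain i' j' where ij': "i' < q ^ n" "j' < q ^ n" "y = of_nat i' + of_nat j' * \<theta>" using xy by (auto simp: oreps_def)
    have "dv n (of_nat i - of_nat i')" "dv n (of_nat j - of_nat j')"
      using dv_re[OF xy(3)] dv_im[OF xy(3)] by (simp_all add: re_diff im_diff ij ij')
    then show "x = y" using ij ij' by (simp add: dv_of_nat_diff_iff)
  qed
qed (simp add: oreps_def)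

lemma card_oreps [simp]: "card (oreps n) = q ^ (2 * n)"
proof -
  have "inj_on (\<lambda>(i, j). of_nat i + of_nat j * \<theta>) ({..<q ^ n} \<times> {..<q ^ n})"
  proof (rule inj_onI, clarify)
    fix i j i' j' :: nat
    assume e: "of_nat i + of_nat j * \<theta> = of_nat i' + of_nat j' * \<theta>"
    have "re (of_nat i + of_nat j * \<theta>) = re (of_nat i' + of_nat j' * \<theta>)" 
      "im (of_nat i + of_nat j * \<theta>) = im (of_nat i' + of_nat j' * \<theta>)" using e by simp_all
    then show "i = i' \<and> j = j'" by simp
  qed
  then show ?thesis by (simp add: oreps_def card_image card_cartesian_product power_add mult_2)
qed

text \<open>Splitting off the lowest \<open>b\<close> digits of a q-adic expansion, for any
  \<open>A\<close> that is closed under adding and removing digits.\<close>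

lemma rep_system_lift:
  assumes R: "rep_system b A R" "rep_system c A R'"
    and A: "\<And>x y. x \<in> A \<Longrightarrow> y \<in> A \<Longrightarrow> x + of_nat q ^ b * y \<in> A"
    and A': "\<And>x y. x \<in> A \<Longrightarrow> y \<in> A \<Longrightarrow> dv b (x - y) \<Longrightarrow> (x - y) / of_nat q ^ b \<in> A"
    and Adv: "\<And>x. x \<in> A \<Longrightarrow> dv 0 x"
  shows "rep_system (b + c) A ((\<lambda>(x, y). x + of_nat q ^ b * y) ` (R \<times> R'))"
    and "inj_on (\<lambda>(x, y). x + of_nat q ^ b * y) (R \<times> R')"
proof -
  note R1 = R[unfolded rep_system_def]
  have *: "x = x' \<and> y = y'" if h: "x \<in> R" "x' \<in> R" "y \<in> R'" "y' \<in> R'"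
    "dv (b + c) (x + of_nat q ^ b * y - (x' + of_nat q ^ b * y'))" for x x' y y'
  proof -
    have "dv 0 (y - y')" using h Adv R1 by (intro dv_diff) auto
    then have "dv b (of_nat q ^ b * (y - y'))" by (intro dv_mult_right dv_p_power)
    from dv_diff[OF dv_mono[OF h(5)] this] have "dv b (x - x')" by (simp add: algebra_simps)
    then have xx: "x = x'" using h R1 by blast
    then have "dv (b + c) (of_nat q ^ b * (y - y'))" using h(5) by (simp add: algebra_simps)
    then have "dv c (y - y')" by (simp only: dv_p_mult_iff)
    then show ?thesis using xx h R1 by blast
  qed
  show "inj_on (\<lambda>(x, y). x + of_nat q ^ b * y) (R \<times> R')"
  proof (rule inj_onI, clarify)
    fix x y x' y' assume "x \<in> R" "y \<in> R'" "x' \<in> R" "y' \<in> R'" "x + of_nat q ^ b * y = x' + of_nat q ^ b * y'"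
    then show "x = x' \<and> y = y'" using *[of x x' y y'] by simp
  qed
  show "rep_system (b + c) A ((\<lambda>(x, y). x + of_nat q ^ b * y) ` (R \<times> R'))"
    unfolding rep_system_def
  proof (intro conjI ballI impI)
    show "finite ((\<lambda>(x, y). x + of_nat q ^ b * y) ` (R \<times> R'))" using R1 by auto
    show "(\<lambda>(x, y). x + of_nat q ^ b * y) ` (R \<times> R') \<subseteq> A"
    proof safe
      fix x y assume "x \<in> R" "y \<in> R'"
      then show "x + of_nat q ^ b * y \<in> A" using R1 by (intro A) auto
    qed
    show "\<exists>y\<in>(\<lambda>(x, y). x + of_nat q ^ b * y) ` (R \<times> R'). dv (b + c) (x - y)" if x: "x \<in> A" for x
    proof -
      obtain y where y: "y \<in> R" "dv b (x - y)" using x R1(1) by metis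
      then have "(x - y) / of_nat q ^ b \<in> A" using A'[OF x _ y(2)] R1(1) by auto
      then obtain z where z: "z \<in> R'" "dv c ((x - y) / of_nat q ^ b - z)" using R1(2) by metis
      then have "dv (b + c) (of_nat q ^ b * ((x - y) / of_nat q ^ b - z))" by (simp only: dv_p_mult_iff)
      moreover have "of_nat q ^ b * ((x - y) / of_nat q ^ b - z) = x - (y + of_nat q ^ b * z)"
        by (simp add: field_simps)
      ultimately have "dv (b + c) (x - (y + of_nat q ^ b * z))" by simp
      then show ?thesis using y z by (intro bexI[of _ "y + of_nat q ^ b * z"]) auto
    qed
    show "x = y" if xy: "x \<in> (\<lambda>(x, y). x + of_nat q ^ b * y) ` (R \<times> R')"
      "y \<in> (\<lambda>(x, y). x + of_nat q ^ b * y) ` (R \<times> R')" "dv (b + c) (x - y)" for x y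
    proof -
      obtain a a' where a: "a \<in> R" "a' \<in> R'" "x = a + of_nat q ^ b * a'" using xy(1) by auto
      obtain b1 b1' where b1: "b1 \<in> R" "b1' \<in> R'" "y = b1 + of_nat q ^ b * b1'" using xy(2) by auto
      show ?thesis using *[OF a(1) b1(1) a(2) b1(2)] xy(3) a(3) b1(3) by simp
    qed
  qed
qed

lemma sum_rep_system_lift:
  fixes g :: "'k \<Rightarrow> 'c::comm_monoid_add"
  assumes R: "rep_system b A R" "rep_system c A R'" "rep_system (b + c) A R''"
    and A: "\<And>x y. x \<in> A \<Longrightarrow> y \<in> A \<Longrightarrow> x + of_nat q ^ b * y \<in> A"
    and A': "\<And>x y. x \<in> A \<Longrightarrow> y \<in> A \<Longrightarrow> dv b (x - y) \<Longrightarrow> (x - y) / of_nat q ^ b \<in> A"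
    and Adv: "\<And>x. x \<in> A \<Longrightarrow> dv 0 x"
    and g: "\<And>x y. x \<in> A \<Longrightarrow> y \<in> A \<Longrightarrow> dv (b + c) (x - y) \<Longrightarrow> g x = g y"
  shows "(\<Sum>x\<in>R''. g x) = (\<Sum>x\<in>R. \<Sum>y\<in>R'. g (x + of_nat q ^ b * y))"
proof -
  let ?R = "(\<lambda>(x, y). x + of_nat q ^ b * y) ` (R \<times> R')"
  note l = rep_system_lift[OF R(1,2) A A' Adv]
  have "(\<Sum>x\<in>?R. g ((\<lambda>x. x) x)) = (\<Sum>x\<in>R''. g x)"
  proof (rule sum_class_reindex[OF l(1) R(3)])
    show "\<exists>x\<in>A. dv (b + c) (x - y)" if "y \<in> A" for y using that by (intro bexI[of _ y]) auto
    show "g x = g y" if "x \<in> A" "y \<in> A" "dv (b + c) (x - y)" for x y using g that by blast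
  qed
  then have "(\<Sum>x\<in>R''. g x) = (\<Sum>x\<in>?R. g x)" by simp
  also have "\<dots> = (\<Sum>(x, y)\<in>R \<times> R'. g (x + of_nat q ^ b * y))"
    by (subst sum.reindex[OF l(2)]) (auto intro!: sum.cong)
  finally show ?thesis by (simp add: sum.cartesian_product)
qed

lemma Zp_lift_closed: 
  "x \<in> Zp \<Longrightarrow> y \<in> Zp \<Longrightarrow> x + of_nat q ^ b * y \<in> (Zp::'k set)"
  "x \<in> Zp \<Longrightarrow> y \<in> Zp \<Longrightarrow> dv b (x - y) \<Longrightarrow> (x - y) / of_nat q ^ b \<in> (Zp::'k set)"
  by (auto simp: Zp_iff intro!: Qp_intros dv_add dv_mult_left)
     (simp add: dv_def absv_divide absv_p_power divide_simps)

lemma OK_lift_closed: 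
  "x \<in> OK \<Longrightarrow> y \<in> OK \<Longrightarrow> x + of_nat q ^ b * y \<in> OK"
  "x \<in> OK \<Longrightarrow> y \<in> OK \<Longrightarrow> dv b (x - y) \<Longrightarrow> (x - y) / of_nat q ^ b \<in> OK"
  by (auto intro!: dv_add dv_mult_left)
     (simp add: dv_def absv_divide absv_p_power divide_simps)

lemma sum_zreps_lift:
  fixes g :: "'k \<Rightarrow> 'c::comm_monoid_add"
  assumes g: "\<And>x y. x \<in> Zp \<Longrightarrow> y \<in> Zp \<Longrightarrow> dv (b + c) (x - y) \<Longrightarrow> g x = g y"
  shows "(\<Sum>x\<in>zreps (b + c). g x) = (\<Sum>x\<in>zreps b. \<Sum>y\<in>zreps c. g (x + of_nat q ^ b * y))"
  by (rule sum_rep_system_lift[OF zreps_rep_system zreps_rep_system zreps_rep_system Zp_lift_closed _ g])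
     (auto simp: Zp_iff)

lemma sum_zreps_level:
  fixes g :: "'k \<Rightarrow> complex"
  assumes g: "\<And>x y. x \<in> Zp \<Longrightarrow> y \<in> Zp \<Longrightarrow> dv b (x - y) \<Longrightarrow> g x = g y"
  shows "(\<Sum>x\<in>zreps (b + c). g x) = of_nat q ^ c * (\<Sum>x\<in>zreps b. g x)"
proof -
  have "(\<Sum>x\<in>zreps (b + c). g x) = (\<Sum>x\<in>zreps b. \<Sum>y\<in>zreps c. g (x + of_nat q ^ b * y))"
    using g dv_mono by (intro sum_zreps_lift) (meson le_add1)
  also have "\<dots> = (\<Sum>x\<in>zreps b. \<Sum>y\<in>zreps c. g x)"
  proof (intro sum.cong refl)
    fix x y assume xy: "x \<in> zreps b" "y \<in> zreps c"
    then have "dv b (of_nat q ^ b * y)" using zreps_Zp by (intro dv_mult_right dv_p_power) (auto simp: Zp_iff)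
    then show "g (x + of_nat q ^ b * y) = g x"
      using xy zreps_Zp Zp_lift_closed(1) by (intro g) auto
  qed
  finally show ?thesis by (simp add: sum_distrib_left)
qed

lemma sum_oreps_level:
  fixes g :: "'k \<Rightarrow> complex"
  assumes g: "\<And>x y. dv 0 x \<Longrightarrow> dv 0 y \<Longrightarrow> dv b (x - y) \<Longrightarrow> g x = g y"
  shows "(\<Sum>x\<in>oreps (b + c). g x) = of_nat q ^ (2 * c) * (\<Sum>x\<in>oreps b. g x)"
proof -
  have "(\<Sum>x\<in>oreps (b + c). g x) = (\<Sum>x\<in>oreps b. \<Sum>y\<in>oreps c. g (x + of_nat q ^ b * y))"
  proof (rule sum_rep_system_lift[OF oreps_rep_system oreps_rep_system oreps_rep_system OK_lift_closed])
    show "g x = g y" if "x \<in> OK" "y \<in> OK" "dv (b + c) (x - y)" for x y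
      using that dv_mono[OF that(3), of b] by (intro g) auto
  qed simp_all
  also have "\<dots> = (\<Sum>x\<in>oreps b. \<Sum>y\<in>oreps c. g x)"
  proof (intro sum.cong refl)
    fix x y assume xy: "x \<in> oreps b" "y \<in> oreps c"
    then have "dv b (of_nat q ^ b * y)" using oreps_OK by (intro dv_mult_right dv_p_power) auto
    then show "g (x + of_nat q ^ b * y) = g x"
      using xy oreps_OK OK_lift_closed(1)[of x y b] by (intro g) auto
  qed
  finally show ?thesis by (simp add: sum_distrib_left)
qed

lemma sum_zreps_dv:
  fixes g :: "'k \<Rightarrow> 'c::comm_monoid_add"
  assumes g: "\<And>x y. x \<in> Zp \<Longrightarrow> y \<in> Zp \<Longrightarrow> dv (b + c) (x - y) \<Longrightarrow> g x = g y"
  shows "(\<Sum>x\<in>zreps (b + c). if dv b x then g x else 0) = (\<Sum>y\<in>zreps c. g (of_nat q ^ b * y))"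
proof -
  have Zq: "of_nat q ^ b * y \<in> Zp" if "y \<in> Zp" for y :: 'k
    using that Zp_lift_closed(1)[of 0 y b] by (simp add: Zp_iff)
  have "(\<Sum>y\<in>zreps c. (\<lambda>x. if dv b x then g x else 0) (of_nat q ^ b * y)) = 
      (\<Sum>x\<in>zreps (b + c). if dv b x then g x else 0)"
  proof (rule sum_class_reindex[OF zreps_rep_system zreps_rep_system])
    fix x y :: 'k assume xy: "x \<in> Zp" "y \<in> Zp"
    have e: "of_nat q ^ b * x - of_nat q ^ b * y = of_nat q ^ b * (x - y)" by (simp add: algebra_simps)
    show "of_nat q ^ b * x \<in> Zp" using Zq xy by blast
    show "dv c (x - y) \<Longrightarrow> dv (b + c) (of_nat q ^ b * x - of_nat q ^ b * y)"
      "dv (b + c) (of_nat q ^ b * x - of_nat q ^ b * y) \<Longrightarrow> dv c (x - y)"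
      unfolding e dv_p_mult_iff by auto
    show "\<exists>x\<in>Zp. dv (b + c) (of_nat q ^ b * x - y)" if "(if dv b y then g y else 0) \<noteq> 0"
    proof (intro bexI)
      have "dv b y" using that by (auto split: if_splits)
      then show "y / of_nat q ^ b \<in> Zp" using Zp_lift_closed(2)[OF xy(2), of 0 b] by (simp add: Zp_iff)
    qed simp
    assume d: "dv (b + c) (x - y)"
    then have "dv b (x - y)" "dv b (y - x)" using dv_mono dv_diff_commute by (meson le_add1)+
    then have "dv b x \<longleftrightarrow> dv b y" using dv_add[of b "x - y" y] dv_add[of b "y - x" x] by auto
    then show "(if dv b x then g x else 0) = (if dv b y then g y else 0)" using g[OF xy d] by simp
  qed
  moreover have "dv b (of_nat q ^ b * y)" if "y \<in> zreps c" for y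
    using that zreps_Zp by (intro dv_mult_right dv_p_power) (auto simp: Zp_iff)
  ultimately show ?thesis by (auto intro!: sum.cong)
qed

text \<open>Scaling by an arbitrary element of valuation \<open>b\<close>, not just by
  \<open>q^b\<close>; it will be applied to the element \<kappa> whose norm normalises a quadratic
  condition.\<close>

lemma sum_oreps_scale:
  fixes g :: "'k \<Rightarrow> 'c::comm_monoid_add"
  assumes k: "absv \<kappa> = 1 / real q ^ b"
    and g: "\<And>x y. dv 0 x \<Longrightarrow> dv 0 y \<Longrightarrow> dv (b + c) (x - y) \<Longrightarrow> g x = g y"
    and s: "\<And>x. dv 0 x \<Longrightarrow> g x \<noteq> 0 \<Longrightarrow> dv b x"
  shows "(\<Sum>x\<in>oreps (b + c). g x) = (\<Sum>y\<in>oreps c. g (\<kappa> * y))"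
proof -
  have "absv \<kappa> > 0" using k by simp
  then have k0: "\<kappa> \<noteq> 0" by simp
  have kd: "dv (b + n) (\<kappa> * x) \<longleftrightarrow> dv n x" for n x
    by (simp add: dv_def absv_mult k power_add field_simps)
  have "(\<Sum>y\<in>oreps c. g (\<kappa> * y)) = (\<Sum>x\<in>oreps (b + c). g x)"
  proof (rule sum_class_reindex[OF oreps_rep_system oreps_rep_system])
    fix x y assume xy: "x \<in> OK" "y \<in> OK"
    show "\<kappa> * x \<in> OK" using xy kd[of 0 x] dv_mono[of b "\<kappa> * x" 0] by simp
    show "dv c (x - y) \<Longrightarrow> dv (b + c) (\<kappa> * x - \<kappa> * y)" "dv (b + c) (\<kappa> * x - \<kappa> * y) \<Longrightarrow> dv c (x - y)"
      by (simp_all add: kd right_diff_distrib[symmetric])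
    show "\<exists>x\<in>OK. dv (b + c) (\<kappa> * x - y)" if "g y \<noteq> 0"
    proof (intro bexI)
      show "y / \<kappa> \<in> OK" using s[of y] that xy kd[of 0 "y / \<kappa>"] k0 by simp
    qed (use k0 in simp)
    show "dv (b + c) (x - y) \<Longrightarrow> g x = g y" using xy by (intro g) auto
  qed
  then show ?thesis by simp
qed

text \<open>A closed ball in a complete space is complete, and the finite sets
  \<open>oreps n\<close> make it totally bounded.\<close>

lemma compact_OK: "compact OK"
  unfolding compact_eq_totally_bounded
proof (intro conjI allI impI)
  have "OK = cball 0 1" by (auto simp: dv_0_iff dist_absv)
  then show "complete OK" by (simp add: complete_eq_closed)
  fix e :: real assume e: "e > 0"
  obtain n where n: "1 / real q ^ n < e"
    using real_arch_pow_inv[of e "1 / real q"] e p_gt_1 by (auto simp: power_divide)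
  have "OK \<subseteq> (\<Union>x\<in>oreps n. ball x e)"
  proof
    fix x assume "x \<in> OK"
    then obtain y where y: "y \<in> oreps n" "dv n (x - y)" using oreps_rep_system[of n] by (auto simp: rep_system_def)
    then have "dist y x < e" using n by (simp add: dist_absv dv_def absv_diff_commute)
    then show "x \<in> (\<Union>x\<in>oreps n. ball x e)" using y by auto
  qed
  then show "\<exists>k. finite k \<and> OK \<subseteq> (\<Union>x\<in>k. ball x e)" using finite_oreps by blast
qed

section \<open>Integration of step functions\<close>

text \<open>Quantitative form of \<open>schwartz_bruhat\<close>. With the level \<open>N\<close> of
  constancy and the bound \<open>M\<close> on the support explicit, an integral is a finite sum over
  \<open>oreps (M + N)\<close>.\<close>

definition step_function :: "nat \<Rightarrow> nat \<Rightarrow> ('k \<Rightarrow> complex) \<Rightarrow> bool"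
  where "step_function N M F \<longleftrightarrow>
    (\<forall>x y. dv N (x - y) \<longrightarrow> F x = F y) \<and> (\<forall>x. F x \<noteq> 0 \<longrightarrow> dv 0 (of_nat q ^ M * x))"

lemma compact_scaled_OK: "compact {x. dv 0 (of_nat q ^ M * x)}"
proof -
  have "{x. dv 0 (of_nat q ^ M * x)} = (\<lambda>x. x / of_nat q ^ M) ` OK"
  proof (intro equalityI subsetI)
    fix x assume "x \<in> {x. dv 0 (of_nat q ^ M * x)}"
    then show "x \<in> (\<lambda>x. x / of_nat q ^ M) ` OK" by (intro image_eqI[of _ _ "of_nat q ^ M * x"]) auto
  qed auto
  moreover have "continuous_on OK (\<lambda>x. x / of_nat q ^ M)"
  proof (unfold continuous_on_iff, intro ballI allI impI)
    fix x :: 'k and e :: real assume "e > 0"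
    show "\<exists>d>0. \<forall>x'\<in>OK. dist x' x < d \<longrightarrow> dist (x' / of_nat q ^ M) (x / of_nat q ^ M) < e"
    proof (intro exI conjI ballI impI)
      show "e / real q ^ M > 0" using \<open>e > 0\<close> by simp
      fix x' assume d: "dist x' x < e / real q ^ M"
      have "x' / of_nat q ^ M - x / of_nat q ^ M = (x' - x) / of_nat q ^ M"
        by (simp add: diff_divide_distrib)
      then show "dist (x' / of_nat q ^ M) (x / of_nat q ^ M) < e"
        using d by (simp add: dist_absv absv_divide absv_p_power field_simps)
    qed
  qed
  ultimately show ?thesis using compact_OK by (simp add: compact_continuous_image)
qed

lemma ex_inverse_power_less: "e > 0 \<Longrightarrow> \<exists>n. 1 / real q ^ n < e"
  using real_arch_pow_inv[of e "1 / real q"] p_gt_1 by (auto simp: power_divide)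

text \<open>The Lebesgue number of a cover of the compact closure of the support turns local
  constancy into constancy on balls of one fixed radius; a point outside this closure contributes
  the value 0.\<close>

lemma schwartz_bruhat_iff: "schwartz_bruhat \<Phi> \<longleftrightarrow> (\<exists>N M. step_function N M \<Phi>)"
proof
  assume "schwartz_bruhat \<Phi>"
  then have lc: "\<exists>U. open U \<and> x \<in> U \<and> (\<forall>y\<in>U. \<Phi> y = \<Phi> x)" 
    and cp: "compact (closure {x. \<Phi> x \<noteq> 0})" for x
    by (auto simp: schwartz_bruhat_def)
  define C where "C = closure {x. \<Phi> x \<noteq> 0}"
  define G where "G = {U. open U \<and> (\<forall>x\<in>U. \<forall>y\<in>U. \<Phi> x = \<Phi> y)}"
  have C: "compact C" "\<And>x. \<Phi> x \<noteq> 0 \<Longrightarrow> x \<in> C"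
    using cp closure_subset[of "{x. \<Phi> x \<noteq> 0}"] by (auto simp: C_def)
  have op: "open U" if "U \<in> G" for U using that by (simp add: G_def)
  have sub: "C \<subseteq> \<Union>G"
  proof
    fix x assume "x \<in> C"
    obtain U where U: "open U" "x \<in> U" "\<forall>y\<in>U. \<Phi> y = \<Phi> x" using lc[of x] by (elim exE conjE)
    have "\<forall>a\<in>U. \<forall>b\<in>U. \<Phi> a = \<Phi> b"
    proof (intro ballI)
      fix a b assume "a \<in> U" "b \<in> U"
      then have "\<Phi> a = \<Phi> x" "\<Phi> b = \<Phi> x" using U(3) by blast+
      then show "\<Phi> a = \<Phi> b" by (rule trans[OF _ sym])
    qed
    then have "U \<in> G" unfolding G_def by (intro CollectI conjI U(1))
    then have "\<exists>U\<in>G. x \<in> U" using U(2) by (rule_tac bexI)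
    then show "x \<in> \<Union>G" by blast
  qed
  obtain e where e: "e > 0" "\<And>x. x \<in> C \<Longrightarrow> \<exists>U\<in>G. ball x e \<subseteq> U"
    using Heine_Borel_lemma[OF C(1) sub op] by metis
  obtain N where N: "1 / real q ^ N < e" using ex_inverse_power_less e(1) by blast
  have *: "\<Phi> x = \<Phi> y" if "x \<in> C" "dv N (x - y)" for x y
  proof -
    obtain U where U: "U \<in> G" "ball x e \<subseteq> U" using e(2) \<open>x \<in> C\<close> by blast
    have "y \<in> ball x e" "x \<in> ball x e" using that(2) N e(1) by (auto simp: dist_absv dv_def)
    moreover have "\<forall>x\<in>U. \<forall>y\<in>U. \<Phi> x = \<Phi> y" using U(1) unfolding G_def by (elim CollectE conjE)
    ultimately show ?thesis using U(2) by blast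
  qed
  obtain B where B: "\<And>x. x \<in> C \<Longrightarrow> dist 0 x \<le> B"
    using compact_imp_bounded[OF C(1)] unfolding bounded_any_center[where a=0] by blast
  obtain M where M: "B < real q ^ M" using real_arch_pow[of "real q" B] p_gt_1 by blast
  have "step_function N M \<Phi>"
    unfolding step_function_def
  proof (intro conjI allI impI)
    fix x y assume d: "dv N (x - y)"
    then have d': "dv N (y - x)" by (simp add: dv_diff_commute)
    show "\<Phi> x = \<Phi> y"
    proof (cases "x \<in> C \<or> y \<in> C")
      case True
      then show ?thesis using *[OF _ d] *[OF _ d', symmetric] by blast
    next
      case False
      then have "\<Phi> x = 0" "\<Phi> y = 0" using C(2) by blast+
      then show ?thesis by simp
    qed
  next
    fix x assume "\<Phi> x \<noteq> 0"
    then have "absv x < real q ^ M" using B[OF C(2)[of x]] M by (simp add: dist_absv)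
    then show "dv 0 (of_nat q ^ M * x)" by (simp add: dv_def absv_mult absv_p_power field_simps)
  qed
  then show "\<exists>N M. step_function N M \<Phi>" by blast
next
  assume "\<exists>N M. step_function N M \<Phi>"
  then obtain N M where st: "step_function N M \<Phi>" by blast
  have "compact (closure {x. \<Phi> x \<noteq> 0})"
  proof -
    have "{x. \<Phi> x \<noteq> 0} \<subseteq> {x. dv 0 (of_nat q ^ M * x)}" using st by (auto simp: step_function_def)
    then have "closure {x. \<Phi> x \<noteq> 0} \<subseteq> {x. dv 0 (of_nat q ^ M * x)}"
      using compact_scaled_OK by (intro closure_minimal compact_imp_closed)
    then show ?thesis using compact_scaled_OK closed_closure
      by (metis compact_Int_closed inf.absorb_iff2)
  qed
  moreover have "\<exists>U. open U \<and> x \<in> U \<and> (\<forall>y\<in>U. \<Phi> y = \<Phi> x)" for x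
  proof (intro exI conjI ballI)
    show "open (ball x (1 / real q ^ N))" "x \<in> ball x (1 / real q ^ N)" by auto
    fix y assume "y \<in> ball x (1 / real q ^ N)"
    then have "dv N (y - x)" by (simp add: dist_absv dv_def absv_diff_commute)
    then show "\<Phi> y = \<Phi> x" using st unfolding step_function_def by blast
  qed
  ultimately show "schwartz_bruhat \<Phi>" by (simp add: schwartz_bruhat_def)
qed

end

locale unram_haar = unram_quad q T bar \<theta>
    for q :: nat and T :: "'k::{field_char_0,complete_space} itself" and bar :: "'k \<Rightarrow> 'k" and \<theta> :: 'k +
  fixes \<mu> :: "'k measure"
  assumes haar: "normalized_add_haar \<mu>"
begin

lemma sets_mu: "sets \<mu> = sets borel" and space_mu: "space \<mu> = UNIV"
  using haar unfolding normalized_add_haar_def haar_measure_def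
  by (auto simp: borel_def)

text \<open>The radius is given by an element \<open>s\<close> rather than by a real number: the
  measure of the ball is then the module |s|^2 of \<open>s\<close> on K, and a dilation acts on
  \<open>s\<close> directly.\<close>

definition bl :: "'k \<Rightarrow> 'k \<Rightarrow> 'k set"
  where "bl a s = {x. absv (x - a) \<le> absv s}"

lemma bl_sets: "bl a s \<in> sets \<mu>"
proof -
  have "bl a s = cball a (absv s)" by (auto simp: bl_def dist_absv absv_diff_commute)
  then show ?thesis by (simp add: sets_mu)
qed

lemma emeasure_bl_translate: "emeasure \<mu> (bl a s) = emeasure \<mu> (bl 0 s)"
proof -
  have "bl a s = (\<lambda>x. a + x) ` bl 0 s"
  proof (intro equalityI subsetI)
    fix x assume "x \<in> bl a s"
    then show "x \<in> (\<lambda>x. a + x) ` bl 0 s" by (intro image_eqI[of _ _ "x - a"]) (auto simp: bl_def)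
  qed (auto simp: bl_def)
  moreover have "emeasure \<mu> ((\<lambda>x. a \<otimes>\<^bsub>add_group_of TYPE('k)\<^esub> x) ` bl 0 s) = emeasure \<mu> (bl 0 s)"
    using haar bl_sets unfolding normalized_add_haar_def haar_measure_def
    by (auto simp: add_group_of_def)
  ultimately show ?thesis by (simp add: add_group_of_def)
qed

lemma emeasure_bl_one: "emeasure \<mu> (bl a 1) = 1"
  using haar emeasure_bl_translate[of a 1] by (simp add: normalized_add_haar_def bl_def)

lemma emeasure_bl_partition:
  assumes "finite S" "bl b s' = (\<Union>a\<in>S. bl a s)" "\<And>a a'. a \<in> S \<Longrightarrow> a' \<in> S \<Longrightarrow> absv (a - a') \<le> absv s \<Longrightarrow> a = a'"
  shows "emeasure \<mu> (bl b s') = of_nat (card S) * emeasure \<mu> (bl 0 s)"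
proof -
  have "disjoint_family_on (\<lambda>a. bl a s) S"
    unfolding disjoint_family_on_def
  proof (intro ballI impI)
    fix a a' assume a: "a \<in> S" "a' \<in> S" "a \<noteq> a'"
    show "bl a s \<inter> bl a' s = {}"
    proof (rule ccontr)
      assume "bl a s \<inter> bl a' s \<noteq> {}"
      then obtain x where "absv (x - a) \<le> absv s" "absv (x - a') \<le> absv s" by (auto simp: bl_def)
      then have "absv (a - a') \<le> absv s" 
        using absv_diff_trans[of a x "absv s" a'] by (simp add: absv_diff_commute)
      then show False using assms(3) a by blast
    qed
  qed
  then have "(\<Sum>a\<in>S. emeasure \<mu> (bl a s)) = emeasure \<mu> (\<Union>a\<in>S. bl a s)"
    using assms(1) bl_sets by (intro sum_emeasure) auto
  moreover have "(\<Sum>a\<in>S. emeasure \<mu> (bl a s)) = (\<Sum>a\<in>S. emeasure \<mu> (bl 0 s))"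
    by (intro sum.cong refl emeasure_bl_translate)
  ultimately show ?thesis using assms(2) by simp
qed

text \<open>By translation invariance only counting is needed: the unit ball consists of q^(2n)
  balls of radius q^(-n), and the ball of radius q^n of q^(2n) unit balls. Every radius is of one of
  these two forms because K is unramified.\<close>

lemma emeasure_bl:
  assumes "s \<noteq> 0"
  shows "emeasure \<mu> (bl a s) = ennreal ((absv s)\<^sup>2)"
proof -
  have dvbl: "x \<in> bl a (of_nat q ^ n) \<longleftrightarrow> dv n (x - a)" for x a n
    by (simp add: bl_def dv_def absv_p_power)
  have rs: "\<exists>y\<in>oreps n. dv n (x - y)" if "dv 0 x" for x n
    using oreps_rep_system[of n] that by (auto simp: rep_system_def)
  have rs': "x = y" if "x \<in> oreps n" "y \<in> oreps n" "dv n (x - y)" for x y n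
    using oreps_rep_system[of n] that by (auto simp: rep_system_def)
  have small: "emeasure \<mu> (bl 0 (of_nat q ^ n)) = ennreal ((absv (of_nat q ^ n :: 'k))\<^sup>2)" for n
  proof -
    have "bl 0 1 = (\<Union>a\<in>oreps n. bl a (of_nat q ^ n))"
    proof (intro equalityI subsetI)
      fix x assume "x \<in> bl 0 1"
      then show "x \<in> (\<Union>a\<in>oreps n. bl a (of_nat q ^ n))" using rs[of x n] by (auto simp: dvbl) (auto simp: bl_def dv_def)
    next
      fix x assume "x \<in> (\<Union>a\<in>oreps n. bl a (of_nat q ^ n))"
      then obtain a where a: "a \<in> oreps n" "dv n (x - a)" by (auto simp: dvbl)
      then have "dv 0 (x - a + a)" by (intro dv_add) (auto intro: dv_mono[of n] oreps_OK)
      then show "x \<in> bl 0 1" by (simp add: bl_def dv_def)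
    qed
    from emeasure_bl_partition[OF finite_oreps this]
    have e: "1 = of_nat (q ^ (2 * n)) * emeasure \<mu> (bl 0 (of_nat q ^ n))"
      using rs' emeasure_bl_one[of 0] by (auto simp: dv_def absv_p_power)
    define r where "r = emeasure \<mu> (bl 0 (of_nat q ^ n))"
    have "r \<noteq> \<infinity>" using e by (auto simp: r_def ennreal_mult_top)
    then obtain r' where r': "r' \<ge> 0" "r = ennreal r'" by (metis ennreal_cases infinity_ennreal_def)
    have "ennreal 1 = ennreal (real (q ^ (2 * n)) * r')"
      using e r' by (simp add: r_def ennreal_mult ennreal_of_nat_eq_real_of_nat)
    then have "1 = real (q ^ (2 * n)) * r'" using r'(1) by (subst (asm) ennreal_inj) auto
    then have "r' = (1 / real q ^ n)\<^sup>2" by (simp add: field_simps power_mult power2_eq_square power_add mult_2)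
    then show ?thesis using r' r_def by (simp add: absv_p_power)
  qed
  have big: "emeasure \<mu> (bl 0 (1 / of_nat q ^ n)) = ennreal ((absv (1 / of_nat q ^ n :: 'k))\<^sup>2)" for n
  proof -
    have dvd: "x \<in> bl 0 (1 / of_nat q ^ n) \<longleftrightarrow> dv 0 (of_nat q ^ n * x)" for x
      by (simp add: bl_def dv_def absv_mult absv_divide absv_p_power field_simps)
    have eq: "bl 0 (1 / of_nat q ^ n) = (\<Union>a\<in>(\<lambda>y. y / of_nat q ^ n) ` oreps n. bl a 1)"
    proof (intro equalityI subsetI)
      fix x assume "x \<in> bl 0 (1 / of_nat q ^ n)"
      then have "dv 0 (of_nat q ^ n * x)" by (simp only: dvd)
      then obtain y where y: "y \<in> oreps n" "dv n (of_nat q ^ n * x - y)" using rs by blast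
      have "x - y / of_nat q ^ n = (of_nat q ^ n * x - y) / of_nat q ^ n" by (simp add: field_simps)
      then have "absv (x - y / of_nat q ^ n) \<le> 1" using y(2)
        by (simp add: dv_def absv_divide absv_p_power field_simps)
      then show "x \<in> (\<Union>a\<in>(\<lambda>y. y / of_nat q ^ n) ` oreps n. bl a 1)" using y(1) by (auto simp: bl_def)
    next
      fix x assume "x \<in> (\<Union>a\<in>(\<lambda>y. y / of_nat q ^ n) ` oreps n. bl a 1)"
      then obtain y where y: "y \<in> oreps n" "absv (x - y / of_nat q ^ n) \<le> 1" by (auto simp: bl_def)
      have "dv 0 (of_nat q ^ n * (x - y / of_nat q ^ n) + y)"
        using y(2) by (intro dv_add dv_mult_left oreps_OK[OF y(1)] dv_p_power_0) (simp add: dv_def)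
      moreover have "of_nat q ^ n * (x - y / of_nat q ^ n) + y = of_nat q ^ n * x" by (simp add: field_simps)
      ultimately show "x \<in> bl 0 (1 / of_nat q ^ n)" by (simp only: dvd)
    qed
    have inj: "a = a'" if aa: "a \<in> (\<lambda>y. y / of_nat q ^ n) ` oreps n" "a' \<in> (\<lambda>y. y / of_nat q ^ n) ` oreps n"
      "absv (a - a') \<le> absv (1::'k)" for a a'
    proof -
      obtain y y' where y: "y \<in> oreps n" "a = y / of_nat q ^ n" "y' \<in> oreps n" "a' = y' / of_nat q ^ n"
        using aa(1,2) by blast
      have "a - a' = (y - y') / of_nat q ^ n" by (simp add: y diff_divide_distrib)
      then have "absv ((y - y') / of_nat q ^ n) \<le> 1" using aa(3) by (simp only: absv_one)
      then have "dv n (y - y')" by (simp add: dv_def absv_divide absv_p_power field_simps)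
      then show "a = a'" using rs' y by blast
    qed
    have "emeasure \<mu> (bl 0 (1 / of_nat q ^ n)) = of_nat (card ((\<lambda>y. y / of_nat q ^ n) ` oreps n)) * emeasure \<mu> (bl 0 1)"
      by (rule emeasure_bl_partition[OF _ eq inj]) simp_all
    also have "emeasure \<mu> (bl 0 1) = 1" by (rule emeasure_bl_one)
    also have "card ((\<lambda>y. y / of_nat q ^ n) ` oreps n) = q ^ (2 * n)"
      by (subst card_image) (auto simp: inj_on_def)
    finally show ?thesis
      by (simp add: absv_divide absv_p_power power_mult power2_eq_square power_add mult_2 ennreal_of_nat_eq_real_of_nat)
  qed
  obtain n where n: "absv s = real q powi n" using absv_value[OF assms] by blast
  have "emeasure \<mu> (bl 0 s) = ennreal ((absv s)\<^sup>2)"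
  proof (cases "n \<ge> 0")
    case True
    then have "absv s = absv (1 / of_nat q ^ nat n :: 'k)" 
      by (simp add: n absv_divide absv_p_power power_int_def)
    then show ?thesis using big[of "nat n"] by (simp add: bl_def)
  next
    case False
    then have "absv s = absv (of_nat q ^ nat (- n) :: 'k)" 
      by (simp add: n absv_p_power power_int_def field_simps)
    then show ?thesis using small[of "nat (- n)"] by (simp add: bl_def)
  qed
  then show ?thesis by (simp only: emeasure_bl_translate[of a s])
qed

lemma measure_bl: "s \<noteq> 0 \<Longrightarrow> measure \<mu> (bl a s) = (absv s)\<^sup>2"
  by (simp add: measure_def emeasure_bl)

lemma step_repr:
  assumes "step_function N M F"
  shows "F x = (\<Sum>a\<in>oreps (M + N). indicator (bl (a / of_nat q ^ M) (of_nat q ^ N)) x *\<^sub>R F (a / of_nat q ^ M))"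
proof -
  have F: "\<And>x y. dv N (x - y) \<Longrightarrow> F x = F y" "\<And>x. F x \<noteq> 0 \<Longrightarrow> dv 0 (of_nat q ^ M * x)"
    using assms unfolding step_function_def by blast+
  have dvbl: "x \<in> bl (a / of_nat q ^ M) (of_nat q ^ N) \<longleftrightarrow> dv (M + N) (of_nat q ^ M * x - a)" for a
  proof -
    have "of_nat q ^ M * x - a = of_nat q ^ M * (x - a / of_nat q ^ M)" by (simp add: field_simps)
    then show ?thesis by (simp add: bl_def absv_p_power dv_p_mult_iff) (simp add: dv_def)
  qed
  show ?thesis
  proof (cases "dv 0 (of_nat q ^ M * x)")
    case True
    then obtain a where a: "a \<in> oreps (M + N)" "dv (M + N) (of_nat q ^ M * x - a)"
      using oreps_rep_system[of "M + N"] by (auto simp: rep_system_def)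
    have u: "b = a" if "b \<in> oreps (M + N)" "dv (M + N) (of_nat q ^ M * x - b)" for b
      using oreps_rep_system[of "M + N"] that a dv_trans[of "M + N" b "of_nat q ^ M * x" a]
      by (auto simp: rep_system_def dv_diff_commute)
    have "(\<Sum>a\<in>oreps (M + N). indicator (bl (a / of_nat q ^ M) (of_nat q ^ N)) x *\<^sub>R F (a / of_nat q ^ M))
      = (\<Sum>b\<in>oreps (M + N). if b = a then F (a / of_nat q ^ M) else 0)"
    proof (intro sum.cong refl)
      fix b assume "b \<in> oreps (M + N)"
      then have "b = a \<longleftrightarrow> x \<in> bl (b / of_nat q ^ M) (of_nat q ^ N)" using u[of b] a(2) by (auto simp: dvbl)
      then show "indicator (bl (b / of_nat q ^ M) (of_nat q ^ N)) x *\<^sub>R F (b / of_nat q ^ M) =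
        (if b = a then F (a / of_nat q ^ M) else 0)" by (auto simp: indicator_def)
    qed
    also have "\<dots> = F (a / of_nat q ^ M)" using a(1) by simp
    also have "\<dots> = F x"
    proof (rule F(1)[symmetric])
      show "dv N (x - a / of_nat q ^ M)" using a(2) dvbl[of a] by (simp add: bl_def dv_def absv_p_power)
    qed
    finally show ?thesis by simp
  next
    case False
    have "x \<notin> bl (a / of_nat q ^ M) (of_nat q ^ N)" if "a \<in> oreps (M + N)" for a
    proof
      assume "x \<in> bl (a / of_nat q ^ M) (of_nat q ^ N)"
      then have "dv (M + N) (of_nat q ^ M * x - a)" by (simp only: dvbl)
      then have "dv 0 (of_nat q ^ M * x - a + a)" using oreps_OK[OF that] by (intro dv_add) (auto intro: dv_mono)
      then show False using False by simp
    qed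
    then show ?thesis using False F(2)[of x] by (auto simp: indicator_def)
  qed
qed

lemma has_integral_step_affine:
  assumes "step_function N M F" "t \<noteq> 0"
  shows "has_bochner_integral \<mu> (\<lambda>x. F (t * x + d))
    (\<Sum>a\<in>oreps (M + N). (1 / real q ^ N / absv t)\<^sup>2 *\<^sub>R F (a / of_nat q ^ M))"
proof -
  have *: "t * x + d \<in> bl b (of_nat q ^ N) \<longleftrightarrow> x \<in> bl ((b - d) / t) (of_nat q ^ N / t)" for x b
  proof -
    have "t * x + d - b = t * (x - (b - d) / t)" using assms(2) by (simp add: field_simps)
    then show ?thesis using assms(2)
      by (simp add: bl_def absv_mult absv_divide field_simps)
  qed
  have "(\<lambda>x. F (t * x + d)) = (\<lambda>x. \<Sum>a\<in>oreps (M + N).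
      indicator (bl ((a / of_nat q ^ M - d) / t) (of_nat q ^ N / t)) x *\<^sub>R F (a / of_nat q ^ M))"
    by (rule ext, subst step_repr[OF assms(1)]) (simp add: indicator_def *)
  moreover have "has_bochner_integral \<mu> (\<lambda>x. \<Sum>a\<in>oreps (M + N).
      indicator (bl ((a / of_nat q ^ M - d) / t) (of_nat q ^ N / t)) x *\<^sub>R F (a / of_nat q ^ M))
      (\<Sum>a\<in>oreps (M + N). measure \<mu> (bl ((a / of_nat q ^ M - d) / t) (of_nat q ^ N / t)) *\<^sub>R F (a / of_nat q ^ M))"
    using assms(2) by (intro has_bochner_integral_sum has_bochner_integral_indicator)
      (auto simp: bl_sets emeasure_bl)
  moreover have "measure \<mu> (bl b (of_nat q ^ N / t)) = (1 / real q ^ N / absv t)\<^sup>2" for b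
    using assms(2) by (simp add: measure_bl absv_divide absv_p_power)
  ultimately show ?thesis by simp
qed

text \<open>Change of variables is proved for step functions by evaluating both sides as finite
  sums; all integrands below are of this kind.\<close>

lemma integral_step_affine:
  assumes "step_function N M F" "t \<noteq> 0"
  shows "(\<integral>x. F (t * x + d) \<partial>\<mu>) = (\<integral>x. F x \<partial>\<mu>) / of_real ((absv t)\<^sup>2)"
proof -
  have "(\<integral>x. F x \<partial>\<mu>) = (\<Sum>a\<in>oreps (M + N). (1 / real q ^ N)\<^sup>2 *\<^sub>R F (a / of_nat q ^ M))"
    using has_integral_step_affine[OF assms(1), of 1 0] by (simp add: has_bochner_integral_integral_eq)
  moreover have "(\<integral>x. F (t * x + d) \<partial>\<mu>) = (\<Sum>a\<in>oreps (M + N). (1 / real q ^ N / absv t)\<^sup>2 *\<^sub>R F (a / of_nat q ^ M))"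
    using has_integral_step_affine[OF assms, of d] by (simp add: has_bochner_integral_integral_eq)
  ultimately show ?thesis
    by (simp add: sum_divide_distrib scaleR_conv_of_real power_divide field_simps)
qed

lemma integrable_step:
  assumes "step_function N M F"
  shows "integrable \<mu> F"
  using has_integral_step_affine[OF assms, of 1 0] by (simp add: has_bochner_integral_iff)

lemma integral_step_oreps:
  assumes "step_function N 0 F"
  shows "(\<integral>x. F x \<partial>\<mu>) = (\<Sum>x\<in>oreps N. F x) / of_nat q ^ (2 * N)"
  using has_integral_step_affine[OF assms, of 1 0]
  by (simp add: has_bochner_integral_integral_eq scaleR_conv_of_real power_divide sum_divide_distrib power_mult power2_eq_square
      power_add mult_2)

end

section \<open>The character of the quadratic extension\<close>

declare One_nat_def [simp del]

text \<open>The multiplicative group of complex numbers has no small subgroups: in z^2 - 1 = (z -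
  1)(z + 1) the second factor has modulus at least 3/2, so each squaring moves z away from 1 by that
  factor.\<close>

lemma eq_1_if_powers_close:
  fixes z :: complex
  assumes "\<And>k. cmod (z ^ (2 ^ k) - 1) \<le> 1 / 2"
  shows "z = 1"
proof (rule ccontr)
  assume "z \<noteq> 1"
  define d where "d = cmod (z - 1)"
  have d: "d > 0" using \<open>z \<noteq> 1\<close> by (simp add: d_def)
  have *: "(3 / 2) ^ k * d \<le> cmod (z ^ (2 ^ k) - 1)" for k
  proof (induction k)
    case 0
    then show ?case by (simp add: d_def)
  next
    case (Suc k)
    define y where "y = z ^ (2 ^ k)"
    have "z ^ (2 ^ Suc k) = y\<^sup>2" unfolding y_def by (metis power_Suc2 power_mult)
    then have "z ^ (2 ^ Suc k) - 1 = (y - 1) * (2 + (y - 1))"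
      by (simp add: power2_eq_square algebra_simps)
    moreover have "cmod (2 + (y - 1)) \<ge> 3 / 2"
      using norm_triangle_ineq2[of "2::complex" "- (y - 1)"] assms[of k] norm_minus_commute[of 1 y] by (simp add: y_def)
    then have "cmod (y - 1) * (3 / 2) \<le> cmod (y - 1) * cmod (2 + (y - 1))"
      by (intro mult_left_mono) auto
    ultimately have "cmod (z ^ (2 ^ Suc k) - 1) \<ge> cmod (y - 1) * (3 / 2)"
      by (simp only: norm_mult)
    then show ?case using Suc by (simp add: y_def algebra_simps)
  qed
  obtain k where "1 / d < (3 / 2) ^ k" using real_arch_pow[of "3 / 2" "1 / d"] by auto
  then have "1 < (3 / 2) ^ k * d" using d by (simp add: field_simps)
  then show False using *[of k] assms[of k] by simp
qed

locale weil_setup = unram_haar q T bar \<theta> \<mu>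
    for q :: nat and T :: "'k::{field_char_0,complete_space} itself" and bar :: "'k \<Rightarrow> 'k" and \<theta> :: 'k
      and \<mu> :: "'k measure" +
  fixes lam \<psi> :: "'k \<Rightarrow> complex" and m :: nat
  assumes mult_char: "mult_character lam" and conductor: "exp_conductor q lam = m" and m_ge_2: "m \<ge> 2"
    and lam_eta: "\<forall>x\<in>Qp - {0}. lam x = eta bar x"
    and add_char: "unramified_add_character q \<psi>"
begin

lemma lam_mult: "x \<noteq> 0 \<Longrightarrow> y \<noteq> 0 \<Longrightarrow> lam (x * y) = lam x * lam y"
  and lam_nonzero: "x \<noteq> 0 \<Longrightarrow> lam x \<noteq> 0"
  using mult_char by (auto simp: mult_character_def)

lemma lam_Qp_unit: "x \<in> Qp \<Longrightarrow> absv x = 1 \<Longrightarrow> lam x = 1"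
  using lam_eta eta_unit by (metis DiffI absv_zero singletonD zero_neq_one)

lemma lam_1 [simp]: "lam 1 = 1"
  by (simp add: lam_Qp_unit)

lemma lam_q: "lam (of_nat q) = -1"
  using lam_eta eta_q by simp

lemma lam_power: "x \<noteq> 0 \<Longrightarrow> lam (x ^ n) = lam x ^ n"
  by (induction n) (auto simp: lam_mult)

lemma lam_inverse: "x \<noteq> 0 \<Longrightarrow> lam (inverse x) = inverse (lam x)"
  using lam_mult[of x "inverse x"] by (metis inverse_unique lam_1 nonzero_imp_inverse_nonzero right_inverse)

lemma lam_divide: "x \<noteq> 0 \<Longrightarrow> y \<noteq> 0 \<Longrightarrow> lam (x / y) = lam x / lam y"
  by (simp add: divide_inverse lam_mult lam_inverse)

lemma unit_nonzero: "absv (x::'k) = 1 \<Longrightarrow> x \<noteq> 0"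
  by auto

lemma unit_one_plus: "dv (Suc n) x \<Longrightarrow> absv (1 + x :: 'k) = 1"
  using unit_cong[of 1 n "1 + x"] by simp

text \<open>\<open>exp_conductor\<close> is a LEAST and says something only once some level works.
  Continuity at 1 maps a small group of units close to 1, and there are no small subgroups, so it is
  mapped to 1.\<close>

lemma conductor_exists: "\<exists>n. \<forall>x\<in>unit_filtration q n. lam x = 1"
proof -
  have "isCont lam 1"
    using mult_char continuous_on_eq_continuous_at[of "- {0}" lam]
    by (simp add: mult_character_def open_Compl)
  then have "\<exists>d>0. \<forall>x. dist x 1 < d \<longrightarrow> dist (lam x) (lam 1) < 1 / 2"
    unfolding continuous_at_eps_delta by (elim allE[of _ "1 / 2"]) simp
  then obtain d where d: "d > 0" "\<And>x. dist x 1 < d \<Longrightarrow> dist (lam x) (lam 1) < 1 / 2"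
    by blast
  obtain n where n: "1 / real q ^ n < d" using ex_inverse_power_less[OF d(1)] by blast
  have small: "cmod (lam (1 + x) - 1) \<le> 1 / 2" if "dv (Suc n) x" for x
  proof -
    have "dist (1 + x) 1 < d"
      using dv_mono[OF that, of n] n by (simp add: dist_absv dv_def)
    then show ?thesis using d(2)[of "1 + x"] by (simp add: dist_norm)
  qed
  have "lam x = 1" if x: "x \<in> unit_filtration q (Suc n)" for x
  proof (rule eq_1_if_powers_close)
    fix k
    obtain y where y: "absv y \<le> 1" "x = 1 + of_nat q ^ Suc n * y"
      using x by (auto simp: unit_filtration_def)
    define e where "e = x - 1"
    have e: "dv (Suc n) e" using y by (simp add: e_def dv_mult_right dv_0_iff del: power_Suc)
    have x0: "x \<noteq> 0" using unit_one_plus[OF e] by (auto simp: e_def)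
    have "dv (Suc n) (x ^ j - 1)" for j
    proof (induction j)
      case (Suc j)
      have "x ^ Suc j - 1 = x * (x ^ j - 1) + e" by (simp add: e_def algebra_simps)
      moreover have "dv 0 x" using dv_add[OF dv_one dv_mono[OF e, of 0]] by (simp add: e_def)
      ultimately show ?case using dv_add[OF dv_mult_left[OF _ Suc] e] by simp
    qed simp
    from small[OF this] have "cmod (lam (x ^ (2 ^ k)) - 1) \<le> 1 / 2" by simp
    then show "cmod (lam x ^ (2 ^ k) - 1) \<le> 1 / 2" using x0 by (simp add: lam_power)
  qed
  then show ?thesis by blast
qed

lemma lam_conductor: 
  assumes "dv m x"
  shows "lam (1 + x) = 1"
proof -
  have "\<forall>x\<in>unit_filtration q m. lam x = 1"
    using LeastI_ex[OF conductor_exists] conductor by (simp add: exp_conductor_def)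
  moreover obtain y where "dv 0 y" "x = of_nat q ^ m * y" using assms by (rule dvE)
  then have "1 + x \<in> unit_filtration q m" using m_ge_2 by (auto simp: unit_filtration_def dv_0_iff)
  ultimately show ?thesis by blast
qed

text \<open>The last level of the unit filtration on which \<open>lam\<close> is nontrivial. The
  twists that cancel terms below are all of size \<open>q^m1\<close>.\<close>

definition m1 :: nat where "m1 = m - 1"

lemma m_eq: "m = Suc m1" "m1 \<ge> 1"
  using m_ge_2 by (auto simp: m1_def)

lemma lam_conductor_exact: "\<exists>y. dv 0 y \<and> lam (1 + of_nat q ^ m1 * y) \<noteq> 1"
proof -
  have "m1 < (LEAST n. \<forall>x\<in>unit_filtration q n. lam x = 1)"
    using conductor m_eq by (simp add: exp_conductor_def)
  then have "\<not> (\<forall>x\<in>unit_filtration q m1. lam x = 1)" by (rule not_less_Least)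
  moreover have "m1 \<noteq> 0" using m_eq by simp
  ultimately show ?thesis by (auto simp: unit_filtration_def dv_0_iff)
qed

lemma lam_cong:
  assumes "absv x = 1" "dv m (x - y)"
  shows "lam x = lam y"
proof -
  have x0: "x \<noteq> 0" using assms by auto
  have "absv y = 1" using unit_cong[OF assms(1), of m1 y] assms(2) m_eq by simp
  then have y0: "y \<noteq> 0" by auto
  have "dv m ((y - x) / x)" using assms by (simp add: dv_divide_unit_iff dv_diff_commute)
  then have "lam (1 + (y - x) / x) = 1" by (rule lam_conductor)
  moreover have "y = x * (1 + (y - x) / x)" using x0 by (simp add: field_simps)
  moreover have "1 + (y - x) / x \<noteq> 0" using y0 x0 by (simp add: field_simps)
  ultimately show ?thesis by (metis lam_mult mult.right_neutral x0)
qed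

text \<open>The powers of \<open>x\<close> repeat modulo \<open>q^m\<close> by pigeonhole. Besides
  giving modulus 1, this makes all values of \<open>lam\<close> on units algebraic.\<close>

lemma lam_unit_root:
  assumes "absv x = 1"
  shows "\<exists>n>0. lam x ^ n = 1"
proof -
  have "\<exists>y\<in>oreps m. dv m (x ^ i - y)" for i
    using oreps_rep_system[of m] assms by (auto simp: rep_system_def dv_0_power unit_dv_0)
  then obtain r where r: "\<And>i. r i \<in> oreps m \<and> dv m (x ^ i - r i)" by metis
  have "\<not> inj r"
  proof
    assume "inj r"
    then have "infinite (range r)" by (simp add: finite_image_iff)
    moreover have "range r \<subseteq> oreps m" using r by blast
    ultimately show False using finite_oreps finite_subset by blast
  qed
  then obtain i j where ij: "r i = r j" "i < j"
    unfolding inj_def by (metis linorder_neqE_nat)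
  have "dv m (x ^ i - x ^ j)"
    using dv_trans[of m "x ^ i" "r i" "x ^ j"] r[of i] r[of j] ij by (simp add: dv_diff_commute)
  then have "lam (x ^ i) = lam (x ^ j)" using assms by (intro lam_cong) (auto simp: absv_power)
  then have "lam x ^ i = lam x ^ j" using assms by (simp add: lam_power unit_nonzero)
  also have "\<dots> = lam x ^ i * lam x ^ (j - i)" using ij by (simp flip: power_add)
  finally have "lam x ^ (j - i) = 1" using lam_nonzero[OF unit_nonzero[OF assms]] by simp
  then show ?thesis using ij by (intro exI[of _ "j - i"]) auto
qed

lemma cmod_lam_unit: "absv x = 1 \<Longrightarrow> cmod (lam x) = 1"
proof -
  assume "absv x = 1"
  then obtain n where n: "n > 0" "lam x ^ n = 1" using lam_unit_root by blast
  then have "cmod (lam x) ^ n = 1 ^ n" by (metis norm_one norm_power power_one)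
  then show ?thesis using n(1) by (intro power_eq_imp_eq_base[of _ n 1]) auto
qed

text \<open>The product of both values is \<open>lam\<close> of the norm, a unit of
  \<open>Qp\<close>, where \<open>lam\<close> agrees with \<open>eta\<close> and is 1.\<close>

lemma lam_bar: 
  assumes "absv x = 1"
  shows "lam (bar x) = inverse (lam x)" "lam (bar x) = cnj (lam x)"
proof -
  have "lam x * lam (bar x) = lam (normK bar x)" using assms by (simp add: normK_def lam_mult unit_nonzero)
  also have "\<dots> = 1" using assms by (intro lam_Qp_unit) auto
  finally show 1: "lam (bar x) = inverse (lam x)" by (metis inverse_unique)
  show "lam (bar x) = cnj (lam x)"
    unfolding 1 using cmod_lam_unit[OF assms] complex_div_cnj[of 1 "lam x"] by (simp add: divide_inverse)
qed

text \<open>The additive character modulo q which \<open>lam\<close> induces on its last nontrivial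
  layer. Since \<open>lam\<close> is trivial on units of \<open>Qp\<close>, that layer is seen only
  through the \<theta>-coordinate; see \<open>lam_one_plus\<close>.\<close>

definition psi1 :: "'k \<Rightarrow> complex"
  where "psi1 s = lam (1 + of_nat q ^ m1 * \<theta> * s)"

lemma dv_m1: "dv m1 (of_nat q ^ m1 * x)" if "dv 0 x"
  using that by (intro dv_mult_right dv_p_power)

lemma unit_one_plus_m1: "dv 0 x \<Longrightarrow> absv (1 + of_nat q ^ m1 * x) = 1"
  using unit_one_plus[of 0, OF dv_mono[OF dv_m1]] m_eq by simp

text \<open>The cross term has valuation at least 2 (m - 1), which is at least m because m is at
  least 2.\<close>

lemma lam_one_plus_mult:
  assumes "dv 0 x" "dv 0 y"
  shows "lam (1 + of_nat q ^ m1 * (x + y)) =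
    lam (1 + of_nat q ^ m1 * x) * lam (1 + of_nat q ^ m1 * y)"
proof -
  let ?Q = "of_nat q ^ m1 :: 'k"
  have "dv (m1 + m1) ((?Q * x) * (?Q * y))"
    using assms by (intro dv_mult dv_m1)
  then have "dv m ((?Q * x) * (?Q * y))" using m_eq by (elim dv_mono) simp
  then have "dv m ((1 + ?Q * x) * (1 + ?Q * y) - (1 + ?Q * (x + y)))" by (simp add: algebra_simps)
  then have "lam ((1 + ?Q * x) * (1 + ?Q * y)) = lam (1 + ?Q * (x + y))"
    using assms by (intro lam_cong) (auto simp: absv_mult unit_one_plus_m1)
  then show ?thesis
    using assms by (simp add: lam_mult unit_nonzero unit_one_plus_m1)
qed

lemma lam_one_plus: 
  assumes "dv 0 x"
  shows "lam (1 + of_nat q ^ m1 * x) = psi1 (im x)"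
proof -
  have "lam (1 + of_nat q ^ m1 * (re x + im x * \<theta>)) = 
    lam (1 + of_nat q ^ m1 * re x) * lam (1 + of_nat q ^ m1 * (im x * \<theta>))"
    using assms by (intro lam_one_plus_mult dv_mult_right) (auto simp: dv_re dv_im)
  also have "lam (1 + of_nat q ^ m1 * re x) = 1"
    using assms by (intro lam_Qp_unit Qp_intros re_im_in_Qp unit_one_plus_m1 dv_re)
  finally have "lam (1 + of_nat q ^ m1 * (re x + im x * \<theta>)) = lam (1 + of_nat q ^ m1 * (im x * \<theta>))"
    by simp
  then show ?thesis by (simp only: psi1_def mult.assoc mult.commute[of \<theta>] re_im[symmetric])
qed

lemma psi1_add: "dv 0 s \<Longrightarrow> dv 0 t \<Longrightarrow> psi1 (s + t) = psi1 s * psi1 t"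
  using lam_one_plus_mult[of "\<theta> * s" "\<theta> * t"]
  by (simp add: psi1_def mult.assoc distrib_left dv_mult_left)

lemma psi1_cong: "dv 0 s \<Longrightarrow> dv 1 (s - t) \<Longrightarrow> psi1 s = psi1 t"
  unfolding psi1_def mult.assoc
proof (rule lam_cong)
  assume a: "dv 0 s" "dv 1 (s - t)"
  show "absv (1 + of_nat q ^ m1 * (\<theta> * s)) = 1" using a by (intro unit_one_plus_m1 dv_mult_left) auto
  have "dv (m1 + 1) (of_nat q ^ m1 * (\<theta> * (s - t)))"
    using a by (intro dv_mult dv_p_power dv_mult_left) auto
  then show "dv m (1 + of_nat q ^ m1 * (\<theta> * s) - (1 + of_nat q ^ m1 * (\<theta> * t)))"
    using m_eq by (simp add: algebra_simps Suc_eq_plus1_left)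
qed

lemma psi1_0 [simp]: "psi1 0 = 1"
  by (simp add: psi1_def)

lemma psi1_minus: "dv 0 s \<Longrightarrow> psi1 (- s) = inverse (psi1 s)"
  using psi1_add[of s "- s"] by (metis add.right_inverse dv_minus_iff inverse_unique psi1_0)

lemma psi1_of_nat: "dv 0 s \<Longrightarrow> psi1 (of_nat n * s) = psi1 s ^ n"
proof (induction n)
  case (Suc n)
  have "psi1 (of_nat (Suc n) * s) = psi1 (s + of_nat n * s)" by (simp add: algebra_simps)
  then show ?case using Suc by (simp add: psi1_add dv_mult_left)
qed simp

lemma psi1_unit_root: "dv 0 s \<Longrightarrow> \<exists>n>0. psi1 s ^ n = 1"
  unfolding psi1_def mult.assoc by (intro lam_unit_root unit_one_plus_m1 dv_mult_left) auto

lemma psi1_cnj: "dv 0 s \<Longrightarrow> cnj (psi1 s) = psi1 (- s)"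
proof -
  assume s: "dv 0 s"
  have u: "absv (1 + of_nat q ^ m1 * (\<theta> * s)) = 1" using s by (intro unit_one_plus_m1 dv_mult_left) auto
  have "cmod (psi1 s) = 1" unfolding psi1_def mult.assoc by (rule cmod_lam_unit[OF u])
  then have "cnj (psi1 s) = inverse (psi1 s)"
    using complex_div_cnj[of 1 "psi1 s"] by (simp add: divide_inverse)
  then show ?thesis by (simp add: psi1_minus s)
qed

text \<open>If this value were 1, then \<open>psi1\<close> would be trivial on all natural numbers,
  hence on all residues, and the conductor would be smaller than m.\<close>

lemma psi1_1: "psi1 1 \<noteq> 1"
proof
  assume 1: "psi1 1 = 1"
  obtain y where y: "dv 0 y" "lam (1 + of_nat q ^ m1 * y) \<noteq> 1" using lam_conductor_exact by blast
  obtain i where "dv 1 (im y - of_nat i)" using Zp_approx_nat[OF re_im_Zp(2)[OF y(1)]] by metis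
  then have "psi1 (im y) = psi1 (of_nat i)" using y(1) by (intro psi1_cong) (auto simp: dv_im)
  also have "\<dots> = 1" using psi1_of_nat[of 1 i] 1 by simp
  finally show False using y lam_one_plus[OF y(1)] by simp
qed

lemma Zp_dv: "x \<in> Zp \<Longrightarrow> dv 0 (x::'k)" and Zp_Qp: "x \<in> Zp \<Longrightarrow> (x::'k) \<in> Qp"
  by (auto simp: Zp_iff)

lemma Zp_add: "x \<in> Zp \<Longrightarrow> y \<in> Zp \<Longrightarrow> x + y \<in> (Zp::'k set)"
  and Zp_diff: "x \<in> Zp \<Longrightarrow> y \<in> Zp \<Longrightarrow> x - y \<in> (Zp::'k set)"
  and Zp_mult: "x \<in> Zp \<Longrightarrow> y \<in> Zp \<Longrightarrow> x * y \<in> (Zp::'k set)"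
  and Zp_minus: "x \<in> Zp \<Longrightarrow> - x \<in> (Zp::'k set)"
  and Zp_power: "x \<in> Zp \<Longrightarrow> x ^ n \<in> (Zp::'k set)"
  and Zp_of_nat [simp]: "of_nat j \<in> (Zp::'k set)"
  and Zp_1 [simp]: "1 \<in> (Zp::'k set)" and Zp_0 [simp]: "0 \<in> (Zp::'k set)"
  and Zp_numeral [simp]: "numeral l \<in> (Zp::'k set)"
  and Zp_theta_sq [simp]: "\<theta>\<^sup>2 \<in> Zp"
  by (auto simp: Zp_iff dv_0_power intro: dv_add dv_diff dv_mult_left)

lemmas Zp_intros = Zp_add Zp_diff Zp_mult Zp_minus Zp_power Zp_of_nat Zp_1 Zp_0 Zp_numeral Zp_theta_sq

lemma psi1_sum:
  assumes "a \<in> Zp"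
  shows "(\<Sum>x\<in>zreps 1. psi1 (a * x)) = (if dv 1 a then of_nat q else 0)"
proof (cases "dv 1 a")
  case True
  have "psi1 (a * x) = 1" if "x \<in> zreps 1" for x
  proof -
    have "dv 1 (a * x)" using True zreps_Zp[OF that] by (intro dv_mult_right) (auto simp: Zp_iff)
    then show ?thesis using psi1_cong[of 0 "a * x"] by simp
  qed
  then show ?thesis using True by simp
next
  case False
  then have a: "absv a = 1" using assms unit_iff by (simp add: Zp_iff)
  define S where "S = (\<Sum>x\<in>zreps 1. psi1 x)"
  have c: "psi1 x = psi1 y" if "x \<in> Zp" "y \<in> Zp" "dv 1 (x - y)" for x y
    using that psi1_cong by (simp add: Zp_iff)
  have "(\<Sum>x\<in>zreps 1. psi1 (a * x)) = S"
    unfolding S_def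
  proof (rule sum_isometry_reindex[OF zreps_rep_system _ _ c])
    show "dv 1 (x - y)" if "dv 1 (a * x - a * y)" for x y
      using that a by (simp add: right_diff_distrib[symmetric] dv_mult_unit_iff)
  qed (use assms Zp_mult in auto)
  moreover have "(\<Sum>x\<in>zreps 1. psi1 (1 + x)) = S"
    unfolding S_def by (rule sum_isometry_reindex[OF zreps_rep_system _ _ c]) (auto intro: Zp_intros)
  moreover have "(\<Sum>x\<in>zreps 1. psi1 (1 + x)) = psi1 1 * S"
    unfolding S_def sum_distrib_left by (intro sum.cong refl psi1_add) (auto dest: zreps_Zp simp: Zp_iff)
  ultimately show ?thesis using False psi1_1 by (metis mult_cancel_right1)
qed

lemma psi_add: "x \<in> Qp \<Longrightarrow> y \<in> Qp \<Longrightarrow> \<psi> (x + y) = \<psi> x * \<psi> y"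
  and psi_Zp: "x \<in> Zp \<Longrightarrow> \<psi> x = 1"
  using add_char by (auto simp: unramified_add_character_def)

lemma psi_0 [simp]: "\<psi> 0 = 1"
  by (simp add: psi_Zp)

lemma psi_cong: "x \<in> Qp \<Longrightarrow> y \<in> Qp \<Longrightarrow> dv 0 (x - y) \<Longrightarrow> \<psi> x = \<psi> y"
  using psi_add[of y "x - y"] psi_Zp[of "x - y"] by (auto simp: Zp_iff)

text \<open>If \<open>s\<close> is not integral then 1/(q s) is; multiplying it by an
  \<open>x0\<close> with nontrivial value at x0/q gives the witness b = x0/(q s).\<close>

lemma psi_nontrivial:
  assumes "s \<in> Qp" "\<not> dv 0 s"
  obtains b where "b \<in> Zp" "\<psi> (b * s) \<noteq> 1"
proof -
  obtain x0 where x0: "x0 \<in> Zp" "\<psi> (x0 / of_nat q) \<noteq> 1"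
    using add_char by (auto simp: unramified_add_character_def)
  have s0: "s \<noteq> 0" using assms by auto
  have "\<not> dv 0 (inverse s) \<or> dv 1 (inverse s)"
    using absv_eq_1_or_dv[of "inverse s"] assms(2) by (auto simp: dv_def absv_inverse)
  moreover have "dv 0 (inverse s)" using assms(2) s0
    by (simp add: dv_def absv_inverse inverse_le_1_iff)
  ultimately have "dv 1 (inverse s)" by blast
  then obtain y where y: "dv 0 y" "inverse s = of_nat q ^ 1 * y" by (rule dvE)
  have "y = inverse s / of_nat q" using y by simp
  then have "y \<in> Qp" using assms(1) by (auto intro!: Qp_intros)
  have "x0 * y * s = x0 / of_nat q" using s0 by (simp add: \<open>y = inverse s / of_nat q\<close>)
  moreover have "x0 * y \<in> Zp" using x0(1) \<open>y \<in> Qp\<close> y(1) by (intro Zp_mult) (auto simp: Zp_iff)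
  ultimately show ?thesis using that[of "x0 * y"] x0 by simp
qed

lemma psi_sum:
  assumes "s \<in> Qp" "dv 0 (of_nat q ^ M * s)"
  shows "(\<Sum>e\<in>zreps M. \<psi> (e * s)) = (if dv 0 s then of_nat q ^ M else 0)"
proof (cases "dv 0 s")
  case True
  then have "\<psi> (e * s) = 1" if "e \<in> zreps M" for e
    using zreps_Zp[OF that] assms(1) by (intro psi_Zp Zp_mult) (auto simp: Zp_iff)
  then show ?thesis using True by simp
next
  case False
  obtain b where b: "b \<in> Zp" "\<psi> (b * s) \<noteq> 1" using psi_nontrivial[OF assms(1) False] .
  have c: "\<psi> (x * s) = \<psi> (y * s)" if h: "x \<in> Zp" "y \<in> Zp" "dv M (x - y)" for x y
  proof -
    obtain z where z: "dv 0 z" "x - y = of_nat q ^ M * z" using h(3) by (rule dvE)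
    have "x * s - y * s = (of_nat q ^ M * s) * z" using z by (simp add: algebra_simps flip: left_diff_distrib)
    then have "dv 0 (x * s - y * s)" using assms(2) z(1) by (simp add: dv_mult_right)
    then show ?thesis using h assms(1) by (intro psi_cong) (auto simp: Zp_iff)
  qed
  let ?S = "\<Sum>e\<in>zreps M. \<psi> (e * s)"
  have "(\<Sum>e\<in>zreps M. \<psi> ((b + e) * s)) = ?S"
    by (rule sum_isometry_reindex[OF zreps_rep_system _ _ c]) (use b in \<open>auto intro: Zp_intros\<close>)
  moreover have "(\<Sum>e\<in>zreps M. \<psi> ((b + e) * s)) = \<psi> (b * s) * ?S"
    unfolding sum_distrib_left distrib_right
    using b assms(1) by (intro sum.cong refl psi_add) (auto dest!: zreps_Zp simp: Zp_iff)
  ultimately show ?thesis using False b(2) by (metis mult_cancel_right1)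
qed

text \<open>A Ramanujan sum: the sum over all residues minus the one over multiples of q. Averages
  over units detect in this way whether s or only q s is integral.\<close>

lemma psi_unit_sum:
  assumes "s \<in> Qp" "dv 0 (of_nat q ^ Suc M * s)"
  shows "(\<Sum>e\<in>zreps (Suc M). if absv e = 1 then \<psi> (e * s) else 0) =
    (if dv 0 s then of_nat q ^ Suc M else 0) - (if dv 0 (of_nat q * s) then of_nat q ^ M else 0)"
proof -
  have c: "\<psi> (x * s) = \<psi> (y * s)" if h: "x \<in> Zp" "y \<in> Zp" "dv (1 + M) (x - y)" for x y
  proof -
    obtain z where z: "dv 0 z" "x - y = of_nat q ^ (1 + M) * z" using h(3) by (rule dvE)
    have "x * s - y * s = (of_nat q ^ Suc M * s) * z" using z by (simp add: algebra_simps power_add flip: left_diff_distrib)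
    then have "dv 0 (x * s - y * s)" using assms(2) z(1) by (simp only: dv_mult_right)
    then show ?thesis using h assms(1) by (intro psi_cong) (auto simp: Zp_iff)
  qed
  have "(\<Sum>e\<in>zreps (Suc M). if absv e = 1 then \<psi> (e * s) else 0) =
    (\<Sum>e\<in>zreps (Suc M). \<psi> (e * s)) - (\<Sum>e\<in>zreps (Suc M). if dv 1 e then \<psi> (e * s) else 0)"
    unfolding sum_subtractf[symmetric]
    by (intro sum.cong refl) (auto simp: unit_iff dest: zreps_Zp[THEN Zp_dv])
  also have "(\<Sum>e\<in>zreps (Suc M). if dv 1 e then \<psi> (e * s) else 0) = (\<Sum>e\<in>zreps M. \<psi> ((of_nat q ^ 1 * e) * s))"
    unfolding Suc_eq_plus1_left by (rule sum_zreps_dv[OF c])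
  also have "\<dots> = (\<Sum>e\<in>zreps M. \<psi> (e * (of_nat q * s)))"
    by (intro sum.cong refl arg_cong[of _ _ \<psi>]) (simp add: mult.assoc mult.left_commute)
  also have "\<dots> = (if dv 0 (of_nat q * s) then of_nat q ^ M else 0)"
  proof (rule psi_sum)
    show "of_nat q * s \<in> Qp" using assms(1) by (intro Qp_intros)
    have "of_nat q ^ M * (of_nat q * s) = of_nat q ^ Suc M * s" by (simp add: mult.assoc mult.left_commute)
    then show "dv 0 (of_nat q ^ M * (of_nat q * s))" using assms(2) by (simp only:)
  qed
  also have "(\<Sum>e\<in>zreps (Suc M). \<psi> (e * s)) = (if dv 0 s then of_nat q ^ Suc M else 0)"
    by (rule psi_sum[OF assms])
  finally show ?thesis .
qed

lemma card_unit_zreps: "(\<Sum>e\<in>zreps (Suc M). if absv e = 1 then 1 else 0) = (of_nat q ^ Suc M - of_nat q ^ M :: complex)"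
  using psi_unit_sum[of 0 M] by (simp cong: if_cong)

end

section \<open>The Weil representation\<close>

definition mat2 :: "'a \<Rightarrow> 'a \<Rightarrow> 'a \<Rightarrow> 'a \<Rightarrow> 'a::zero^2^2"
  where "mat2 a b c d = vector [vector [a, b], vector [c, d]]"

lemma mat2_nth [simp]: "mat2 a b c d $ 1 $ 1 = a" "mat2 a b c d $ 1 $ 2 = b"
  "mat2 a b c d $ 2 $ 1 = c" "mat2 a b c d $ 2 $ 2 = d"
  by (simp_all add: mat2_def)

lemma det_mat2 [simp]: "det (mat2 a b c d :: 'a::comm_ring_1^2^2) = a * d - b * c"
  by (simp add: det_2)

context weil_setup
begin

abbreviation N where "N \<equiv> normK bar"
abbreviation Tr where "Tr \<equiv> traceK bar"
abbreviation weil where "weil \<equiv> weil_rep bar \<psi> \<mu>"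
abbreviation V where "V \<equiv> pi_space bar lam"

lemma ex_dv_scale: "\<exists>n. dv 0 (of_nat q ^ n * (b::'k))"
proof -
  obtain n where "absv b < real q ^ n" using real_arch_pow[of "real q" "absv b"] p_gt_1 by blast
  then show ?thesis by (intro exI[of _ n]) (simp add: dv_def absv_mult absv_p_power field_simps)
qed

lemma dv_scale_mono:
  assumes "dv 0 (of_nat q ^ n * (b::'k))" "n \<le> n'"
  shows "dv 0 (of_nat q ^ n' * b)"
proof -
  have "of_nat q ^ n' * b = of_nat q ^ (n' - n) * (of_nat q ^ n * b)"
    using assms(2) by (simp add: mult.assoc[symmetric] power_add[symmetric])
  moreover have "dv 0 (of_nat q ^ (n' - n) * (of_nat q ^ n * b))" using assms(1) by (simp add: dv_mult_left)
  ultimately show ?thesis by (simp only:)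
qed

lemma normK_add: "N (x + y) = N x + Tr (x * bar y) + N y"
  by (simp add: normK_def traceK_def algebra_simps)

lemma normK_diff: "N (x - y) = N x - Tr (x * bar y) + N y"
  by (simp add: normK_def traceK_def algebra_simps)

lemma dv_normK: "dv a x \<Longrightarrow> dv (2 * a) (N x)"
  using dv_mult[of a x a "bar x"] by (simp add: normK_def mult_2)

lemma dv_traceK: "dv a x \<Longrightarrow> dv a (Tr x)"
  by (simp add: traceK_def dv_add)

lemma step_function_mono:
  assumes "step_function a b F" "a \<le> a'" "b \<le> b'"
  shows "step_function a' b' F"
  using assms dv_mono[of a' _ a] dv_scale_mono[of b _ b'] unfolding step_function_def by metis

lemma step_function_add:
  assumes "step_function a b F" "step_function a' b' G"
  shows "step_function (max a a') (max b b') (\<lambda>x. F x + G x)"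
proof -
  have F: "step_function (max a a') (max b b') F" and G: "step_function (max a a') (max b b') G"
    using step_function_mono[OF assms(1)] step_function_mono[OF assms(2)] by auto
  show ?thesis unfolding step_function_def
  proof (intro conjI allI impI)
    fix x y assume "dv (max a a') (x - y)"
    then have "F x = F y" "G x = G y" using F G unfolding step_function_def by blast+
    then show "F x + G x = F y + G y" by (rule arg_cong2)
  next
    fix x assume "F x + G x \<noteq> 0"
    then have "F x \<noteq> 0 \<or> G x \<noteq> 0" by auto
    then show "dv 0 (of_nat q ^ max b b' * x)" using F G unfolding step_function_def by blast
  qed
qed

lemma step_function_mult_if:
  assumes "step_function a b F" 
    and k: "\<And>x y. F x \<noteq> 0 \<Longrightarrow> dv a (x - y) \<Longrightarrow> k x = k y"
  shows "step_function a b (\<lambda>x. k x * F x)"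
  unfolding step_function_def
proof (intro conjI allI impI)
  fix x y assume d: "dv a (x - y)"
  then have e: "F x = F y" using assms(1) unfolding step_function_def by blast
  show "k x * F x = k y * F y"
  proof (cases "F x = 0")
    case False
    then show ?thesis using k[OF False d] e by (simp only:)
  qed (use e in simp)
next
  fix x assume "k x * F x \<noteq> 0"
  then have "F x \<noteq> 0" by auto
  then show "dv 0 (of_nat q ^ b * x)" using assms(1) unfolding step_function_def by blast
qed

text \<open>Covers every integrand that occurs in \<open>weil_rep\<close>. The mixed term
  \<open>e * x * bar \<delta>\<close> is not bounded uniformly in x, but on the support
  \<open>q^M * x\<close> is integral, which explains the level \<open>n2 + M\<close>.\<close>

lemma step_psi_quad:
  assumes F: "step_function n M F" and \<alpha>: "\<alpha> \<in> Qp" and e: "e \<in> Qp"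
  shows "\<exists>n'. step_function n' M (\<lambda>y. \<psi> (\<alpha> + Tr (b * bar y) + e * N y) * F y)"
proof -
  obtain n1 where n1: "dv 0 (of_nat q ^ n1 * b)" using ex_dv_scale by blast
  obtain n2 where n2: "dv 0 (of_nat q ^ n2 * e)" using ex_dv_scale by blast
  define n' where "n' = max n (max n1 (n2 + M))"
  have F': "step_function n' M F" using step_function_mono[OF F] by (simp add: n'_def)
  have "step_function n' M (\<lambda>y. \<psi> (\<alpha> + Tr (b * bar y) + e * N y) * F y)"
  proof (rule step_function_mult_if[OF F'])
    fix x y assume x: "F x \<noteq> 0" and d: "dv n' (x - y)"
    obtain z where z: "dv 0 z" "x - y = of_nat q ^ n' * z" using d by (rule dvE)
    define \<delta> where "\<delta> = y - x"
    have dl: "\<delta> = - (of_nat q ^ n' * z)" using z(2) by (simp add: \<delta>_def algebra_simps)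
    have x': "dv 0 (of_nat q ^ M * x)" using F x unfolding step_function_def by blast
    have "b * bar \<delta> = - ((of_nat q ^ n' * b) * bar z)" by (simp add: dl)
    moreover have "dv 0 (of_nat q ^ n' * b)" using dv_scale_mono[OF n1, of n'] by (simp add: n'_def)
    ultimately have 1: "dv 0 (Tr (b * bar \<delta>))" using z(1) by (intro dv_traceK) (simp add: dv_mult_left)
    have "of_nat q ^ n' = (of_nat q ^ (n' - (n2 + M)) * of_nat q ^ n2 * of_nat q ^ M :: 'k)"
      unfolding power_add[symmetric] by (simp add: n'_def)
    then have "e * (x * bar \<delta>) = - (of_nat q ^ (n' - (n2 + M)) * (of_nat q ^ n2 * e) * (of_nat q ^ M * x) * bar z)"
      by (simp add: dl algebra_simps)
    then have 2: "dv 0 (e * (x * bar \<delta>))"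
      using n2 x' z(1) by (simp add: dv_mult_left)
    have ed: "dv 0 (e * \<delta>)"
    proof -
      have "e * \<delta> = - ((of_nat q ^ n' * e) * z)" by (simp add: dl)
      then show ?thesis using dv_scale_mono[OF n2, of n'] z(1) by (simp add: n'_def dv_mult_left)
    qed
    have dd: "dv 0 \<delta>" using dv_mono[OF d, of 0] by (simp add: \<delta>_def dv_diff_commute)
    have y: "y = x + \<delta>" by (simp add: \<delta>_def)
    have "e * Tr (x * bar \<delta>) = Tr (e * (x * bar \<delta>))"
      using e by (simp add: traceK_def bar_Qp algebra_simps)
    then have 3: "dv 0 (e * Tr (x * bar \<delta>))" using 2 dv_traceK by simp
    have 4: "dv 0 (e * N \<delta>)" using dv_mult_right[OF ed, of "bar \<delta>"] dd by (simp add: normK_def mult.assoc)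
    have "(\<alpha> + Tr (b * bar y) + e * N y) - (\<alpha> + Tr (b * bar x) + e * N x) =
        Tr (b * bar \<delta>) + (e * Tr (x * bar \<delta>) + e * N \<delta>)"
      unfolding y normK_add by (simp add: traceK_def algebra_simps)
    then have "dv 0 ((\<alpha> + Tr (b * bar y) + e * N y) - (\<alpha> + Tr (b * bar x) + e * N x))"
      using dv_add[OF 1 dv_add[OF 3 4]] by (simp only:)
    then show "\<psi> (\<alpha> + Tr (b * bar x) + e * N x) = \<psi> (\<alpha> + Tr (b * bar y) + e * N y)"
      using \<alpha> e by (intro psi_cong[symmetric] Qp_intros) auto
  qed
  then show ?thesis by blast
qed

lemma V_D:
  assumes "\<phi> \<in> V"
  shows "\<exists>n M. step_function n M (\<lambda>x. \<phi> x u)" "u \<notin> Qp - {0} \<Longrightarrow> \<phi> x u = 0"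
    "t \<noteq> 0 \<Longrightarrow> u \<in> Qp - {0} \<Longrightarrow> \<phi> (x / t) (N t * u) = lam t * \<phi> x u"
  using assms unfolding pi_space_def by (auto simp: schwartz_bruhat_iff)

lemma V_I:
  assumes "\<And>u. u \<in> Qp - {0} \<Longrightarrow> \<exists>n M. step_function n M (\<lambda>x. \<phi> x u)"
    and "\<And>x u. u \<notin> Qp - {0} \<Longrightarrow> \<phi> x u = 0"
    and "\<And>t x u. t \<noteq> 0 \<Longrightarrow> u \<in> Qp - {0} \<Longrightarrow> \<phi> (x / t) (N t * u) = lam t * \<phi> x u"
  shows "\<phi> \<in> V"
proof -
  have "\<exists>n M. step_function n M (\<lambda>x. \<phi> x u)" for u
  proof (cases "u \<in> Qp - {0}")
    case False
    then have "\<phi> x u = 0" for x using assms(2) by blast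
    then show ?thesis by (simp add: step_function_def)
  qed (use assms(1) in blast)
  then show ?thesis unfolding pi_space_def schwartz_bruhat_iff using assms(2,3) by blast
qed

text \<open>Equivariance under K moves any nonzero x to 1, so an element of the space is a function
  of \<open>v\<close> alone, as in a Kirillov model where upper unipotents act by multiplication
  with \<open>\<psi> (b * v)\<close>.\<close>

lemma V_eval:
  assumes "\<phi> \<in> V" "x \<noteq> 0" "u \<in> Qp - {0}"
  shows "\<phi> x u = \<phi> 1 (N x * u) / lam x"
  using V_D(3)[OF assms(1,2,3), of x] assms(2) lam_nonzero[of x] by (simp add: field_simps)

lemma normK_Qp_nonzero: "t \<noteq> 0 \<Longrightarrow> u \<in> Qp - {0} \<Longrightarrow> N t * u \<in> Qp - {0}"
  by (auto intro: Qp_intros)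

text \<open>As q is odd, 2 is invertible modulo q: (q+1)/2 times 2 is congruent to 1, so
  \<open>psi1 1\<close> is a power of \<open>psi1 2\<close>.\<close>

lemma psi1_2: "psi1 2 \<noteq> 1"
proof
  assume a: "psi1 2 = 1"
  have "psi1 (of_nat ((q + 1) div 2) * 2) = psi1 2 ^ ((q + 1) div 2)" by (rule psi1_of_nat) simp
  moreover have "of_nat ((q + 1) div 2) * 2 = (of_nat q + 1 :: 'k)"
    using odd_q by (metis even_plus_one_iff dvd_div_mult_self of_nat_1 of_nat_add of_nat_mult of_nat_numeral)
  moreover have "psi1 1 = psi1 (of_nat q + 1)"
    using psi1_cong[of 1 "of_nat q + 1"] dv_p_power[of 1] by simp
  ultimately show False using a psi1_1 by simp
qed

text \<open>The element t = s / bar s has norm 1 and so fixes the point (0, u), while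
  \<open>lam t = psi1 2\<close> is not 1. Behind this is the fact that \<open>lam\<close> does not
  factor through the norm.\<close>

lemma V_0:
  assumes "\<phi> \<in> V"
  shows "\<phi> 0 u = 0"
proof (cases "u \<in> Qp - {0}")
  case True
  define s where "s = 1 + of_nat q ^ m1 * \<theta>"
  have s: "absv s = 1" unfolding s_def by (intro unit_one_plus_m1) simp
  then have s0: "s \<noteq> 0" "bar s \<noteq> 0" by auto
  define t where "t = s / bar s"
  have "N t = 1" using s0 by (simp add: t_def normK_def)
  have "lam s = psi1 1" by (simp add: s_def psi1_def)
  moreover have "lam (bar s) = psi1 (- 1)" by (simp add: s_def psi1_def)
  moreover have "lam t = lam s / lam (bar s)" using s0 by (simp add: t_def lam_divide)
  ultimately have "lam t = psi1 1 * psi1 1"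
    using psi1_minus[of 1] by (simp add: divide_inverse)
  also have "\<dots> = psi1 2" using psi1_add[of 1 1] by simp
  finally have "lam t \<noteq> 1" using psi1_2 by simp
  moreover have "\<phi> 0 u = lam t * \<phi> 0 u"
    using V_D(3)[OF assms _ True, of t 0] s0 \<open>N t = 1\<close> by (simp add: t_def)
  ultimately show ?thesis by simp
qed (use V_D(2)[OF assms] in blast)

lemma V_eqI:
  assumes "\<phi> \<in> V" "\<phi>' \<in> V" "\<And>v. v \<in> Qp - {0} \<Longrightarrow> \<phi> 1 v = \<phi>' 1 v"
  shows "\<phi> = \<phi>'"
proof (intro ext)
  fix x u
  show "\<phi> x u = \<phi>' x u"
  proof (cases "u \<in> Qp - {0}")
    case u: True
    show ?thesis
    proof (cases "x = 0")
      case False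
      then show ?thesis
        using V_eval[OF assms(1) False u] V_eval[OF assms(2) False u] assms(3)[OF normK_Qp_nonzero[OF False u]]
        by simp
    qed (use V_0[OF assms(1)] V_0[OF assms(2)] in simp)
  qed (use V_D(2)[OF assms(1)] V_D(2)[OF assms(2)] in simp)
qed

lemma V_add: "\<phi> \<in> V \<Longrightarrow> \<phi>' \<in> V \<Longrightarrow> (\<lambda>x u. \<phi> x u + \<phi>' x u) \<in> V"
proof (rule V_I)
  assume a: "\<phi> \<in> V" "\<phi>' \<in> V"
  show "\<exists>n M. step_function n M (\<lambda>x. \<phi> x u + \<phi>' x u)" for u
    using V_D(1)[OF a(1), of u] V_D(1)[OF a(2), of u] step_function_add by blast
  show "\<phi> x u + \<phi>' x u = 0" if "u \<notin> Qp - {0}" for x u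
    using V_D(2)[OF a(1) that] V_D(2)[OF a(2) that] by simp
  show "\<phi> (x / t) (N t * u) + \<phi>' (x / t) (N t * u) = lam t * (\<phi> x u + \<phi>' x u)"
    if "t \<noteq> 0" "u \<in> Qp - {0}" for t x u
    using V_D(3)[OF a(1) that] V_D(3)[OF a(2) that] by (simp add: distrib_left)
qed

text \<open>\<open>u * N x\<close> is invariant under K, so multiplication by a function of it
  preserves equivariance. Used both for unipotent elements and for cutting the support.\<close>

lemma V_mult:
  assumes "\<phi> \<in> V"
    and "\<And>u n M. u \<in> Qp - {0} \<Longrightarrow> step_function n M (\<lambda>x. \<phi> x u) \<Longrightarrow>
      \<exists>n M. step_function n M (\<lambda>x. k (u * N x) * \<phi> x u)"
  shows "(\<lambda>x u. k (u * N x) * \<phi> x u) \<in> V"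
proof (rule V_I)
  show "\<exists>n M. step_function n M (\<lambda>x. k (u * N x) * \<phi> x u)" if "u \<in> Qp - {0}" for u
    using V_D(1)[OF assms(1), of u] assms(2)[OF that] by blast
  show "k (u * N x) * \<phi> x u = 0" if "u \<notin> Qp - {0}" for x u
    using V_D(2)[OF assms(1) that] by simp
  show "k (N t * u * N (x / t)) * \<phi> (x / t) (N t * u) = lam t * (k (u * N x) * \<phi> x u)"
    if "t \<noteq> 0" "u \<in> Qp - {0}" for t x u
  proof -
    have "N t * u * N (x / t) = u * N x" using that(1) by (simp add: normK_def)
    then show ?thesis unfolding V_D(3)[OF assms(1) that] by (simp only: mult.left_commute)
  qed
qed

lemma V_scale: "\<phi> \<in> V \<Longrightarrow> (\<lambda>x u. c * \<phi> x u) \<in> V"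
proof -
  assume a: "\<phi> \<in> V"
  have "(\<lambda>x u. (\<lambda>_. c) (u * N x) * \<phi> x u) \<in> V"
  proof (rule V_mult[OF a])
    fix u n M assume "step_function n M (\<lambda>x. \<phi> x u)"
    then show "\<exists>n M. step_function n M (\<lambda>x. (\<lambda>_. c) (u * N x) * \<phi> x u)"
      using step_function_mult_if[of n M "\<lambda>x. \<phi> x u" "\<lambda>_. c"] by blast
  qed
  then show ?thesis by simp
qed

lemma V_zero: "(\<lambda>x u. 0) \<in> V"
  by (rule V_I) (auto simp: step_function_def)

lemma V_sum: "finite S \<Longrightarrow> (\<And>i. i \<in> S \<Longrightarrow> \<phi> i \<in> V) \<Longrightarrow> (\<lambda>x u. \<Sum>i\<in>S. \<phi> i x u) \<in> V"
proof (induction S rule: finite_induct)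
  case (insert i S)
  then have "(\<lambda>x u. \<phi> i x u + (\<Sum>i\<in>S. \<phi> i x u)) \<in> V" by (intro V_add) auto
  then show ?case using insert by simp
qed (simp add: V_zero)

lemma V_unip: 
  assumes "\<phi> \<in> V" "b \<in> Qp"
  shows "(\<lambda>x u. \<psi> (b * (u * N x)) * \<phi> x u) \<in> V"
proof (rule V_mult[OF assms(1), where k="\<lambda>s. \<psi> (b * s)"])
  fix u n M assume u: "u \<in> Qp - {0}" and st: "step_function n M (\<lambda>x. \<phi> x u)"
  have "b * u \<in> Qp" using u assms(2) by (auto intro: Qp_intros)
  from step_psi_quad[OF st Qp_0 this, of 0]
  show "\<exists>n M. step_function n M (\<lambda>x. \<psi> (b * (u * N x)) * \<phi> x u)" 
    by (auto simp: traceK_def mult.assoc)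
qed

lemma weil_unip:
  assumes "\<phi> \<in> V" "b \<in> Qp"
  shows "weil (mat2 1 b 0 1) \<phi> = (\<lambda>x u. \<psi> (b * (u * N x)) * \<phi> x u)"
proof (intro ext)
  fix x u
  show "weil (mat2 1 b 0 1) \<phi> x u = \<psi> (b * (u * N x)) * \<phi> x u"
    using V_D(2)[OF assms(1), of u x] eta_unit[of 1]
    by (auto simp: weil_rep_def Let_def mult.assoc mult.left_commute)
qed

lemma weil_diag_unit:
  assumes "\<phi> \<in> V" "a \<in> Qp" "absv a = 1"
  shows "weil (mat2 a 0 0 1) \<phi> = (\<lambda>x u. \<phi> (a * x) (u / a))" "(\<lambda>x u. \<phi> (a * x) (u / a)) \<in> V"
proof -
  have a0: "a \<noteq> 0" using assms(3) by auto
  have ua: "u / a \<notin> Qp - {0}" if u: "u \<notin> Qp - {0}" for u :: 'k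
  proof
    assume "u / a \<in> Qp - {0}"
    then have "u / a * a \<in> Qp" "u \<noteq> 0" using assms(2) Qp_mult[of "u / a" a] by auto
    then show False using u a0 by simp
  qed
  show "weil (mat2 a 0 0 1) \<phi> = (\<lambda>x u. \<phi> (a * x) (u / a))"
  proof (intro ext)
    fix x u
    show "weil (mat2 a 0 0 1) \<phi> x u = \<phi> (a * x) (u / a)"
    proof (cases "u \<in> Qp - {0}")
      case False
      then show ?thesis using V_D(2)[OF assms(1) ua[OF False]] by (simp add: weil_rep_def Let_def)
    next
      case True
      then show ?thesis using eta_unit[OF assms(2,3)] assms(3) by (simp add: weil_rep_def Let_def)
    qed
  qed
  show "(\<lambda>x u. \<phi> (a * x) (u / a)) \<in> V"
  proof (rule V_I)
    fix u :: 'k assume u: "u \<in> Qp - {0}"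
    obtain n M where st: "step_function n M (\<lambda>x. \<phi> x (u / a))" using V_D(1)[OF assms(1)] by blast
    have "step_function n M (\<lambda>x. \<phi> (a * x) (u / a))"
      unfolding step_function_def
    proof (intro conjI allI impI)
      fix x y assume "dv n (x - y)"
      then have "dv n (a * x - a * y)" using assms(3) by (simp add: right_diff_distrib[symmetric] dv_mult_unit_iff)
      then show "\<phi> (a * x) (u / a) = \<phi> (a * y) (u / a)" using st unfolding step_function_def by blast
    next
      fix x assume "\<phi> (a * x) (u / a) \<noteq> 0"
      then have "dv 0 (of_nat q ^ M * (a * x))" using st unfolding step_function_def by blast
      then have "dv 0 (a * (of_nat q ^ M * x))" by (simp add: mult.left_commute)
      then show "dv 0 (of_nat q ^ M * x)" using assms(3) by (simp add: dv_mult_unit_iff)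
    qed
    then show "\<exists>n M. step_function n M (\<lambda>x. \<phi> (a * x) (u / a))" by blast
  next
    show "\<phi> (a * x) (u / a) = 0" if "u \<notin> Qp - {0}" for x and u :: 'k using V_D(2)[OF assms(1) ua[OF that]] .
  next
    fix t x u :: 'k assume t: "t \<noteq> 0" "u \<in> Qp - {0}"
    have "u / a \<in> Qp - {0}" using t(2) assms(2) a0 by (auto intro: Qp_intros)
    from V_D(3)[OF assms(1) t(1) this, of "a * x"]
    show "\<phi> (a * (x / t)) (N t * u / a) = lam t * \<phi> (a * x) (u / a)" by simp
  qed
qed

lemma dv_norm_ball:
  assumes "dv 0 (r * N w)" "dv 0 (r * N \<delta>)"
  shows "dv 0 (r * N (w + \<delta>))"
proof -
  have "absv (w + \<delta>) ^ 2 \<le> max (absv w ^ 2) (absv \<delta> ^ 2)"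
    using absv_add[of w \<delta>] by (auto simp: max_def intro: power_mono split: if_splits)
  then have "absv r * absv (w + \<delta>) ^ 2 \<le> absv r * max (absv w ^ 2) (absv \<delta> ^ 2)"
    by (intro mult_left_mono) auto
  also have "\<dots> \<le> 1" using assms by (auto simp: dv_def absv_mult max_def)
  finally show ?thesis by (simp add: dv_def absv_mult)
qed

lemma dv_norm_ball_iff:
  assumes "dv 0 (r * N \<delta>)"
  shows "dv 0 (r * N (w + \<delta>)) \<longleftrightarrow> dv 0 (r * N w)"
proof
  have d': "dv 0 (r * N (- \<delta>))" using assms by (simp add: normK_def)
  show "dv 0 (r * N (w + \<delta>)) \<Longrightarrow> dv 0 (r * N w)" using dv_norm_ball[OF _ d', of "w + \<delta>"] by simp
qed (rule dv_norm_ball[OF _ assms])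

lemma step_norm_ball:
  assumes "step_function n M F"
  shows "\<exists>n'. step_function n' M (\<lambda>y. (if dv 0 (r * N (x - y)) then 1 else 0) * F y)"
proof -
  obtain n2 where n2: "dv 0 (of_nat q ^ n2 * r)" using ex_dv_scale by blast
  have F': "step_function (max n n2) M F" using step_function_mono[OF assms] by simp
  have "step_function (max n n2) M (\<lambda>y. (if dv 0 (r * N (x - y)) then 1 else 0) * F y)"
  proof (rule step_function_mult_if[OF F'])
    fix y y' assume d: "dv (max n n2) (y - y')"
    then have "dv n2 (y - y')" by (rule dv_mono) simp
    then obtain z where z: "dv 0 z" "y - y' = of_nat q ^ n2 * z" by (rule dvE)
    have "r * N (y - y') = of_nat q ^ n2 * ((of_nat q ^ n2 * r) * N z)"
      unfolding z(2) by (simp add: normK_def algebra_simps)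
    moreover have "dv 0 (of_nat q ^ n2 * ((of_nat q ^ n2 * r) * N z))"
      using dv_mult_left[OF dv_p_power_0 dv_mult_right[OF n2, of "N z"]] dv_normK[OF z(1)] by simp
    ultimately have "dv 0 (r * N (y - y'))" by (simp only:)
    from dv_norm_ball_iff[OF this, of "x - y"]
    show "(if dv 0 (r * N (x - y)) then 1 else 0) = ((if dv 0 (r * N (x - y')) then 1 else 0)::complex)" by simp
  qed
  then show ?thesis by blast
qed

text \<open>The lower left entry carries 1/e so that e enters the phase linearly and can be averaged
  over units. The three terms of the phase combine to \<open>N (x - y)\<close>.\<close>

lemma weil_lower_unip:
  assumes "e \<in> Zp" "absv e = 1" "u \<in> Qp - {0}"
  shows "weil (mat2 1 0 (of_nat q ^ (2 * m) / e) 1) \<phi> x u =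
    lam u * of_real (absv u * real q ^ (2 * m)) *
      (\<integral>y. \<psi> (e * (u / of_nat q ^ (2 * m) * N (x - y))) * \<phi> y u \<partial>\<mu>)"
proof -
  let ?c = "of_nat q ^ (2 * m) / e"
  have e0: "e \<noteq> 0" using assms(2) by auto
  have c0: "?c \<noteq> 0" using e0 by simp
  have eQ: "e \<in> Qp" using assms(1) by (simp add: Zp_iff)
  have "?c * u \<in> Qp - {0}" using assms(3) eQ e0 by (auto intro!: Qp_intros)
  then have "eta bar (?c * u) = lam (?c * u)" using lam_eta by simp
  also have "\<dots> = lam u"
    using e0 assms lam_Qp_unit[OF eQ assms(2)] by (simp add: lam_mult lam_divide lam_power lam_q)
  finally have eta: "eta bar (?c * u) = lam u" .
  have ab: "absv u / absv ?c = absv u * real q ^ (2 * m)"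
    using assms(2) by (simp add: absv_divide absv_p_power)
  have arg: "u * (N x - Tr (x * bar y) + N y) * e / of_nat q ^ (2 * m) = e * (u * N (x - y)) / of_nat q ^ (2 * m)" for y
    by (simp add: normK_diff)
  show ?thesis
    unfolding weil_rep_def Let_def
    using assms(3) c0 by (simp add: eta[simplified] ab arg)
qed

lemma weil_lower:
  assumes "c \<noteq> 0" "u \<in> Qp - {0}"
  shows "weil (mat2 a b c d) \<phi> x u =
    eta bar (c * u) * of_real (absv u / absv c * absv (a * d - b * c) powr (- 1 / 2)) *
      (\<integral>y. \<psi> (u * (a * N x - Tr (x * bar y) + d / (a * d - b * c) * N y) / c) * \<phi> y (u / (a * d - b * c)) \<partial>\<mu>)"
  using assms by (simp add: weil_rep_def Let_def)

text \<open>The integers of K are their own dual under the trace pairing because K is unramified.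
  The witness is chosen so that \<open>x * bar \<epsilon> = b / (2 q)\<close> lies in
  \<open>Qp\<close> and has trace b/q.\<close>

lemma psi_trace_nontrivial:
  assumes "\<not> dv 0 x"
  shows "\<exists>\<epsilon>. dv 0 \<epsilon> \<and> \<psi> (Tr (x * bar \<epsilon>)) \<noteq> 1"
proof -
  have x0: "x \<noteq> 0" using assms by auto
  have "\<not> dv 0 (1 / of_nat q :: 'k)" using p_gt_1 by (simp add: dv_def absv_divide absv_p)
  then obtain b where b: "b \<in> Zp" "\<psi> (b * (1 / of_nat q)) \<noteq> 1"
    using psi_nontrivial[OF Qp_divide[OF Qp_1 Qp_of_nat]] by blast
  have "absv (inverse x) < 1" using assms by (simp add: dv_def absv_inverse inverse_less_1_iff)
  then have "dv 1 (inverse x)" using absv_eq_1_or_dv[of "inverse x"] by (auto simp: dv_def)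
  then obtain z where z: "dv 0 z" "inverse x = of_nat q ^ 1 * z" by (rule dvE)
  define \<epsilon> where "\<epsilon> = bar (b * z / 2)"
  have "dv 0 (b * z / 2)" using b(1) z(1) by (simp add: dv_divide_unit_iff dv_mult_left Zp_iff)
  then have "dv 0 \<epsilon>" by (simp only: \<epsilon>_def dv_bar)
  have "z = inverse x / of_nat q" using z(2) by simp
  then have xe: "x * bar \<epsilon> = b / of_nat q / 2" using x0 by (simp add: \<epsilon>_def)
  have "bar b = b" using b(1) by (simp add: Zp_iff bar_Qp)
  then have "Tr (x * bar \<epsilon>) = b * (1 / of_nat q)" unfolding traceK_def xe by (simp add: field_simps)
  then show ?thesis using b(2) \<open>dv 0 \<epsilon>\<close> by auto
qed

lemma psi_minus_ne: "s \<in> Qp \<Longrightarrow> \<psi> s \<noteq> 1 \<Longrightarrow> \<psi> (- s) \<noteq> 1"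
  using psi_add[of s "- s"] Qp_minus[of s] by auto

lemma psi_add3: "x \<in> Qp \<Longrightarrow> y \<in> Qp \<Longrightarrow> z \<in> Qp \<Longrightarrow> \<psi> (x + y + z) = \<psi> x * \<psi> y * \<psi> z"
  using psi_add[of "x + y" z] psi_add[of x y] Qp_add[of x y] by simp

lemma traceK_Qp_mult: "c \<in> Qp \<Longrightarrow> Tr (c * x) = c * Tr x"
  by (simp add: traceK_def bar_Qp distrib_left)

text \<open>The axioms for \<open>B\<close> speak about \<open>V\<close> only, so the translates of
  \<open>f\<close> must be shown to stay there. Equivariance is the substitution y -> t y;
  smoothness says that the Fourier transform exchanges level and support.\<close>

lemma weil_in_V:
  assumes phi: "\<phi> \<in> V" and Q: "a \<in> Qp" "b \<in> Qp" "c \<in> Qp" "d \<in> Qp" and c: "c \<noteq> 0"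
    and D: "a * d - b * c \<noteq> 0"
  shows "weil (mat2 a b c d) \<phi> \<in> V"
proof (rule V_I)
  define D where "D = a * d - b * c"
  have D: "D \<in> Qp" "D \<noteq> 0" using Q assms(7) by (auto simp: D_def intro!: Qp_intros)
  note w = weil_lower[OF c, of _ a b d \<phi>, folded D_def]
  have arg: "u * (a * N x - Tr (x * bar y) + d / D * N y) / c =
      u / c * a * N x + Tr (- (u / c) * x * bar y) + u * d / D / c * N y" if "u \<in> Qp - {0}" for u x y
  proof -
    have "u / c \<in> Qp" using that Q by (auto intro!: Qp_intros)
    then have eq: "Tr (- (u / c) * x * bar y) = - (u / c) * Tr (x * bar y)"
      using traceK_Qp_mult[of "- (u / c)" "x * bar y"] Qp_minus by (simp only: mult.assoc)
    show ?thesis unfolding eq using c D(2) by (simp add: field_simps)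
  qed
  show "weil (mat2 a b c d) \<phi> x u = 0" if "u \<notin> Qp - {0}" for x u
    using that by (simp add: weil_rep_def)
  have uD: "u / D \<in> Qp - {0}" if "u \<in> Qp - {0}" for u using that D by (auto intro!: Qp_intros)
  show "weil (mat2 a b c d) \<phi> (x / t) (N t * u) = lam t * weil (mat2 a b c d) \<phi> x u"
    if t: "t \<noteq> 0" and u: "u \<in> Qp - {0}" for t x u
  proof -
    have Ntu: "N t * u \<in> Qp - {0}" using normK_Qp_nonzero[OF t u] .
    define G where "G y = \<psi> (u * (a * N x - Tr (x * bar y) + d / D * N y) / c) * \<phi> y (u / D)" for y
    obtain n M where st: "step_function n M (\<lambda>y. \<phi> y (u / D))" using V_D(1)[OF phi] by blast
    have q1: "u / c * a * N x \<in> Qp" using u Q by (intro Qp_intros normK_Qp) auto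
    have q2: "u * d / D / c \<in> Qp" using u Q D by (intro Qp_intros) auto
    obtain n' where "step_function n' M (\<lambda>y. \<psi> (u / c * a * N x + Tr (- (u / c) * x * bar y) + u * d / D / c * N y) * \<phi> y (u / D))"
      using step_psi_quad[OF st q1 q2, of "- (u / c) * x"] by blast
    then have G: "step_function n' M G" unfolding G_def arg[OF u] .
    \<comment> \<open>Equivariance of \<phi> rewrites the integrand at (x / t, N t u) as
      \<open>lam t\<close> times the integrand at (x, u), dilated by t. The Jacobian 1/|t|^2 is then
      cancelled by |N t u| in the prefactor.\<close>
    have "\<psi> (N t * u * (a * N (x / t) - Tr (x / t * bar y) + d / D * N y) / c) * \<phi> y (N t * u / D) = lam t * G (t * y + 0)" for y
    proof -
      have 1: "N t * u * (a * N (x / t) - Tr (x / t * bar y) + d / D * N y) = u * (a * N x - Tr (x * bar (t * y)) + d / D * N (t * y))"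
      proof -
        have "N t * N (x / t) = N x" using t by (simp add: normK_def)
        moreover have "N t * Tr (x / t * bar y) = Tr (x * bar (t * y))"
          using t by (simp add: normK_def traceK_def field_simps)
        moreover have "N t * N y = N (t * y)" by (simp add: normK_mult)
        moreover have "N t * u * (a * N (x / t) - Tr (x / t * bar y) + d / D * N y) =
          u * (a * (N t * N (x / t)) - N t * Tr (x / t * bar y) + d / D * (N t * N y))" by (simp add: algebra_simps)
        ultimately show ?thesis by (simp only:)
      qed
      have "\<phi> y (N t * u / D) = \<phi> (t * y / t) (N t * (u / D))" using t by simp
      also have "\<dots> = lam t * \<phi> (t * y) (u / D)" by (rule V_D(3)[OF phi t uD[OF u]])
      finally show ?thesis unfolding 1 by (simp add: G_def)
    qed
    then have "(\<integral>y. \<psi> (N t * u * (a * N (x / t) - Tr (x / t * bar y) + d / D * N y) / c) * \<phi> y (N t * u / D) \<partial>\<mu>) =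
      lam t * (\<integral>y. G (t * y + 0) \<partial>\<mu>)"
      by (simp only: integral_mult_right_zero)
    also have "\<dots> = lam t * ((\<integral>y. G y \<partial>\<mu>) / of_real ((absv t)\<^sup>2))"
      by (simp only: integral_step_affine[OF G t])
    finally have I: "(\<integral>y. \<psi> (N t * u * (a * N (x / t) - Tr (x / t * bar y) + d / D * N y) / c) * \<phi> y (N t * u / D) \<partial>\<mu>) =
      lam t * ((\<integral>y. G y \<partial>\<mu>) / of_real ((absv t)\<^sup>2))" .
    have E: "eta bar (c * (N t * u)) = eta bar (c * u)"
      using eta_normK_mult[OF t, of "c * u"] by (simp add: mult.left_commute)
    have A: "absv (N t * u) = (absv t)\<^sup>2 * absv u" by (simp add: absv_mult)
    have t0: "absv t \<noteq> 0" using t by simp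
    show ?thesis
      unfolding w[OF Ntu] w[OF u] I E A G_def[symmetric] using t0 by (simp add: field_simps)
  qed
  show "\<exists>n M. step_function n M (\<lambda>x. weil (mat2 a b c d) \<phi> x u)" if u: "u \<in> Qp - {0}" for u
  proof -
    define \<beta> where "\<beta> = u / c"
    have \<beta>: "\<beta> \<in> Qp" "\<beta> \<noteq> 0" using u Q c by (auto simp: \<beta>_def intro!: Qp_intros)
    define e where "e = u * d / D / c"
    have e: "e \<in> Qp" using u Q D by (auto simp: e_def intro!: Qp_intros)
    obtain n M where st: "step_function n M (\<lambda>y. \<phi> y (u / D))" using V_D(1)[OF phi] by blast
    define G where "G y = \<psi> (e * N y) * \<phi> y (u / D)" for y
    have "G = (\<lambda>y. \<psi> (0 + Tr (0 * bar y) + e * N y) * \<phi> y (u / D))"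
      by (rule ext) (simp add: G_def traceK_def)
    then obtain n1 where G: "step_function n1 M G"
      using step_psi_quad[OF st Qp_0 e, of 0] by blast
    define H where "H x = (\<integral>y. \<psi> (Tr (- \<beta> * x * bar y)) * G y \<partial>\<mu>)" for x
    have int: "\<exists>n'. step_function n' M (\<lambda>y. \<psi> (Tr (- \<beta> * x * bar y)) * G y)" for x
      using step_psi_quad[OF G Qp_0 Qp_0, of "- \<beta> * x"] by simp
    have wH: "weil (mat2 a b c d) \<phi> x u = 
      eta bar (c * u) * of_real (absv u / absv c * absv D powr (- 1 / 2)) * (\<psi> (\<beta> * a * N x) * H x)" for x
    proof -
      have "\<psi> (u * (a * N x - Tr (x * bar y) + d / D * N y) / c) * \<phi> y (u / D) =
        \<psi> (\<beta> * a * N x) * (\<psi> (Tr (- \<beta> * x * bar y)) * G y)" for y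
        unfolding arg[OF u] \<beta>_def[symmetric] e_def[symmetric] G_def
      proof -
        have "\<beta> * a * N x \<in> Qp" using \<beta>(1) Q(1) by (intro Qp_intros normK_Qp)
        moreover have "e * N y \<in> Qp" using e by (intro Qp_intros normK_Qp)
        ultimately show "\<psi> (\<beta> * a * N x + Tr (- \<beta> * x * bar y) + e * N y) * \<phi> y (u / D) =
          \<psi> (\<beta> * a * N x) * (\<psi> (Tr (- \<beta> * x * bar y)) * (\<psi> (e * N y) * \<phi> y (u / D)))"
          using psi_add3[OF _ traceK_Qp, of "\<beta> * a * N x" "e * N y" "- \<beta> * x * bar y"] by (simp only: mult.assoc)
      qed
      then show ?thesis unfolding w[OF u] H_def by (simp only: integral_mult_right_zero)
    qed
    \<comment> \<open>\<open>G\<close> has period \<open>q^n1\<close> times the integers.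
      Translating by a suitable period multiplies \<open>H x\<close> by a value of \<psi> different
      from 1 unless \<open>q^n1 * \<beta> * x\<close> is integral.\<close>
    have supp: "dv 0 (of_nat q ^ n1 * \<beta> * x)" if "H x \<noteq> 0" for x
    proof (rule ccontr)
      assume "\<not> dv 0 (of_nat q ^ n1 * \<beta> * x)"
      then obtain \<epsilon> where \<epsilon>: "dv 0 \<epsilon>" "\<psi> (Tr (of_nat q ^ n1 * \<beta> * x * bar \<epsilon>)) \<noteq> 1"
        using psi_trace_nontrivial by blast
      define \<delta> where "\<delta> = of_nat q ^ n1 * \<epsilon>"
      have "- \<beta> * x * bar \<delta> = - (of_nat q ^ n1 * \<beta> * x * bar \<epsilon>)" by (simp add: \<delta>_def)
      then have "Tr (- \<beta> * x * bar \<delta>) = Tr (- (of_nat q ^ n1 * \<beta> * x * bar \<epsilon>))" by (simp only:)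
      also have "\<dots> = - Tr (of_nat q ^ n1 * \<beta> * x * bar \<epsilon>)" by (simp add: traceK_def)
      finally have "Tr (- \<beta> * x * bar \<delta>) = - Tr (of_nat q ^ n1 * \<beta> * x * bar \<epsilon>)" .
      then have ne: "\<psi> (Tr (- \<beta> * x * bar \<delta>)) \<noteq> 1" using psi_minus_ne[OF _ \<epsilon>(2)] by simp
      have Gd: "G (y + \<delta>) = G y" for y
      proof -
        have "dv n1 (y + \<delta> - y)" using \<epsilon>(1) by (simp add: \<delta>_def dv_mult_right)
        then show ?thesis using G unfolding step_function_def by blast
      qed
      obtain n' where n': "step_function n' M (\<lambda>y. \<psi> (Tr (- \<beta> * x * bar y)) * G y)" using int by blast
      have "H x = (\<integral>y. \<psi> (Tr (- \<beta> * x * bar (1 * y + \<delta>))) * G (1 * y + \<delta>) \<partial>\<mu>)"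
        unfolding H_def using integral_step_affine[OF n', of 1 \<delta>] by simp
      also have "\<dots> = (\<integral>y. \<psi> (Tr (- \<beta> * x * bar \<delta>)) * (\<psi> (Tr (- \<beta> * x * bar y)) * G y) \<partial>\<mu>)"
      proof -
        have "Tr (- \<beta> * x * bar (1 * y + \<delta>)) = Tr (- \<beta> * x * bar \<delta>) + Tr (- \<beta> * x * bar y)" for y
          by (simp add: traceK_def algebra_simps)
        then show ?thesis using Gd by (simp add: psi_add mult.assoc)
      qed
      also have "\<dots> = \<psi> (Tr (- \<beta> * x * bar \<delta>)) * H x" unfolding H_def by (rule integral_mult_right_zero)
      finally show False using ne that by simp
    qed
    obtain n3 where n3: "dv 0 (of_nat q ^ n3 * (1 / (of_nat q ^ n1 * \<beta>)))" using ex_dv_scale by blast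
    obtain n4 where n4: "dv 0 (of_nat q ^ n4 * \<beta>)" using ex_dv_scale by blast
    \<comment> \<open>Dually to the bound on the support, the support of \<open>G\<close> bounds the
      level of \<open>H\<close>: on it a change of x by \<open>q^(n4 + M)\<close> alters the phase
      by an integer.\<close>
    have "step_function (n4 + M) n3 H"
      unfolding step_function_def
    proof (intro conjI allI impI)
      fix x x' assume "dv (n4 + M) (x - x')"
      then obtain z where z: "dv 0 z" "x - x' = of_nat q ^ (n4 + M) * z" by (rule dvE)
      have "\<psi> (Tr (- \<beta> * x * bar y)) * G y = \<psi> (Tr (- \<beta> * x' * bar y)) * G y" for y
      proof (cases "G y = 0")
        case False
        then have y: "dv 0 (of_nat q ^ M * y)" using G unfolding step_function_def by blast
        have "- \<beta> * x * bar y - - \<beta> * x' * bar y = - (\<beta> * (x - x') * bar y)" by (simp add: algebra_simps)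
        also have "\<dots> = - ((of_nat q ^ n4 * \<beta>) * z * bar (of_nat q ^ M * y))"
          unfolding z(2) by (simp add: power_add)
        finally have "dv 0 (- \<beta> * x * bar y - - \<beta> * x' * bar y)"
          using dv_mult_right[OF dv_mult_right[OF n4 z(1)], of "bar (of_nat q ^ M * y)"] y
          by (simp only: dv_minus_iff dv_bar)
        then have "dv 0 (Tr (- \<beta> * x * bar y - - \<beta> * x' * bar y))" by (rule dv_traceK)
        moreover have "Tr (- \<beta> * x * bar y - - \<beta> * x' * bar y) = Tr (- \<beta> * x * bar y) - Tr (- \<beta> * x' * bar y)"
          by (simp add: traceK_def)
        ultimately have "\<psi> (Tr (- \<beta> * x * bar y)) = \<psi> (Tr (- \<beta> * x' * bar y))"
          by (intro psi_cong traceK_Qp) (simp only:)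
        then show ?thesis by (simp only:)
      qed simp
      then show "H x = H x'" unfolding H_def by (simp only:)
    next
      fix x assume "H x \<noteq> 0"
      then have "dv 0 (of_nat q ^ n1 * \<beta> * x)" by (rule supp)
      from dv_mult_left[OF n3 this]
      show "dv 0 (of_nat q ^ n3 * x)" using \<beta>(2) by simp
    qed
    then obtain n5 where "step_function n5 n3 (\<lambda>x. \<psi> (\<beta> * a * N x) * H x)"
      using step_psi_quad[of "n4 + M" n3 H 0 "\<beta> * a" 0] \<beta> Q by (auto simp: traceK_def intro: Qp_intros)
    then have "step_function n5 n3 (\<lambda>x. eta bar (c * u) * of_real (absv u / absv c * absv D powr (- 1 / 2)) * (\<psi> (\<beta> * a * N x) * H x))"
      by (rule step_function_mult_if[where k="\<lambda>_. _"]) simp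
    then have "step_function n5 n3 (\<lambda>x. weil (mat2 a b c d) \<phi> x u)" unfolding wH .
    then show ?thesis by blast
  qed
qed

end

section \<open>The newform\<close>

locale newform_setup = weil_setup q T bar \<theta> \<mu> lam \<psi> m
    for q :: nat and T :: "'k::{field_char_0,complete_space} itself" and bar :: "'k \<Rightarrow> 'k" and \<theta> :: 'k
      and \<mu> :: "'k measure" and lam \<psi> :: "'k \<Rightarrow> complex" and m :: nat +
  fixes f :: "'k \<Rightarrow> 'k \<Rightarrow> complex"
    and B :: "('k \<Rightarrow> 'k \<Rightarrow> complex) \<Rightarrow> ('k \<Rightarrow> 'k \<Rightarrow> complex) \<Rightarrow> complex"
  assumes newf: "newform q (2 * m) bar \<psi> \<mu> lam f"
    and herm: "invariant_hermitian bar \<psi> \<mu> lam B"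
begin

lemma f_V: "f \<in> V" and f_nonzero: "f \<noteq> (\<lambda>x u. 0)" and f_fixed: "g \<in> U0 q (2 * m) \<Longrightarrow> weil g f = f"
  using newf by (auto simp: newform_def)

lemma power_m: "(x::'a::monoid_mult) ^ m = x * x ^ m1"
  using m_eq(1) by (metis power_Suc)

lemma mat2_U0:
  fixes a b c d z :: 'k
  assumes "a \<in> Zp" "b \<in> Zp" "d \<in> Zp" "z \<in> Zp" "c = of_nat q ^ n * z" "absv (a * d - b * c) = 1"
  shows "mat2 a b c d \<in> U0 q n"
proof -
  have c: "c \<in> Zp" unfolding assms(5) using assms(4) by (intro Zp_intros)
  have "a * d - b * c \<in> Qp" using assms c by (intro Zp_Qp Zp_intros)
  then show ?thesis unfolding U0_def using assms c by (auto simp: forall_2 Zp_units_def)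
qed

lemma f_unit_scale:
  assumes "d \<in> Qp" "absv d = 1"
  shows "f x (d * u) = f x u"
proof (cases "u \<in> Qp - {0}")
  case True
  have d0: "d \<noteq> 0" using assms(2) by auto
  have du: "d * u \<in> Qp - {0}" using True assms d0 by (auto intro!: Qp_intros)
  have "mat2 1 0 0 d \<in> U0 q (2 * m)"
  proof (rule mat2_U0[of 1 0 d 0])
    show "d \<in> Zp" using assms by (simp add: Zp_iff unit_dv_0)
    show "absv (1 * d - 0 * 0) = 1" using assms(2) by simp
  qed simp_all
  then have "weil (mat2 1 0 0 d) f x (d * u) = f x (d * u)" by (simp add: f_fixed)
  moreover have "weil (mat2 1 0 0 d) f x (d * u) = f x u"
    using du d0 eta_unit[of 1] assms(2) by (simp add: weil_rep_def Let_def)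
  ultimately show ?thesis by simp
next
  case False
  have "d * u \<notin> Qp - {0}"
  proof
    assume "d * u \<in> Qp - {0}"
    then have "d * u / d \<in> Qp" "u \<noteq> 0" using assms Qp_divide[of "d * u" d] by auto
    moreover have "d \<noteq> 0" using assms(2) by auto
    ultimately show False using False by auto
  qed
  then show ?thesis using False V_D(2)[OF f_V] by simp
qed

text \<open>Invariance under (1, b; 0, 1) with b in \<open>Zp\<close> gives
  \<open>f 1 v = \<psi> (b * v) * f 1 v\<close>, and some such b has a nontrivial value as soon as v
  is not integral.\<close>

lemma f_support_large:
  assumes "v \<in> Qp - {0}" "\<not> dv 0 v"
  shows "f 1 v = 0"
proof -
  obtain b where b: "b \<in> Zp" "\<psi> (b * v) \<noteq> 1" using psi_nontrivial assms by blast
  have "mat2 1 b 0 1 \<in> U0 q (2 * m)"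
    by (rule mat2_U0[of 1 b 1 0]) (simp_all add: b(1))
  then have "\<psi> (b * (v * N 1)) * f 1 v = f 1 v"
    using fun_cong[OF fun_cong[OF weil_unip[OF f_V Zp_Qp[OF b(1)]]], of 1 v] f_fixed by simp
  then show ?thesis using b(2) by (simp add: normK_def)
qed

text \<open>Averages the invariance under (1, 0; q^(2m)/e, 1) over units e. The Ramanujan sum
  replaces the oscillating phase by the indicators of two norm balls around x, so
  \<open>f x u\<close> is expressed by ball averages of \<open>f\<close>.\<close>

lemma f_average:
  assumes u: "u \<in> Qp - {0}"
  defines "c0 \<equiv> u / of_nat q ^ (2 * m)"
  shows "(of_nat q - 1) * f x u = lam u * of_real (absv u * real q ^ (2 * m)) *
    (of_nat q * (\<integral>y. (if dv 0 (c0 * N (x - y)) then 1 else 0) * f y u \<partial>\<mu>)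
      - (\<integral>y. (if dv 0 (of_nat q * c0 * N (x - y)) then 1 else 0) * f y u \<partial>\<mu>))"
proof -
  obtain n M where st: "step_function n M (\<lambda>y. f y u)" using V_D(1)[OF f_V] by blast
  have c0: "c0 \<in> Qp" using u by (auto simp: c0_def intro!: Qp_intros)
  obtain n1 where n1: "dv 0 (of_nat q ^ n1 * c0)" using ex_dv_scale by blast
  obtain n2 where n2: "dv 0 (of_nat q ^ n2 * x)" using ex_dv_scale by blast
  \<comment> \<open>Large enough for \<open>q^L\<close> to clear the denominator of
    \<open>c0 * N (x - y)\<close> for all y in the support of \<open>f\<close>, so that one finite
    average over e serves every y.\<close>
  define L where "L = n1 + (max n2 M + max n2 M)"
  have bound: "dv 0 (of_nat q ^ Suc L * (c0 * N (x - y)))" if "f y u \<noteq> 0" for y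
  proof -
    have "dv 0 (of_nat q ^ M * y)" using st that unfolding step_function_def by blast
    then have "dv 0 (of_nat q ^ max n2 M * x)" "dv 0 (of_nat q ^ max n2 M * y)"
      using dv_scale_mono[OF n2, of "max n2 M"] dv_scale_mono[of M y "max n2 M"] by simp_all
    then have "dv 0 (of_nat q ^ max n2 M * x - of_nat q ^ max n2 M * y)" by (rule dv_diff)
    then have xy: "dv 0 (of_nat q ^ max n2 M * (x - y))" by (simp only: right_diff_distrib)
    have "dv 0 ((of_nat q ^ n1 * c0) * N (of_nat q ^ max n2 M * (x - y)))"
      using dv_normK[OF xy] by (intro dv_mult_right[OF n1]) simp
    moreover have "(of_nat q ^ n1 * c0) * N (of_nat q ^ max n2 M * (x - y)) = of_nat q ^ L * (c0 * N (x - y))"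
      by (simp add: normK_def L_def power_add algebra_simps)
    ultimately have "dv 0 (of_nat q ^ L * (c0 * N (x - y)))" by (simp only:)
    then show ?thesis by (rule dv_scale_mono) simp
  qed
  define \<kappa> where "\<kappa> = lam u * of_real (absv u * real q ^ (2 * m))"
  let ?I = "\<lambda>e. \<integral>y. \<psi> (e * (c0 * N (x - y))) * f y u \<partial>\<mu>"
  have I: "f x u = \<kappa> * ?I e" if e: "e \<in> Zp" "absv e = 1" for e
  proof -
    have e0: "e \<noteq> 0" using e by auto
    have "1 / e \<in> Zp" using e by (auto simp: Zp_iff dv_def absv_divide intro!: Qp_intros)
    then have "mat2 1 0 (of_nat q ^ (2 * m) / e) 1 \<in> U0 q (2 * m)"
      by (rule_tac mat2_U0[of 1 0 1 "1 / e"]) simp_all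
    then have "f x u = weil (mat2 1 0 (of_nat q ^ (2 * m) / e) 1) f x u" by (simp add: f_fixed)
    also have "\<dots> = \<kappa> * ?I e" unfolding \<kappa>_def c0_def by (rule weil_lower_unip[OF e u])
    finally show ?thesis .
  qed
  have int: "integrable \<mu> (\<lambda>y. \<psi> (e * (c0 * N (x - y))) * f y u)" if "e \<in> Zp" for e
  proof -
    have ec: "e * c0 \<in> Qp" using Zp_Qp[OF that] c0 by (intro Qp_intros)
    have "e * (c0 * N (x - y)) = e * c0 * N x + Tr (- (e * c0) * x * bar y) + e * c0 * N y" for y
    proof -
      have "Tr (- (e * c0) * x * bar y) = - (e * c0) * Tr (x * bar y)"
        using traceK_Qp_mult[OF Qp_minus[OF ec], of "x * bar y"] by (simp only: mult.assoc)
      then show ?thesis by (simp add: normK_diff algebra_simps)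
    qed
    moreover obtain n' where "step_function n' M (\<lambda>y. \<psi> (e * c0 * N x + Tr (- (e * c0) * x * bar y) + e * c0 * N y) * f y u)"
      using step_psi_quad[OF st Qp_mult[OF ec normK_Qp] ec] by blast
    ultimately show ?thesis by (simp only: integrable_step)
  qed
  let ?U = "\<Sum>e\<in>zreps (Suc L). if absv e = 1 then f x u else 0"
  have "?U = (\<Sum>e\<in>zreps (Suc L). if absv e = 1 then 1 else 0) * f x u"
    unfolding sum_distrib_right by (intro sum.cong) auto
  then have U1: "?U = of_nat q ^ L * ((of_nat q - 1) * f x u)"
    unfolding card_unit_zreps by (simp add: algebra_simps)
  let ?J = "\<lambda>r. \<integral>y. (if dv 0 (r * N (x - y)) then 1 else 0) * f y u \<partial>\<mu>"
  have "?U = (\<Sum>e\<in>zreps (Suc L). if absv e = 1 then \<kappa> * ?I e else 0)"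
  proof (intro sum.cong refl)
    fix e assume "e \<in> zreps (Suc L)"
    then have "e \<in> Zp" by (rule zreps_Zp)
    then show "(if absv e = 1 then f x u else 0) = (if absv e = 1 then \<kappa> * ?I e else 0)"
      using I[of e] by (cases "absv e = 1") simp_all
  qed
  also have "\<dots> = \<kappa> * (\<Sum>e\<in>zreps (Suc L). \<integral>y. (if absv e = 1 then \<psi> (e * (c0 * N (x - y))) else 0) * f y u \<partial>\<mu>)"
    unfolding sum_distrib_left by (intro sum.cong refl) auto
  also have "(\<Sum>e\<in>zreps (Suc L). \<integral>y. (if absv e = 1 then \<psi> (e * (c0 * N (x - y))) else 0) * f y u \<partial>\<mu>) =
    (\<integral>y. (\<Sum>e\<in>zreps (Suc L). (if absv e = 1 then \<psi> (e * (c0 * N (x - y))) else 0) * f y u) \<partial>\<mu>)"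
  proof (rule Bochner_Integration.integral_sum[symmetric])
    fix e assume "e \<in> zreps (Suc L)"
    then have "e \<in> Zp" by (rule zreps_Zp)
    then show "integrable \<mu> (\<lambda>y. (if absv e = 1 then \<psi> (e * (c0 * N (x - y))) else 0) * f y u)"
      using int by (cases "absv e = 1") auto
  qed
  also have "(\<lambda>y. \<Sum>e\<in>zreps (Suc L). (if absv e = 1 then \<psi> (e * (c0 * N (x - y))) else 0) * f y u) =
    (\<lambda>y. of_nat q ^ Suc L * ((if dv 0 (c0 * N (x - y)) then 1 else 0) * f y u)
       - of_nat q ^ L * ((if dv 0 (of_nat q * c0 * N (x - y)) then 1 else 0) * f y u))"
  proof
    fix y
    show "(\<Sum>e\<in>zreps (Suc L). (if absv e = 1 then \<psi> (e * (c0 * N (x - y))) else 0) * f y u) =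
      of_nat q ^ Suc L * ((if dv 0 (c0 * N (x - y)) then 1 else 0) * f y u)
       - of_nat q ^ L * ((if dv 0 (of_nat q * c0 * N (x - y)) then 1 else 0) * f y u)"
    proof (cases "f y u = 0")
      case False
      have "c0 * N (x - y) \<in> Qp" using c0 by (intro Qp_intros normK_Qp)
      from psi_unit_sum[OF this bound[OF False]] show ?thesis
        unfolding sum_distrib_right[symmetric] by (simp add: mult.assoc left_diff_distrib)
    qed simp
  qed
  also have "(\<integral>y. of_nat q ^ Suc L * ((if dv 0 (c0 * N (x - y)) then 1 else 0) * f y u)
       - of_nat q ^ L * ((if dv 0 (of_nat q * c0 * N (x - y)) then 1 else 0) * f y u) \<partial>\<mu>) =
     of_nat q ^ Suc L * ?J c0 - of_nat q ^ L * ?J (of_nat q * c0)"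
  proof -
    have i: "integrable \<mu> (\<lambda>y. (if dv 0 (r * N (x - y)) then 1 else 0) * f y u)" for r
      using step_norm_ball[OF st, of r x] integrable_step by blast
    show ?thesis
      by (subst Bochner_Integration.integral_diff) (auto intro!: integrable_mult_right i)
  qed
  finally have "of_nat q ^ L * ((of_nat q - 1) * f x u) =
    of_nat q ^ L * (\<kappa> * (of_nat q * ?J c0 - ?J (of_nat q * c0)))"
    unfolding U1 by (simp add: algebra_simps)
  then show ?thesis by (simp add: \<kappa>_def)
qed

text \<open>Replacing x = 1 by 1 + \<delta>, with \<delta> of size \<open>q^m1\<close>, divides
  \<open>f x v\<close> by \<open>lam (1 + \<delta>)\<close>, which is not 1 for a suitable \<delta>.
  The ball averages do not notice the shift when q^2 divides v; valuation 1 is the borderline case,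
  where only the larger ball is insensitive.\<close>

lemma f_support_small:
  assumes v: "v \<in> Qp - {0}" "dv 1 v"
  shows "f 1 v = 0"
proof -
  obtain y0 where y0: "dv 0 y0" "lam (1 + of_nat q ^ m1 * y0) \<noteq> 1" using lam_conductor_exact by blast
  define \<delta> where "\<delta> = of_nat q ^ m1 * y0"
  define c0 where "c0 = v / of_nat q ^ (2 * m)"
  have unit: "absv (1 + \<delta>) = 1" unfolding \<delta>_def by (rule unit_one_plus_m1[OF y0(1)])
  have fx: "f x v = f 1 v / lam x" if "absv x = 1" for x
    using V_eval[OF f_V unit_nonzero[OF that] v(1)] f_unit_scale[of "N x" 1 v] that by simp
  have q2m: "of_nat q ^ (2 * m) = (of_nat q * of_nat q ^ m1) * (of_nat q * of_nat q ^ m1 :: 'k)"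
    by (simp add: power_add mult_2 power_m)
  have c0d: "c0 * N \<delta> = v / (of_nat q * of_nat q) * N y0"
    unfolding c0_def \<delta>_def q2m by (simp add: normK_def)
  define J where "J r x = (\<integral>y. (if dv 0 (r * N (x - y)) then 1 else 0) * f y v \<partial>\<mu>)" for r x
  note av = f_average[OF v(1), folded c0_def, folded J_def]
  have Jinv: "J r (1 + \<delta>) = J r 1" if "dv 0 (r * N \<delta>)" for r
  proof -
    have "dv 0 (r * N (1 + \<delta> - y)) \<longleftrightarrow> dv 0 (r * N (1 - y))" for y
      using dv_norm_ball_iff[OF that, of "1 - y"] by (simp add: algebra_simps)
    then show ?thesis unfolding J_def by (simp only:)
  qed
  obtain v1 where v1: "dv 0 v1" "v = of_nat q ^ 1 * v1" using v(2) by (rule dvE)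
  have J2: "J (of_nat q * c0) (1 + \<delta>) = J (of_nat q * c0) 1"
  proof (rule Jinv)
    have "of_nat q * c0 * N \<delta> = v1 * N y0" using c0d v1(2) by (simp add: field_simps)
    then show "dv 0 (of_nat q * c0 * N \<delta>)" using v1(1) dv_normK[OF y0(1)] by (simp add: dv_mult_left)
  qed
  have "f (1 + \<delta>) v = f 1 v"
  proof (cases "dv 2 v")
    case True
    then obtain v2 where v2: "dv 0 v2" "v = of_nat q ^ 2 * v2" by (rule dvE)
    have "c0 * N \<delta> = v2 * N y0" using c0d v2(2) by (simp add: power2_eq_square)
    then have "dv 0 (c0 * N \<delta>)" using v2(1) dv_normK[OF y0(1)] by (simp add: dv_mult_left)
    then have "J c0 (1 + \<delta>) = J c0 1" by (rule Jinv)
    then have "(of_nat q - 1) * f (1 + \<delta>) v = (of_nat q - 1) * f 1 v" unfolding av J2 by simp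
    moreover have "of_nat q - 1 \<noteq> (0::complex)" using q_ge_3 by (metis One_nat_def eq_iff_diff_eq_0 numeral_One of_nat_1 of_nat_eq_iff one_le_numeral not_less_eq_eq numeral_3_eq_3 le_SucI le_antisym)
    ultimately show ?thesis by simp
  next
    case False
    then have av1: "absv v = 1 / real q" using absv_eq_of_dv[of 1 v] v(2) by (simp add: numeral_2_eq_2 One_nat_def)
    have v1u: "absv v1 = 1" using av1 v1(2) by (simp add: absv_mult absv_p)
    have v1Q: "v1 \<in> Qp" using v1(2) v(1) Qp_divide[of v "of_nat q"] by auto
    have lv: "lam v = -1"
      unfolding v1(2) using v1u lam_Qp_unit[OF v1Q v1u] by (simp add: lam_mult lam_q unit_nonzero)
    have ball: "dv 0 (c0 * N w) \<longleftrightarrow> dv m w" for w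
    proof
      assume "dv m w"
      then obtain w' where w': "dv 0 w'" "w = of_nat q ^ m * w'" by (rule dvE)
      have "c0 * N w = v * N w'" unfolding c0_def w'(2) by (simp add: normK_def mult_2 power_add)
      then show "dv 0 (c0 * N w)" using dv_mono[OF v(2), of 0] dv_normK[OF w'(1)] by (simp add: dv_mult_left)
    next
      assume d: "dv 0 (c0 * N w)"
      show "dv m w"
      proof (rule ccontr)
        assume nd: "\<not> dv m w"
        have "absv w \<ge> 1 / real q ^ m1"
        proof (cases "dv m1 w")
          case True
          then show ?thesis using absv_eq_of_dv[of m1 w] nd m_eq by simp
        qed (simp add: dv_def)
        then have "(1 / real q ^ m1)\<^sup>2 \<le> (absv w)\<^sup>2" by (intro power_mono) auto
        then have "absv c0 * (1 / real q ^ m1)\<^sup>2 \<le> absv c0 * (absv w)\<^sup>2" by (intro mult_left_mono) auto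
        also have "\<dots> \<le> 1" using d by (simp add: dv_def absv_mult)
        finally have "absv c0 * (1 / real q ^ m1)\<^sup>2 \<le> 1" .
        moreover have "absv c0 * (1 / real q ^ m1)\<^sup>2 = real q"
          unfolding c0_def q2m by (simp add: absv_divide absv_mult absv_p absv_p_power av1 power2_eq_square)
        ultimately show False using p_gt_1 by simp
      qed
    qed
    \<comment> \<open>At valuation 1 the smaller ball is x + q^m OK. By the conductor
      \<open>lam\<close>, hence \<open>f\<close>, is constant on it, and its integral is a value
      times a volume.\<close>
    have J1: "J c0 x = f x v / of_nat q ^ (2 * m)" if x: "absv x = 1" for x
    proof -
      have "(if dv 0 (c0 * N (x - y)) then 1 else 0) * f y v = indicator (bl x (of_nat q ^ m)) y *\<^sub>R f x v" for y
      proof (cases "dv m (x - y)")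
        case True
        then have "absv y = 1" using unit_cong[OF x, of m1] m_eq by simp
        moreover have "lam x = lam y" using lam_cong[OF x True] .
        ultimately have "f y v = f x v" using fx[OF \<open>absv y = 1\<close>] fx[OF x] by (simp only:)
        moreover have "y \<in> bl x (of_nat q ^ m)" using True by (simp add: bl_def dv_def absv_p_power absv_diff_commute)
        ultimately show ?thesis using True by (simp add: ball)
      next
        case False
        then have "y \<notin> bl x (of_nat q ^ m)" by (simp add: bl_def dv_def absv_p_power absv_diff_commute)
        then show ?thesis using False by (simp add: ball)
      qed
      then have "J c0 x = (\<integral>y. indicator (bl x (of_nat q ^ m)) y *\<^sub>R f x v \<partial>\<mu>)" unfolding J_def by (simp only:)
      also have "\<dots> = measure \<mu> (bl x (of_nat q ^ m)) *\<^sub>R f x v"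
        by (rule has_bochner_integral_integral_eq[OF has_bochner_integral_indicator]) (auto simp: bl_sets emeasure_bl)
      also have "\<dots> = f x v / of_nat q ^ (2 * m)"
        by (simp add: measure_bl absv_p_power scaleR_conv_of_real power2_eq_square mult_2 power_add)
      finally show ?thesis .
    qed
    define K where "K = lam v * of_real (absv v * real q ^ (2 * m))"
    have K: "K * of_nat q = - (of_nat q ^ (2 * m))" by (simp add: K_def lv av1)
    \<comment> \<open>The sign \<open>lam v = - 1\<close> at odd valuation matters: it turns the
      identity into (q - 1) X = - X for the difference X, hence q X = 0.\<close>
    have "(of_nat q - 1) * (f (1 + \<delta>) v - f 1 v) = K * of_nat q * (J c0 (1 + \<delta>) - J c0 1)"
      unfolding right_diff_distrib[of "of_nat q - 1"] av J2 K_def[symmetric] by (simp add: algebra_simps)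
    also have "\<dots> = - (f (1 + \<delta>) v - f 1 v)"
      unfolding J1[OF unit] J1[OF absv_one] K by (simp add: field_simps)
    finally have "of_nat q * (f (1 + \<delta>) v - f 1 v) = 0" by (simp add: algebra_simps)
    then show ?thesis by simp
  qed
  moreover have "f (1 + \<delta>) v = f 1 v / lam (1 + \<delta>)" by (rule fx[OF unit])
  ultimately have "f 1 v * lam (1 + \<delta>) = f 1 v" using lam_nonzero[OF unit_nonzero[OF unit]] by (simp add: field_simps)
  then show ?thesis using y0(2) by (simp add: \<delta>_def)
qed

definition C where "C = f 1 1"

lemma f_one: "v \<in> Qp - {0} \<Longrightarrow> f 1 v = (if absv v = 1 then C else 0)"
  using f_support_small[of v] f_support_large[of v] f_unit_scale[of v 1 1] unit_iff[of v]
  by (auto simp: C_def)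

lemma f_explicit:
  assumes "x \<noteq> 0" "u \<in> Qp - {0}"
  shows "f x u = (if absv (N x * u) = 1 then C / lam x else 0)"
  using V_eval[OF f_V assms] f_one[OF normK_Qp_nonzero[OF assms]] by simp

lemma C_nonzero: "C \<noteq> 0"
proof
  assume "C = 0"
  then have "f = (\<lambda>x u. 0)" using f_one by (intro V_eqI[OF f_V V_zero]) simp
  then show False using f_nonzero by simp
qed

section \<open>The invariant pairing against the newform\<close>

lemma B_add: "\<phi> \<in> V \<Longrightarrow> \<phi>' \<in> V \<Longrightarrow> h \<in> V \<Longrightarrow> B (\<lambda>x u. \<phi> x u + \<phi>' x u) h = B \<phi> h + B \<phi>' h"
  and B_scale: "\<phi> \<in> V \<Longrightarrow> h \<in> V \<Longrightarrow> B (\<lambda>x u. c * \<phi> x u) h = c * B \<phi> h"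
  and B_cnj: "\<phi> \<in> V \<Longrightarrow> h \<in> V \<Longrightarrow> B h \<phi> = cnj (B \<phi> h)"
  and B_nondegenerate: "\<phi> \<in> V \<Longrightarrow> (\<And>h. h \<in> V \<Longrightarrow> B \<phi> h = 0) \<Longrightarrow> \<phi> = (\<lambda>x u. 0)"
  and B_invariant: "g \<in> GL2_Qp \<Longrightarrow> \<phi> \<in> V \<Longrightarrow> h \<in> V \<Longrightarrow> B (weil g \<phi>) (weil g h) = B \<phi> h"
  using herm unfolding invariant_hermitian_def Let_def by blast+

lemma B_zero: "h \<in> V \<Longrightarrow> B (\<lambda>x u. 0) h = 0"
  using B_scale[OF V_zero, of h 0] by simp

lemma B_sum: "finite S \<Longrightarrow> (\<And>i. i \<in> S \<Longrightarrow> \<phi> i \<in> V) \<Longrightarrow> h \<in> V \<Longrightarrow>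
    B (\<lambda>x u. \<Sum>i\<in>S. \<phi> i x u) h = (\<Sum>i\<in>S. B (\<phi> i) h)"
proof (induction S rule: finite_induct)
  case (insert i S)
  have "B (\<lambda>x u. \<phi> i x u + (\<Sum>i\<in>S. \<phi> i x u)) h = B (\<phi> i) h + B (\<lambda>x u. \<Sum>i\<in>S. \<phi> i x u) h"
    using insert by (intro B_add V_sum) auto
  then show ?case using insert by simp
qed (simp add: B_zero)

lemma B_sum_right: "finite S \<Longrightarrow> (\<And>i. i \<in> S \<Longrightarrow> \<phi> i \<in> V) \<Longrightarrow> h \<in> V \<Longrightarrow>
    B h (\<lambda>x u. \<Sum>i\<in>S. \<phi> i x u) = (\<Sum>i\<in>S. B h (\<phi> i))"
proof -
  assume a: "finite S" "\<And>i. i \<in> S \<Longrightarrow> \<phi> i \<in> V" "h \<in> V"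
  have "B h (\<lambda>x u. \<Sum>i\<in>S. \<phi> i x u) = cnj (\<Sum>i\<in>S. B (\<phi> i) h)"
    using B_cnj[OF V_sum[OF a(1,2)] a(3)] B_sum[OF a] by simp
  also have "\<dots> = (\<Sum>i\<in>S. B h (\<phi> i))"
    unfolding cnj_sum using a by (intro sum.cong refl B_cnj[symmetric]) auto
  finally show ?thesis .
qed

lemma mat2_GL2: "a \<in> Qp \<Longrightarrow> b \<in> Qp \<Longrightarrow> c \<in> Qp \<Longrightarrow> d \<in> Qp \<Longrightarrow> a * d - b * c \<noteq> 0 \<Longrightarrow> mat2 a b c d \<in> GL2_Qp"
  by (simp add: GL2_Qp_def forall_2)

lemma absv_power_int: "absv ((x::'k) powi n) = absv x powi n"
  by (simp add: power_int_def absv_power absv_inverse)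

lemma Qp_even_norm:
  assumes "v \<in> Qp - {0}" "absv v = real q powi (2 * j)"
  shows "\<exists>t. t \<noteq> 0 \<and> v = N t"
proof -
  define y where "y = (of_nat q powi (- j) :: 'k)"
  have yQ: "y \<in> Qp" unfolding y_def power_int_def by (auto intro!: Qp_intros)
  have y0: "y \<noteq> 0" by (simp add: y_def)
  have "absv y = real q powi j"
    unfolding y_def absv_power_int absv_p by (simp add: power_int_minus power_int_divide_distrib)
  then have "absv (v / y\<^sup>2) = 1"
    using assms(2) by (simp add: absv_divide absv_power power_int_mult mult.commute[of 2])
  moreover have "v / y\<^sup>2 \<in> Qp" using assms yQ by (auto intro!: Qp_intros)
  ultimately obtain s where s: "absv s = 1" "N s = v / y\<^sup>2" using normK_surj_unit by blast
  have "N (y * s) = v" using s y0 yQ by (simp add: normK_mult) (simp add: normK_def bar_Qp power2_eq_square)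
  then show ?thesis using y0 s(1) by (intro exI[of _ "y * s"]) auto
qed

lemma Qp_norm_decomp:
  assumes "v \<in> Qp - {0}"
  shows "\<exists>t. t \<noteq> 0 \<and> (v = N t * 1 \<or> v = N t * of_nat q)"
proof -
  obtain n where n: "absv v = real q powi n" using absv_value assms by blast
  show ?thesis
  proof (cases "even n")
    case True
    then obtain j where "n = 2 * j" by (elim evenE)
    then show ?thesis using Qp_even_norm[OF assms, of j] n by auto
  next
    case False
    then obtain j where j: "n = 2 * j + 1" by (elim oddE)
    have "absv (v / of_nat q) = real q powi (2 * (j + 1))"
      using n j by (simp add: absv_divide absv_p power_int_add power2_eq_square)
    moreover have "v / of_nat q \<in> Qp - {0}" using assms by (auto intro!: Qp_intros)
    ultimately obtain t where "t \<noteq> 0" "v / of_nat q = N t" using Qp_even_norm by blast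
    then show ?thesis by (intro exI[of _ t]) (auto simp: field_simps)
  qed
qed

text \<open>The support bounds in the definition of the space may depend on u. Modulo norms there
  are only the two values u = 1 and u = q, and equivariance carries their bounds to all v.\<close>

lemma V_support:
  assumes "h \<in> V"
  shows "\<exists>M. \<forall>v\<in>Qp - {0}. h 1 v \<noteq> 0 \<longrightarrow> dv 0 (of_nat q ^ M * v)"
proof -
  obtain n1 M1 where 1: "step_function n1 M1 (\<lambda>x. h x 1)" using V_D(1)[OF assms] by blast
  obtain n2 M2 where 2: "step_function n2 M2 (\<lambda>x. h x (of_nat q))" using V_D(1)[OF assms] by blast
  define M where "M = max M1 M2"
  show ?thesis
  proof (intro exI ballI impI)
    fix v assume v: "v \<in> Qp - {0}" "h 1 v \<noteq> 0"
    obtain t where t: "t \<noteq> 0" "v = N t * 1 \<or> v = N t * of_nat q" using Qp_norm_decomp[OF v(1)] by blast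
    obtain r where r: "v = N t * r" "r = 1 \<or> r = of_nat q" using t(2) by blast
    have rQ: "r \<in> Qp - {0}" using r(2) by auto
    have "h t r \<noteq> 0" using V_eval[OF assms t(1) rQ] v(2) r(1) lam_nonzero[OF t(1)] by simp
    then have "dv 0 (of_nat q ^ M * t)"
      using r(2) 1 2 dv_scale_mono[of M1 t M] dv_scale_mono[of M2 t M]
      unfolding step_function_def M_def by auto
    from dv_normK[OF this] have "dv 0 (N (of_nat q ^ M * t) * r)"
      using r(2) by (intro dv_mult_right) auto
    moreover have "N (of_nat q ^ M * t) * r = of_nat q ^ (M + M) * v"
      by (simp add: r(1) normK_def power_add)
    ultimately show "dv 0 (of_nat q ^ (M + M) * v)" by (simp only:)
  qed
qed

text \<open>The definition of the space asks for smoothness in x only. For units it passes to u: by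
  Hensel a' = a s^2 with s close to 1 in \<open>Qp\<close>, and with a = N t the values at a and a'
  are those of \<open>h\<close> at t and t s over u = 1.\<close>

lemma V_unit_locally_constant:
  assumes "h \<in> V"
  shows "\<exists>L. \<forall>a\<in>Qp. \<forall>a'\<in>Qp. absv a = 1 \<longrightarrow> dv L (a - a') \<longrightarrow> h 1 a = h 1 a'"
proof -
  obtain n M where st: "step_function n M (\<lambda>x. h x 1)" using V_D(1)[OF assms] by blast
  show ?thesis
  proof (intro exI ballI impI)
    fix a a' :: 'k assume a: "a \<in> Qp" "a' \<in> Qp" "absv a = 1" "dv (Suc n) (a - a')"
    have a0: "a \<noteq> 0" using a(3) by auto
    obtain t where t: "absv t = 1" "N t = a" using normK_surj_unit[OF a(1,3)] .
    have t0: "t \<noteq> 0" using t by auto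
    have "a' / a - 1\<^sup>2 = (a' - a) / a" using a0 by (simp add: field_simps)
    then have "dv (Suc n) (a' / a - 1\<^sup>2)" using a(3,4) by (simp add: dv_divide_unit_iff dv_diff_commute)
    then obtain s where s: "s \<in> Qp" "s\<^sup>2 = a' / a" "dv (Suc n) (s - 1)" "absv s = 1"
      using Qp_sqrt[of "a' / a" 1 n] a by (metis Qp_1 Qp_divide absv_one)
    have "N (t * s) = a'" using s a0 t by (simp add: normK_mult) (simp add: normK_def bar_Qp power2_eq_square)
    moreover have ts0: "t * s \<noteq> 0" using t0 s(4) by auto
    ultimately have 1: "h (t * s) 1 = h 1 a' / lam (t * s)" using V_eval[OF assms ts0, of 1] by simp
    have 2: "h t 1 = h 1 a / lam t" using V_eval[OF assms t0, of 1] t(2) by simp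
    have 3: "lam (t * s) = lam t" using lam_Qp_unit[OF s(1,4)] t0 s(4) by (simp add: lam_mult unit_nonzero)
    have "t * s - t = t * (s - 1)" by (simp add: algebra_simps)
    then have "dv n (t * s - t)" using t(1) dv_mono[OF s(3), of n] by (simp add: dv_mult_unit_iff)
    then have "h (t * s) 1 = h t 1" using st unfolding step_function_def by blast
    then show "h 1 a = h 1 a'" unfolding 1 2 3 using lam_nonzero[OF t0] by simp
  qed
qed

lemma V_cut:
  assumes "h \<in> V"
  shows "(\<lambda>x u. (if dv 0 (e * (u * N x)) then 1 else 0) * h x u) \<in> V"
proof (rule V_mult[OF assms, where k="\<lambda>s. if dv 0 (e * s) then 1 else 0"])
  fix u n M assume st: "step_function n M (\<lambda>x. h x u)"
  have "N (0 - y) = N y" for y by (simp add: normK_def)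
  then show "\<exists>n M. step_function n M (\<lambda>x. (if dv 0 (e * (u * N x)) then 1 else 0) * h x u)"
    using step_norm_ball[OF st, of "e * u" 0] by (auto simp: mult.assoc)
qed

definition unit_reps :: "nat \<Rightarrow> 'k set"
  where "unit_reps L = {a \<in> zreps (Suc L). absv a = 1}"

lemma unit_repsD: "a \<in> unit_reps L \<Longrightarrow> a \<in> Qp \<and> a \<in> Zp \<and> absv a = 1"
  using zreps_Zp by (auto simp: unit_reps_def Zp_iff)

lemma finite_unit_reps [simp]: "finite (unit_reps L)"
  by (simp add: unit_reps_def)

lemma sum_unit_reps: "(\<Sum>a\<in>unit_reps L. g a) = (\<Sum>a\<in>zreps (Suc L). if absv a = 1 then g a else (0::complex))"
  unfolding unit_reps_def by (rule sum.inter_filter) simp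

lemma card_unit_reps: "of_nat (card (unit_reps L)) = (of_nat q ^ Suc L - of_nat q ^ L :: complex)"
  using sum_unit_reps[of "\<lambda>_. 1" L] card_unit_zreps[of L] by simp

lemma q_power_nonzero: "of_nat q ^ Suc L - of_nat q ^ L \<noteq> (0::complex)"
proof -
  have "q \<noteq> 1" using q_ge_3 by auto
  then have "of_nat q \<noteq> (1::complex)" by (metis of_nat_1 of_nat_eq_iff)
  then show ?thesis by simp
qed

lemma f_unip: 
  assumes "b \<in> Zp"
  shows "(\<lambda>x u. \<psi> (b * (u * N x)) * f x u) = f" "weil (mat2 1 b 0 1) f = f"
proof -
  have "mat2 1 b 0 1 \<in> U0 q (2 * m)" by (rule mat2_U0[of 1 b 1 0]) (simp_all add: assms)
  then show "weil (mat2 1 b 0 1) f = f" by (rule f_fixed)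
  then show "(\<lambda>x u. \<psi> (b * (u * N x)) * f x u) = f" using weil_unip[OF f_V Zp_Qp[OF assms]] by simp
qed

text \<open>As \<open>f\<close> is fixed by integral upper unipotents, pairing with \<open>f\<close>
  does not change when \<open>h\<close> is averaged over them; on functions of v this average is the
  projection to integral v.\<close>

lemma B_f_cut:
  assumes h: "h \<in> V"
  shows "B (\<lambda>x u. (if dv 0 (u * N x) then 1 else 0) * h x u) f = B h f"
proof -
  obtain M where M: "\<And>v. v \<in> Qp - {0} \<Longrightarrow> h 1 v \<noteq> 0 \<Longrightarrow> dv 0 (of_nat q ^ M * v)" using V_support[OF h] by blast
  let ?P = "\<lambda>x u. (if dv 0 (u * N x) then 1 else 0) * h x u"
  have P: "?P \<in> V" using V_cut[OF h, of 1] by simp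
  have "(\<lambda>x u. \<Sum>b\<in>zreps M. \<psi> (b * (u * N x)) * h x u) = (\<lambda>x u. of_nat q ^ M * ?P x u)"
  proof (intro ext)
    fix x u
    show "(\<Sum>b\<in>zreps M. \<psi> (b * (u * N x)) * h x u) = of_nat q ^ M * ?P x u"
    proof (cases "h x u = 0")
      case False
      then have u: "u \<in> Qp - {0}" using V_D(2)[OF h] by blast
      have x: "x \<noteq> 0" using V_0[OF h] False by auto
      have "h 1 (N x * u) \<noteq> 0" using V_eval[OF h x u] False by auto
      then have "dv 0 (of_nat q ^ M * (u * N x))" using M[OF normK_Qp_nonzero[OF x u]] by (simp add: mult.commute)
      moreover have "u * N x \<in> Qp" using u by (intro Qp_intros normK_Qp) auto
      ultimately show ?thesis using psi_sum[of "u * N x" M] by (simp flip: sum_distrib_right)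
    qed simp
  qed
  then have "of_nat q ^ M * B ?P f = B (\<lambda>x u. \<Sum>b\<in>zreps M. \<psi> (b * (u * N x)) * h x u) f"
    using B_scale[OF P f_V] by simp
  also have "\<dots> = (\<Sum>b\<in>zreps M. B (\<lambda>x u. \<psi> (b * (u * N x)) * h x u) f)"
    by (intro B_sum f_V V_unip[OF h]) (auto dest: zreps_Zp Zp_Qp)
  also have "\<dots> = (\<Sum>b\<in>zreps M. B h f)"
  proof (intro sum.cong refl)
    fix b assume "b \<in> zreps M"
    then have b: "b \<in> Zp" "b \<in> Qp" by (auto dest: zreps_Zp Zp_Qp)
    have "mat2 1 b 0 1 \<in> GL2_Qp" using b by (intro mat2_GL2) auto
    from B_invariant[OF this h f_V] show "B (\<lambda>x u. \<psi> (b * (u * N x)) * h x u) f = B h f"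
      unfolding f_unip(2)[OF b(1)] weil_unip[OF h b(2)] .
  qed
  finally have "of_nat q ^ M * B ?P f = of_nat q ^ M * B h f" by simp
  then show ?thesis by simp
qed

text \<open>Here the unipotents with entry b/q are moved to the other side: they fix functions
  supported on multiples of q, and their sum over b modulo q kills \<open>f\<close>, which lives on
  units.\<close>

lemma B_f_small:
  assumes h: "h \<in> V"
  shows "B (\<lambda>x u. (if dv 0 (1 / of_nat q * (u * N x)) then 1 else 0) * h x u) f = 0"
proof -
  let ?P = "\<lambda>x u. (if dv 0 (1 / of_nat q * (u * N x)) then 1 else 0) * h x u"
  have P: "?P \<in> V" using V_cut[OF h, of "1 / of_nat q"] .
  let ?n = "\<lambda>b x u. \<psi> (b / of_nat q * (u * N x)) * f x u"
  have bQ: "b / of_nat q \<in> Qp" if "b \<in> zreps 1" for b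
    using zreps_Zp[OF that] by (intro Qp_intros) (auto simp: Zp_iff)
  have "B ?P (?n b) = B ?P f" if b: "b \<in> zreps 1" for b
  proof -
    have bZ: "b \<in> Zp" using zreps_Zp[OF b] .
    have "(\<lambda>x u. \<psi> (b / of_nat q * (u * N x)) * ?P x u) = ?P"
    proof (intro ext)
      fix x u
      show "\<psi> (b / of_nat q * (u * N x)) * ?P x u = ?P x u"
      proof (cases "dv 0 (1 / of_nat q * (u * N x)) \<and> u \<in> Qp - {0}")
        case True
        then have "1 / of_nat q * (u * N x) \<in> Zp" by (auto simp: Zp_iff intro!: Qp_intros)
        from psi_Zp[OF Zp_mult[OF bZ this]] show ?thesis by simp
      next
        case False
        then show ?thesis using V_D(2)[OF h, of u x] by auto
      qed
    qed
    then have "weil (mat2 1 (b / of_nat q) 0 1) ?P = ?P" using weil_unip[OF P bQ[OF b]] by simp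
    moreover have "mat2 1 (b / of_nat q) 0 1 \<in> GL2_Qp" using bQ[OF b] by (intro mat2_GL2) auto
    ultimately show ?thesis using B_invariant[OF _ P f_V, of "mat2 1 (b / of_nat q) 0 1"] weil_unip[OF f_V bQ[OF b]] by simp
  qed
  then have "of_nat q * B ?P f = (\<Sum>b\<in>zreps 1. B ?P (?n b))" by simp
  also have "\<dots> = B ?P (\<lambda>x u. \<Sum>b\<in>zreps 1. ?n b x u)"
  proof (rule B_sum_right[symmetric, OF finite_zreps _ P])
    show "?n b \<in> V" if "b \<in> zreps 1" for b by (rule V_unip[OF f_V bQ[OF that]])
  qed
  also have "(\<lambda>x u. \<Sum>b\<in>zreps 1. ?n b x u) = (\<lambda>x u. 0)"
  proof (intro ext)
    fix x u
    show "(\<Sum>b\<in>zreps 1. ?n b x u) = 0"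
    proof (cases "f x u = 0")
      case False
      then have u: "u \<in> Qp - {0}" using V_D(2)[OF f_V] by blast
      have x: "x \<noteq> 0" using V_0[OF f_V] False by auto
      have "absv (N x * u) = 1" using f_explicit[OF x u] False by (auto split: if_splits)
      then have un: "absv (u * N x) = 1" by (simp add: mult.commute)
      have "u * N x / of_nat q \<in> Qp" using u by (intro Qp_intros normK_Qp) auto
      moreover have "dv 0 (of_nat q ^ 1 * (u * N x / of_nat q))" using un by (simp add: unit_dv_0)
      moreover have "\<not> dv 0 (u * N x / of_nat q)" using un p_gt_1 by (simp add: dv_def absv_divide absv_p)
      ultimately have "(\<Sum>b\<in>zreps 1. \<psi> (b * (u * N x / of_nat q))) = 0" using psi_sum[of "u * N x / of_nat q" 1] by simp
      then have "(\<Sum>b\<in>zreps 1. \<psi> (b / of_nat q * (u * N x))) = 0" by simp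
      then show ?thesis unfolding sum_distrib_right[symmetric] by simp
    qed simp
  qed
  also have "B ?P (\<lambda>x u. 0) = 0" using B_cnj[OF V_zero P] B_zero[OF P] by simp
  finally show ?thesis by simp
qed

text \<open>After the two cuts only unit values of v remain, and the sum over diag(a, 1) with a a
  unit makes the function constant there, that is, a multiple of \<open>f\<close>. The mean over
  units is independent of \<open>L\<close> once \<open>L\<close> passes the level of local constancy
  of \<open>h\<close>.\<close>

lemma B_f:
  assumes h: "h \<in> V"
  shows "\<exists>L0. \<forall>L\<ge>L0. (of_nat q ^ Suc L - of_nat q ^ L) * C * B h f = (\<Sum>a\<in>unit_reps L. h 1 a) * B f f"
proof -
  let ?P1 = "\<lambda>x u. (if dv 0 (u * N x) then 1 else 0) * h x u"
  let ?P2 = "\<lambda>x u. (if dv 0 (1 / of_nat q * (u * N x)) then 1 else 0) * h x u"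
  define W where "W = (\<lambda>x u. ?P1 x u + (-1) * ?P2 x u)"
  have P1: "?P1 \<in> V" using V_cut[OF h, of 1] by simp
  have P2: "?P2 \<in> V" by (rule V_cut[OF h])
  have P2': "(\<lambda>x u. (-1) * ?P2 x u) \<in> V" by (rule V_scale[OF P2])
  have W: "W \<in> V" unfolding W_def by (rule V_add[OF P1 P2'])
  have "B W f = B ?P1 f + B (\<lambda>x u. (-1) * ?P2 x u) f" unfolding W_def by (rule B_add[OF P1 P2' f_V])
  also have "\<dots> = B h f" using B_f_cut[OF h] B_scale[OF P2 f_V, of "-1"] B_f_small[OF h] by simp
  finally have BW: "B W f = B h f" .
  have W1: "W x u = (if absv (u * N x) = 1 then h x u else 0)" for x u
  proof -
    have d: "dv 0 (1 / of_nat q * s) \<longleftrightarrow> dv 1 s" for s :: 'k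
      by (simp add: dv_def absv_divide absv_p field_simps)
    show ?thesis unfolding W_def d unit_iff using dv_mono[of 1 "u * N x" 0] by auto
  qed
  obtain L0 where L0: "\<And>a a'. a \<in> Qp \<Longrightarrow> a' \<in> Qp \<Longrightarrow> absv a = 1 \<Longrightarrow> dv L0 (a - a') \<Longrightarrow> h 1 a = h 1 a'"
    using V_unit_locally_constant[OF h] by blast
  show ?thesis
  proof (intro exI[of _ L0] allI impI)
    fix L assume L: "L0 \<le> L"
    let ?S = "\<Sum>a\<in>unit_reps L. h 1 a"
    let ?d = "\<lambda>a x u. W (a * x) (u / a)"
    have dV: "?d a \<in> V" if "a \<in> unit_reps L" for a
      using unit_repsD[OF that] by (intro weil_diag_unit(2)[OF W]) auto
    have Bd: "B (?d a) f = B W f" if "a \<in> unit_reps L" for a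
    proof -
      have a: "a \<in> Qp" "a \<in> Zp" "absv a = 1" using unit_repsD[OF that] by auto
      have "mat2 a 0 0 1 \<in> U0 q (2 * m)"
        by (rule mat2_U0[of a 0 1 0]) (simp_all add: a)
      then have "weil (mat2 a 0 0 1) f = f" by (rule f_fixed)
      moreover have "mat2 a 0 0 1 \<in> GL2_Qp" using a by (intro mat2_GL2) auto
      ultimately show ?thesis
        using B_invariant[OF _ W f_V, of "mat2 a 0 0 1"] weil_diag_unit(1)[OF W a(1,3)] by simp
    qed
    have sumV: "(\<lambda>x u. \<Sum>a\<in>unit_reps L. ?d a x u) \<in> V" by (intro V_sum dV) auto
    have "(\<lambda>x u. C * (\<Sum>a\<in>unit_reps L. ?d a x u)) = (\<lambda>x u. ?S * f x u)"
    proof (rule V_eqI[OF V_scale[OF sumV] V_scale[OF f_V]])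
      fix v :: 'k assume v: "v \<in> Qp - {0}"
      have d1: "?d a 1 v = (if absv v = 1 then h 1 (a * v) else 0)" if "a \<in> unit_reps L" for a
      proof -
        have a: "a \<in> Qp" "absv a = 1" using unit_repsD[OF that] by auto
        have a0: "a \<noteq> 0" using a by auto
        have va: "v / a \<in> Qp - {0}" using v a a0 by (auto intro!: Qp_intros)
        have Na: "N a = a * a" using a by (simp add: normK_def bar_Qp)
        have "h a (v / a) = h 1 (a * v)"
          using V_eval[OF h a0 va] lam_Qp_unit[OF a] a0 by (simp add: Na)
        moreover have "absv (v / a * N a) = absv v" using a0 by (simp add: Na absv_mult absv_divide a(2))
        ultimately show ?thesis unfolding W1 by simp
      qed
      show "C * (\<Sum>a\<in>unit_reps L. ?d a 1 v) = ?S * f 1 v"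
      proof (cases "absv v = 1")
        case True
        have "(\<Sum>a\<in>unit_reps L. ?d a 1 v) = (\<Sum>a\<in>unit_reps L. h 1 (a * v))"
          using d1 True by (intro sum.cong) auto
        also have "\<dots> = (\<Sum>a\<in>zreps (Suc L). (\<lambda>a. if absv a = 1 then h 1 a else 0) (a * v))"
          unfolding sum_unit_reps using True by (simp add: absv_mult)
        also have "\<dots> = (\<Sum>a\<in>zreps (Suc L). if absv a = 1 then h 1 a else 0)"
        proof (rule sum_isometry_reindex[OF zreps_rep_system])
          fix x y :: 'k assume xy: "x \<in> Zp" "y \<in> Zp"
          show "x * v \<in> Zp" using xy v True by (intro Zp_mult) (auto simp: Zp_iff unit_dv_0)
          show "dv (Suc L) (x * v - y * v) \<Longrightarrow> dv (Suc L) (x - y)"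
            using True by (simp add: left_diff_distrib[symmetric] dv_mult_unit_iff)
          show "(if absv x = 1 then h 1 x else 0) = (if absv y = 1 then h 1 y else 0)" if d: "dv (Suc L) (x - y)"
          proof -
            have "absv x = 1 \<longleftrightarrow> absv y = 1" using unit_cong[OF _ d] unit_cong[of y L x] d by (auto simp: dv_diff_commute)
            moreover have "h 1 x = h 1 y" if "absv x = 1"
              using L0[of x y] xy that dv_mono[OF d, of L0] L by (simp add: Zp_iff)
            ultimately show ?thesis by auto
          qed
        qed
        also have "\<dots> = ?S" by (simp only: sum_unit_reps)
        finally show ?thesis using f_one[OF v] True by simp
      next
        case False
        then show ?thesis using d1 f_one[OF v] by simp
      qed
    qed
    then have "?S * B f f = B (\<lambda>x u. C * (\<Sum>a\<in>unit_reps L. ?d a x u)) f" using B_scale[OF f_V f_V] by simp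
    also have "\<dots> = C * (\<Sum>a\<in>unit_reps L. B (?d a) f)"
      using B_scale[OF sumV f_V] B_sum[of "unit_reps L" ?d f, OF finite_unit_reps dV f_V] by simp
    also have "\<dots> = C * (of_nat (card (unit_reps L)) * B h f)" using Bd BW by simp
    finally show "(of_nat q ^ Suc L - of_nat q ^ L) * C * B h f = ?S * B f f" unfolding card_unit_reps by simp
  qed
qed

text \<open>By \<open>B_f\<close> every value \<open>B h f\<close> is a multiple of
  \<open>B f f\<close>; if that vanished, nondegeneracy would give f = 0.\<close>

lemma B_ff_nonzero: "B f f \<noteq> 0"
proof
  assume z: "B f f = 0"
  have *: "B h f = 0" if h: "h \<in> V" for h
  proof -
    obtain L where "(of_nat q ^ Suc L - of_nat q ^ L) * C * B h f = (\<Sum>a\<in>unit_reps L. h 1 a) * B f f"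
      using B_f[OF h] by blast
    then show ?thesis using z q_power_nonzero[of L] C_nonzero by simp
  qed
  have "B f h = 0" if "h \<in> V" for h using B_cnj[OF that f_V] *[OF that] by simp
  then have "f = (\<lambda>x u. 0)" by (intro B_nondegenerate f_V)
  then show False using f_nonzero by simp
qed

end

section \<open>Matrix coefficients of the newform\<close>

locale period_setup = newform_setup q T bar \<theta> \<mu> lam \<psi> m f B
    for q :: nat and T :: "'k::{field_char_0,complete_space} itself" and bar :: "'k \<Rightarrow> 'k" and \<theta> :: 'k
      and \<mu> :: "'k measure" and lam \<psi> :: "'k \<Rightarrow> complex" and m :: nat
      and f :: "'k \<Rightarrow> 'k \<Rightarrow> complex" and B +
  fixes u w :: 'k
  assumes u: "u \<in> Qp" "absv u = 1" and w: "w \<in> Qp" "absv w = 1" and uw: "u\<^sup>2 * \<theta>\<^sup>2 - 1 = w\<^sup>2"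
begin

lemma uw_Zp [simp]: "u \<in> Zp" "w \<in> Zp" "u \<in> Qp" "w \<in> Qp" "dv 0 u" "dv 0 w" "u \<noteq> 0" "w \<noteq> 0"
  using u w by (auto simp: Zp_iff unit_dv_0)

lemma absv_theta_sq [simp]: "absv (\<theta>\<^sup>2) = 1"
  by (simp add: absv_power)

text \<open>The image of p + r \<theta> under the embedding, as \<open>iota_eq\<close>
  confirms.\<close>

definition tmat :: "'k \<Rightarrow> 'k \<Rightarrow> 'k^2^2"
  where "tmat p r = mat2 (p - r * u * \<theta>\<^sup>2) (r * (1 - u\<^sup>2 * \<theta>\<^sup>2) / of_nat q ^ m)
    (of_nat q ^ m * r * \<theta>\<^sup>2) (p + r * u * \<theta>\<^sup>2)"

lemma tmat_det:
  "(p - r * u * \<theta>\<^sup>2) * (p + r * u * \<theta>\<^sup>2) - (r * (1 - u\<^sup>2 * \<theta>\<^sup>2) / of_nat q ^ m) * (of_nat q ^ m * r * \<theta>\<^sup>2)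
    = p\<^sup>2 - \<theta>\<^sup>2 * r\<^sup>2"
proof -
  have "(r * (1 - u\<^sup>2 * \<theta>\<^sup>2) / of_nat q ^ m) * (of_nat q ^ m * r * \<theta>\<^sup>2) = r * (1 - u\<^sup>2 * \<theta>\<^sup>2) * (r * \<theta>\<^sup>2)"
    by simp
  then show ?thesis by (simp add: algebra_simps power2_eq_square)
qed

lemma dv_normK_diff:
  assumes "dv 0 x" "dv 0 y" "dv e (x - y)"
  shows "dv e (N x - N y)"
proof -
  have "N x - N y = x * bar (x - y) + (x - y) * bar y" by (simp add: normK_def algebra_simps)
  then show ?thesis using dv_add[OF dv_mult_left[OF assms(1), of e "bar (x - y)"] dv_mult_right[OF assms(3), of "bar y"]] assms
    by (simp only: dv_bar)
qed

lemma dv_iff_cong: "dv e ((x::'k) - y) \<Longrightarrow> dv e x \<longleftrightarrow> dv e y"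
  using dv_add[of e "x - y" y] dv_diff[of e x "x - y"] by auto

lemma unit_iff_cong: "dv (Suc e) ((x::'k) - y) \<Longrightarrow> absv x = 1 \<longleftrightarrow> absv y = 1"
  using unit_cong[of x e y] unit_cong[of y e x] by (auto simp: dv_diff_commute)

lemma absv_sq_le: "absv (x::'k) ^ 2 \<le> (1 / real q ^ j) ^ 2 \<Longrightarrow> dv j x"
  unfolding dv_def by (rule power2_le_imp_le) auto

section \<open>The matrix coefficient at one unit p + r \<theta> with r of valuation j\<close>

context
  fixes p r :: 'k and j n :: nat
  assumes p: "p \<in> Zp" and r: "r \<in> Zp" and t1: "absv (p + r * \<theta>) = 1"
    and rj: "absv r = 1 / real q ^ j" and mnj: "m = n + j" "n \<ge> 1"
begin

private definition "a = p - r * u * \<theta>\<^sup>2"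
private definition "d = p + r * u * \<theta>\<^sup>2"
private definition "b = r * (1 - u\<^sup>2 * \<theta>\<^sup>2) / of_nat q ^ m"
private definition "c = of_nat q ^ m * r * \<theta>\<^sup>2"
private definition "D = p\<^sup>2 - \<theta>\<^sup>2 * r\<^sup>2"
private definition "t = p + r * \<theta>"
text \<open>The valuation of the lower left entry \<open>c\<close>, hence the level of all
  integrands. The phase at x = 1 is \<open>v * s y / c\<close>, so conditions modulo
  \<open>q^k\<close> on \<open>s y\<close> will appear.\<close>

private definition "k = m + j"
private definition "s y = a - Tr (bar y) + d / D * N y"
private definition "\<tau> = w\<^sup>2 * r\<^sup>2 * \<theta>\<^sup>2 / D"
private definition "S e = (\<Sum>y\<in>oreps k. if absv y = 1 \<and> dv e (s y) then 1 / lam y else 0)"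
private definition "g e z = (if absv (1 + z) = 1 \<and> dv e (N z - \<tau>) then 1 / lam (1 + z) else 0)"

private lemma Qs: "p \<in> Qp" "r \<in> Qp" "a \<in> Qp" "b \<in> Qp" "c \<in> Qp" "d \<in> Qp" "D \<in> Qp"
  using p r u by (auto simp: Zp_iff a_def b_def c_def d_def D_def intro!: Qp_intros theta_sq_Qp)

private lemma det_eq: "a * d - b * c = D"
  unfolding a_def b_def c_def d_def D_def by (rule tmat_det)

private lemma Nt: "N t = D"
  using Qs by (simp add: t_def normK_Qp_theta D_def)

private lemma D1: "absv D = 1" "D \<noteq> 0"
proof -
  show "absv D = 1" unfolding Nt[symmetric] absv_normK using t1 by (simp add: t_def)
  then show "D \<noteq> 0" by auto
qed

private lemma Zs: "a \<in> Zp" "d \<in> Zp" "dv 0 a" "dv 0 d" "dv 0 D"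
proof -
  show "a \<in> Zp" unfolding a_def using p r by (intro Zp_intros uw_Zp)
  show "d \<in> Zp" unfolding d_def using p r by (intro Zp_intros uw_Zp)
  then show "dv 0 d" by (simp add: Zp_iff)
  show "dv 0 a" using \<open>a \<in> Zp\<close> by (simp add: Zp_iff)
  show "dv 0 D" using D1 by (simp add: unit_dv_0)
qed

text \<open>a + d = 2 p and d - a = 2 r u \<theta>^2, so if q divided both, it would divide p and r
  and then the unit p + r \<theta>. This feeds the case distinction in \<open>S_g\<close>.\<close>

private lemma ad_unit: "absv a = 1 \<or> absv d = 1"
proof (rule ccontr)
  assume "\<not> (absv a = 1 \<or> absv d = 1)"
  then have ad: "dv 1 a" "dv 1 d" using Zs absv_eq_1_or_dv by auto
  have "2 * p = a + d" by (simp add: a_def d_def)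
  then have "dv 1 (2 * p)" using dv_add[OF ad] by (simp only:)
  then have p1: "dv 1 p" by (simp add: dv_mult_unit_iff)
  have "(2 * (u * \<theta>\<^sup>2)) * r = d - a" by (simp add: a_def d_def)
  then have "dv 1 ((2 * (u * \<theta>\<^sup>2)) * r)" using dv_diff[OF ad(2,1)] by (simp only:)
  then have "dv 1 r" using u by (simp add: dv_mult_unit_iff absv_mult)
  then have "dv 1 (p + r * \<theta>)" using p1 by (intro dv_add dv_mult_right) auto
  then show False using t1 unit_iff by blast
qed

private lemma c_abs: "absv c = 1 / real q ^ k" "c \<noteq> 0"
proof -
  show "absv c = 1 / real q ^ k" by (simp add: c_def absv_mult absv_p_power rj k_def power_add)
  then have "absv c > 0" by simp
  then show "c \<noteq> 0" by simp
qed

private lemma k_Suc: "k = Suc (m1 + j)" "m \<le> k" "1 \<le> k"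
  using m_eq by (auto simp: k_def)

private lemma s_Qp: "s y \<in> Qp"
  unfolding s_def using Qs by (intro Qp_intros normK_Qp traceK_Qp)

private lemma s_cong: "dv 0 x \<Longrightarrow> dv 0 y \<Longrightarrow> dv e (x - y) \<Longrightarrow> dv e (s x - s y)"
proof -
  assume h: "dv 0 x" "dv 0 y" "dv e (x - y)"
  have "s x - s y = - Tr (bar (x - y)) + d / D * (N x - N y)"
    by (simp only: s_def traceK_def right_diff_distrib bar_diff bar_bar) simp
  moreover have "dv 0 (d / D)" using Zs D1 by (simp add: dv_divide_unit_iff)
  then have "dv e (d / D * (N x - N y))" by (rule dv_mult_left[OF _ dv_normK_diff[OF h]])
  moreover have "dv e (- Tr (bar (x - y)))" unfolding dv_minus_iff using h by (intro dv_traceK) (simp only: dv_bar)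
  ultimately show ?thesis using dv_add by (simp only:)
qed

private lemma s_dv: "dv 0 y \<Longrightarrow> dv 0 (s y)"
proof -
  assume y: "dv 0 y"
  have "dv 0 (s y - s 0)" using y by (intro s_cong) auto
  moreover have "s 0 = a" by (simp add: s_def traceK_def normK_def)
  ultimately show ?thesis using Zs dv_iff_cong by simp
qed

private definition "F y = (if absv y = 1 then C / lam y else 0)"

private lemma f_F: 
  assumes "v \<in> Qp" "absv v = 1"
  shows "f y (v / D) = F y"
proof (cases "y = 0")
  case True
  then show ?thesis using V_0[OF f_V] by (simp add: F_def)
next
  case False
  have vD: "v / D \<in> Qp - {0}" using assms Qs D1 by (auto intro!: Qp_intros)
  have "absv (N y * (v / D)) = (absv y)\<^sup>2" using assms D1 by (simp add: absv_mult absv_divide)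
  moreover have "(absv y)\<^sup>2 = 1 \<longleftrightarrow> absv y = 1" using power2_eq_iff_nonneg[of "absv y" 1] by simp
  ultimately show ?thesis unfolding f_explicit[OF False vD] F_def by simp
qed

private lemma step_F: "step_function k 0 F"
  unfolding step_function_def
proof (intro conjI allI impI)
  fix x y assume d: "dv k (x - y)"
  have "absv x = 1 \<longleftrightarrow> absv y = 1" using d unit_iff_cong[of "m1 + j" x y] unfolding k_Suc(1) by simp
  moreover have "lam x = lam y" if "absv x = 1" using lam_cong[OF that dv_mono[OF d k_Suc(2)]] .
  ultimately show "F x = F y" by (auto simp: F_def)
next
  fix x assume "F x \<noteq> 0"
  then show "dv 0 (of_nat q ^ 0 * x)" by (auto simp: F_def unit_dv_0 split: if_splits)
qed

private lemma step_psi_F: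
  assumes v: "v \<in> Qp" "absv v = 1"
  shows "step_function k 0 (\<lambda>y. \<psi> (v * (s y / c)) * F y)"
proof (rule step_function_mult_if[OF step_F])
  fix x y assume x: "F x \<noteq> 0" and d: "dv k (x - y)"
  have x1: "dv 0 x" using x by (auto simp: F_def unit_dv_0 split: if_splits)
  have y1: "dv 0 y" using dv_iff_cong[OF dv_mono[OF d, of 0]] x1 by simp
  have "dv k (s x - s y)" by (rule s_cong[OF x1 y1 d])
  moreover have eq: "v * (s x / c) - v * (s y / c) = v * ((s x - s y) / c)"
    by (simp only: right_diff_distrib diff_divide_distrib)
  ultimately have "dv 0 (v * (s x / c) - v * (s y / c))"
    unfolding eq dv_def absv_mult absv_divide c_abs(1) v(2) by (simp add: field_simps)
  moreover have "v * (s x / c) \<in> Qp" "v * (s y / c) \<in> Qp" using v Qs s_Qp by (blast intro: Qp_intros)+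
  ultimately show "\<psi> (v * (s x / c)) = \<psi> (v * (s y / c))" by (intro psi_cong)
qed

private lemma weil_at_one:
  assumes v: "v \<in> Qp" "absv v = 1"
  shows "weil (tmat p r) f 1 v = (-1) ^ k / of_nat q ^ k * (\<Sum>y\<in>oreps k. \<psi> (v * (s y / c)) * F y)"
proof -
  have v0: "v \<in> Qp - {0}" using v by auto
  have tm: "tmat p r = mat2 a b c d" by (simp add: tmat_def a_def b_def c_def d_def)
  have "dv j r" using rj by (simp add: dv_def)
  then obtain r' where r': "dv 0 r'" "r = of_nat q ^ j * r'" by (rule dvE)
  have r'1: "absv r' = 1" using rj r'(2) by (simp add: absv_mult absv_p_power)
  have r'Q: "r' \<in> Qp" using r'(2) Qs(2) Qp_divide[of r "of_nat q ^ j"] by (auto intro: Qp_intros)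
  have c_eq: "c = of_nat q ^ m * (of_nat q ^ j * r') * \<theta>\<^sup>2" by (simp only: c_def r'(2)[symmetric])
  have "c * v = of_nat q ^ k * (r' * \<theta>\<^sup>2 * v)" unfolding c_eq by (simp add: k_def power_add)
  moreover have "r' * \<theta>\<^sup>2 * v \<in> Qp" using r'Q v by (intro Qp_intros theta_sq_Qp)
  moreover have "absv (r' * \<theta>\<^sup>2 * v) = 1" using r'1 v by (simp add: absv_mult)
  ultimately have "lam (c * v) = (-1) ^ k"
    using lam_Qp_unit[of "r' * \<theta>\<^sup>2 * v"] unit_nonzero[of "r' * \<theta>\<^sup>2 * v"] by (simp add: lam_mult lam_power lam_q mult.assoc)
  moreover have "c * v \<in> Qp - {0}" using v0 Qs c_abs by (auto intro!: Qp_intros)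
  ultimately have eta: "eta bar (c * v) = (-1) ^ k" using lam_eta by simp
  have arg: "v * (a * N 1 - Tr (1 * bar y) + d / D * N y) / c = v * (s y / c)" for y by (simp add: s_def normK_def)
  have "weil (tmat p r) f 1 v = (-1) ^ k * of_real (real q ^ k) * (\<integral>y. \<psi> (v * (s y / c)) * F y \<partial>\<mu>)"
    unfolding tm weil_lower[OF c_abs(2) v0] det_eq f_F[OF v] eta arg using v(2) c_abs(1) D1(1) by simp
  also have "\<dots> = (-1) ^ k * of_real (real q ^ k) * ((\<Sum>y\<in>oreps k. \<psi> (v * (s y / c)) * F y) / of_nat q ^ (2 * k))"
    unfolding integral_step_oreps[OF step_psi_F[OF v]] ..
  also have "\<dots> = (-1) ^ k / of_nat q ^ k * (\<Sum>y\<in>oreps k. \<psi> (v * (s y / c)) * F y)"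
    by (simp add: mult_2 power_add)
  finally show ?thesis .
qed

text \<open>The mean over units v prescribed by \<open>B_f\<close> is again a Ramanujan sum in the
  phase \<open>v * s y / c\<close>; it leaves the conditions that \<open>q^k\<close>, respectively
  \<open>q^(k-1)\<close>, divides \<open>s y\<close>, where k - 1 = m1 + j.\<close>

private lemma B_S:
  "(of_nat q - 1) * B (weil (tmat p r) f) f = (-1) ^ k / of_nat q ^ k * (of_nat q * S k - S (m1 + j)) * B f f"
proof -
  have tm: "tmat p r = mat2 a b c d" by (simp add: tmat_def a_def b_def c_def d_def)
  have hV: "weil (tmat p r) f \<in> V"
    unfolding tm using Qs c_abs D1 det_eq by (intro weil_in_V f_V) auto
  obtain L0 where L0: "\<And>L. L \<ge> L0 \<Longrightarrow> (of_nat q ^ Suc L - of_nat q ^ L) * C * B (weil (tmat p r) f) f =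
      (\<Sum>a\<in>unit_reps L. weil (tmat p r) f 1 a) * B f f"
    using B_f[OF hV] by blast
  define L where "L = max L0 k"
  have inner: "(\<Sum>v\<in>unit_reps L. \<psi> (v * (s y / c))) * F y =
      C * (of_nat q ^ Suc L * (if absv y = 1 \<and> dv k (s y) then 1 / lam y else 0)
        - of_nat q ^ L * (if absv y = 1 \<and> dv (m1 + j) (s y) then 1 / lam y else 0))" if "y \<in> oreps k" for y
  proof -
    have sQ: "s y / c \<in> Qp" using s_Qp Qs by (intro Qp_intros)
    have 1: "dv 0 (s y / c) \<longleftrightarrow> dv k (s y)" by (simp add: dv_def absv_divide c_abs divide_simps)
    have 2: "dv 0 (of_nat q * (s y / c)) \<longleftrightarrow> dv (m1 + j) (s y)"
      by (simp add: dv_def absv_divide absv_mult absv_p c_abs k_Suc(1) divide_simps)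
    have "dv 0 (s y)" using s_dv[OF oreps_OK[OF that]] .
    then have "dv 0 (of_nat q ^ (Suc L - k) * s y)" by (intro dv_mult_left) auto
    moreover have "absv (of_nat q ^ (Suc L - k) * s y) = absv (of_nat q ^ Suc L * (s y / c))"
      using power_diff[of "real q" k "Suc L"] by (simp add: absv_mult absv_divide absv_p_power c_abs L_def del: power_Suc)
    ultimately have 3: "dv 0 (of_nat q ^ Suc L * (s y / c))" by (simp only: dv_def)
    show ?thesis unfolding sum_unit_reps psi_unit_sum[OF sQ 3] 1 2 by (auto simp: F_def algebra_simps)
  qed
  have "(\<Sum>v\<in>unit_reps L. weil (tmat p r) f 1 v) =
      (\<Sum>v\<in>unit_reps L. (-1) ^ k / of_nat q ^ k * (\<Sum>y\<in>oreps k. \<psi> (v * (s y / c)) * F y))"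
    using unit_repsD by (intro sum.cong refl weil_at_one) blast+
  also have "\<dots> = (-1) ^ k / of_nat q ^ k * (\<Sum>y\<in>oreps k. (\<Sum>v\<in>unit_reps L. \<psi> (v * (s y / c))) * F y)"
    unfolding sum_distrib_left[symmetric] sum_distrib_right by (subst sum.swap) (rule refl)
  also have "(\<Sum>y\<in>oreps k. (\<Sum>v\<in>unit_reps L. \<psi> (v * (s y / c))) * F y) =
      C * (of_nat q ^ Suc L * S k - of_nat q ^ L * S (m1 + j))"
    unfolding S_def sum_distrib_left right_diff_distrib sum_subtractf[symmetric]
    using inner by (intro sum.cong refl) (simp only: right_diff_distrib)
  finally have "(of_nat q ^ Suc L - of_nat q ^ L) * C * B (weil (tmat p r) f) f =
      ((-1) ^ k / of_nat q ^ k * (C * (of_nat q ^ Suc L * S k - of_nat q ^ L * S (m1 + j)))) * B f f"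
    using L0[of L] by (simp add: L_def)
  then have "(of_nat q ^ L * C) * ((of_nat q - 1) * B (weil (tmat p r) f) f) =
      (of_nat q ^ L * C) * ((-1) ^ k / of_nat q ^ k * (of_nat q * S k - S (m1 + j)) * B f f)"
    by (simp add: algebra_simps)
  moreover have "of_nat q ^ L * C \<noteq> 0" using C_nonzero by simp
  ultimately show ?thesis by (simp only: mult_cancel_left) simp
qed

private lemma tau_eq: "\<tau> = 1 - a * d / D"
proof -
  have "b * c = r * (1 - u\<^sup>2 * \<theta>\<^sup>2) * (r * \<theta>\<^sup>2)" by (simp add: b_def c_def)
  also have "1 - u\<^sup>2 * \<theta>\<^sup>2 = - w\<^sup>2" using uw by (simp add: algebra_simps)
  finally have "b * c = - (w\<^sup>2 * r\<^sup>2 * \<theta>\<^sup>2)" by (simp add: power2_eq_square algebra_simps)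
  then have "w\<^sup>2 * r\<^sup>2 * \<theta>\<^sup>2 = D - a * d" using det_eq by (simp add: algebra_simps)
  then show ?thesis unfolding \<tau>_def using D1 by (simp add: diff_divide_distrib)
qed

private lemma N_one_plus: "N (1 + z) = 1 + Tr z + N z" and Tr_one_plus: "Tr (1 + z) = 2 + Tr z"
  and Tr_bar: "Tr (bar z) = Tr z" and N_bar: "N (bar z) = N z"
  by (simp_all add: normK_def traceK_def algebra_simps)

text \<open>Completes the square. If d is a unit, y = (D/d) (1 + z) does it; otherwise a is a unit
  and y = a / (1 + bar z) does. Both turn \<open>s y\<close> into a unit times
  \<open>N z - \<tau>\<close>, and \<open>lam y = lam (1 + z)\<close>, in the second case because
  \<open>lam\<close> inverts under conjugation.\<close>

private lemma S_g:
  assumes e: "e \<le> k"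
  shows "S e = (\<Sum>z\<in>oreps k. g e z)"
proof -
  let ?G = "\<lambda>y. if absv y = 1 \<and> dv e (s y) then 1 / lam y else 0"
  have Gc: "?G x = ?G y" if "x \<in> OK" "y \<in> OK" "dv k (x - y)" for x y
  proof -
    have "absv x = 1 \<longleftrightarrow> absv y = 1" using that(3) unit_iff_cong[of "m1 + j" x y] unfolding k_Suc(1) by simp
    moreover have "dv e (s x) \<longleftrightarrow> dv e (s y)" using that by (intro dv_iff_cong s_cong dv_mono[OF that(3) e]) auto
    moreover have "lam x = lam y" if "absv x = 1" using lam_cong[OF that dv_mono[OF \<open>dv k (x - y)\<close> k_Suc(2)]] .
    ultimately show ?thesis by auto
  qed
  show ?thesis
  proof (cases "absv d = 1")
    case True
    have d0: "d \<noteq> 0" using True by auto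
    have Dd: "D / d \<in> Qp" "absv (D / d) = 1" using Qs D1 True by (auto simp: absv_divide intro!: Qp_intros)
    have ND: "N (D / d) = (D / d)\<^sup>2" unfolding normK_def bar_Qp[OF Dd(1)] power2_eq_square ..
    have "(\<Sum>z\<in>oreps k. ?G (D / d * (1 + z))) = (\<Sum>y\<in>oreps k. ?G y)"
    proof (rule sum_isometry_reindex[OF oreps_rep_system _ _ Gc])
      fix x y assume "x \<in> OK" "y \<in> OK"
      then show "D / d * (1 + x) \<in> OK" 
        using dv_mult_left[OF unit_dv_0[OF Dd(2)] dv_add[OF dv_one, of x]] by simp
      have "D / d * (1 + x) - D / d * (1 + y) = D / d * (x - y)" by (simp only: distrib_left right_diff_distrib add_diff_cancel_left)
      then show "dv k (D / d * (1 + x) - D / d * (1 + y)) \<Longrightarrow> dv k (x - y)"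
        using Dd(2) by (simp only: dv_mult_unit_iff)
    qed
    moreover have "?G (D / d * (1 + z)) = g e z" for z
    proof -
      have "Tr (bar (D / d * (1 + z))) = D / d * (2 + Tr z)"
        unfolding Tr_bar traceK_Qp_mult[OF Dd(1)] Tr_one_plus ..
      moreover have "N (D / d * (1 + z)) = (D / d)\<^sup>2 * (1 + Tr z + N z)"
        unfolding normK_mult N_one_plus ND ..
      ultimately have "s (D / d * (1 + z)) = D / d * (N z - \<tau>)"
        unfolding s_def tau_eq using D1 d0 by (simp add: field_simps power2_eq_square)
      then have 1: "dv e (s (D / d * (1 + z))) \<longleftrightarrow> dv e (N z - \<tau>)" using Dd(2) by (simp only: dv_mult_unit_iff)
      have 2: "absv (D / d * (1 + z)) = absv (1 + z)" using Dd(2) by (simp only: absv_mult mult_1)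
      have "lam (D / d * (1 + z)) = lam (1 + z)" if "absv (1 + z) = 1"
        using lam_Qp_unit[OF Dd] unit_nonzero[OF that] unit_nonzero[OF Dd(2)] lam_mult[of "D / d" "1 + z"] by simp
      then show ?thesis unfolding g_def 1 2 by auto
    qed
    ultimately show ?thesis unfolding S_def by (simp only:)
  next
    case False
    then have a1: "absv a = 1" using ad_unit by blast
    have a0: "a \<noteq> 0" using a1 by auto
    \<comment> \<open>The value 1 + z off the units only serves to make the map an isometry of all
      integers; both summands vanish there.\<close>
    let ?\<sigma> = "\<lambda>z. if absv (1 + z) = 1 then a / (1 + bar z) else 1 + z"
    have bu: "absv (1 + bar z) = absv (1 + z)" for z using absv_bar[of "1 + z"] by simp
    have s1: "absv (?\<sigma> z) = 1 \<longleftrightarrow> absv (1 + z) = 1" for z using a1 bu[of z] by (auto simp: absv_divide)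
    have "(\<Sum>z\<in>oreps k. ?G (?\<sigma> z)) = (\<Sum>y\<in>oreps k. ?G y)"
    proof (rule sum_isometry_reindex[OF oreps_rep_system _ _ Gc])
      fix x y assume xy: "x \<in> OK" "y \<in> OK"
      show "?\<sigma> x \<in> OK" using xy s1[of x] by (auto simp: unit_dv_0 dv_add)
      assume h: "dv k (?\<sigma> x - ?\<sigma> y)"
      have i: "absv (1 + x) = 1 \<longleftrightarrow> absv (1 + y) = 1"
        using h unit_iff_cong[of "m1 + j" "?\<sigma> x" "?\<sigma> y"] s1[of x] s1[of y] unfolding k_Suc(1) by simp
      show "dv k (x - y)"
      proof (cases "absv (1 + x) = 1")
        case True
        then have xu: "absv (1 + bar x) = 1" "absv (1 + bar y) = 1" using bu i by simp_all
        then have "1 + bar x \<noteq> 0" "1 + bar y \<noteq> 0" by auto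
        then have "a / (1 + bar x) - a / (1 + bar y) = a / ((1 + bar x) * (1 + bar y)) * bar (y - x)"
          by (simp add: field_simps)
        then have "dv k (a / ((1 + bar x) * (1 + bar y)) * bar (y - x))" using h True i by simp
        moreover have "absv (a / ((1 + bar x) * (1 + bar y))) = 1" using a1 xu by (simp add: absv_divide absv_mult)
        ultimately have "dv k (bar (y - x))" by (simp only: dv_mult_unit_iff)
        then show ?thesis by (simp only: dv_bar dv_diff_commute)
      next
        case False
        then show ?thesis using h i by simp
      qed
    qed
    moreover have "?G (?\<sigma> z) = g e z" for z
    proof (cases "absv (1 + z) = 1")
      case False
      then show ?thesis using s1[of z] by (simp add: g_def)
    next
      case True
      define Y where "Y = 1 + bar z"
      have Y1: "absv Y = 1" using True bu by (simp add: Y_def)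
      have Y0: "Y \<noteq> 0" "bar Y \<noteq> 0" using Y1 by auto
      have NY: "N Y = 1 + Tr z + N z" unfolding Y_def N_one_plus Tr_bar N_bar ..
      have NY0: "1 + Tr z + N z \<noteq> 0" unfolding NY[symmetric] using Y0 by simp
      have NY1: "absv (1 + Tr z + N z) = 1" unfolding NY[symmetric] using Y1 by simp
      have "Tr (1 / Y) = Tr Y / N Y" using Y0 by (simp add: traceK_def normK_def field_simps)
      then have "Tr (bar (a / Y)) = a * ((2 + Tr z) / (1 + Tr z + N z))"
        using traceK_Qp_mult[OF Qs(3), of "1 / Y"] unfolding Tr_bar NY by (simp add: Y_def Tr_one_plus Tr_bar)
      moreover have "N (a / Y) = a\<^sup>2 / (1 + Tr z + N z)"
        unfolding NY[symmetric] using Qs(3) by (simp add: normK_def bar_Qp power2_eq_square)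
      ultimately have "s (a / Y) = a / (1 + Tr z + N z) * (N z - \<tau>)"
        unfolding s_def tau_eq using D1 NY0 by (simp add: divide_simps) (simp add: algebra_simps power2_eq_square)
      moreover have "absv (a / (1 + Tr z + N z)) = 1" using a1 NY1 by (simp add: absv_divide)
      ultimately have 1: "dv e (s (a / Y)) \<longleftrightarrow> dv e (N z - \<tau>)" by (simp only: dv_mult_unit_iff)
      have "lam (a / Y) = 1 / lam Y" using lam_Qp_unit[OF Qs(3) a1] a0 Y0 by (simp add: lam_divide)
      also have "lam Y = inverse (lam (1 + z))" using lam_bar(1)[OF True] by (simp add: Y_def)
      finally have 2: "lam (a / Y) = lam (1 + z)" by (simp add: inverse_eq_divide)
      have 3: "absv (a / Y) = 1" using a1 Y1 by (simp add: absv_divide)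
      show ?thesis using True by (simp add: g_def 1 2 3 Y_def[symmetric])
    qed
    ultimately show ?thesis unfolding S_def by (simp only:)
  qed
qed

text \<open>Its norm is - r^2 \<theta>^2 / D, so
  \<open>N (\<kappa> * z) - \<tau> = N \<kappa> * (N z + w^2)\<close>: scaling by \<kappa> removes r
  and t from the condition. Also 1 + \<kappa> z = (t + z r \<theta>) / t.\<close>

private definition "\<kappa> = r * \<theta> / t"
private definition "g' e z = (if absv (1 + \<kappa> * z) = 1 \<and> dv e (N z + w\<^sup>2) then 1 / lam (1 + \<kappa> * z) else 0)"

private lemma kappa: "absv \<kappa> = 1 / real q ^ j" "\<kappa> \<noteq> 0"
proof -
  show 1: "absv \<kappa> = 1 / real q ^ j" using t1 by (simp add: \<kappa>_def t_def absv_divide absv_mult rj)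
  have "absv \<kappa> > 0" unfolding 1 by simp
  then show "\<kappa> \<noteq> 0" by simp
qed

private lemma dv_kappa: "dv (j + e) (\<kappa> * x) \<longleftrightarrow> dv e x"
  by (simp add: dv_def absv_mult kappa power_add field_simps)

private lemma g_kappa: "g (e + 2 * j) (\<kappa> * z) = g' e z"
proof -
  have Nk: "N \<kappa> = - (r\<^sup>2 * \<theta>\<^sup>2) / D"
    using Qs(2) Nt by (simp add: \<kappa>_def normK_def bar_Qp power2_eq_square)
  have "N (\<kappa> * z) - \<tau> = N \<kappa> * (N z + w\<^sup>2)"
    unfolding normK_mult Nk \<tau>_def by (simp add: algebra_simps add_divide_distrib diff_divide_distrib)
  moreover have "dv (e + 2 * j) (N \<kappa> * x) \<longleftrightarrow> dv e x" for x
  proof -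
    have "dv (e + 2 * j) (N \<kappa> * x) \<longleftrightarrow>
        absv x * (1 / real q ^ j * (1 / real q ^ j)) \<le> 1 / real q ^ e * (1 / real q ^ j * (1 / real q ^ j))"
      by (simp add: dv_def absv_mult kappa power_add mult_2 power2_eq_square)
    also have "\<dots> \<longleftrightarrow> absv x \<le> 1 / real q ^ e" by (rule mult_le_cancel_right_pos) simp
    finally show ?thesis by (simp only: dv_def)
  qed
  ultimately show ?thesis by (simp add: g_def g'_def)
qed

private lemma S_g':
  assumes e: "e + 2 * j \<le> k"
  shows "S (e + 2 * j) = (\<Sum>z\<in>oreps m. g' e z)"
proof -
  have tau1: "absv \<tau> = (1 / real q ^ j)\<^sup>2"
    by (simp add: \<tau>_def absv_divide absv_mult absv_power D1 w rj)
  then have tau2: "dv (2 * j) \<tau>" by (simp add: dv_def power_divide power_mult[symmetric] mult.commute)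
  have "(\<Sum>z\<in>oreps (j + m). g (e + 2 * j) z) = (\<Sum>z\<in>oreps m. g (e + 2 * j) (\<kappa> * z))"
  proof (rule sum_oreps_scale[OF kappa(1)])
    fix x y :: 'k assume xy: "dv 0 x" "dv 0 y" "dv (j + m) (x - y)"
    have d: "dv k (x - y)" using xy(3) by (simp add: k_def add.commute)
    have d1: "(1 + x) - (1 + y) = x - y" by simp
    have "absv (1 + x) = 1 \<longleftrightarrow> absv (1 + y) = 1"
      using d unit_iff_cong[of "m1 + j" "1 + x" "1 + y"] unfolding k_Suc(1) d1 by blast
    moreover have "(N x - \<tau>) - (N y - \<tau>) = N x - N y" by simp
    then have "dv (e + 2 * j) (N x - \<tau>) \<longleftrightarrow> dv (e + 2 * j) (N y - \<tau>)"
      using dv_normK_diff[OF xy(1,2) dv_mono[OF d e]] dv_iff_cong by metis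
    moreover have "lam (1 + x) = lam (1 + y)" if "absv (1 + x) = 1"
      using that dv_mono[OF d k_Suc(2)] by (intro lam_cong) (simp_all add: d1)
    ultimately show "g (e + 2 * j) x = g (e + 2 * j) y" by (auto simp: g_def)
  next
    fix x assume "dv 0 x" "g (e + 2 * j) x \<noteq> 0"
    then have "dv (e + 2 * j) (N x - \<tau>)" by (auto simp: g_def split: if_splits)
    then have "dv (2 * j) (N x)" using tau2 dv_iff_cong[of "2 * j" "N x" \<tau>] dv_mono[of "e + 2 * j" _ "2 * j"] by simp
    then have "absv x ^ 2 \<le> (1 / real q ^ j) ^ 2" by (simp add: dv_def power_divide power_mult[symmetric] mult.commute)
    then show "dv j x" by (rule absv_sq_le)
  qed
  then show ?thesis unfolding S_g[OF e] g_kappa by (simp add: k_def add.commute)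
qed

text \<open>A substitution in z multiplies 1 + \<kappa> z by a unit \<epsilon> with
  \<open>lam \<epsilon>\<close> different from 1, hence the sum by the inverse of that value. It
  moves z by multiples of \<open>q^(n-1)\<close> only, which the condition modulo
  \<open>q^(n-1)\<close> does not notice; the condition modulo \<open>q^n\<close> in
  \<open>S k\<close> would.\<close>

private lemma S_small: "S (m1 + j) = 0"
proof -
  obtain n1 where n1: "n = Suc n1" using mnj(2) by (cases n) auto
  have m1: "m1 = n1 + j" using mnj(1) m_eq(1) n1 by simp
  obtain y0 where y0: "dv 0 y0" "lam (1 + of_nat q ^ m1 * y0) \<noteq> 1" using lam_conductor_exact by blast
  define \<epsilon> where "\<epsilon> = 1 + of_nat q ^ m1 * y0"
  have \<epsilon>: "absv \<epsilon> = 1" unfolding \<epsilon>_def by (rule unit_one_plus_m1[OF y0(1)])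
  \<comment> \<open>Found by solving 1 + \<kappa> z' = (1 + \<kappa> z) (1 + q^m1 y0) for
    z'.\<close>
  let ?\<sigma> = "\<lambda>z. z + of_nat q ^ m1 * y0 * (1 + \<kappa> * z) / \<kappa>"
  have kz: "1 + \<kappa> * ?\<sigma> z = (1 + \<kappa> * z) * \<epsilon>" for z using kappa(2) by (simp add: \<epsilon>_def field_simps)
  have k0: "dv 0 (\<kappa> * z)" if "dv 0 z" for z using dv_kappa[of 0 z] that dv_mono[of j _ 0] by simp
  have sd: "dv n1 (?\<sigma> z - z)" if "dv 0 z" for z
  proof -
    have "dv m1 (of_nat q ^ m1 * y0 * (1 + \<kappa> * z))"
      by (rule dv_mult_right[OF dv_m1[OF y0(1)] dv_add[OF dv_one k0[OF that]]])
    moreover have "of_nat q ^ m1 * y0 * (1 + \<kappa> * z) = \<kappa> * (?\<sigma> z - z)" using kappa(2) by simp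
    ultimately have "dv m1 (\<kappa> * (?\<sigma> z - z))" by (simp only:)
    then have "dv (j + n1) (\<kappa> * (?\<sigma> z - z))" using m1 by (metis add.commute)
    then show ?thesis by (simp only: dv_kappa)
  qed
  have sO: "dv 0 (?\<sigma> z)" if "dv 0 z" for z
    using dv_add[OF dv_mono[OF sd[OF that], of 0] that] by (simp add: add.commute)
  have "(\<Sum>z\<in>oreps m. g' n1 (?\<sigma> z)) = (\<Sum>z\<in>oreps m. g' n1 z)"
  proof (rule sum_isometry_reindex[OF oreps_rep_system])
    fix x y assume xy: "x \<in> OK" "y \<in> OK"
    show "?\<sigma> x \<in> OK" using sO xy by simp
    have "?\<sigma> x - ?\<sigma> y = (x - y) * \<epsilon>" using kappa(2) by (simp add: \<epsilon>_def field_simps)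
    then show "dv m (?\<sigma> x - ?\<sigma> y) \<Longrightarrow> dv m (x - y)" using \<epsilon> by (simp add: dv_mult_unit_iff)
    assume d: "dv m (x - y)"
    have "(1 + \<kappa> * x) - (1 + \<kappa> * y) = \<kappa> * (x - y)" by (simp add: algebra_simps)
    moreover have "dv (j + m) (\<kappa> * (x - y))" using d dv_kappa by blast
    ultimately have d': "dv m ((1 + \<kappa> * x) - (1 + \<kappa> * y))" using dv_mono[of "j + m" _ m] by simp
    have "absv (1 + \<kappa> * x) = 1 \<longleftrightarrow> absv (1 + \<kappa> * y) = 1"
      using unit_iff_cong[of m1] d' m_eq(1) by metis
    moreover have "(N x + w\<^sup>2) - (N y + w\<^sup>2) = N x - N y" by simp
    then have "dv n1 (N x + w\<^sup>2) \<longleftrightarrow> dv n1 (N y + w\<^sup>2)"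
      using dv_normK_diff[OF _ _ dv_mono[OF d, of n1]] xy mnj n1 dv_iff_cong[of n1 "N x + w\<^sup>2" "N y + w\<^sup>2"] by simp
    moreover have "lam (1 + \<kappa> * x) = lam (1 + \<kappa> * y)" if "absv (1 + \<kappa> * x) = 1" by (rule lam_cong[OF that d'])
    ultimately show "g' n1 x = g' n1 y" by (auto simp: g'_def)
  qed
  moreover have "g' n1 (?\<sigma> z) = g' n1 z / lam \<epsilon>" if z: "z \<in> oreps m" for z
  proof -
    have z0: "dv 0 z" using oreps_OK[OF z] .
    have "dv n1 (N (?\<sigma> z) + w\<^sup>2) \<longleftrightarrow> dv n1 (N z + w\<^sup>2)"
    proof (rule dv_iff_cong)
      have "(N (?\<sigma> z) + w\<^sup>2) - (N z + w\<^sup>2) = N (?\<sigma> z) - N z" by simp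
      then show "dv n1 ((N (?\<sigma> z) + w\<^sup>2) - (N z + w\<^sup>2))" using dv_normK_diff[OF sO[OF z0] z0 sd[OF z0]] by (simp only:)
    qed
    moreover have "absv (1 + \<kappa> * ?\<sigma> z) = absv (1 + \<kappa> * z)" unfolding kz using \<epsilon> by (simp add: absv_mult)
    moreover have "lam (1 + \<kappa> * ?\<sigma> z) = lam (1 + \<kappa> * z) * lam \<epsilon>" if "absv (1 + \<kappa> * z) = 1"
      unfolding kz using unit_nonzero[OF that] unit_nonzero[OF \<epsilon>] by (rule lam_mult)
    ultimately show ?thesis unfolding g'_def by (auto simp: divide_simps)
  qed
  ultimately have "(\<Sum>z\<in>oreps m. g' n1 z / lam \<epsilon>) = (\<Sum>z\<in>oreps m. g' n1 z)" by simp
  then have "(\<Sum>z\<in>oreps m. g' n1 z) / lam \<epsilon> = (\<Sum>z\<in>oreps m. g' n1 z)" by (simp only: sum_divide_distrib)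
  moreover have "lam \<epsilon> \<noteq> 1" "lam \<epsilon> \<noteq> 0" using y0(2) lam_nonzero[OF unit_nonzero[OF \<epsilon>]] by (auto simp: \<epsilon>_def)
  ultimately have "(\<Sum>z\<in>oreps m. g' n1 z) = 0" by (auto simp: divide_simps)
  moreover have "m1 + j = n1 + 2 * j" using m1 by arith
  moreover have "n1 + 2 * j \<le> k" unfolding k_def using m1 m_eq(1) by arith
  ultimately show ?thesis using S_g'[of n1] by metis
qed

text \<open>Since \<kappa> has valuation j, the summand depends on z modulo \<open>q^n\<close> only,
  and passing from level m to level n costs the factor q^(2j).\<close>

private lemma S_large: "S k = of_nat q ^ (2 * j) * (\<Sum>z\<in>oreps n. g' n z)"
proof -
  have "k = n + 2 * j" unfolding k_def using mnj(1) by arith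
  then have "S k = (\<Sum>z\<in>oreps m. g' n z)" using S_g'[of n] by simp
  also have "\<dots> = of_nat q ^ (2 * j) * (\<Sum>z\<in>oreps n. g' n z)"
    unfolding mnj(1)
  proof (rule sum_oreps_level)
    fix x y assume xy: "dv 0 x" "dv 0 y" and d: "dv n (x - y)"
    have "(1 + \<kappa> * x) - (1 + \<kappa> * y) = \<kappa> * (x - y)" by (simp add: algebra_simps)
    moreover have "dv (j + n) (\<kappa> * (x - y))" using d dv_kappa by blast
    ultimately have d': "dv m ((1 + \<kappa> * x) - (1 + \<kappa> * y))" using mnj(1) by (simp add: add.commute)
    have "absv (1 + \<kappa> * x) = 1 \<longleftrightarrow> absv (1 + \<kappa> * y) = 1"
      using unit_iff_cong[of m1] d' m_eq(1) by metis
    moreover have "(N x + w\<^sup>2) - (N y + w\<^sup>2) = N x - N y" by simp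
    then have "dv n (N x + w\<^sup>2) \<longleftrightarrow> dv n (N y + w\<^sup>2)"
      using dv_normK_diff[OF xy d] dv_iff_cong[of n "N x + w\<^sup>2" "N y + w\<^sup>2"] by simp
    moreover have "lam (1 + \<kappa> * x) = lam (1 + \<kappa> * y)" if "absv (1 + \<kappa> * x) = 1" by (rule lam_cong[OF that d'])
    ultimately show "g' n x = g' n y" by (auto simp: g'_def)
  qed
  finally show ?thesis .
qed

lemma matrix_coefficient:
  "B (weil (tmat p r) f) f = (-1) ^ n / of_nat q ^ n * (of_nat q / (of_nat q - 1)) *
    (\<Sum>z\<in>oreps n. if dv n (N z + w\<^sup>2) \<and> absv (p + r * \<theta> + z * r * \<theta>) = 1
       then lam (p + r * \<theta>) / lam (p + r * \<theta> + z * r * \<theta>) else 0) * B f f"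
proof -
  have t0: "t \<noteq> 0" using t1 by (auto simp: t_def)
  have g'_eq: "g' n z = (if dv n (N z + w\<^sup>2) \<and> absv (p + r * \<theta> + z * r * \<theta>) = 1
       then lam (p + r * \<theta>) / lam (p + r * \<theta> + z * r * \<theta>) else 0)" for z
  proof -
    have e: "1 + \<kappa> * z = (p + r * \<theta> + z * r * \<theta>) / t" using t0 by (simp add: \<kappa>_def field_simps) (simp add: t_def)
    have "absv (1 + \<kappa> * z) = absv (p + r * \<theta> + z * r * \<theta>)" unfolding e absv_divide using t1 by (simp add: t_def)
    moreover have "lam (1 + \<kappa> * z) = lam (p + r * \<theta> + z * r * \<theta>) / lam t" if "absv (p + r * \<theta> + z * r * \<theta>) = 1"
      unfolding e using t0 unit_nonzero[OF that] by (simp add: lam_divide)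
    ultimately show ?thesis unfolding g'_def using lam_nonzero[OF t0] by (auto simp: t_def)
  qed
  let ?X = "\<Sum>z\<in>oreps n. g' n z"
  have q1: "of_nat q - 1 \<noteq> (0::complex)" using q_power_nonzero[of 0] by simp
  have "(of_nat q - 1) * B (weil (tmat p r) f) f = (-1) ^ k / of_nat q ^ k * (of_nat q * (of_nat q ^ (2 * j) * ?X)) * B f f"
    using B_S S_small S_large by simp
  also have "(-1) ^ k / of_nat q ^ k * (of_nat q * (of_nat q ^ (2 * j) * ?X)) = (-1) ^ n / of_nat q ^ n * of_nat q * ?X"
  proof -
    have k: "k = n + 2 * j" unfolding k_def using mnj(1) by arith
    show ?thesis unfolding k by (simp add: power_add power_mult)
  qed
  finally have "B (weil (tmat p r) f) f = ((-1) ^ n / of_nat q ^ n * of_nat q * ?X) * B f f / (of_nat q - 1)"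
    using q1 by (simp add: field_simps)
  then show ?thesis unfolding g'_eq by simp
qed

end

section \<open>The embedding of the torus and the descent modulo scalars\<close>

lemma tmat_nth [simp]: "tmat p r $ 1 $ 1 = p - r * u * \<theta>\<^sup>2" "tmat p r $ 1 $ 2 = r * (1 - u\<^sup>2 * \<theta>\<^sup>2) / of_nat q ^ m"
  "tmat p r $ 2 $ 1 = of_nat q ^ m * r * \<theta>\<^sup>2" "tmat p r $ 2 $ 2 = p + r * u * \<theta>\<^sup>2"
  by (simp_all add: tmat_def)

lemma re_mult: "re (x * y) = re x * re y + \<theta>\<^sup>2 * (im x * im y)"
  and im_mult: "im (x * y) = re x * im y + im x * re y"
proof -
  have "x * y = (re x + im x * \<theta>) * (re y + im y * \<theta>)" using re_im by metis
  also have "\<dots> = (re x * re y + \<theta>\<^sup>2 * (im x * im y)) + (re x * im y + im x * re y) * \<theta>"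
    by (simp add: algebra_simps power2_eq_square)
  finally have xy: "x * y = (re x * re y + \<theta>\<^sup>2 * (im x * im y)) + (re x * im y + im x * re y) * \<theta>" .
  have Q: "re x * re y + \<theta>\<^sup>2 * (im x * im y) \<in> Qp" "re x * im y + im x * re y \<in> Qp"
    by (intro Qp_intros theta_sq_Qp re_im_in_Qp)+
  show "re (x * y) = re x * re y + \<theta>\<^sup>2 * (im x * im y)" "im (x * y) = re x * im y + im x * re y"
    unfolding xy using re_im_Qp[OF Q] by blast+
qed

lemma re_Qp: "a \<in> Qp \<Longrightarrow> re a = a" and im_Qp: "a \<in> Qp \<Longrightarrow> im a = 0"
  by (auto simp: re_def im_def bar_Qp)

lemma re_theta: "re \<theta> = 0" and im_theta: "im \<theta> = 1"
  by (auto simp: re_def im_def)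

text \<open>\<open>iota\<close> is a definite description, so existence and uniqueness are both due:
  the explicit map is an embedding, and an embedding is determined by its value at \<theta> because
  1 and \<theta> span K over \<open>Qp\<close>.\<close>

lemma iota_eq: "iota q m \<theta> u x = tmat (re x) (im x)"
proof -
  define J where "J x = tmat (re x) (im x)" for x
  have u': "(1 - u\<^sup>2 * \<theta>\<^sup>2) / of_nat q ^ m * (of_nat q ^ m * \<theta>\<^sup>2) = (1 - u\<^sup>2 * \<theta>\<^sup>2) * \<theta>\<^sup>2" by simp
  have "Qp_algebra_embedding J"
    unfolding Qp_algebra_embedding_def
  proof (intro conjI allI ballI)
    show "inj J"
    proof (rule injI)
      fix x y assume "J x = J y"
      then have "of_nat q ^ m * im x * \<theta>\<^sup>2 = of_nat q ^ m * im y * \<theta>\<^sup>2"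
        "re x - im x * u * \<theta>\<^sup>2 = re y - im y * u * \<theta>\<^sup>2"
        unfolding J_def by (metis tmat_nth(3), metis tmat_nth(1))
      then have "im x = im y" "re x = re y" by auto
      then show "x = y" by (metis re_im)
    qed
    have "\<forall>i k. J t $ i $ k \<in> Qp" for t
      unfolding forall_2 J_def tmat_nth
      by (intro conjI Qp_intros theta_sq_Qp re_im_in_Qp uw_Zp)
    then show "J t $ i $ k \<in> Qp" for t i k by blast
    show "J (s + t) = J s + J t" for s t
      unfolding vec_eq_iff forall_2 J_def re_add im_add
      by (simp add: algebra_simps add_divide_distrib diff_divide_distrib)
    show "J (s * t) = J s ** J t" for s t
      unfolding vec_eq_iff forall_2 matrix_matrix_mult_def vec_lambda_beta sum_2 J_def re_mult im_mult tmat_nth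
      by (simp add: field_simps power2_eq_square)
    show "J a = mat a" if "a \<in> Qp" for a
      unfolding vec_eq_iff forall_2 J_def re_Qp[OF that] im_Qp[OF that] by (simp add: mat_def)
  qed
  moreover have JT: "J \<theta> = iota_matrix q m \<theta> u"
    unfolding vec_eq_iff forall_2 J_def re_theta im_theta by (simp add: iota_matrix_def)
  moreover have "j = J" if j: "Qp_algebra_embedding j \<and> j \<theta> = iota_matrix q m \<theta> u" for j
  proof
    fix x
    have *: "j' x = mat (re x) + mat (im x) ** iota_matrix q m \<theta> u"
      if j': "Qp_algebra_embedding j' \<and> j' \<theta> = iota_matrix q m \<theta> u" for j'
    proof -
      have "j' x = j' (re x + im x * \<theta>)" using re_im[of x] by simp
      also have "\<dots> = j' (re x) + j' (im x) ** j' \<theta>" using j' unfolding Qp_algebra_embedding_def by simp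
      also have "\<dots> = mat (re x) + mat (im x) ** iota_matrix q m \<theta> u"
        using j' unfolding Qp_algebra_embedding_def by simp
      finally show ?thesis .
    qed
    show "j x = J x" using *[OF j] *[of J] calculation by simp
  qed
  ultimately have "iota q m \<theta> u = J" unfolding iota_def by (intro the_equality) blast+
  then show ?thesis by (simp add: J_def)
qed

lemma lam_Qp_sq: "c \<in> Qp - {0} \<Longrightarrow> lam c * lam c = 1"
  using lam_eta by (auto simp: eta_def)

lemma f_scale_Qp:
  assumes c: "c \<in> Qp - {0}" and v: "v \<in> Qp - {0}"
  shows "f (c * x) (v / c\<^sup>2) = lam c * f x v"
proof -
  have c0: "c \<noteq> 0" "c \<in> Qp" using c by auto
  have "f (x / (1 / c)) (N (1 / c) * v) = lam (1 / c) * f x v" using c0 v by (intro V_D(3)[OF f_V]) auto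
  moreover have "N (1 / c) * v = v / c\<^sup>2" using c0 by (simp add: normK_def bar_Qp power2_eq_square)
  moreover have "lam (1 / c) = lam c"
  proof -
    have "lam c * lam (1 / c) = lam c * lam c" using lam_Qp_sq[OF c] c0 lam_mult[of c "1 / c"] by simp
    then show ?thesis using lam_nonzero[OF c0(1)] by simp
  qed
  moreover have "x / (1 / c) = c * x" by simp
  ultimately show ?thesis by (simp only:)
qed

text \<open>Scalars act trivially because \<open>lam\<close> restricts to \<open>eta\<close>. This
  is read off from the formula of \<open>weil_rep\<close>: the case r = 0 is its branch without
  integral, and in the other one the substitution y -> y / c produces a second factor
  \<open>lam c\<close> that cancels the first.\<close>

lemma weil_tmat_scale:
  assumes c: "c \<in> Qp - {0}" and p: "p \<in> Qp" and r: "r \<in> Qp" and t: "p + r * \<theta> \<noteq> 0"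
  shows "weil (tmat (c * p) (c * r)) f = weil (tmat p r) f"
proof (intro ext)
  fix x v
  have c0: "c \<noteq> 0" "c \<in> Qp" using c by auto
  show "weil (tmat (c * p) (c * r)) f x v = weil (tmat p r) f x v"
  proof (cases "v \<in> Qp - {0}")
    case False
    then show ?thesis by (simp add: weil_rep_def)
  next
    case v: True
    define D where "D = p\<^sup>2 - \<theta>\<^sup>2 * r\<^sup>2"
    have DN: "D = N (p + r * \<theta>)" using p r by (simp add: normK_Qp_theta D_def)
    have D0: "D \<noteq> 0" "D \<in> Qp" unfolding DN using t by auto
    have vD: "v / D \<in> Qp - {0}" using v D0 by (auto intro!: Qp_intros)
    have dc: "(c * p)\<^sup>2 - \<theta>\<^sup>2 * (c * r)\<^sup>2 = c\<^sup>2 * D" by (simp add: D_def power_mult_distrib algebra_simps)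
    have pw: "absv (c\<^sup>2 * D) powr (- 1 / 2) = absv D powr (- 1 / 2) / absv c"
    proof -
      have "((absv c)\<^sup>2) powr (- 1 / 2) = 1 / absv c"
        using c0 powr_powr[of "absv c" 2 "- 1 / 2"] by (simp add: powr_minus_divide)
      then show ?thesis by (simp add: absv_mult absv_power powr_mult)
    qed
    have fc: "f y (v / (c\<^sup>2 * D)) = lam c * f (y / c) (v / D)" for y
      using f_scale_Qp[OF c vD, of "y / c"] c0 by (simp add: mult.commute)
    show ?thesis
    proof (cases "r = 0")
      case True
      have p0: "p \<noteq> 0" using t True by simp
      have Dp: "D = p * p" by (simp add: D_def True power2_eq_square)
      have cp: "c * p \<in> Qp - {0}" "p \<in> Qp - {0}" using c0 p p0 by (auto intro!: Qp_intros)
      have e: "eta bar (c * p) = lam c * lam p" "eta bar p = lam p" 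
        using bspec[OF lam_eta cp(1)] bspec[OF lam_eta cp(2)] lam_mult[of c p] c0 p0 by simp_all
      have "weil (tmat (c * p) (c * r)) f x v = lam c * lam p * (absv (c * p) * absv (c\<^sup>2 * D) powr (- 1 / 2)) * f (c * p * x) (v / (c\<^sup>2 * D))"
        using v by (simp add: weil_rep_def Let_def True tmat_def e Dp power2_eq_square mult_ac)
      also have "\<dots> = lam p * (absv p * absv D powr (- 1 / 2)) * f (p * x) (v / D)"
        unfolding pw fc using c0 lam_Qp_sq[OF c] by (simp add: absv_mult mult.assoc[symmetric])
      also have "\<dots> = weil (tmat p r) f x v"
        using v by (simp add: weil_rep_def Let_def True tmat_def e Dp)
      finally show ?thesis .
    next
      case False
      define cc where "cc = of_nat q ^ m * r * \<theta>\<^sup>2"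
      have cc: "cc \<noteq> 0" "cc \<in> Qp" using False r by (auto simp: cc_def intro!: theta_sq_Qp Qp_mult Qp_power[of "of_nat q"])
      define a where "a = p - r * u * \<theta>\<^sup>2"
      define b where "b = r * (1 - u\<^sup>2 * \<theta>\<^sup>2) / of_nat q ^ m"
      define d where "d = p + r * u * \<theta>\<^sup>2"
      have Q: "a \<in> Qp" "d \<in> Qp" using p r u by (auto simp: a_def d_def intro!: theta_sq_Qp Qp_mult Qp_add Qp_diff)
      have tm: "tmat p r = mat2 a b cc d" by (simp add: tmat_def a_def b_def cc_def d_def)
      have tmc: "tmat (c * p) (c * r) = mat2 (c * a) (c * b) (c * cc) (c * d)"
        by (simp add: tmat_def a_def b_def cc_def d_def algebra_simps)
      have det: "a * d - b * cc = D" unfolding a_def b_def cc_def d_def D_def by (rule tmat_det)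
      have detc: "(c * a) * (c * d) - (c * b) * (c * cc) = c\<^sup>2 * D"
        unfolding det[symmetric] by (simp add: power2_eq_square algebra_simps)
      have ccv: "cc * v \<in> Qp - {0}" "c * cc * v \<in> Qp - {0}" using cc c0 v by (auto intro!: Qp_intros)
      have e1: "eta bar (c * cc * v) = lam c * eta bar (cc * v)"
        using lam_eta ccv c0 lam_mult[of c "cc * v"] by (auto simp: mult.assoc)
      define G where "G y = \<psi> (v * (a * N x - Tr (x * bar y) + d / D * N y) / cc) * f y (v / D)" for y
      obtain n M where st: "step_function n M (\<lambda>y. f y (v / D))" using V_D(1)[OF f_V] by blast
      have q1: "v / cc * a * N x \<in> Qp" "v * d / D / cc \<in> Qp" using v Q D0 cc by (auto intro!: Qp_intros)
      have vc: "v / cc \<in> Qp" using v cc by (auto intro!: Qp_intros)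
      have arg: "v * (a * N x - Tr (x * bar y) + d / D * N y) / cc =
          v / cc * a * N x + Tr (- (v / cc) * x * bar y) + v * d / D / cc * N y" for y
      proof -
        have eq: "Tr (- (v / cc) * x * bar y) = - (v / cc) * Tr (x * bar y)"
          using traceK_Qp_mult[OF Qp_minus[OF vc], of "x * bar y"] by (simp only: mult.assoc)
        show ?thesis unfolding eq using cc(1) D0(1) by (simp add: field_simps)
      qed
      obtain n' where G: "step_function n' M G"
        using step_psi_quad[OF st q1, of "- (v / cc) * x"] unfolding G_def arg by blast
      have c1: "1 / c \<noteq> 0" using c0 by simp
      have int: "\<psi> (v * (c * a * N x - Tr (x * bar y) + c * d / (c\<^sup>2 * D) * N y) / (c * cc)) * f y (v / (c\<^sup>2 * D)) =
          lam c * G (1 / c * y + 0)" for y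
      proof -
        have bc: "bar c = c" using c0 by (simp add: bar_Qp)
        have "c * a * N x - Tr (x * bar y) + c * d / (c\<^sup>2 * D) * N y =
            c * (a * N x - Tr (x * bar (1 / c * y)) + d / D * N (1 / c * y))"
        proof -
          have "c * Tr (x * bar (1 / c * y)) = Tr (x * bar y)" using c0 bc by (simp add: traceK_def field_simps)
          moreover have "c * (d / D * N (1 / c * y)) = c * d / (c\<^sup>2 * D) * N y"
            using c0 bc by (simp add: normK_def power2_eq_square field_simps)
          moreover have "c * (a * N x - Tr (x * bar (1 / c * y)) + d / D * N (1 / c * y)) =
             c * a * N x - c * Tr (x * bar (1 / c * y)) + c * (d / D * N (1 / c * y))" by (simp only: distrib_left right_diff_distrib mult.assoc)
          ultimately show ?thesis by (simp only:)
        qed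
        then have "v * (c * a * N x - Tr (x * bar y) + c * d / (c\<^sup>2 * D) * N y) / (c * cc) =
            v * (a * N x - Tr (x * bar (1 / c * y)) + d / D * N (1 / c * y)) / cc"
          using c0 by (simp only:) simp
        moreover have "1 / c * y + 0 = 1 / c * y" "y / c = 1 / c * y" by simp_all
        ultimately show ?thesis unfolding G_def fc by (simp only: mult.left_commute)
      qed
      have "weil (tmat (c * p) (c * r)) f x v = lam c * eta bar (cc * v) * of_real (absv v / absv (c * cc) * (absv D powr (- 1 / 2) / absv c)) *
          (lam c * ((\<integral>y. G y \<partial>\<mu>) / of_real ((absv (1 / c))\<^sup>2)))"
        unfolding tmc weil_lower[OF _ v, of "c * cc", simplified c0 cc] detc
        using weil_lower[OF _ v, of "c * cc"] c0 cc
        by (subst weil_lower[OF _ v]) (simp_all only: detc int e1 pw integral_mult_right_zero integral_step_affine[OF G c1] mult_eq_0_iff, simp_all)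
      also have "\<dots> = (lam c * lam c) * (eta bar (cc * v) * of_real (absv v / absv cc * absv D powr (- 1 / 2)) * (\<integral>y. G y \<partial>\<mu>))"
        using c0 by (simp add: absv_mult absv_divide field_simps power2_eq_square)
      also have "\<dots> = weil (tmat p r) f x v"
        unfolding tm weil_lower[OF cc(1) v] det G_def lam_Qp_sq[OF c] by simp
      finally show ?thesis .
    qed
  qed
qed

definition Phi :: "'k \<Rightarrow> complex"
  where "Phi t = B (weil (iota q m \<theta> u t) f) f / B f f"

lemma Phi_scale:
  assumes "c \<in> Qp - {0}" "t \<noteq> 0"
  shows "Phi (c * t) = Phi t"
proof -
  have "re t + im t * \<theta> \<noteq> 0" using assms re_im by metis
  then show ?thesis unfolding Phi_def iota_eq using weil_tmat_scale[OF assms(1), of "re t" "im t"] assms(1)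
    by (simp add: re_mult_Qp im_mult_Qp)
qed

text \<open>If \<open>q^m\<close> divides the imaginary part then the matrix lies in
  \<open>U0 q (2 * m)\<close>: the denominator \<open>q^m\<close> of the upper right entry is
  cleared and the lower left entry gains a second factor \<open>q^m\<close>.\<close>

lemma Phi_trivial:
  assumes t: "absv t = 1" and d: "dv m (im t)"
  shows "Phi t = 1"
proof -
  let ?p = "re t" and ?r = "im t"
  have tz: "dv 0 t" using t by (rule unit_dv_0)
  note Z = re_im_Zp[OF tz]
  obtain r' where r': "dv 0 r'" "?r = of_nat q ^ m * r'" using d by (rule dvE)
  have "r' = ?r / of_nat q ^ m" using r'(2) by simp
  then have r'Z: "r' \<in> Zp" using r'(1) by (auto simp: Zp_iff intro!: Qp_intros)
  have "mat2 (?p - ?r * u * \<theta>\<^sup>2) (?r * (1 - u\<^sup>2 * \<theta>\<^sup>2) / of_nat q ^ m)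
    (of_nat q ^ m * ?r * \<theta>\<^sup>2) (?p + ?r * u * \<theta>\<^sup>2) \<in> U0 q (2 * m)"
  proof (rule mat2_U0)
    show "?p - ?r * u * \<theta>\<^sup>2 \<in> Zp" "?p + ?r * u * \<theta>\<^sup>2 \<in> Zp" using Z by (auto intro!: Zp_intros uw_Zp)
    have "?r * (1 - u\<^sup>2 * \<theta>\<^sup>2) / of_nat q ^ m = r' * (1 - u\<^sup>2 * \<theta>\<^sup>2)" unfolding r'(2) by simp
    then show "?r * (1 - u\<^sup>2 * \<theta>\<^sup>2) / of_nat q ^ m \<in> Zp" using r'Z by (simp only:) (intro Zp_intros uw_Zp)
    show "r' * \<theta>\<^sup>2 \<in> Zp" using r'Z by (intro Zp_intros)
    show "of_nat q ^ m * ?r * \<theta>\<^sup>2 = of_nat q ^ (2 * m) * (r' * \<theta>\<^sup>2)" unfolding r'(2) by (simp add: mult_2 power_add)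
    have "absv (N t) = 1" using t by simp
    then show "absv ((?p - ?r * u * \<theta>\<^sup>2) * (?p + ?r * u * \<theta>\<^sup>2) - ?r * (1 - u\<^sup>2 * \<theta>\<^sup>2) / of_nat q ^ m * (of_nat q ^ m * ?r * \<theta>\<^sup>2)) = 1"
      unfolding tmat_det normK_re_im .
  qed
  then have "weil (tmat ?p ?r) f = f" unfolding tmat_def by (rule f_fixed)
  then show ?thesis unfolding Phi_def iota_eq using B_ff_nonzero by simp
qed

lemma Phi_formula:
  assumes t: "absv t = 1" and r: "absv (im t) = 1 / real q ^ j" and mnj: "m = n + j" "n \<ge> 1"
  shows "Phi t = (-1) ^ n / of_nat q ^ n * (of_nat q / (of_nat q - 1)) *
    (\<Sum>z\<in>oreps n. if dv n (N z + w\<^sup>2) \<and> absv (t + z * im t * \<theta>) = 1 then lam t / lam (t + z * im t * \<theta>) else 0)"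
proof -
  have tz: "dv 0 t" using t by (rule unit_dv_0)
  have e: "re t + im t * \<theta> = t" by (rule re_im[symmetric])
  have "absv (re t + im t * \<theta>) = 1" unfolding e by (rule t)
  from matrix_coefficient[OF re_im_Zp[OF tz] this r mnj] show ?thesis
    unfolding Phi_def iota_eq e using B_ff_nonzero by simp
qed

text \<open>Makes the period a finite sum. The imaginary parts of both arguments are either
  divisible by \<open>q^m\<close> together or have the same valuation j below m, and the explicit
  formulas then agree term by term.\<close>

lemma Phi_cong:
  assumes t: "absv t = 1" and d: "dv m (t - t')"
  shows "Phi t = Phi t'"
proof -
  have t': "absv t' = 1" using unit_cong[OF t, of m1 t'] d m_eq(1) by simp
  have di: "dv m (im t - im t')" using dv_im[OF d] by (simp only: im_diff)
  show ?thesis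
  proof (cases "dv m (im t)")
    case True
    then have "dv m (im t')" using dv_iff_cong[OF di] by simp
    then show ?thesis using True Phi_trivial t t' by simp
  next
    case False
    define j where "j = (LEAST j. \<not> dv (Suc j) (im t))"
    have ex: "\<not> dv (Suc m1) (im t)" using False m_eq(1) by metis
    have j1: "\<not> dv (Suc j) (im t)" unfolding j_def by (rule LeastI[of "\<lambda>j. \<not> dv (Suc j) (im t)", OF ex])
    have jm: "j \<le> m1" unfolding j_def by (rule Least_le[of "\<lambda>j. \<not> dv (Suc j) (im t)", OF ex])
    have j2: "dv j (im t)"
    proof (cases j)
      case 0
      then show ?thesis using dv_im[OF unit_dv_0[OF t]] by simp
    next
      case (Suc i)
      then have "i < j" by simp
      then show ?thesis using not_less_Least[of i "\<lambda>j. \<not> dv (Suc j) (im t)"] Suc unfolding j_def by simp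
    qed
    have r: "absv (im t) = 1 / real q ^ j" by (rule absv_eq_of_dv[OF j2 j1])
    have jm': "Suc j \<le> m" using jm m_eq(1) by simp
    have r': "absv (im t') = 1 / real q ^ j"
    proof (rule absv_eq_of_dv)
      show "dv j (im t')" using dv_iff_cong[OF dv_mono[OF di, of j]] j2 jm' by simp
      show "\<not> dv (Suc j) (im t')" using dv_iff_cong[OF dv_mono[OF di jm']] j1 by simp
    qed
    define n where "n = m - j"
    have mnj: "m = n + j" "n \<ge> 1" using jm' by (auto simp: n_def)
    have "(if dv n (N z + w\<^sup>2) \<and> absv (t + z * im t * \<theta>) = 1 then lam t / lam (t + z * im t * \<theta>) else 0) =
      (if dv n (N z + w\<^sup>2) \<and> absv (t' + z * im t' * \<theta>) = 1 then lam t' / lam (t' + z * im t' * \<theta>) else 0)"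
      if "z \<in> oreps n" for z
    proof -
      have "(t + z * im t * \<theta>) - (t' + z * im t' * \<theta>) = (t - t') + z * (im t - im t') * \<theta>" by (simp add: algebra_simps)
      moreover have "dv m ((t - t') + z * (im t - im t') * \<theta>)"
        by (rule dv_add[OF d dv_mult_right[OF dv_mult_left[OF oreps_OK[OF that] di] dv_theta]])
      ultimately have dd: "dv m ((t + z * im t * \<theta>) - (t' + z * im t' * \<theta>))" by (simp only:)
      then have "absv (t + z * im t * \<theta>) = 1 \<longleftrightarrow> absv (t' + z * im t' * \<theta>) = 1"
        using unit_iff_cong[of m1] m_eq(1) by metis
      moreover have "lam (t + z * im t * \<theta>) = lam (t' + z * im t' * \<theta>)" if "absv (t + z * im t * \<theta>) = 1"
        by (rule lam_cong[OF that dd])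
      moreover have "lam t = lam t'" by (rule lam_cong[OF t d])
      ultimately show ?thesis by auto
    qed
    then show ?thesis unfolding Phi_formula[OF t r mnj] Phi_formula[OF t' r' mnj] by (simp cong: sum.cong)
  qed
qed

section \<open>The period as a finite sum\<close>

abbreviation Gm where "Gm \<equiv> mult_group_of TYPE('k)"
abbreviation H where "H \<equiv> Qp - {0::'k}"

definition cls :: "'k \<Rightarrow> 'k set"
  where "cls t = H #>\<^bsub>Gm\<^esub> t"

lemma cls_eq: "cls t = (\<lambda>h. h * t) ` H"
  by (auto simp: cls_def r_coset_def mult_group_of_def)

lemma carrier_quotient: "carrier (Gm Mod H) = cls ` (- {0})"
  by (auto simp: FactGroup_def RCOSETS_def cls_def mult_group_of_def)

lemma cls_eqI:
  assumes "c \<in> H"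
  shows "cls (c * t) = cls t"
proof (intro equalityI subsetI)
  have c: "c \<in> Qp" "c \<noteq> 0" using assms by auto
  fix x assume "x \<in> cls (c * t)"
  then obtain h where "h \<in> H" "x = h * (c * t)" by (auto simp: cls_eq)
  then show "x \<in> cls t" unfolding cls_eq using c by (intro image_eqI[of _ _ "h * c"]) (auto intro: Qp_intros)
next
  have c: "c \<in> Qp" "c \<noteq> 0" using assms by auto
  fix x assume "x \<in> cls t"
  then obtain h where "h \<in> H" "x = h * t" by (auto simp: cls_eq)
  then show "x \<in> cls (c * t)" unfolding cls_eq using c by (intro image_eqI[of _ _ "h / c"]) (auto intro: Qp_intros)
qed

lemma cls_eqD: "cls s = cls t \<Longrightarrow> \<exists>c\<in>H. s = c * t"
proof -
  assume e: "cls s = cls t"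
  have "s \<in> cls s" unfolding cls_eq by (intro image_eqI[of _ _ 1]) auto
  then have "s \<in> cls t" by (simp only: e)
  then show ?thesis by (auto simp: cls_eq)
qed

lemma cls_mult: "cls s \<otimes>\<^bsub>Gm Mod H\<^esub> cls t = cls (s * t)"
proof -
  have "cls s <#>\<^bsub>Gm\<^esub> cls t = cls (s * t)"
  proof (intro equalityI subsetI)
    fix x assume "x \<in> cls s <#>\<^bsub>Gm\<^esub> cls t"
    then obtain h k where "h \<in> H" "k \<in> H" "x = (h * s) * (k * t)"
      by (auto simp: set_mult_def cls_eq mult_group_of_def)
    then show "x \<in> cls (s * t)" unfolding cls_eq by (intro image_eqI[of _ _ "h * k"]) (auto intro: Qp_intros)
  next
    fix x assume "x \<in> cls (s * t)"
    then obtain h where h: "h \<in> H" "x = h * (s * t)" unfolding cls_eq by (elim imageE)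
    have "1 * t \<in> cls t" unfolding cls_eq by (rule imageI) simp
    moreover have "h * s \<in> cls s" unfolding cls_eq using h(1) by (rule imageI)
    ultimately show "x \<in> cls s <#>\<^bsub>Gm\<^esub> cls t"
      unfolding set_mult_def by (intro UN_I[of "h * s"] UN_I[of "1 * t"]) (simp_all add: mult_group_of_def h(2))
  qed
  then show ?thesis by (simp add: FactGroup_def)
qed

definition nbhd :: "'k \<Rightarrow> 'k set set"
  where "nbhd t = (\<lambda>x. cls (t * x)) ` {x. dv m (x - 1)}"

text \<open>With coordinates [re : im], the classes of K* modulo Qp* (1 + q^m OK) are the points of
  the projective line over Z/q^m: the points [1 : \<beta>] and the points [q b : 1].\<close>

definition treps :: "'k set"
  where "treps = (\<lambda>\<beta>. 1 + \<beta> * \<theta>) ` zreps m \<union> (\<lambda>b. of_nat q * b + \<theta>) ` zreps m1"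

lemma unit_re_im: "p \<in> Zp \<Longrightarrow> r \<in> Zp \<Longrightarrow> absv p = 1 \<or> absv r = 1 \<Longrightarrow> absv (p + r * \<theta>) = 1"
  by (auto simp: absv_re_im[of "p + r * \<theta>"] Zp_iff dv_def)

lemma qb_Zp: "b \<in> Zp \<Longrightarrow> of_nat q * b \<in> (Zp::'k set)"
  by (intro Zp_intros)

lemma treps_unit: "t \<in> treps \<Longrightarrow> absv t = 1"
proof -
  assume "t \<in> treps"
  then consider \<beta> where "\<beta> \<in> Zp" "t = 1 + \<beta> * \<theta>" | b where "b \<in> Zp" "t = of_nat q * b + 1 * \<theta>"
    by (auto simp: treps_def dest!: zreps_Zp)
  then show ?thesis
  proof cases
    case 1
    then show ?thesis using unit_re_im[of 1 \<beta>] by simp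
  next
    case 2
    then show ?thesis using unit_re_im[OF qb_Zp[OF 2(1)] Zp_1] by simp
  qed
qed

lemma one_plus_unit: "dv m (x - 1) \<Longrightarrow> absv (x::'k) = 1"
  using unit_cong[of 1 m1 x] m_eq(1) by (simp add: dv_diff_commute)

lemma treps_cover:
  assumes "t \<noteq> 0"
  shows "\<exists>t0\<in>treps. cls t \<in> nbhd t0"
proof -
  obtain n where n: "absv t = real q powi n" using absv_value[OF assms] by blast
  \<comment> \<open>Since |q| = 1/q, it is the power with exponent n, not -n, that scales an element
    of absolute value q^n to a unit.\<close>
  define c where "c = (of_nat q powi n :: 'k)"
  have cH: "c \<in> H" unfolding c_def power_int_def by (auto intro!: Qp_intros)
  define s where "s = c * t"
  have s1: "absv s = 1"
    unfolding s_def absv_mult c_def absv_power_int absv_p n by (simp add: power_int_divide_distrib)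
  have cs: "cls t = cls s" unfolding s_def by (rule cls_eqI[OF cH, symmetric])
  have sd: "dv 0 s" using s1 by (rule unit_dv_0)
  define p where "p = re s"
  define r where "r = im s"
  have pr: "p \<in> Zp" "r \<in> Zp" "p \<in> Qp" "r \<in> Qp" using re_im_Zp[OF sd] by (auto simp: p_def r_def)
  have spr: "s = p + r * \<theta>" unfolding p_def r_def by (rule re_im)
  have key: "cls t \<in> nbhd t0" if h: "h \<in> H" "absv h = 1" "absv t0 = 1" "dv m (s - h * t0)" for h t0
  proof -
    have nz: "h \<noteq> 0" "t0 \<noteq> 0" using h by auto
    define x where "x = s / (h * t0)"
    have "x - 1 = (s - h * t0) / (h * t0)" using nz by (simp add: x_def field_simps)
    then have "dv m (x - 1)" using h by (simp add: dv_divide_unit_iff absv_mult)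
    moreover have "s = h * (t0 * x)" using nz by (simp add: x_def)
    then have "cls t = cls (t0 * x)" using cs cls_eqI[OF h(1), of "t0 * x"] by simp
    ultimately show ?thesis by (auto simp: nbhd_def)
  qed
  show ?thesis
  proof (cases "absv p = 1")
    case True
    then have p0: "p \<noteq> 0" by auto
    have "r / p \<in> Zp" using pr True by (auto simp: Zp_iff dv_divide_unit_iff intro!: Qp_intros)
    then obtain \<beta> where b: "\<beta> \<in> zreps m" "dv m (r / p - \<beta>)" using zreps_rep_system[of m] by (auto simp: rep_system_def)
    have mem: "1 + \<beta> * \<theta> \<in> treps" using b(1) by (auto simp: treps_def)
    have "s - p * (1 + \<beta> * \<theta>) = p * (r / p - \<beta>) * \<theta>" using p0 by (simp add: spr field_simps)
    then have "dv m (s - p * (1 + \<beta> * \<theta>))" using dv_mult_right[OF dv_mult_left[OF _ b(2), of p] dv_theta] True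
      by (simp only: unit_dv_0)
    then show ?thesis using mem key[of p "1 + \<beta> * \<theta>"] True p0 pr treps_unit[OF mem] by auto
  next
    case False
    then have p1: "dv 1 p" using absv_eq_1_or_dv[of p] pr by (auto simp: Zp_iff)
    have r1: "absv r = 1"
    proof (rule ccontr)
      assume "absv r \<noteq> 1"
      then have "dv 1 r" using absv_eq_1_or_dv[of r] pr by (auto simp: Zp_iff)
      then have "dv 1 s" unfolding spr using p1 by (intro dv_add dv_mult_right) auto
      then show False using s1 unit_iff by blast
    qed
    then have r0: "r \<noteq> 0" by auto
    obtain p' where p': "dv 0 p'" "p = of_nat q ^ 1 * p'" using p1 by (rule dvE)
    have "p' = p / of_nat q" using p' by simp
    then have "p' \<in> Qp" using pr by (auto intro!: Qp_intros)
    then have "p' / r \<in> Zp" using p'(1) pr r1 by (auto simp: Zp_iff dv_divide_unit_iff intro!: Qp_intros)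
    then obtain b where b: "b \<in> zreps m1" "dv m1 (p' / r - b)" using zreps_rep_system[of m1] by (auto simp: rep_system_def)
    have mem: "of_nat q * b + \<theta> \<in> treps" using b(1) by (auto simp: treps_def)
    have "s - r * (of_nat q * b + \<theta>) = r * (of_nat q ^ 1 * (p' / r - b))" using r0 p'(2) by (simp add: spr field_simps)
    moreover have "dv (1 + m1) (of_nat q ^ 1 * (p' / r - b))" using b(2) by (simp only: dv_p_mult_iff)
    ultimately have "dv (1 + m1) (s - r * (of_nat q * b + \<theta>))" using r1 by (simp only: dv_mult_unit_iff)
    then have "dv m (s - r * (of_nat q * b + \<theta>))" using m_eq(1) by (metis Suc_eq_plus1_left)
    then show ?thesis using mem key[of r "of_nat q * b + \<theta>"] r1 r0 pr treps_unit[OF mem] by auto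
  qed
qed

lemma treps_cong:
  assumes t: "t \<in> treps" and t': "t' \<in> treps" and c: "c \<in> Qp" and d: "dv m (t - c * t')"
  shows "t = t'"
proof -
  have form: "(\<exists>\<beta>\<in>zreps m. s = 1 + \<beta> * \<theta> \<and> re s = 1 \<and> im s = \<beta>) \<or>
      (\<exists>b\<in>zreps m1. s = of_nat q * b + \<theta> \<and> re s = of_nat q * b \<and> im s = 1)" if "s \<in> treps" for s
  proof -
    have "(\<exists>\<beta>\<in>zreps m. s = 1 + \<beta> * \<theta>) \<or> (\<exists>b\<in>zreps m1. s = of_nat q * b + 1 * \<theta>)"
      using that by (auto simp: treps_def)
    moreover have "re (1 + \<beta> * \<theta>) = 1 \<and> im (1 + \<beta> * \<theta>) = \<beta>" if "\<beta> \<in> zreps m" for \<beta>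
      using zreps_Zp[OF that] by (simp add: Zp_iff)
    moreover have "re (of_nat q * b + 1 * \<theta>) = of_nat q * b \<and> im (of_nat q * b + 1 * \<theta>) = 1" if "b \<in> zreps m1" for b
      using Zp_Qp[OF qb_Zp[OF zreps_Zp[OF that]]] by (simp only: re_im_Qp Qp_1)
    ultimately show ?thesis by (metis mult_1)
  qed
  have dr: "dv m (re t - c * re t')" using dv_re[OF d] by (simp only: re_diff re_mult_Qp[OF c])
  have di: "dv m (im t - c * im t')" using dv_im[OF d] by (simp only: im_diff im_mult_Qp[OF c])
  have m1': "1 \<le> m" using m_eq by simp
  have c1: "absv c = 1"
  proof -
    have "absv (c * t') = 1" using unit_cong[OF treps_unit[OF t], of m1 "c * t'"] d m_eq(1) by simp
    then show ?thesis using treps_unit[OF t'] by (simp add: absv_mult)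
  qed
  have q1: "\<not> dv m (1 - y)" if "dv 1 y" for y :: 'k
  proof
    assume "dv m (1 - y)"
    then have "dv 1 (1 - y)" using m1' by (rule dv_mono)
    then have "dv 1 (1 - y + y)" using that by (rule dv_add)
    then show False using absv_eq_1_not_dv[of 1 0] by (simp add: One_nat_def)
  qed
  have dq: "dv 1 (of_nat q * b)" if "b \<in> Zp" for b :: 'k
    using dv_mult_right[OF dv_p_power[of 1], of b] that by (simp add: Zp_iff)
  from form[OF t] form[OF t'] show ?thesis
  proof (elim disjE bexE conjE)
    fix \<beta> \<beta>' assume b: "\<beta> \<in> zreps m" "t = 1 + \<beta> * \<theta>" "re t = 1" "im t = \<beta>"
      "\<beta>' \<in> zreps m" "t' = 1 + \<beta>' * \<theta>" "re t' = 1" "im t' = \<beta>'"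
    have "dv m ((\<beta> - c * \<beta>') - (1 - c) * \<beta>')"
      using di dr by (rule_tac dv_diff[OF _ dv_mult_right[OF _ Zp_dv[OF zreps_Zp[OF b(5)]]]])
        (simp_all only: b(3,4,7,8) mult_1_right)
    then have "dv m (\<beta> - \<beta>')" by (simp add: algebra_simps)
    then have "\<beta> = \<beta>'" using b zreps_rep_system[of m] unfolding rep_system_def by blast
    then show ?thesis using b by simp
  next
    fix \<beta> b assume b: "re t = 1" "b \<in> zreps m1" "re t' = of_nat q * b"
    have "dv 1 (c * (of_nat q * b))" using dv_mult_left[OF unit_dv_0[OF c1] dq[OF zreps_Zp[OF b(2)]]] .
    then show ?thesis using q1 dr b by auto
  next
    fix b \<beta>' assume b: "im t = 1" "b \<in> zreps m1" "re t = of_nat q * b" "re t' = 1"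
    have "dv m (of_nat q * b - c)" using dr b by simp
    then have "dv 1 (of_nat q * b - c)" using m1' by (rule dv_mono)
    then have "dv 1 c" using dv_iff_cong dq[OF zreps_Zp[OF b(2)]] by blast
    then show ?thesis using c1 unit_iff by blast
  next
    fix b b' assume b: "b \<in> zreps m1" "t = of_nat q * b + \<theta>" "re t = of_nat q * b" "im t = 1"
      "b' \<in> zreps m1" "t' = of_nat q * b' + \<theta>" "re t' = of_nat q * b'" "im t' = 1"
    have "dv m ((of_nat q * b - c * (of_nat q * b')) - (1 - c) * (of_nat q * b'))"
      using di dr by (rule_tac dv_diff[OF _ dv_mult_right[OF _ Zp_dv[OF qb_Zp[OF zreps_Zp[OF b(5)]]]]])
        (simp_all only: b(3,4,7,8) mult_1_right)
    then have "dv m (of_nat q ^ 1 * (b - b'))" by (simp add: algebra_simps)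
    then have "dv (1 + m1) (of_nat q ^ 1 * (b - b'))" using m_eq(1) by (metis Suc_eq_plus1_left)
    then have "dv m1 (b - b')" by (simp only: dv_p_mult_iff)
    then have "b = b'" using b zreps_rep_system[of m1] unfolding rep_system_def by blast
    then show ?thesis using b by simp
  qed
qed

lemma nbhd_disjoint:
  assumes "t \<in> treps" "t' \<in> treps" "X \<in> nbhd t" "X \<in> nbhd t'"
  shows "t = t'"
proof -
  obtain x where x: "dv m (x - 1)" "X = cls (t * x)" using assms(3) by (auto simp: nbhd_def)
  obtain x' where x': "dv m (x' - 1)" "X = cls (t' * x')" using assms(4) by (auto simp: nbhd_def)
  have "cls (t * x) = cls (t' * x')" using x(2) x'(2) by simp
  then obtain c where c: "c \<in> H" "t * x = c * (t' * x')" using cls_eqD by blast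
  have u: "absv t = 1" "absv t' = 1" "absv x = 1" "absv x' = 1"
    using treps_unit assms(1,2) one_plus_unit x x' by auto
  have "absv c = 1" using arg_cong[OF c(2), of absv] u by (simp add: absv_mult)
  then have cd: "dv 0 c" by (rule unit_dv_0)
  have "t - c * t' = c * t' * (x' - 1) - t * (x - 1)" using c(2) by (simp add: algebra_simps)
  moreover have "dv m (c * t' * (x' - 1) - t * (x - 1))"
    using x x' u by (intro dv_diff[OF dv_mult_left dv_mult_left]) (auto intro: dv_mult_left cd unit_dv_0)
  ultimately have "dv m (t - c * t')" by (simp only:)
  then show ?thesis using treps_cong[OF assms(1,2), of c] c(1) by blast
qed

lemma card_treps: "card treps = q ^ m + q ^ m1" and finite_treps: "finite treps"
  and sum_treps: "(\<Sum>t\<in>treps. g t) = (\<Sum>\<beta>\<in>zreps m. g (1 + \<beta> * \<theta>)) + (\<Sum>b\<in>zreps m1. g (of_nat q * b + \<theta>) :: complex)"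
proof -
  let ?A = "(\<lambda>\<beta>. 1 + \<beta> * \<theta>) ` zreps m" and ?B = "(\<lambda>b. of_nat q * b + \<theta>) ` zreps m1"
  have iA: "inj_on (\<lambda>\<beta>. 1 + \<beta> * \<theta>) (zreps m)" and iB: "inj_on (\<lambda>b. of_nat q * b + \<theta>) (zreps m1)"
    by (auto simp: inj_on_def)
  have dis: "?A \<inter> ?B = {}"
  proof (rule ccontr)
    assume "?A \<inter> ?B \<noteq> {}"
    then obtain \<beta> b where b: "\<beta> \<in> zreps m" "b \<in> zreps m1" "1 + \<beta> * \<theta> = of_nat q * b + \<theta>" by auto
    have "re (1 + \<beta> * \<theta>) = re (of_nat q * b + 1 * \<theta>)" using b(3) by simp
    then have "1 = of_nat q * b"
      using Zp_Qp[OF zreps_Zp[OF b(1)]] Zp_Qp[OF qb_Zp[OF zreps_Zp[OF b(2)]]] by (simp only: re_im_Qp Qp_1)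
    moreover have "dv 1 (of_nat q ^ 1 * b)" using zreps_Zp[OF b(2)] by (intro dv_mult_right dv_p_power) (simp add: Zp_iff)
    ultimately have "dv 1 (1::'k)" by simp
    then show False using absv_eq_1_not_dv[of 1 0] by (simp add: One_nat_def)
  qed
  show "card treps = q ^ m + q ^ m1"
    unfolding treps_def using iA iB dis by (subst card_Un_disjoint) (auto simp: card_image)
  show "finite treps" by (simp add: treps_def)
  show "(\<Sum>t\<in>treps. g t) = (\<Sum>\<beta>\<in>zreps m. g (1 + \<beta> * \<theta>)) + (\<Sum>b\<in>zreps m1. g (of_nat q * b + \<theta>))"
    unfolding treps_def using iA iB dis by (subst sum.union_disjoint) (auto simp: sum.reindex)
qed

text \<open>The sets \<open>nbhd t\<close> for t in \<open>treps\<close> are disjoint open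
  translates of \<open>nbhd 1\<close> that exhaust the quotient, so an invariant measure gives them
  equal mass; the integrand is constant on each of them, and the mass cancels.\<close>

lemma gamma_formula:
  assumes tor: "torus_haar \<nu>"
  shows "gamma_period q m bar \<psi> \<mu> B \<nu> f \<theta> u = (\<Sum>t\<in>treps. Phi t) / of_nat (card treps)"
proof -
  let ?T = "quotient_topology Gm H (subtopology euclidean (- {0}))"
  note tor' = tor[unfolded torus_haar_def haar_measure_def]
  have T1: "topspace ?T = carrier (Gm Mod H)" using tor' by (elim conjE)
  have T2: "space \<nu> = topspace ?T" using tor' by (elim conjE)
  have T3: "sets \<nu> = sigma_sets (topspace ?T) {U. openin ?T U}" using tor' by (elim conjE)
  have "\<forall>g\<in>carrier (Gm Mod H). \<forall>A\<in>sets \<nu>. emeasure \<nu> ((\<lambda>x. g \<otimes>\<^bsub>Gm Mod H\<^esub> x) ` A) = emeasure \<nu> A"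
    using tor' by (elim conjE)
  then have T4: "emeasure \<nu> ((\<lambda>x. g \<otimes>\<^bsub>Gm Mod H\<^esub> x) ` A) = emeasure \<nu> A"
    if "g \<in> carrier (Gm Mod H)" "A \<in> sets \<nu>" for g A using that by (elim ballE) auto
  have "\<forall>C\<in>sets \<nu>. compactin ?T C \<longrightarrow> emeasure \<nu> C < \<infinity>" using tor' by (elim conjE)
  then have T5: "emeasure \<nu> C < \<infinity>" if "C \<in> sets \<nu>" "compactin ?T C" for C using that by (elim ballE) auto
  have T6: "emeasure \<nu> (space \<nu>) \<noteq> 0" using tor' by (elim conjE)
  have sp: "space \<nu> = cls ` (- {0})" using T1 T2 carrier_quotient by simp
  have opn: "openin ?T A \<longleftrightarrow> A \<subseteq> cls ` (- {0}) \<and> open {x. x \<noteq> 0 \<and> cls x \<in> A}" for A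
  proof -
    have "{x \<in> topspace (subtopology euclidean (- {0::'k})). H #>\<^bsub>Gm\<^esub> x \<in> A} = {x. x \<noteq> 0 \<and> cls x \<in> A}"
      by (auto simp: cls_def)
    moreover have "openin (subtopology euclidean (- {0})) {x. x \<noteq> 0 \<and> cls x \<in> A} \<longleftrightarrow> open {x. x \<noteq> 0 \<and> cls x \<in> A}"
      by (subst openin_open_eq) (auto simp: open_Compl)
    ultimately show ?thesis unfolding openin_quotient_topology carrier_quotient by simp
  qed
  have nb_sub: "nbhd t \<subseteq> cls ` (- {0})" if "absv t = 1" for t
  proof
    fix X assume "X \<in> nbhd t"
    then obtain x where x: "dv m (x - 1)" "X = cls (t * x)" by (auto simp: nbhd_def)
    have "absv (t * x) = 1" using that one_plus_unit[OF x(1)] by (simp add: absv_mult)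
    then have "t * x \<noteq> 0" by auto
    then show "X \<in> cls ` (- {0})" unfolding x(2) by (intro imageI) simp
  qed
  have nb_sets: "nbhd t \<in> sets \<nu>" if t: "absv t = 1" for t
  proof -
    have "open {x. x \<noteq> 0 \<and> cls x \<in> nbhd t}"
      unfolding open_dist
    proof (intro ballI)
      fix y assume "y \<in> {x. x \<noteq> 0 \<and> cls x \<in> nbhd t}"
      then obtain x where y: "y \<noteq> 0" "dv m (x - 1)" "cls y = cls (t * x)" by (auto simp: nbhd_def)
      show "\<exists>e>0. \<forall>y'. dist y' y < e \<longrightarrow> y' \<in> {x. x \<noteq> 0 \<and> cls x \<in> nbhd t}"
      proof (intro exI[of _ "absv y / real q ^ m"] conjI allI impI)
        show "absv y / real q ^ m > 0" using y(1) by simp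
        fix y' assume "dist y' y < absv y / real q ^ m"
        then have "absv (y' - y) < absv y / real q ^ m" by (simp add: dist_absv)
        then have dd: "dv m ((y' - y) / y)" using y(1) by (simp add: dv_def absv_divide field_simps)
        define z where "z = y' / y"
        have z: "dv m (z - 1)" using dd y(1) by (simp add: z_def diff_divide_distrib)
        have y': "y' = z * y" using y(1) by (simp add: z_def)
        have z0: "z \<noteq> 0" using one_plus_unit[OF z] by auto
        obtain c where c: "c \<in> H" "y = c * (t * x)" using cls_eqD[OF y(3)] by blast
        have "y' = c * (t * (x * z))" unfolding y' c(2) by (simp add: mult_ac)
        then have "cls y' = cls (t * (x * z))" using cls_eqI[OF c(1)] by simp
        moreover have xz: "x * z - 1 = x * (z - 1) + (x - 1)" by (simp add: algebra_simps)
        have "dv m (x * z - 1)"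
          unfolding xz by (rule dv_add[OF dv_mult_left[OF unit_dv_0[OF one_plus_unit[OF y(2)]] z] y(2)])
        ultimately show "y' \<in> {x. x \<noteq> 0 \<and> cls x \<in> nbhd t}" using y' z0 y(1) by (auto simp: nbhd_def)
      qed
    qed
    then have "openin ?T (nbhd t)" using nb_sub[OF t] opn by simp
    then show ?thesis unfolding T3 by (intro sigma_sets.Basic) simp
  qed
  have nb_meas: "emeasure \<nu> (nbhd t) = emeasure \<nu> (nbhd 1)" if t: "absv t = 1" for t
  proof -
    have eq: "nbhd t = (\<lambda>x. cls t \<otimes>\<^bsub>Gm Mod H\<^esub> x) ` nbhd 1"
      by (simp only: nbhd_def image_image cls_mult mult_1)
    have "cls t \<in> carrier (Gm Mod H)" unfolding carrier_quotient using unit_nonzero[OF t] by (intro imageI) simp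
    from T4[OF this nb_sets[OF absv_one]] show ?thesis by (simp only: eq)
  qed
  \<comment> \<open>Every class contains a unit, so the quotient is the image of the compact unit
    group and has finite measure.\<close>
  have fin: "emeasure \<nu> (space \<nu>) < \<infinity>"
  proof (rule T5)
    show "space \<nu> \<in> sets \<nu>" by (rule sets.top)
    let ?S = "{x::'k. absv x = 1}"
    have "closed {x::'k. dist x 0 = 1}" by (intro closed_Collect_eq continuous_intros)
    moreover have "{x::'k. dist x 0 = 1} = ?S" by (simp add: absv_def)
    ultimately have "compact (OK \<inter> ?S)" using compact_OK by (simp add: compact_Int_closed)
    moreover have "OK \<inter> ?S = ?S" by (auto simp: unit_dv_0)
    ultimately have "compactin (subtopology euclidean (- {0})) ?S"
      by (auto simp: compactin_subtopology)
    moreover have "continuous_map (subtopology euclidean (- {0})) ?T cls"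
      unfolding continuous_map_def
    proof (intro conjI allI impI)
      show "cls \<in> topspace (subtopology euclidean (- {0})) \<rightarrow> topspace ?T"
        using T1 carrier_quotient by auto
      fix U assume "openin ?T U"
      then show "openin (subtopology euclidean (- {0})) {x \<in> topspace (subtopology euclidean (- {0})). cls x \<in> U}"
        unfolding openin_quotient_topology cls_def[symmetric] by simp
    qed
    ultimately have "compactin ?T (cls ` ?S)" by (rule image_compactin)
    moreover have "cls ` ?S = space \<nu>"
    proof (intro equalityI subsetI)
      fix X assume "X \<in> cls ` ?S"
      then obtain t where t: "t \<in> ?S" "X = cls t" by (elim imageE)
      have "t \<noteq> 0" using t(1) by auto
      then show "X \<in> space \<nu>" unfolding sp t(2) by (intro imageI) simp
    next
      fix X assume "X \<in> space \<nu>"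
      then obtain t where t': "t \<in> - {0}" and tX: "X = cls t" unfolding sp by (elim imageE)
      have t: "t \<noteq> 0" "X = cls t" using t' tX by auto
      obtain t0 where "t0 \<in> treps" "cls t \<in> nbhd t0" using treps_cover[OF t(1)] by blast
      then obtain x where x: "dv m (x - 1)" "cls t = cls (t0 * x)" "absv t0 = 1" by (auto simp: nbhd_def treps_unit)
      have "absv (t0 * x) = 1" using x one_plus_unit by (simp add: absv_mult)
      then show "X \<in> cls ` ?S" unfolding t(2) x(2) by (intro imageI) simp
    qed
    ultimately show "compactin ?T (space \<nu>)" by simp
  qed
  have un: "space \<nu> = (\<Union>t\<in>treps. nbhd t)"
  proof (intro equalityI subsetI)
    fix X assume "X \<in> space \<nu>"
    then obtain t where t: "t \<in> - {0}" "X = cls t" unfolding sp by (elim imageE)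
    then have "t \<noteq> 0" by simp
    from treps_cover[OF this] show "X \<in> (\<Union>t\<in>treps. nbhd t)" unfolding t(2) by blast
  next
    fix X assume "X \<in> (\<Union>t\<in>treps. nbhd t)"
    then show "X \<in> space \<nu>" unfolding sp using nb_sub treps_unit by blast
  qed
  define \<nu>1 where "\<nu>1 = measure \<nu> (nbhd 1)"
  have mt: "measure \<nu> (nbhd t) = \<nu>1" if "t \<in> treps" for t
    unfolding \<nu>1_def measure_def using nb_meas[OF treps_unit[OF that]] by simp
  have nb_fin: "emeasure \<nu> (nbhd t) < \<infinity>" if "t \<in> treps" for t
    using emeasure_mono[of "nbhd t" "space \<nu>" \<nu>] fin nb_sub[OF treps_unit[OF that]] unfolding sp
    by (metis T2 sets.top sp le_less_trans)
  have disj: "disjoint_family_on nbhd treps"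
    unfolding disjoint_family_on_def using nbhd_disjoint by blast
  have "(\<Sum>t\<in>treps. emeasure \<nu> (nbhd t)) = emeasure \<nu> (space \<nu>)"
    unfolding un using disj nb_sets treps_unit by (intro sum_emeasure) (auto simp: finite_treps)
  moreover have "emeasure \<nu> (nbhd t) = ennreal \<nu>1" if "t \<in> treps" for t
    using nb_fin[OF that] mt[OF that] by (simp add: emeasure_eq_ennreal_measure less_top[symmetric])
  ultimately have tot: "emeasure \<nu> (space \<nu>) = of_nat (card treps) * ennreal \<nu>1" by simp
  \<comment> \<open>Otherwise the total mass, a finite multiple of this one, would vanish, contrary
    to the definition of a Haar measure.\<close>
  have \<nu>1_0: "\<nu>1 \<noteq> 0" using tot T6 by auto
  have m_tot: "measure \<nu> (space \<nu>) = real (card treps) * \<nu>1"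
    unfolding measure_def tot by (simp add: enn2real_mult \<nu>1_def)
  let ?F = "\<lambda>X. the_elem ((\<lambda>t. B (weil (iota q m \<theta> u t) f) f) ` X)"
  have Fv: "?F X = Phi t * B f f" if "t \<in> treps" "X \<in> nbhd t" for X t
  proof -
    obtain x where x: "dv m (x - 1)" "X = cls (t * x)" using \<open>X \<in> nbhd t\<close> by (auto simp: nbhd_def)
    have t1: "absv t = 1" using treps_unit that(1) by blast
    have x1: "absv x = 1" using one_plus_unit[OF x(1)] .
    have "B (weil (iota q m \<theta> u s) f) f = Phi t * B f f" if s: "s \<in> X" for s
    proof -
      obtain c where c: "c \<in> H" "s = c * (t * x)" using s x(2) by (auto simp: cls_eq)
      have nz: "t * x \<noteq> 0" using t1 x1 by auto
      have "t - t * x = - (t * (x - 1))" by (simp add: algebra_simps)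
      then have "dv m (t - t * x)" using dv_mult_left[OF unit_dv_0[OF t1] x(1)] by simp
      then have "Phi s = Phi t" using Phi_scale[OF c(1) nz] c(2) Phi_cong[OF t1] by simp
      then show ?thesis unfolding Phi_def using B_ff_nonzero by (simp add: field_simps)
    qed
    moreover have "1 * (t * x) \<in> X" unfolding x(2) cls_eq by (rule imageI) simp
    then have "X \<noteq> {}" by blast
    ultimately have "(\<lambda>t. B (weil (iota q m \<theta> u t) f) f) ` X = {Phi t * B f f}" by auto
    then show ?thesis by simp
  qed
  have "(\<integral>X. ?F X \<partial>\<nu>) = (\<integral>X. (\<Sum>t\<in>treps. indicator (nbhd t) X *\<^sub>R (Phi t * B f f)) \<partial>\<nu>)"
  proof (rule Bochner_Integration.integral_cong[OF refl])
    fix X assume "X \<in> space \<nu>"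
    then obtain t where t: "t \<in> treps" "X \<in> nbhd t" unfolding un by blast
    have "(\<Sum>t\<in>treps. indicator (nbhd t) X *\<^sub>R (Phi t * B f f)) = (\<Sum>s\<in>treps. if s = t then Phi t * B f f else 0)"
    proof (intro sum.cong refl)
      fix s assume s: "s \<in> treps"
      show "indicator (nbhd s) X *\<^sub>R (Phi s * B f f) = (if s = t then Phi t * B f f else 0)"
      proof (cases "s = t")
        case True
        then show ?thesis using t(2) by (simp add: indicator_def)
      next
        case False
        then have "X \<notin> nbhd s" using nbhd_disjoint[OF s t(1) _ t(2)] by blast
        then show ?thesis using False by (simp add: indicator_def)
      qed
    qed
    then show "?F X = (\<Sum>t\<in>treps. indicator (nbhd t) X *\<^sub>R (Phi t * B f f))"
      using Fv[OF t] t(1) finite_treps by simp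
  qed
  also have "\<dots> = (\<Sum>t\<in>treps. measure \<nu> (nbhd t) *\<^sub>R (Phi t * B f f))"
    using nb_sets treps_unit nb_fin
    by (intro has_bochner_integral_integral_eq has_bochner_integral_sum has_bochner_integral_indicator) auto
  also have "\<dots> = (\<Sum>t\<in>treps. of_real \<nu>1 * (Phi t * B f f))"
    by (intro sum.cong refl) (simp only: mt scaleR_conv_of_real)
  also have "\<dots> = of_real \<nu>1 * B f f * (\<Sum>t\<in>treps. Phi t)"
    unfolding sum_distrib_left by (intro sum.cong refl) simp
  finally show ?thesis
    unfolding gamma_period_def m_tot using B_ff_nonzero \<nu>1_0 by simp
qed

section \<open>Classes near the identity\<close>

text \<open>A sum that is unchanged by twisting its terms is replaced by its average over all twists.\<close>

lemma two_char_average: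
  fixes G :: "'i \<Rightarrow> complex"
  assumes "finite I"
    and S: "\<And>e c. e \<in> zreps 1 \<Longrightarrow> c \<in> zreps 1 \<Longrightarrow> S = (\<Sum>i\<in>I. G i * (psi1 (a i * e) * psi1 (b i * c)))"
    and ab: "\<And>i. i \<in> I \<Longrightarrow> G i \<noteq> 0 \<Longrightarrow> a i \<in> Zp \<and> b i \<in> Zp"
  shows "S = (\<Sum>i\<in>I. if dv 1 (a i) \<and> dv 1 (b i) then G i else 0)"
proof -
  have "of_nat q * (of_nat q * S) = (\<Sum>e\<in>zreps 1. \<Sum>c\<in>zreps 1. S)" by simp
  also have "\<dots> = (\<Sum>e\<in>zreps 1. \<Sum>c\<in>zreps 1. \<Sum>i\<in>I. G i * (psi1 (a i * e) * psi1 (b i * c)))"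
    by (intro sum.cong refl S)
  also have "\<dots> = (\<Sum>e\<in>zreps 1. \<Sum>i\<in>I. \<Sum>c\<in>zreps 1. G i * (psi1 (a i * e) * psi1 (b i * c)))"
    by (intro sum.cong refl sum.swap)
  also have "\<dots> = (\<Sum>i\<in>I. \<Sum>e\<in>zreps 1. \<Sum>c\<in>zreps 1. G i * (psi1 (a i * e) * psi1 (b i * c)))"
    by (rule sum.swap)
  also have "\<dots> = (\<Sum>i\<in>I. of_nat q * (of_nat q * (if dv 1 (a i) \<and> dv 1 (b i) then G i else 0)))"
  proof (intro sum.cong refl)
    fix i assume i: "i \<in> I"
    have "(\<Sum>e\<in>zreps 1. \<Sum>c\<in>zreps 1. G i * (psi1 (a i * e) * psi1 (b i * c))) =
        G i * ((\<Sum>e\<in>zreps 1. psi1 (a i * e)) * (\<Sum>c\<in>zreps 1. psi1 (b i * c)))"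
      by (subst sum_product) (simp only: sum_distrib_left)
    also have "\<dots> = of_nat q * (of_nat q * (if dv 1 (a i) \<and> dv 1 (b i) then G i else 0))"
    proof (cases "G i = 0")
      case False
      then have "a i \<in> Zp" "b i \<in> Zp" using ab[OF i] by auto
      then show ?thesis by (simp add: psi1_sum)
    qed simp
    finally show "(\<Sum>e\<in>zreps 1. \<Sum>c\<in>zreps 1. G i * (psi1 (a i * e) * psi1 (b i * c))) =
      of_nat q * (of_nat q * (if dv 1 (a i) \<and> dv 1 (b i) then G i else 0))" .
  qed
  finally show ?thesis by (simp flip: sum_distrib_left)
qed

lemma im_dv_cong: "dv e (x - y) \<Longrightarrow> dv e (im x - im y)"
  using dv_im[of e "x - y"] by (simp only: im_diff)

lemma unit_of_norm: "dv (Suc e) (N z + w\<^sup>2) \<Longrightarrow> absv z = 1"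
proof -
  assume d: "dv (Suc e) (N z + w\<^sup>2)"
  have "absv (w\<^sup>2) = 1" using w by (simp add: absv_power)
  moreover have "w\<^sup>2 - (- N z) = N z + w\<^sup>2" by simp
  ultimately have "absv (- N z) = 1" using unit_cong[of "w\<^sup>2" e "- N z"] d by metis
  then have "(absv z)\<^sup>2 = 1" by simp
  then show ?thesis using power2_eq_iff_nonneg[of "absv z" 1] by simp
qed

text \<open>First-order expansion of \<open>lam\<close> at x: the logarithmic derivative in the
  direction y is the imaginary part of y / x. Every twisting argument below goes through it.\<close>

lemma lam_quot_psi1:
  assumes "absv x = 1" "dv 0 y" "x' = x + of_nat q ^ m1 * y"
  shows "lam x' = lam x * psi1 (im (y / x))" "absv x' = 1"
proof -
  have x0: "x \<noteq> 0" using assms(1) by auto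
  have yx: "dv 0 (y / x)" using assms by (simp add: dv_divide_unit_iff)
  have x': "x' = x * (1 + of_nat q ^ m1 * (y / x))" unfolding assms(3) using x0 by (simp add: field_simps)
  show "lam x' = lam x * psi1 (im (y / x))"
    unfolding x' lam_one_plus[OF yx, symmetric]
    using x0 unit_nonzero[OF unit_one_plus_m1[OF yx]] by (rule lam_mult)
  show "absv x' = 1" unfolding x' absv_mult unit_one_plus_m1[OF yx] using assms(1) by simp
qed

text \<open>The summand of \<open>Phi_formula\<close> at t = 1 + \<beta> \<theta>, whose imaginary
  part is \<beta>.\<close>

definition kern :: "nat \<Rightarrow> 'k \<Rightarrow> 'k \<Rightarrow> complex"
  where "kern n \<beta> z = (if dv n (N z + w\<^sup>2) \<and> absv (1 + \<beta> * \<theta> + z * \<beta> * \<theta>) = 1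
    then lam (1 + \<beta> * \<theta>) / lam (1 + \<beta> * \<theta> + z * \<beta> * \<theta>) else 0)"

lemma one_plus_theta_unit: "\<beta> \<in> Zp \<Longrightarrow> absv (1 + \<beta> * \<theta>) = 1"
  using unit_re_im[of 1 \<beta>] by simp

lemma kern_cong_left:
  assumes "dv 0 \<beta>" "dv 0 \<beta>'" "dv m (\<beta> - \<beta>')" "dv 0 z" "\<beta> \<in> Zp"
  shows "kern n \<beta> z = kern n \<beta>' z"
proof -
  have 1: "(1 + \<beta> * \<theta>) - (1 + \<beta>' * \<theta>) = (\<beta> - \<beta>') * \<theta>" by (simp add: algebra_simps)
  have d1: "dv m ((1 + \<beta> * \<theta>) - (1 + \<beta>' * \<theta>))" unfolding 1 using assms by (intro dv_mult_right) auto
  have 2: "(1 + \<beta> * \<theta> + z * \<beta> * \<theta>) - (1 + \<beta>' * \<theta> + z * \<beta>' * \<theta>) = (\<beta> - \<beta>') * (\<theta> * (1 + z))" by (simp add: algebra_simps)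
  have d2: "dv m ((1 + \<beta> * \<theta> + z * \<beta> * \<theta>) - (1 + \<beta>' * \<theta> + z * \<beta>' * \<theta>))"
    unfolding 2 using dv_mult_right[OF assms(3), of "\<theta> * (1 + z)"] dv_mult_left[OF dv_theta dv_add[OF dv_one assms(4)]] by blast
  have "absv (1 + \<beta> * \<theta> + z * \<beta> * \<theta>) = 1 \<longleftrightarrow> absv (1 + \<beta>' * \<theta> + z * \<beta>' * \<theta>) = 1"
    using unit_iff_cong[of m1] d2 m_eq(1) by metis
  moreover have "lam (1 + \<beta> * \<theta> + z * \<beta> * \<theta>) = lam (1 + \<beta>' * \<theta> + z * \<beta>' * \<theta>)" if "absv (1 + \<beta> * \<theta> + z * \<beta> * \<theta>) = 1"
    by (rule lam_cong[OF that d2])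
  moreover have "lam (1 + \<beta> * \<theta>) = lam (1 + \<beta>' * \<theta>)"
    by (rule lam_cong[OF one_plus_theta_unit[OF assms(5)] d1])
  ultimately show ?thesis unfolding kern_def by auto
qed

lemma kern_cong_right:
  assumes "dv j \<beta>" "m = n + j" "dv 0 z" "dv 0 z'" "dv n (z - z')"
  shows "kern n \<beta> z = kern n \<beta> z'"
proof -
  have 2: "(1 + \<beta> * \<theta> + z * \<beta> * \<theta>) - (1 + \<beta> * \<theta> + z' * \<beta> * \<theta>) = (z - z') * \<beta> * \<theta>" by (simp add: algebra_simps)
  have d2: "dv m ((1 + \<beta> * \<theta> + z * \<beta> * \<theta>) - (1 + \<beta> * \<theta> + z' * \<beta> * \<theta>))"
    unfolding 2 assms(2) by (rule dv_mult_right[OF dv_mult[OF assms(5,1)] dv_theta])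
  have "absv (1 + \<beta> * \<theta> + z * \<beta> * \<theta>) = 1 \<longleftrightarrow> absv (1 + \<beta> * \<theta> + z' * \<beta> * \<theta>) = 1"
    using unit_iff_cong[of m1] d2 m_eq(1) by metis
  moreover have "lam (1 + \<beta> * \<theta> + z * \<beta> * \<theta>) = lam (1 + \<beta> * \<theta> + z' * \<beta> * \<theta>)" if "absv (1 + \<beta> * \<theta> + z * \<beta> * \<theta>) = 1"
    by (rule lam_cong[OF that d2])
  moreover have "(N z + w\<^sup>2) - (N z' + w\<^sup>2) = N z - N z'" by simp
  then have "dv n (N z + w\<^sup>2) \<longleftrightarrow> dv n (N z' + w\<^sup>2)"
    using dv_normK_diff[OF assms(3-5)] dv_iff_cong by metis
  ultimately show ?thesis unfolding kern_def by auto
qed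

text \<open>The factor has norm 1 - q^(2 n1) \<theta>^2 c^2, and 2 n1 is at least n1 + 1.\<close>

lemma norm_twist_cong:
  assumes "dv 0 z" "c \<in> Zp" "n1 \<ge> 1"
  shows "dv (Suc n1) (N (z * (1 + of_nat q ^ n1 * \<theta> * c) ) + w\<^sup>2) \<longleftrightarrow> dv (Suc n1) (N z + w\<^sup>2)"
proof (rule dv_iff_cong)
  have c: "bar c = c" "dv 0 c" using assms(2) by (auto simp: Zp_iff bar_Qp)
  have "N (z * (1 + of_nat q ^ n1 * \<theta> * c)) + w\<^sup>2 - (N z + w\<^sup>2) =
      (of_nat q ^ n1 * of_nat q ^ n1) * (- (N z * (\<theta> * c)\<^sup>2))"
    unfolding normK_def using c(1) by (simp add: algebra_simps power2_eq_square)
  moreover have "dv (n1 + n1) ((of_nat q ^ n1 * of_nat q ^ n1) * (- (N z * (\<theta> * c)\<^sup>2)))"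
    using dv_normK[OF assms(1)] c(2)
    by (intro dv_mult_right dv_mult[OF dv_p_power dv_p_power]) (simp add: dv_mult_left dv_0_power)
  ultimately have "dv (n1 + n1) (N (z * (1 + of_nat q ^ n1 * \<theta> * c)) + w\<^sup>2 - (N z + w\<^sup>2))" by (simp only:)
  then show "dv (Suc n1) (N (z * (1 + of_nat q ^ n1 * \<theta> * c)) + w\<^sup>2 - (N z + w\<^sup>2))"
    using assms(3) by (elim dv_mono) simp
qed

lemma twist_isometry:
  assumes "c \<in> Zp" "n1 \<ge> 1"
  shows "absv (1 + of_nat q ^ n1 * \<theta> * c) = 1"
proof -
  have "dv n1 (of_nat q ^ n1 * (\<theta> * c))" using assms by (intro dv_mult_right dv_p_power dv_mult_left) (auto simp: Zp_iff)
  then have "dv (Suc 0) (of_nat q ^ n1 * (\<theta> * c))" using assms(2) by (elim dv_mono) simp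
  then show ?thesis using unit_one_plus by (simp add: mult.assoc)
qed

lemma absv_level_cong:
  assumes "dv (Suc j) (x - y)"
  shows "absv x = 1 / real q ^ j \<longleftrightarrow> absv (y::'k) = 1 / real q ^ j"
proof -
  have *: "absv y = 1 / real q ^ j" if x: "absv x = 1 / real q ^ j" and d: "dv (Suc j) (x - y)" for x y :: 'k
  proof (rule absv_eq_of_dv)
    have xj: "dv j x" using x by (simp add: dv_def)
    show "dv j y" using dv_iff_cong[OF dv_mono[OF d, of j]] xj by simp
    have "1 / real q ^ Suc j < 1 / real q ^ j" using p_gt_1 by (simp add: field_simps)
    then have "\<not> dv (Suc j) x" using x by (simp add: dv_def)
    then show "\<not> dv (Suc j) y" using dv_iff_cong[OF d] by simp
  qed
  show ?thesis using *[of x y] *[of y x] assms by (auto simp: dv_diff_commute)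
qed

text \<open>The substitutions \<open>\<beta> + q^(m-1) e\<close> and \<open>z (1 + q^(n-1) \<theta> c)\<close> twist the terms by characters of \<open>e\<close>
  and \<open>c\<close> which are never both trivial, because \<open>z\<close> is a unit.\<close>

lemma sum_kern_zero:
  assumes nj: "m = n + j" "n \<ge> 2"
  shows "(\<Sum>\<beta>\<in>zreps m. if absv \<beta> = 1 / real q ^ j then \<Sum>z\<in>oreps n. kern n \<beta> z else 0) = 0"
proof -
  define n1 where "n1 = n - 1"
  have n1: "n = Suc n1" "n1 \<ge> 1" "m1 = n1 + j" using nj m_eq(1) by (auto simp: n1_def)
  define G where "G \<beta> z = (if absv \<beta> = 1 / real q ^ j then kern n \<beta> z else 0)" for \<beta> z
  let ?I = "zreps m \<times> oreps n"
  let ?S = "\<Sum>(\<beta>, z)\<in>?I. G \<beta> z"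
  \<comment> \<open>\<open>a\<close> and \<open>b\<close> are the coefficients of e and c in the
    logarithmic derivative of the summand \<open>lam t / lam W\<close>. The quotient by
    \<open>q^j\<close> in \<open>b\<close> appears because q^(n-1) \<beta> = q^m1 (\<beta> /
    q^j).\<close>
  define a where "a = (\<lambda>(\<beta>, z). - im (\<theta> * z / ((1 + \<beta> * \<theta>) * (1 + \<beta> * \<theta> + z * \<beta> * \<theta>))))"
  define b where "b = (\<lambda>(\<beta>, z). - (\<theta>\<^sup>2 * (\<beta> / of_nat q ^ j) * im (z / (1 + \<beta> * \<theta> + z * \<beta> * \<theta>))))"
  have jm1: "Suc j \<le> m1" "Suc j \<le> m" using n1 m_eq(1) by auto
  have Gc1: "G x z = G y z" if "x \<in> Zp" "y \<in> Zp" "dv m (x - y)" "dv 0 z" for x y z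
    using kern_cong_left[of x y z n] absv_level_cong[OF dv_mono[OF that(3) jm1(2)]] that by (simp add: G_def Zp_iff)
  have Gc2: "G \<beta> x = G \<beta> y" if "x \<in> OK" "y \<in> OK" "dv n (x - y)" for \<beta> x y
  proof (cases "absv \<beta> = 1 / real q ^ j")
    case True
    then have "dv j \<beta>" by (simp add: dv_def)
    then show ?thesis using kern_cong_right[of j \<beta> n x y] that nj(1) by (simp add: G_def)
  qed (simp add: G_def)
  have key: "G (\<beta> + of_nat q ^ m1 * e) (z * (1 + of_nat q ^ n1 * \<theta> * c)) = G \<beta> z * (psi1 (a (\<beta>, z) * e) * psi1 (b (\<beta>, z) * c))"
    and key2: "G \<beta> z \<noteq> 0 \<Longrightarrow> a (\<beta>, z) \<in> Zp \<and> b (\<beta>, z) \<in> Zp \<and> \<not> (dv 1 (a (\<beta>, z)) \<and> dv 1 (b (\<beta>, z)))"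
    if h: "\<beta> \<in> Zp" "dv 0 z" "e \<in> Zp" "c \<in> Zp" for \<beta> z e c
  proof -
    define \<beta>1 where "\<beta>1 = \<beta> + of_nat q ^ m1 * e"
    define z1 where "z1 = z * (1 + of_nat q ^ n1 * \<theta> * c)"
    have e0: "dv 0 e" "dv 0 c" "e \<in> Qp" "c \<in> Qp" using h by (auto simp: Zp_iff)
    have b1Z: "\<beta>1 \<in> Zp" unfolding \<beta>1_def using h by (intro Zp_intros)
    have "dv m1 (of_nat q ^ m1 * e)" by (rule dv_m1[OF e0(1)])
    then have db: "dv (Suc j) (\<beta>1 - \<beta>)" using jm1(1) dv_mono by (simp add: \<beta>1_def)
    define t where "t = 1 + \<beta> * \<theta>"
    define W where "W = t + z * \<beta> * \<theta>"
    define t1 where "t1 = 1 + \<beta>1 * \<theta>"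
    define W1 where "W1 = t1 + z1 * \<beta>1 * \<theta>"
    have tu: "absv t = 1" unfolding t_def by (rule one_plus_theta_unit[OF h(1)])
    have t0: "t \<noteq> 0" using tu by auto
    show "G \<beta>1 z1 = G \<beta> z * (psi1 (a (\<beta>, z) * e) * psi1 (b (\<beta>, z) * c))"
    proof (cases "absv \<beta> = 1 / real q ^ j")
      case False
      then have "absv \<beta>1 \<noteq> 1 / real q ^ j" using absv_level_cong[OF db] by simp
      then show ?thesis using False by (simp add: G_def)
    next
      case True
      have T1: "absv \<beta>1 = 1 / real q ^ j" using absv_level_cong[OF db] True by simp
      have "dv j \<beta>" using True by (simp add: dv_def)
      then obtain \<beta>' where b': "dv 0 \<beta>'" "\<beta> = of_nat q ^ j * \<beta>'" by (rule dvE)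
      have b'': "\<beta>' = \<beta> / of_nat q ^ j" using b'(2) by simp
      have b'Q: "\<beta>' \<in> Qp" unfolding b'' using h by (intro Qp_intros) (auto simp: Zp_iff)
      \<comment> \<open>The exact change of W divided by \<open>q^m1\<close>; its last, mixed term
        carries q^(n-1) and drops out under \<open>psi1\<close>.\<close>
      define Y where "Y = e * \<theta> * (1 + z) + z * \<theta>\<^sup>2 * c * \<beta>' + of_nat q ^ n1 * (z * \<theta>\<^sup>2 * c * e)"
      have Yd: "dv 0 Y" unfolding Y_def
        by (intro dv_add dv_mult_right dv_mult_left dv_0_power dv_theta dv_one dv_p_power_0 e0 h b')
      have qn: "of_nat q ^ m1 = (of_nat q ^ n1 * of_nat q ^ j :: 'k)" unfolding n1(3) power_add ..
      have W1: "W1 = W + of_nat q ^ m1 * Y"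
        unfolding W1_def W_def t1_def t_def z1_def \<beta>1_def Y_def qn b'(2)
        by (simp add: algebra_simps power2_eq_square)
      have t1: "t1 = t + of_nat q ^ m1 * (e * \<theta>)" unfolding t1_def t_def \<beta>1_def by (simp add: algebra_simps)
      have et: "dv 0 (e * \<theta>)" using e0 by (intro dv_mult_right) auto
      have cond: "dv n (N z1 + w\<^sup>2) \<longleftrightarrow> dv n (N z + w\<^sup>2)"
        unfolding n1(1) z1_def by (rule norm_twist_cong[OF h(2,4) n1(2)])
      have Wu: "absv W1 = 1 \<longleftrightarrow> absv W = 1"
      proof (rule unit_iff_cong)
        have "dv m1 (of_nat q ^ m1 * Y)" by (rule dv_m1[OF Yd])
        then have "dv (Suc 0) (of_nat q ^ m1 * Y)" using m_eq(2) by (elim dv_mono) simp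
        then show "dv (Suc 0) (W1 - W)" unfolding W1 by simp
      qed
      show ?thesis
      proof (cases "dv n (N z + w\<^sup>2) \<and> absv W = 1")
        case False
        then have "kern n \<beta> z = 0" "kern n \<beta>1 z1 = 0"
          using cond Wu unfolding kern_def W_def t_def W1_def t1_def by auto
        then show ?thesis by (simp add: G_def)
      next
        case c1: True
        have W0: "W \<noteq> 0" using c1 by auto
        have k: "G \<beta> z = lam t / lam W" "G \<beta>1 z1 = lam t1 / lam W1"
          using c1 cond Wu True T1 unfolding G_def kern_def W_def t_def W1_def t1_def by simp_all
        note L1 = lam_quot_psi1(1)[OF tu et t1] and L2 = lam_quot_psi1(1)[OF conjunct2[OF c1] Yd W1]
        have WW: "W - (1 + z) * t = - z" unfolding W_def t_def by (simp add: algebra_simps)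
        have "e * \<theta> / t - Y / W = - e * (\<theta> * z / (t * W)) - c * (\<theta>\<^sup>2 * \<beta>' * (z / W)) - of_nat q ^ n1 * (z * \<theta>\<^sup>2 * c * e / W)"
        proof -
          have "e * \<theta> / t - e * \<theta> * (1 + z) / W = e * \<theta> * ((W - (1 + z) * t) / (t * W))"
            using t0 W0 by (simp add: field_simps)
          then have "e * \<theta> / t - e * \<theta> * (1 + z) / W = - e * (\<theta> * z / (t * W))" unfolding WW by simp
          then show ?thesis unfolding Y_def by (simp add: add_divide_distrib algebra_simps)
        qed
        then have ieq: "im (e * \<theta> / t) - im (Y / W) = a (\<beta>, z) * e + b (\<beta>, z) * c - of_nat q ^ n1 * im (z * \<theta>\<^sup>2 * c * e / W)"
        proof -
          assume eq: "e * \<theta> / t - Y / W = - e * (\<theta> * z / (t * W)) - c * (\<theta>\<^sup>2 * \<beta>' * (z / W)) - of_nat q ^ n1 * (z * \<theta>\<^sup>2 * c * e / W)"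
          have q2: "c * (\<theta>\<^sup>2 * \<beta>') \<in> Qp" using e0 b'Q by (intro theta_sq_Qp Qp_mult)
          have "im (e * \<theta> / t) - im (Y / W) = im (- e * (\<theta> * z / (t * W)) - (c * (\<theta>\<^sup>2 * \<beta>')) * (z / W) - of_nat q ^ n1 * (z * \<theta>\<^sup>2 * c * e / W))"
            unfolding im_diff[symmetric] eq by (simp only: mult.assoc)
          also have "\<dots> = - e * im (\<theta> * z / (t * W)) - c * (\<theta>\<^sup>2 * \<beta>') * im (z / W) - of_nat q ^ n1 * im (z * \<theta>\<^sup>2 * c * e / W)"
            unfolding im_diff im_mult_Qp[OF Qp_minus[OF e0(3)]] im_mult_Qp[OF q2] im_mult_Qp[OF Qp_power[OF Qp_of_nat]] ..
          also have "\<dots> = a (\<beta>, z) * e + b (\<beta>, z) * c - of_nat q ^ n1 * im (z * \<theta>\<^sup>2 * c * e / W)"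
            unfolding a_def b_def W_def t_def b'' by simp
          finally show ?thesis .
        qed
        have ab0: "dv 0 (a (\<beta>, z))" "dv 0 (b (\<beta>, z))"
        proof -
          have "dv 0 (\<theta> * z / (t * W))" using tu c1 h by (simp add: dv_divide_unit_iff absv_mult dv_mult_left)
          then show "dv 0 (a (\<beta>, z))" unfolding a_def by (simp add: t_def W_def dv_im)
          have "dv 0 (z / W)" using c1 h by (simp add: dv_divide_unit_iff)
          then have "dv 0 (\<theta>\<^sup>2 * \<beta>' * im (z / W))" using b'(1) by (intro dv_mult_left dv_0_power dv_im) auto
          then show "dv 0 (b (\<beta>, z))" unfolding b_def b'' by (simp add: t_def W_def)
        qed
        have r0: "dv 1 (of_nat q ^ n1 * im (z * \<theta>\<^sup>2 * c * e / W))"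
        proof -
          have "dv 0 (z * \<theta>\<^sup>2 * c * e / W)" using c1 h e0 by (simp add: dv_divide_unit_iff dv_mult_left dv_0_power)
          then have "dv n1 (of_nat q ^ n1 * im (z * \<theta>\<^sup>2 * c * e / W))" by (intro dv_mult_right dv_p_power dv_im)
          then show ?thesis using n1(2) by (rule dv_mono)
        qed
        have iu: "dv 0 (im (e * \<theta> / t))" "dv 0 (im (Y / W))"
          using tu c1 et Yd by (auto intro!: dv_im simp: dv_divide_unit_iff)
        have "psi1 (im (e * \<theta> / t)) / psi1 (im (Y / W)) = psi1 (im (e * \<theta> / t) + - im (Y / W))"
          using iu psi1_add[of "im (e * \<theta> / t)" "- im (Y / W)"] psi1_minus[OF iu(2)] by (simp add: divide_inverse)
        also have "\<dots> = psi1 (a (\<beta>, z) * e + b (\<beta>, z) * c)"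
        proof (rule psi1_cong)
          show "dv 0 (im (e * \<theta> / t) + - im (Y / W))" using iu by (intro dv_add) auto
          have "im (e * \<theta> / t) + - im (Y / W) - (a (\<beta>, z) * e + b (\<beta>, z) * c) = - (of_nat q ^ n1 * im (z * \<theta>\<^sup>2 * c * e / W))"
            using ieq by simp
          then show "dv 1 (im (e * \<theta> / t) + - im (Y / W) - (a (\<beta>, z) * e + b (\<beta>, z) * c))" using r0 by (simp only: dv_minus_iff)
        qed
        also have "\<dots> = psi1 (a (\<beta>, z) * e) * psi1 (b (\<beta>, z) * c)"
          using ab0 e0 by (intro psi1_add dv_mult_left)
        finally have "psi1 (im (e * \<theta> / t)) / psi1 (im (Y / W)) = psi1 (a (\<beta>, z) * e) * psi1 (b (\<beta>, z) * c)" .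
        then show ?thesis unfolding k L1 L2 times_divide_times_eq[symmetric] by (simp only:)
      qed
    qed
    assume nz: "G \<beta> z \<noteq> 0"
    then have c: "absv \<beta> = 1 / real q ^ j" "dv n (N z + w\<^sup>2)" "absv W = 1"
      unfolding G_def kern_def W_def t_def by (auto split: if_splits)
    have "dv j \<beta>" using c by (simp add: dv_def)
    then obtain \<beta>' where b': "dv 0 \<beta>'" "\<beta> = of_nat q ^ j * \<beta>'" by (rule dvE)
    have b'': "\<beta>' = \<beta> / of_nat q ^ j" using b'(2) by simp
    have b'Q: "\<beta>' \<in> Qp" unfolding b'' using h by (intro Qp_intros) (auto simp: Zp_iff)
    have b'1: "absv \<beta>' = 1" using c(1) b'(2) by (simp add: absv_mult absv_p_power)
    have zu: "absv z = 1" using unit_of_norm[of n1 z] c(2) n1(1) by simp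
    define V where "V = z / W"
    have V1: "absv V = 1" unfolding V_def absv_divide using zu c(3) by simp
    have A: "a (\<beta>, z) = - im (\<theta> * V / t)"
    proof -
      have "\<theta> * z / (t * W) = \<theta> * V / t" unfolding V_def using t0 by simp
      then show ?thesis unfolding a_def by (simp add: t_def W_def)
    qed
    have Bb: "b (\<beta>, z) = - (\<theta>\<^sup>2 * \<beta>' * im V)" unfolding b_def V_def b'' by (simp add: t_def W_def)
    have Z1: "a (\<beta>, z) \<in> Zp" unfolding A using V1 tu
      by (intro Zp_minus) (simp add: Zp_iff dv_im dv_divide_unit_iff dv_mult_left unit_dv_0)
    have "im V \<in> Zp" using V1 by (simp add: Zp_iff dv_im unit_dv_0)
    then have Z2: "b (\<beta>, z) \<in> Zp" unfolding Bb using b'(1) b'Q by (intro Zp_minus Zp_mult Zp_theta_sq) (auto simp: Zp_iff)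
    \<comment> \<open>With V = z / W a unit, triviality of \<open>b\<close> means that q divides
      \<open>im V\<close>, so \<open>re V\<close> is a unit. Then \<open>a\<close> is congruent to -
      re V / N t, also a unit, as the imaginary part of \<theta> * bar t is 1.\<close>
    have "\<not> (dv 1 (a (\<beta>, z)) \<and> dv 1 (b (\<beta>, z)))"
    proof
      assume d: "dv 1 (a (\<beta>, z)) \<and> dv 1 (b (\<beta>, z))"
      then have iV: "dv 1 (im V)" unfolding Bb using b'1 by (simp add: dv_mult_unit_iff absv_mult)
      have rV: "absv (re V) = 1"
        using V1 iV absv_eq_1_not_dv[of "im V" 0] absv_re_im[of V] by (auto simp: max_def One_nat_def split: if_splits)
      have bt: "bar t = 1 - \<beta> * \<theta>" unfolding t_def using h(1) by (simp add: Zp_iff bar_Qp)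
      have Nt: "N t \<in> Qp" "absv (N t) = 1" "N t \<noteq> 0" using tu by auto
      have "\<theta> * V / t - re V / N t * (\<theta> - \<beta> * \<theta>\<^sup>2) = \<theta> * (im V * \<theta>) / t"
      proof -
        have "re V / N t * (\<theta> - \<beta> * \<theta>\<^sup>2) = re V * \<theta> * bar t / N t" unfolding bt by (simp add: algebra_simps power2_eq_square)
        also have "\<dots> = \<theta> * re V / t" using t0 by (simp add: normK_def field_simps)
        finally have "\<theta> * V / t - re V / N t * (\<theta> - \<beta> * \<theta>\<^sup>2) = \<theta> * (V - re V) / t"
          by (simp add: diff_divide_distrib right_diff_distrib)
        moreover have "V - re V = im V * \<theta>" using re_im[of V] by (metis add_diff_cancel_left')
        ultimately show ?thesis by (simp only:)
      qed
      moreover have "dv 1 (\<theta> * (im V * \<theta>) / t)" using iV tu by (simp add: dv_divide_unit_iff dv_mult_unit_iff)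
      ultimately have dd: "dv 1 (im (\<theta> * V / t) - im (re V / N t * (\<theta> - \<beta> * \<theta>\<^sup>2)))" by (intro im_dv_cong) simp
      have "im (\<theta> - \<beta> * \<theta>\<^sup>2) = 1"
        using h(1) by (simp add: im_diff im_theta im_Qp Zp_iff Qp_mult)
      then have "im (re V / N t * (\<theta> - \<beta> * \<theta>\<^sup>2)) = re V / N t"
        using im_mult_Qp[OF Qp_divide[OF re_im_in_Qp(1) Nt(1)], of V "\<theta> - \<beta> * \<theta>\<^sup>2"] by simp
      then have "dv 1 (im (\<theta> * V / t) - re V / N t)" using dd by simp
      moreover have "dv 1 (im (\<theta> * V / t))" using d unfolding A by simp
      ultimately have "dv 1 (re V / N t)" using dv_iff_cong by blast
      then show False using rV Nt by (simp add: dv_divide_unit_iff unit_iff)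
    qed
    then show "a (\<beta>, z) \<in> Zp \<and> b (\<beta>, z) \<in> Zp \<and> \<not> (dv 1 (a (\<beta>, z)) \<and> dv 1 (b (\<beta>, z)))" using Z1 Z2 by blast
  qed
  have shift: "?S = (\<Sum>i\<in>?I. (case i of (\<beta>, z) \<Rightarrow> G \<beta> z) * (psi1 (a i * e) * psi1 (b i * c)))"
    if ec: "e \<in> zreps 1" "c \<in> zreps 1" for e c
  proof -
    have eZ: "e \<in> Zp" "c \<in> Zp" using ec zreps_Zp by auto
    have "(\<Sum>\<beta>\<in>zreps m. \<Sum>z\<in>oreps n. G \<beta> z) = (\<Sum>\<beta>\<in>zreps m. \<Sum>z\<in>oreps n. G (\<beta> + of_nat q ^ m1 * e) z)"
    proof (rule sum_isometry_reindex[OF zreps_rep_system, where \<tau>="\<lambda>\<beta>. \<beta> + of_nat q ^ m1 * e" and g="\<lambda>\<beta>. \<Sum>z\<in>oreps n. G \<beta> z", symmetric])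
      show "x + of_nat q ^ m1 * e \<in> Zp" if "x \<in> Zp" for x using that eZ by (intro Zp_intros)
      show "(\<Sum>z\<in>oreps n. G x z) = (\<Sum>z\<in>oreps n. G y z)" if "x \<in> Zp" "y \<in> Zp" "dv m (x - y)" for x y
        using Gc1[OF that] oreps_OK by (intro sum.cong refl) blast
    qed simp
    also have "\<dots> = (\<Sum>\<beta>\<in>zreps m. \<Sum>z\<in>oreps n. G (\<beta> + of_nat q ^ m1 * e) (z * (1 + of_nat q ^ n1 * \<theta> * c)))"
    proof (rule sum.cong[OF refl], rule sum_isometry_reindex[OF oreps_rep_system _ _ Gc2, symmetric])
      have u1: "absv (1 + of_nat q ^ n1 * \<theta> * c) = 1" by (rule twist_isometry[OF eZ(2) n1(2)])
      fix x y assume "x \<in> OK" "y \<in> OK"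
      then show "x * (1 + of_nat q ^ n1 * \<theta> * c) \<in> OK" using u1 by (simp add: dv_mult_right unit_dv_0)
      show "dv n (x * (1 + of_nat q ^ n1 * \<theta> * c) - y * (1 + of_nat q ^ n1 * \<theta> * c)) \<Longrightarrow> dv n (x - y)"
        using u1 by (simp add: left_diff_distrib[symmetric] dv_mult_unit_iff)
    qed
    also have "\<dots> = (\<Sum>\<beta>\<in>zreps m. \<Sum>z\<in>oreps n. G \<beta> z * (psi1 (a (\<beta>, z) * e) * psi1 (b (\<beta>, z) * c)))"
      using key[OF zreps_Zp oreps_OK eZ] by (intro sum.cong refl) blast
    finally show ?thesis by (simp add: sum.cartesian_product case_prod_beta)
  qed
  have "?S = (\<Sum>i\<in>?I. if dv 1 (a i) \<and> dv 1 (b i) then (case i of (\<beta>, z) \<Rightarrow> G \<beta> z) else 0)"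
  proof (rule two_char_average[OF _ shift])
    fix i assume "i \<in> ?I" "(case i of (\<beta>, z) \<Rightarrow> G \<beta> z) \<noteq> 0"
    then show "a i \<in> Zp \<and> b i \<in> Zp" using key2[OF zreps_Zp oreps_OK Zp_0 Zp_0] by auto
  qed simp_all
  also have "\<dots> = 0"
    using key2[OF zreps_Zp oreps_OK Zp_0 Zp_0] by (intro sum.neutral) (auto split: if_splits)
  finally have "(\<Sum>\<beta>\<in>zreps m. \<Sum>z\<in>oreps n. G \<beta> z) = 0" by (simp add: sum.cartesian_product)
  moreover have "(\<Sum>z\<in>oreps n. G \<beta> z) = (if absv \<beta> = 1 / real q ^ j then \<Sum>z\<in>oreps n. kern n \<beta> z else 0)" for \<beta>
    by (simp add: G_def)
  ultimately show ?thesis by simp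
qed

end

context unram_quad
begin

lemma zero_in_zreps: "0 \<in> zreps n"
proof -
  have "(0::'k) = of_nat 0" "0 \<in> {..<q ^ n}" by simp_all
  then show ?thesis unfolding zreps_def by (rule image_eqI)
qed

end

context period_setup
begin

lemma psi1_nonzero: "dv 0 s \<Longrightarrow> psi1 s \<noteq> 0"
  using psi1_unit_root[of s] by (auto simp: zero_power)

lemma zreps_1_unit: "a \<in> zreps 1 - {0} \<Longrightarrow> absv a = 1"
proof -
  assume a: "a \<in> zreps 1 - {0}"
  have "\<not> dv 1 (a - 0)" using a zreps_rep_system[of 1] zero_in_zreps[of 1] unfolding rep_system_def by blast
  then show ?thesis using a zreps_Zp[of a 1] by (simp add: unit_iff Zp_iff)
qed

lemma sum_zreps_1: 
  fixes g :: "'k \<Rightarrow> complex"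
  shows "(\<Sum>a\<in>zreps 1. g a) = g 0 + (\<Sum>a\<in>zreps 1 - {0}. g a)"
  using zero_in_zreps[of 1] by (intro sum.remove) auto

lemma rep_system_indicator:
  assumes "rep_system n A R" "x \<in> A"
  shows "(\<Sum>y\<in>R. if dv n (x - y) then 1 else 0) = (1 :: complex)"
proof -
  obtain y where y: "y \<in> R" "dv n (x - y)" using assms unfolding rep_system_def by blast
  have "dv n (x - z) \<longleftrightarrow> z = y" if "z \<in> R" for z
  proof
    assume z: "dv n (x - z)"
    have "dv n (z - y)" using dv_trans[of n z x y] z y(2) by (simp add: dv_diff_commute)
    then show "z = y" using assms(1) that y(1) unfolding rep_system_def by blast
  qed (use y in simp)
  then have "(\<Sum>y\<in>R. if dv n (x - y) then 1 else 0) = (\<Sum>z\<in>R. if z = y then 1 else (0::complex))"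
    by (intro sum.cong refl) simp
  also have "\<dots> = 1" using y(1) assms(1) unfolding rep_system_def by simp
  finally show ?thesis .
qed

text \<open>Norm fibres over units all have the same size, since multiplication by an element of
  norm a permutes them, and the fibre over 0 is a single class. Counting all q^2 classes leaves q +
  1 for each of the q - 1 units.\<close>

lemma norm_fibre_count:
  assumes a: "a \<in> Zp" "absv a = 1"
  shows "(\<Sum>z\<in>oreps 1. if dv 1 (N z - a) then 1 else 0) = (of_nat q + 1 :: complex)"
proof -
  define F where "F a = (\<Sum>z\<in>oreps 1. if dv 1 (N z - a) then 1 else (0::complex))" for a
  have F1: "F a = F 1" if a: "a \<in> Qp" "absv a = 1" for a
  proof -
    obtain g where g: "N g = a" using normK_surj_unit[OF a] by metis
    have gu: "absv g = 1"
    proof -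
      have "(absv g)\<^sup>2 = 1" using a(2) unfolding g[symmetric] by simp
      then show ?thesis using power2_eq_iff_nonneg[of "absv g" 1] by simp
    qed
    have "F a = (\<Sum>z\<in>oreps 1. if dv 1 (N (g * z) - a) then 1 else (0::complex))"
      unfolding F_def
    proof (rule sum_isometry_reindex[OF oreps_rep_system, where \<tau>="\<lambda>z. g * z" and g="\<lambda>z. if dv 1 (N z - a) then 1 else (0::complex)", symmetric])
      show "g * x \<in> OK" if "x \<in> OK" for x using that gu by (simp add: dv_mult_unit_iff)
      show "dv 1 (x - y)" if "dv 1 (g * x - g * y)" for x y
        using that gu by (simp add: right_diff_distrib[symmetric] dv_mult_unit_iff)
      fix x y assume h: "x \<in> OK" "y \<in> OK" "dv 1 (x - y)"
      have "(N x - a) - (N y - a) = N x - N y" by simp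
      then have "dv 1 (N x - a) \<longleftrightarrow> dv 1 (N y - a)"
        using dv_normK_diff[of x y 1] h dv_iff_cong[of 1 "N x - a" "N y - a"] by simp
      then show "(if dv 1 (N x - a) then 1 else (0::complex)) = (if dv 1 (N y - a) then 1 else 0)" by simp
    qed
    also have "\<dots> = F 1"
    proof -
      have "N (g * z) - a = a * (N z - 1)" for z unfolding g[symmetric] normK_def by (simp add: algebra_simps)
      then show ?thesis unfolding F_def using a(2) by (simp add: dv_mult_unit_iff)
    qed
    finally show ?thesis .
  qed
  have F0: "F 0 = 1"
  proof -
    have *: "dv 1 (N z - 0) \<longleftrightarrow> dv 1 (0 - z)" if "z \<in> oreps 1" for z
    proof
      assume "dv 1 (N z - 0)"
      then have "dv 1 (z * bar z)" by (simp add: normK_def)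
      then show "dv 1 (0 - z)" using dv_1_multD[of z "bar z"] oreps_OK[OF that] by (simp add: dv_bar)
    next
      assume "dv 1 (0 - z)"
      then show "dv 1 (N z - 0)" using dv_mult_right[of 1 z "bar z"] oreps_OK[OF that] by (simp add: normK_def dv_bar)
    qed
    have "F 0 = (\<Sum>z\<in>oreps 1. if dv 1 (0 - z) then 1 else 0)" unfolding F_def
      by (intro sum.cong refl if_cong *)
    also have "\<dots> = 1" by (rule rep_system_indicator[OF oreps_rep_system]) simp
    finally show ?thesis .
  qed
  have "(of_nat q)\<^sup>2 = (\<Sum>z\<in>oreps 1. 1::complex)" by simp
  also have "\<dots> = (\<Sum>z\<in>oreps 1. \<Sum>a\<in>zreps 1. if dv 1 (N z - a) then 1 else 0)"
  proof (intro sum.cong refl)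
    fix z assume "z \<in> oreps 1"
    then have "N z \<in> Zp" using dv_normK[of 0 z] oreps_OK[of z 1] by (simp add: Zp_iff)
    from rep_system_indicator[OF zreps_rep_system this, of 1]
    show "1 = (\<Sum>a\<in>zreps 1. if dv 1 (N z - a) then 1 else (0::complex))" by (rule sym)
  qed
  also have "\<dots> = (\<Sum>a\<in>zreps 1. F a)" unfolding F_def by (rule sum.swap)
  also have "\<dots> = 1 + (\<Sum>a\<in>zreps 1 - {0}. F 1)"
    unfolding sum_zreps_1 F0 using zreps_1_unit zreps_Zp Zp_Qp by (intro arg_cong2[where f="(+)"] refl sum.cong F1) auto
  also have "\<dots> = 1 + (of_nat q - 1) * F 1"
    using zero_in_zreps[of 1] q_ge_3 by (simp add: card_Diff_singleton of_nat_diff)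
  finally have "(of_nat q - 1) * F 1 = (of_nat q - 1) * (of_nat q + 1 :: complex)"
    by (simp add: algebra_simps power2_eq_square)
  moreover have "of_nat q - 1 \<noteq> (0::complex)" using q_ge_3 by simp
  ultimately have "F 1 = of_nat q + 1" by (metis mult_left_cancel)
  then show ?thesis using F1[OF Zp_Qp[OF a(1)] a(2)] unfolding F_def by simp
qed

text \<open>If q divided \<open>re z\<close>, then \<open>N z + w^2\<close> would be congruent to (w
  + im z \<theta>) (w - im z \<theta>), a product of two units.\<close>

lemma re_unit_of_norm:
  assumes z: "dv 0 z" "dv 1 (N z + w\<^sup>2)"
  shows "absv (re z) = 1"
proof (rule ccontr)
  assume "absv (re z) \<noteq> 1"
  then have d: "dv 1 (re z)" using absv_eq_1_or_dv dv_re[OF z(1)] by blast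
  have "N z + w\<^sup>2 - (re z)\<^sup>2 = (w + im z * \<theta>) * (w - im z * \<theta>)"
    unfolding normK_re_im by (simp add: algebra_simps power2_eq_square)
  moreover have "dv 1 ((re z)\<^sup>2)" using dv_mult_right[OF d dv_re[OF z(1)]] by (simp add: power2_eq_square)
  ultimately have "dv 1 ((w + im z * \<theta>) * (w - im z * \<theta>))" using dv_diff[OF z(2)] by metis
  moreover have "absv (w + im z * \<theta>) = 1" "absv (w - im z * \<theta>) = 1"
    using unit_re_im[of w "im z"] unit_re_im[of w "- im z"] w uw_Zp re_im_Zp[OF z(1)] by (auto intro: Zp_minus)
  ultimately show False by (simp add: dv_mult_unit_iff unit_iff)
qed

text \<open>At the top level n = 1, with \<beta> = q^m1 y, the summand is
  \<open>psi1 (- re z * y)\<close>. As \<open>re z\<close> is a unit, the sum over nonzero y is -1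
  for each of the q + 1 residues z.\<close>

lemma sum_kern_top:
  "(\<Sum>\<beta>\<in>zreps m. if absv \<beta> = 1 / real q ^ m1 then \<Sum>z\<in>oreps 1. kern 1 \<beta> z else 0) = - (of_nat q + 1)"
proof -
  define g where "g \<beta> = (if absv \<beta> = 1 / real q ^ m1 then \<Sum>z\<in>oreps 1. kern 1 \<beta> z else 0)" for \<beta>
  have m': "m = m1 + 1" using m_eq(1) by simp
  have gc: "g x = g y" if "x \<in> Zp" "y \<in> Zp" "dv (m1 + 1) (x - y)" for x y
  proof -
    have "dv (Suc m1) (x - y)" using that(3) unfolding Suc_eq_plus1 .
    note * = absv_level_cong[OF this]
    have "kern 1 x z = kern 1 y z" if "z \<in> oreps 1" for z
      using kern_cong_left[of x y z 1] oreps_OK[OF that] \<open>x \<in> Zp\<close> \<open>y \<in> Zp\<close> \<open>dv (m1 + 1) (x - y)\<close> m' by (metis Zp_dv)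
    then show ?thesis unfolding g_def * by simp
  qed
  have "(\<Sum>\<beta>\<in>zreps m. g \<beta>) = (\<Sum>\<beta>\<in>zreps (m1 + 1). if dv m1 \<beta> then g \<beta> else 0)"
    unfolding m'[symmetric] by (intro sum.cong refl) (simp add: g_def dv_def)
  also have "\<dots> = (\<Sum>y\<in>zreps 1. g (of_nat q ^ m1 * y))" by (rule sum_zreps_dv[OF gc])
  also have "\<dots> = (\<Sum>y\<in>zreps 1 - {0}. g (of_nat q ^ m1 * y))"
    unfolding sum_zreps_1 by (simp add: g_def)
  also have "\<dots> = (\<Sum>y\<in>zreps 1 - {0}. \<Sum>z\<in>oreps 1. if dv 1 (N z + w\<^sup>2) then psi1 (- re z * y) else 0)"
  proof (intro sum.cong refl)
    fix y assume y: "y \<in> zreps 1 - {0}"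
    have yZ: "y \<in> Zp" "dv 0 y" "y \<in> Qp" using y zreps_Zp[of y 1] by (auto simp: Zp_iff)
    have "g (of_nat q ^ m1 * y) = (\<Sum>z\<in>oreps 1. kern 1 (of_nat q ^ m1 * y) z)"
      unfolding g_def using zreps_1_unit[OF y] by (simp add: absv_mult absv_p_power)
    also have "\<dots> = (\<Sum>z\<in>oreps 1. if dv 1 (N z + w\<^sup>2) then psi1 (- re z * y) else 0)"
    proof (intro sum.cong refl)
      fix z assume z: "z \<in> oreps 1"
      note z0 = oreps_OK[OF z]
      define Y where "Y = y * \<theta> + z * y * \<theta>"
      have Y0: "dv 0 Y" unfolding Y_def using yZ z0 by (intro dv_add dv_mult_left) auto
      have yt: "dv 0 (y * \<theta>)" using yZ by (intro dv_mult_left) auto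
      have e: "1 + of_nat q ^ m1 * y * \<theta> = 1 + of_nat q ^ m1 * (y * \<theta>)"
        "1 + of_nat q ^ m1 * (y * \<theta>) + z * (of_nat q ^ m1 * y) * \<theta> = 1 + of_nat q ^ m1 * Y"
        unfolding Y_def by (simp_all add: algebra_simps)
      have iY: "im Y = y + re z * y" "im (y * \<theta>) = y"
        unfolding Y_def im_add im_mult using yZ by (simp_all add: im_mult re_mult im_theta re_theta re_Qp im_Qp)
      have ry: "dv 0 (re z * y)" using yZ dv_re[OF z0] by (intro dv_mult_left)
      have "psi1 y / psi1 (y + re z * y) = psi1 (- re z * y)"
        using psi1_add[OF yZ(2) ry] psi1_minus[OF ry] psi1_nonzero[OF yZ(2)] by (simp add: field_simps)
      then show "kern 1 (of_nat q ^ m1 * y) z = (if dv 1 (N z + w\<^sup>2) then psi1 (- re z * y) else 0)"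
        unfolding kern_def e unit_one_plus_m1[OF Y0] lam_one_plus[OF Y0] lam_one_plus[OF yt] iY by simp
    qed
    finally show "g (of_nat q ^ m1 * y) = (\<Sum>z\<in>oreps 1. if dv 1 (N z + w\<^sup>2) then psi1 (- re z * y) else 0)" .
  qed
  also have "\<dots> = (\<Sum>z\<in>oreps 1. \<Sum>y\<in>zreps 1 - {0}. if dv 1 (N z + w\<^sup>2) then psi1 (- re z * y) else 0)"
    by (rule sum.swap)
  also have "\<dots> = (\<Sum>z\<in>oreps 1. - (if dv 1 (N z - - w\<^sup>2) then 1 else 0))"
  proof (intro sum.cong refl)
    fix z assume z: "z \<in> oreps 1"
    note z0 = oreps_OK[OF z]
    show "(\<Sum>y\<in>zreps 1 - {0}. if dv 1 (N z + w\<^sup>2) then psi1 (- re z * y) else 0) = - (if dv 1 (N z - - w\<^sup>2) then 1 else 0)"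
    proof (cases "dv 1 (N z + w\<^sup>2)")
      case True
      have "\<not> dv 1 (- re z)" using re_unit_of_norm[OF z0 True] by (simp add: unit_iff)
      then have "(\<Sum>y\<in>zreps 1. psi1 (- re z * y)) = 0"
        using psi1_sum[of "- re z"] re_im_Zp(1)[OF z0] by (simp add: Zp_minus)
      then show ?thesis unfolding sum_zreps_1 using True by (simp add: eq_neg_iff_add_eq_0 add.commute)
    qed simp
  qed
  also have "\<dots> = - (of_nat q + 1)"
    unfolding sum_negf using uw_Zp w by (subst norm_fibre_count) (auto simp: absv_power intro!: Zp_minus Zp_power)
  finally show ?thesis unfolding g_def .
qed

lemma level_exists:
  assumes "dv 0 x" "\<not> dv n x"
  shows "\<exists>j<n. absv (x::'k) = 1 / real q ^ j"
proof -
  obtain k where k: "k < n" "\<forall>i\<le>k. \<not> \<not> dv i x" "\<not> dv (Suc k) x"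
    using ex_least_nat_less[of "\<lambda>k. \<not> dv k x" n] assms by auto
  then show ?thesis using absv_eq_of_dv[of k x] by auto
qed

text \<open>Sorted by the valuation of \<beta>: the class of 0 contributes 1, the top level
  contributes (q + 1)/(q - 1), and the other levels cancel by \<open>sum_kern_zero\<close>.\<close>

lemma sum_Phi_one_plus: "(\<Sum>\<beta>\<in>zreps m. Phi (1 + \<beta> * \<theta>)) = 2 * of_nat q / (of_nat q - 1)"
proof -
  define c :: "nat \<Rightarrow> complex" where "c n = (-1) ^ n / of_nat q ^ n * (of_nat q / (of_nat q - 1))" for n
  define h where "h j \<beta> = (if absv \<beta> = 1 / real q ^ j then \<Sum>z\<in>oreps (m - j). kern (m - j) \<beta> z else 0)" for j \<beta>
  have q1: "of_nat q - 1 \<noteq> (0::complex)" using q_ge_3 by simp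
  have "Phi (1 + \<beta> * \<theta>) = (if dv m (0 - \<beta>) then 1 else 0) + (\<Sum>j<m. c (m - j) * h j \<beta>)" if b: "\<beta> \<in> zreps m" for \<beta>
  proof -
    have bZ: "\<beta> \<in> Zp" "dv 0 \<beta>" "\<beta> \<in> Qp" using zreps_Zp[OF b] by (auto simp: Zp_iff)
    have im: "im (1 + \<beta> * \<theta>) = \<beta>" using bZ by simp
    note u = one_plus_theta_unit[OF bZ(1)]
    show ?thesis
    proof (cases "dv m \<beta>")
      case True
      have "h j \<beta> = 0" if "j < m" for j
      proof -
        have "1 / real q ^ m < 1 / real q ^ j" using that p_gt_1 by (simp add: field_simps)
        then have "absv \<beta> \<noteq> 1 / real q ^ j" using True by (simp add: dv_def)
        then show ?thesis by (simp add: h_def)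
      qed
      then show ?thesis using Phi_trivial[OF u] True unfolding im by simp
    next
      case False
      obtain j where j: "j < m" "absv \<beta> = 1 / real q ^ j" using level_exists[OF bZ(2) False] by blast
      have "h i \<beta> = 0" if "i \<noteq> j" for i
      proof -
        have "absv \<beta> \<noteq> 1 / real q ^ i" unfolding j(2) using that p_gt_1 by (simp add: power_inject_exp)
        then show ?thesis by (simp add: h_def)
      qed
      then have "(\<Sum>i<m. c (m - i) * h i \<beta>) = (\<Sum>i<m. if i = j then c (m - j) * h j \<beta> else 0)"
        by (intro sum.cong refl) auto
      also have "\<dots> = c (m - j) * h j \<beta>" using j(1) by simp
      also have "\<dots> = Phi (1 + \<beta> * \<theta>)"
        using Phi_formula[OF u, unfolded im, OF j(2), of "m - j"] j unfolding c_def h_def kern_def by simp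
      finally show ?thesis using False by simp
    qed
  qed
  then have "(\<Sum>\<beta>\<in>zreps m. Phi (1 + \<beta> * \<theta>)) =
      (\<Sum>\<beta>\<in>zreps m. if dv m (0 - \<beta>) then 1 else 0) + (\<Sum>\<beta>\<in>zreps m. \<Sum>j<m. c (m - j) * h j \<beta>)"
    by (simp only: sum.distrib cong: sum.cong)
  also have "(\<Sum>\<beta>\<in>zreps m. if dv m (0 - \<beta>) then 1 else 0) = (1::complex)"
    by (rule rep_system_indicator[OF zreps_rep_system]) (simp add: Zp_iff)
  also have "(\<Sum>\<beta>\<in>zreps m. \<Sum>j<m. c (m - j) * h j \<beta>) = (\<Sum>j<m. c (m - j) * (\<Sum>\<beta>\<in>zreps m. h j \<beta>))"
    unfolding sum_distrib_left by (rule sum.swap)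
  also have "\<dots> = (\<Sum>j<m. if j = m1 then c 1 * - (of_nat q + 1) else 0)"
  proof (intro sum.cong refl)
    fix j assume "j \<in> {..<m}"
    then have j: "j < m" by simp
    show "c (m - j) * (\<Sum>\<beta>\<in>zreps m. h j \<beta>) = (if j = m1 then c 1 * - (of_nat q + 1) else 0)"
    proof (cases "j = m1")
      case True
      have 1: "m - m1 = 1" using m_eq(1) by arith
      show ?thesis unfolding h_def True 1 sum_kern_top by simp
    next
      case False
      have "m = (m - j) + j" "m - j \<ge> 2" using j False m_eq(1) by arith+
      from sum_kern_zero[OF this] show ?thesis unfolding h_def using False by simp
    qed
  qed
  also have "\<dots> = c 1 * - (of_nat q + 1)" using m_eq(1) by (subst sum.delta) auto
  also have "1 + c 1 * - (of_nat q + 1) = 2 * of_nat q / (of_nat q - 1)"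
    unfolding c_def using q1 by (simp add: field_simps)
  finally show ?thesis .
qed

section \<open>Stationary phase\<close>

text \<open>The summand of \<open>Phi_formula\<close> at t = q b + \<theta>. The imaginary part is
  1, so here j = 0 and n = m.\<close>

definition trm :: "'k \<Rightarrow> 'k \<Rightarrow> complex"
  where "trm b z = (if dv m (N z + w\<^sup>2) \<and> absv (of_nat q * b + \<theta> + z * \<theta>) = 1
    then lam (of_nat q * b + \<theta>) / lam (of_nat q * b + \<theta> + z * \<theta>) else 0)"

lemma qb_theta_unit: "b \<in> Zp \<Longrightarrow> absv (of_nat q * b + \<theta>) = 1"
  using unit_re_im[OF qb_Zp Zp_1] by simp

lemma Phi_qb:
  assumes "b \<in> Zp"
  shows "Phi (of_nat q * b + \<theta>) = (-1) ^ m / of_nat q ^ m * (of_nat q / (of_nat q - 1)) * (\<Sum>z\<in>oreps m. trm b z)"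
proof -
  have im: "im (of_nat q * b + \<theta>) = 1"
    using re_im_Qp(2)[of "of_nat q * b" 1] Zp_Qp[OF qb_Zp[OF assms]] by simp
  have "absv (1::'k) = 1 / real q ^ 0" by simp
  from Phi_formula[OF qb_theta_unit[OF assms], unfolded im, OF this, of m] show ?thesis
    unfolding trm_def mult_1_right using m_ge_2 by simp
qed

lemma trm_cong_right:
  assumes "dv 0 z" "dv 0 z'" "dv m (z - z')"
  shows "trm b z = trm b z'"
proof -
  let ?t = "of_nat q * b + \<theta>"
  have 2: "(?t + z * \<theta>) - (?t + z' * \<theta>) = (z - z') * \<theta>" by (simp add: algebra_simps)
  have d2: "dv m ((?t + z * \<theta>) - (?t + z' * \<theta>))" unfolding 2 by (rule dv_mult_right[OF assms(3) dv_theta])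
  have "absv (?t + z * \<theta>) = 1 \<longleftrightarrow> absv (?t + z' * \<theta>) = 1" using unit_iff_cong[of m1] d2 m_eq(1) by metis
  moreover have "lam (?t + z * \<theta>) = lam (?t + z' * \<theta>)" if "absv (?t + z * \<theta>) = 1" by (rule lam_cong[OF that d2])
  moreover have "(N z + w\<^sup>2) - (N z' + w\<^sup>2) = N z - N z'" by simp
  then have "dv m (N z + w\<^sup>2) \<longleftrightarrow> dv m (N z' + w\<^sup>2)"
    using dv_normK_diff[OF assms] dv_iff_cong by metis
  ultimately show ?thesis unfolding trm_def by auto
qed

lemma trm_cong_left:
  assumes "b \<in> Zp" "dv m1 (b - b')"
  shows "trm b z = trm b' z"
proof -
  have "dv (1 + m1) (of_nat q ^ 1 * (b - b'))" using assms(2) by (simp only: dv_p_mult_iff)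
  then have d: "dv m (of_nat q * (b - b'))" using m_eq(1) by (metis plus_1_eq_Suc power_one_right)
  have e: "(of_nat q * b + \<theta> + z * \<theta>) - (of_nat q * b' + \<theta> + z * \<theta>) = of_nat q * (b - b')"
    "(of_nat q * b + \<theta>) - (of_nat q * b' + \<theta>) = of_nat q * (b - b')" by (simp_all add: algebra_simps)
  note d1 = d[folded e(1)] and d2 = d[folded e(2)]
  have "absv (of_nat q * b + \<theta> + z * \<theta>) = 1 \<longleftrightarrow> absv (of_nat q * b' + \<theta> + z * \<theta>) = 1"
    using unit_iff_cong[of m1] d1 m_eq(1) by metis
  moreover have "lam (of_nat q * b + \<theta> + z * \<theta>) = lam (of_nat q * b' + \<theta> + z * \<theta>)" if "absv (of_nat q * b + \<theta> + z * \<theta>) = 1"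
    by (rule lam_cong[OF that d1])
  moreover have "lam (of_nat q * b + \<theta>) = lam (of_nat q * b' + \<theta>)"
    by (rule lam_cong[OF qb_theta_unit[OF assms(1)] d2])
  ultimately show ?thesis unfolding trm_def by auto
qed

text \<open>The critical point, equal to w (w + u \<theta>). It solves \<open>N z = - w^2\<close>
  exactly, because w + u \<theta> has norm -1, together with the criticality equation
  \<open>re z + N z = 0\<close>.\<close>

definition om :: 'k where "om = w\<^sup>2 + u * w * \<theta>"

lemma uw': "u\<^sup>2 * \<theta>\<^sup>2 = w\<^sup>2 + 1"
  using uw by (simp add: algebra_simps)

lemma uw_in_Zp: "u * w \<in> Zp" "w\<^sup>2 \<in> Zp"
  by (auto intro!: Zp_intros)

lemma re_om: "re om = w\<^sup>2" and im_om: "im om = u * w"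
  unfolding om_def using re_im_Qp[of "w\<^sup>2" "u * w"] uw_in_Zp[THEN Zp_Qp] by simp_all

lemma absv_om: "absv om = 1"
  unfolding om_def using w by (intro unit_re_im uw_in_Zp) (simp add: absv_power)

lemma norm_om: "N om = - w\<^sup>2"
proof -
  have "N om = w\<^sup>2 * w\<^sup>2 - (u\<^sup>2 * \<theta>\<^sup>2) * w\<^sup>2" unfolding normK_re_im re_om im_om by (simp add: power2_eq_square)
  also have "\<dots> = - w\<^sup>2" unfolding uw' by (simp add: algebra_simps)
  finally show ?thesis .
qed

lemma one_plus_om: "1 + om = u * \<theta> * (w + u * \<theta>)"
proof -
  have "1 + om = (w\<^sup>2 + 1) + u * w * \<theta>" unfolding om_def by simp
  also have "\<dots> = u * \<theta> * (w + u * \<theta>)" unfolding uw'[symmetric] by (simp add: algebra_simps power2_eq_square)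
  finally show ?thesis .
qed

lemma absv_one_plus_om: "absv (1 + om) = 1"
  unfolding one_plus_om absv_mult using unit_re_im[of w u] u w by simp

lemma om_not_cong_bar: "\<not> dv 1 (om - bar om)"
proof -
  have "om - bar om = 2 * \<theta> * (u * w)" using im_om unfolding im_def by (simp add: field_simps)
  then have "absv (om - bar om) = 1" using u w by (simp add: absv_mult)
  then show ?thesis by (simp add: unit_iff)
qed

text \<open>Given the norm condition, \<open>re z = w^2\<close> modulo q amounts to (im z)^2 = (u
  w)^2, because w^2 + 1 = u^2 \<theta>^2; this factors, and the two signs are \<open>om\<close> and
  its conjugate.\<close>

lemma re_cong_norm:
  assumes z: "dv 0 z" "dv 1 (N z + w\<^sup>2)"
  shows "dv 1 (re z - w\<^sup>2) \<longleftrightarrow> dv 1 (z - om) \<or> dv 1 (z - bar om)"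
proof
  assume "dv 1 (z - om) \<or> dv 1 (z - bar om)"
  moreover have "re (bar om) = w\<^sup>2" using re_om by (simp add: re_def add.commute)
  ultimately show "dv 1 (re z - w\<^sup>2)" using dv_re[of 1 "z - om"] dv_re[of 1 "z - bar om"] re_om by (auto simp: re_diff)
next
  assume d: "dv 1 (re z - w\<^sup>2)"
  have "\<theta>\<^sup>2 * ((im z - u * w) * (im z + u * w)) = (\<theta>\<^sup>2 * (im z)\<^sup>2) - (u\<^sup>2 * \<theta>\<^sup>2) * w\<^sup>2"
    by (simp add: algebra_simps power2_eq_square)
  also have "\<dots> = (re z - w\<^sup>2) * (re z + w\<^sup>2) - (N z + w\<^sup>2)"
    unfolding uw' normK_re_im by (simp add: algebra_simps power2_eq_square)
  finally have e: "\<theta>\<^sup>2 * ((im z - u * w) * (im z + u * w)) = (re z - w\<^sup>2) * (re z + w\<^sup>2) - (N z + w\<^sup>2)" .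
  have "dv 0 (re z + w\<^sup>2)" using dv_re[OF z(1)] uw_in_Zp(2) by (simp add: dv_add Zp_dv)
  then have "dv 1 (\<theta>\<^sup>2 * ((im z - u * w) * (im z + u * w)))" unfolding e by (rule dv_diff[OF dv_mult_right[OF d] z(2)])
  then have "dv 1 ((im z - u * w) * (im z + u * w))" by (simp add: dv_mult_unit_iff)
  moreover have "dv 0 (im z - u * w)" "dv 0 (im z + u * w)"
    using dv_add[OF dv_im[OF z(1)] Zp_dv[OF uw_in_Zp(1)]] dv_diff[OF dv_im[OF z(1)] Zp_dv[OF uw_in_Zp(1)]] by auto
  ultimately have "dv 1 (im z - u * w) \<or> dv 1 (im z + u * w)" by (rule dv_1_multD)
  moreover have "re (bar om) = w\<^sup>2" "im (bar om) = - (u * w)"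
    using re_om im_om by (simp_all add: re_def im_def field_simps)
  ultimately show "dv 1 (z - om) \<or> dv 1 (z - bar om)"
    unfolding dv_re_im_iff[of 1 "z - om"] dv_re_im_iff[of 1 "z - bar om"] re_diff im_diff using d re_om im_om by simp
qed

text \<open>Modulo q the denominator is (1 + z) \<theta>, and the imaginary part of z / ((1 + z)
  \<theta>) is a unit times \<open>re z + N z\<close>.\<close>

lemma stationary_iff:
  assumes b: "b \<in> Zp" and z: "dv 0 z" "dv 1 (N z + w\<^sup>2)" and W: "absv (of_nat q * b + \<theta> + z * \<theta>) = 1"
  shows "dv 1 (im (z / (of_nat q * b + \<theta> + z * \<theta>))) \<longleftrightarrow> dv 1 (z - om) \<or> dv 1 (z - bar om)"
proof -
  define W where "W = of_nat q * b + \<theta> + z * \<theta>"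
  define W0 where "W0 = (1 + z) * \<theta>"
  have d: "W - W0 = of_nat q ^ 1 * b" unfolding W_def W0_def by (simp add: algebra_simps)
  have dW: "dv (Suc 0) (W - W0)" unfolding d using dv_mult_right[OF dv_p_power[of 1] Zp_dv[OF b]] by (simp only: One_nat_def)
  have Wu: "absv W = 1" using W by (simp add: W_def)
  have W0u: "absv W0 = 1" using unit_cong[OF Wu dW] .
  have zu: "absv (1 + z) = 1" using W0u by (simp add: W0_def absv_mult)
  have nz: "W \<noteq> 0" "W0 \<noteq> 0" "1 + z \<noteq> 0" "1 + bar z \<noteq> 0"
    using Wu W0u zu bar_eq_0_iff[of "1 + z"] by auto
  have "z / W - z / W0 = - (z * (W - W0)) / (W * W0)" using nz by (simp add: field_simps)
  moreover have "dv 1 (z * (W - W0))" using dv_mult_left[OF z(1) dW] by (simp only: One_nat_def)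
  ultimately have "dv 1 (z / W - z / W0)" using Wu W0u by (simp add: dv_divide_unit_iff absv_mult)
  then have 1: "dv 1 (im (z / W)) \<longleftrightarrow> dv 1 (im (z / W0))" by (intro dv_iff_cong im_dv_cong)
  define c where "c = 1 / (N (1 + z) * \<theta>\<^sup>2)"
  have c: "c \<in> Qp" "absv c = 1" unfolding c_def using zu by (auto simp: absv_divide absv_mult intro!: Qp_divide Qp_mult)
  have "z / W0 = c * ((z + N z) * \<theta>)"
  proof -
    have "c * ((z + N z) * \<theta>) = (z * \<theta> * (1 + bar z)) / (((1 + z) * \<theta> * \<theta>) * (1 + bar z))"
      unfolding c_def normK_def by (simp add: algebra_simps power2_eq_square)
    also have "\<dots> = z / W0" unfolding W0_def using nz(4) by simp
    finally show ?thesis by (rule sym)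
  qed
  then have "im (z / W0) = c * (re z + N z)"
  proof -
    have "im ((z + N z) * \<theta>) = re z + N z" by (simp add: im_mult re_theta im_theta re_add re_Qp)
    then show ?thesis unfolding \<open>z / W0 = c * ((z + N z) * \<theta>)\<close> im_mult_Qp[OF c(1)] by (simp only:)
  qed
  then have "dv 1 (im (z / W0)) \<longleftrightarrow> dv 1 (re z + N z)" using c(2) by (simp add: dv_mult_unit_iff)
  also have "\<dots> \<longleftrightarrow> dv 1 (re z - w\<^sup>2)"
    using dv_iff_cong[of 1 "re z + N z" "re z - w\<^sup>2"] z(2) by simp
  finally show ?thesis using 1 re_cong_norm[OF z] unfolding W_def by simp
qed

lemma trm_twist:
  assumes b: "b \<in> Zp" and z: "dv 0 z" and c: "c \<in> Zp"
  shows "trm b (z * (1 + of_nat q ^ m1 * \<theta> * c)) =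
    trm b z * psi1 (- (\<theta>\<^sup>2 * im (z / (of_nat q * b + \<theta> + z * \<theta>))) * c)"
proof -
  define z1 where "z1 = z * (1 + of_nat q ^ m1 * \<theta> * c)"
  define t where "t = of_nat q * b + \<theta>"
  define W where "W = t + z * \<theta>"
  define W1 where "W1 = t + z1 * \<theta>"
  have cQ: "dv 0 c" "c \<in> Qp" using c by (auto simp: Zp_iff)
  have Y: "dv 0 (z * \<theta>\<^sup>2 * c)" using z cQ by (intro dv_mult_left dv_0_power) auto
  have W1: "W1 = W + of_nat q ^ m1 * (z * \<theta>\<^sup>2 * c)" unfolding W1_def W_def z1_def by (simp add: algebra_simps power2_eq_square)
  have cond: "dv m (N z1 + w\<^sup>2) \<longleftrightarrow> dv m (N z + w\<^sup>2)"
    using norm_twist_cong[OF z c m_eq(2)] m_eq(1) unfolding z1_def by metis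
  have Wu: "absv W1 = 1 \<longleftrightarrow> absv W = 1"
  proof (rule unit_iff_cong)
    have "dv (Suc 0) (of_nat q ^ m1 * (z * \<theta>\<^sup>2 * c))" using dv_m1[OF Y] m_eq(2) by (elim dv_mono) simp
    then show "dv (Suc 0) (W1 - W)" unfolding W1 by simp
  qed
  show ?thesis
  proof (cases "dv m (N z + w\<^sup>2) \<and> absv W = 1")
    case False
    then have "trm b z = 0" "trm b z1 = 0" using cond Wu unfolding trm_def W_def t_def W1_def by auto
    then show ?thesis by (simp add: z1_def)
  next
    case c1: True
    have k: "trm b z = lam t / lam W" "trm b z1 = lam t / lam W1"
      using c1 cond Wu unfolding trm_def W_def t_def W1_def by simp_all
    have e: "im (z * \<theta>\<^sup>2 * c / W) = \<theta>\<^sup>2 * im (z / W) * c"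
    proof -
      have e: "z * \<theta>\<^sup>2 * c / W = (\<theta>\<^sup>2 * c) * (z / W)" by simp
      show ?thesis unfolding e im_mult_Qp[OF Qp_mult[OF theta_sq_Qp cQ(2)]] by (simp only: ac_simps)
    qed
    have d: "dv 0 (\<theta>\<^sup>2 * im (z / W) * c)"
      using c1 z cQ(1) by (intro dv_mult_left dv_mult_right dv_im dv_0_power) (auto simp: dv_divide_unit_iff)
    have "lam W1 = lam W * psi1 (\<theta>\<^sup>2 * im (z / W) * c)"
      using lam_quot_psi1(1)[OF conjunct2[OF c1] Y W1] unfolding e .
    then have "lam t / lam W1 = lam t / lam W * psi1 (- (\<theta>\<^sup>2 * im (z / W) * c))"
      unfolding psi1_minus[OF d] by (simp add: field_simps)
    then show ?thesis using k unfolding z1_def W_def t_def by simp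
  qed
qed

text \<open>Stationary phase: the substitution \<open>z (1 + q^(m-1) \<theta> c)\<close> cancels all terms except those near the
  critical points \<open>om\<close> and \<open>bar om\<close>.\<close>

lemma sum_trm_split:
  assumes b: "b \<in> Zp"
  shows "(\<Sum>z\<in>oreps m. trm b z) =
    (\<Sum>z\<in>oreps m. if dv 1 (z - om) then trm b z else 0) + (\<Sum>z\<in>oreps m. if dv 1 (z - bar om) then trm b z else 0)"
proof -
  define a where "a z = - (\<theta>\<^sup>2 * im (z / (of_nat q * b + \<theta> + z * \<theta>)))" for z
  \<comment> \<open>A single twist is available here, so the second character of
    \<open>two_char_average\<close> is taken to be trivial.\<close>
  have "(\<Sum>z\<in>oreps m. trm b z) = (\<Sum>z\<in>oreps m. if dv 1 (a z) \<and> dv 1 (0::'k) then trm b z else 0)"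
  proof (rule two_char_average)
    fix e c :: 'k assume e: "e \<in> zreps 1"
    have eZ: "e \<in> Zp" using zreps_Zp[OF e] .
    have u1: "absv (1 + of_nat q ^ m1 * \<theta> * e) = 1" by (rule twist_isometry[OF eZ m_eq(2)])
    have "(\<Sum>z\<in>oreps m. trm b z) = (\<Sum>z\<in>oreps m. trm b (z * (1 + of_nat q ^ m1 * \<theta> * e)))"
    proof (rule sum_isometry_reindex[OF oreps_rep_system, symmetric])
      fix x y assume "x \<in> OK" "y \<in> OK"
      then show "x * (1 + of_nat q ^ m1 * \<theta> * e) \<in> OK" using u1 by (simp add: dv_mult_right unit_dv_0)
      show "dv m (x * (1 + of_nat q ^ m1 * \<theta> * e) - y * (1 + of_nat q ^ m1 * \<theta> * e)) \<Longrightarrow> dv m (x - y)"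
        using u1 by (simp add: left_diff_distrib[symmetric] dv_mult_unit_iff)
    qed (rule trm_cong_right, simp_all)
    also have "\<dots> = (\<Sum>z\<in>oreps m. trm b z * (psi1 (a z * e) * psi1 (0 * c)))"
    proof (intro sum.cong refl)
      fix z assume z: "z \<in> oreps m"
      show "trm b (z * (1 + of_nat q ^ m1 * \<theta> * e)) = trm b z * (psi1 (a z * e) * psi1 (0 * c))"
        unfolding a_def trm_twist[OF b oreps_OK[OF z] eZ] by simp
    qed
    finally show "(\<Sum>z\<in>oreps m. trm b z) = (\<Sum>z\<in>oreps m. trm b z * (psi1 (a z * e) * psi1 (0 * c)))" .
  next
    fix z assume z: "z \<in> oreps m" "trm b z \<noteq> 0"
    then have W: "absv (of_nat q * b + \<theta> + z * \<theta>) = 1" by (auto simp: trm_def split: if_splits)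
    have "im (z / (of_nat q * b + \<theta> + z * \<theta>)) \<in> Zp"
      using oreps_OK[OF z(1)] W by (intro re_im_Zp) (simp add: dv_divide_unit_iff)
    then show "a z \<in> Zp \<and> 0 \<in> (Zp::'k set)" unfolding a_def by (auto intro!: Zp_intros)
  qed simp
  also have "\<dots> = (\<Sum>z\<in>oreps m. (if dv 1 (z - om) then trm b z else 0) + (if dv 1 (z - bar om) then trm b z else 0))"
  proof (intro sum.cong refl)
    fix z assume z: "z \<in> oreps m"
    show "(if dv 1 (a z) \<and> dv 1 (0::'k) then trm b z else 0) =
      (if dv 1 (z - om) then trm b z else 0) + (if dv 1 (z - bar om) then trm b z else 0)"
    proof (cases "trm b z = 0")
      case False
      then have c: "dv m (N z + w\<^sup>2)" "absv (of_nat q * b + \<theta> + z * \<theta>) = 1" by (auto simp: trm_def split: if_splits)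
      have "dv 1 (N z + w\<^sup>2)" using c(1) m_ge_2 by (elim dv_mono) simp
      from stationary_iff[OF b oreps_OK[OF z] this c(2)]
      have "dv 1 (a z) \<longleftrightarrow> dv 1 (z - om) \<or> dv 1 (z - bar om)" unfolding a_def by (simp add: dv_mult_unit_iff)
      moreover have "\<not> (dv 1 (z - om) \<and> dv 1 (z - bar om))"
        using om_not_cong_bar dv_trans[of 1 om z "bar om"] by (auto simp: dv_diff_commute)
      ultimately show ?thesis by auto
    qed simp
  qed
  finally show ?thesis by (simp only: sum.distrib)
qed

text \<open>Under z -> bar z and b -> -b the denominator W becomes - bar W, and \<open>lam\<close>
  of that is the complex conjugate. So the neighbourhood of \<open>bar om\<close> contributes the
  conjugate of what \<open>om\<close> contributes.\<close>

lemma trm_bar: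
  assumes b: "b \<in> Zp"
  shows "trm b (bar z) = cnj (trm (- b) z)"
proof -
  have bb: "bar b = b" using b by (simp add: bar_Qp Zp_iff)
  have e1: "of_nat q * b + \<theta> + bar z * \<theta> = - bar (of_nat q * (- b) + \<theta> + z * \<theta>)"
    and e2: "of_nat q * b + \<theta> = - bar (of_nat q * (- b) + \<theta>)" by (simp_all add: bb)
  have lm: "lam (- bar x) = cnj (lam x)" if "absv x = 1" for x
  proof -
    have "lam (- bar x) = lam ((-1) * bar x)" by simp
    also have "\<dots> = lam (-1) * lam (bar x)" using unit_nonzero[OF that] by (intro lam_mult) auto
    also have "lam (-1) = 1" by (intro lam_Qp_unit Qp_minus) auto
    finally show ?thesis using lam_bar(2)[OF that] by simp
  qed
  define W t where "W = of_nat q * (- b) + \<theta> + z * \<theta>" and "t = of_nat q * (- b) + \<theta>"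
  have N: "N (bar z) = N z" by (simp add: normK_def mult.commute)
  have t: "lam (- bar t) = cnj (lam t)" unfolding t_def by (rule lm[OF qb_theta_unit[OF Zp_minus[OF b]]])
  have "trm b (bar z) = (if dv m (N z + w\<^sup>2) \<and> absv W = 1 then lam (- bar t) / lam (- bar W) else 0)"
    unfolding trm_def N W_def t_def e1[symmetric] e2[symmetric] unfolding e1 absv_minus absv_bar ..
  also have "\<dots> = cnj (if dv m (N z + w\<^sup>2) \<and> absv W = 1 then lam t / lam W else 0)"
    unfolding t by (simp add: lm)
  finally show ?thesis unfolding trm_def W_def t_def .
qed

definition Esum :: complex
  where "Esum = (\<Sum>b\<in>zreps m1. \<Sum>z\<in>oreps m. if dv 1 (z - om) then trm b z else 0)"

lemma sum_trm: "(\<Sum>b\<in>zreps m1. \<Sum>z\<in>oreps m. trm b z) = Esum + cnj Esum"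
proof -
  have g: "(if dv 1 (x - a) then trm b x else 0) = (if dv 1 (y - a) then trm b y else 0)"
    if "dv 0 x" "dv 0 y" "dv m (x - y)" for x y a b
  proof -
    have "dv 1 (x - y)" using that(3) m_ge_2 by (elim dv_mono) simp
    then have "dv 1 ((x - a) - (y - a))" by simp
    then show ?thesis using trm_cong_right[OF that] dv_iff_cong by metis
  qed
  have "(\<Sum>b\<in>zreps m1. \<Sum>z\<in>oreps m. if dv 1 (z - bar om) then trm b z else 0) =
      (\<Sum>b\<in>zreps m1. \<Sum>z\<in>oreps m. if dv 1 (bar z - bar om) then trm b (bar z) else 0)"
  proof (rule sum.cong[OF refl], rule sum_isometry_reindex[OF oreps_rep_system, symmetric])
    show "bar x \<in> OK" if "x \<in> OK" for x using that by simp
    show "dv m (x - y)" if "dv m (bar x - bar y)" for x y using that unfolding bar_diff[symmetric] dv_bar .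
  qed (rule g, simp_all)
  also have "\<dots> = (\<Sum>b\<in>zreps m1. \<Sum>z\<in>oreps m. cnj (if dv 1 (z - om) then trm (- b) z else 0))"
    using trm_bar[OF zreps_Zp] by (intro sum.cong refl) (simp add: bar_diff[symmetric] dv_bar del: bar_diff)
  also have "\<dots> = cnj (\<Sum>b\<in>zreps m1. \<Sum>z\<in>oreps m. if dv 1 (z - om) then trm (- b) z else 0)"
    by (simp only: cnj_sum)
  also have "(\<Sum>b\<in>zreps m1. \<Sum>z\<in>oreps m. if dv 1 (z - om) then trm (- b) z else 0) = Esum"
    unfolding Esum_def
  proof (rule sum_isometry_reindex[OF zreps_rep_system, where \<tau>=uminus and g="\<lambda>b. \<Sum>z\<in>oreps m. if dv 1 (z - om) then trm b z else 0"])
    show "dv m1 (x - y)" if "dv m1 (- x - - y)" for x y :: 'k using that by (simp add: dv_diff_commute)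
    show "(\<Sum>z\<in>oreps m. if dv 1 (z - om) then trm x z else 0) = (\<Sum>z\<in>oreps m. if dv 1 (z - om) then trm y z else 0)"
      if "x \<in> Zp" "dv m1 (x - y)" for x y unfolding trm_cong_left[OF that] ..
  qed (rule Zp_minus)
  finally show ?thesis using sum_trm_split[OF zreps_Zp] by (simp add: Esum_def sum.distrib)
qed

text \<open>The Cayley transform parametrizes the norm-one elements near \<open>1\<close>.\<close>

definition cay :: "'k \<Rightarrow> 'k" where "cay x = (1 + x * \<theta>) / (1 - x * \<theta>)"

lemma cay_diff:
  assumes "1 - x * \<theta> \<noteq> 0" "1 - y * \<theta> \<noteq> 0"
  shows "cay x - cay y = 2 * \<theta> * (x - y) / ((1 - x * \<theta>) * (1 - y * \<theta>))"
  unfolding cay_def using assms by (simp add: diff_frac_eq) (simp add: algebra_simps)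

text \<open>The inverse Cayley transform c0 of s is divisible by q, and \<open>im c0\<close> is a
  unit times N s - 1. Hence c0 agrees modulo \<open>q^m\<close> with its rational part, which is q
  x.\<close>

lemma cay_surj:
  assumes s: "dv 1 (s - 1)" "dv m (N s - 1)"
  shows "\<exists>x\<in>Zp. dv m (cay (of_nat q * x) - s)"
proof -
  have s1: "absv (s + 1) = 1"
  proof -
    have e: "2 - (s + 1) = - (s - 1)" by simp
    have "dv (Suc 0) (2 - (s + 1))" using s(1) unfolding e by (simp only: One_nat_def dv_minus_iff)
    then show ?thesis by (rule unit_cong[OF absv_two])
  qed
  have nz: "s + 1 \<noteq> 0" "bar s + 1 \<noteq> 0" using s1 bar_eq_0_iff[of "s + 1"] by auto
  define c0 where "c0 = (s - 1) / (\<theta> * (s + 1))"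
  have c0d: "dv 1 c0" unfolding c0_def using s s1 by (simp add: dv_divide_unit_iff absv_mult)
  have c1: "1 - c0 * \<theta> = 2 / (s + 1)" "1 + c0 * \<theta> = 2 * s / (s + 1)"
  proof -
    have c: "c0 * \<theta> = (s - 1) / (s + 1)" unfolding c0_def by simp
    show "1 - c0 * \<theta> = 2 / (s + 1)" "1 + c0 * \<theta> = 2 * s / (s + 1)"
      unfolding c using nz(1) by (simp_all add: divide_simps)
  qed
  have cs: "cay c0 = s" unfolding cay_def c1 using nz by simp
  have b0: "bar c0 = - ((bar s - 1) / (\<theta> * (bar s + 1)))" unfolding c0_def by simp
  have "im c0 = (N s - 1) / (\<theta>\<^sup>2 * N (s + 1))"
  proof -
    have f: "(s - 1) / (s + 1) + (bar s - 1) / (bar s + 1) = 2 * ((N s - 1) / N (s + 1))"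
      unfolding add_frac_eq[OF nz] normK_def by (simp add: algebra_simps)
    have "c0 - bar c0 = ((s - 1) / (s + 1) + (bar s - 1) / (bar s + 1)) / \<theta>"
      unfolding b0 unfolding c0_def by (simp add: add_divide_distrib mult.commute)
    then have "im c0 = 2 * ((N s - 1) / N (s + 1)) / \<theta> / (2 * \<theta>)" unfolding im_def f by (simp only:)
    also have "\<dots> = (N s - 1) / (\<theta>\<^sup>2 * N (s + 1))"
      unfolding divide_divide_eq_left divide_divide_eq_right times_divide_eq_right
      by (subst mult_divide_mult_cancel_left[of 2, symmetric]) (simp_all add: power2_eq_square ac_simps)
    finally show ?thesis .
  qed
  then have ic: "dv m (im c0)" using s(2) s1 by (simp add: dv_divide_unit_iff absv_mult)
  have "dv (Suc 0) (re c0)" using dv_re[OF c0d] by (simp only: One_nat_def)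
  then obtain x where x: "dv 0 x" "re c0 = of_nat q ^ Suc 0 * x" by (rule dvE)
  have x': "x = re c0 / of_nat q" using x(2) by simp
  have xZ: "x \<in> Zp" unfolding Zp_iff using x(1) unfolding x' by (auto intro!: Qp_divide)
  have u1: "absv (1 - c0 * \<theta>) = 1" unfolding c1 absv_divide s1 by simp
  have "dv (Suc 0) (- (of_nat q * x * \<theta>))"
    using dv_mult_right[OF dv_mult_right[OF dv_p_power[of "Suc 0"] x(1)] dv_theta] by simp
  then have u2: "absv (1 - of_nat q * x * \<theta>) = 1" using unit_one_plus[of 0 "- (of_nat q * x * \<theta>)"] by simp
  have "of_nat q * x - c0 = - (im c0 * \<theta>)" using x(2) re_im[of c0] by (simp add: algebra_simps)
  then have "dv m (of_nat q * x - c0)" using dv_mult_right[OF ic dv_theta] by (simp only: dv_minus_iff)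
  then have "dv m (cay (of_nat q * x) - cay c0)"
    using u1 u2 unit_nonzero[OF u1] unit_nonzero[OF u2]
    by (simp add: cay_diff dv_divide_unit_iff absv_mult dv_mult_unit_iff)
  then show ?thesis using xZ unfolding cs by blast
qed

lemma one_minus_q_unit: "x \<in> Zp \<Longrightarrow> absv (1 - of_nat q * x * \<theta>) = 1"
  using unit_re_im[OF Zp_1 Zp_minus[OF qb_Zp]] by simp

lemma cay_norm:
  assumes "x \<in> Zp"
  shows "N (cay (of_nat q * x)) = 1" "absv (cay (of_nat q * x)) = 1" "dv 1 (cay (of_nat q * x) - 1)"
proof -
  have bx: "bar x = x" using assms by (simp add: bar_Qp Zp_iff)
  have u1: "absv (1 - of_nat q * x * \<theta>) = 1" by (rule one_minus_q_unit[OF assms])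
  have u2: "absv (1 + of_nat q * x * \<theta>) = 1" by (rule one_plus_theta_unit[OF qb_Zp[OF assms]])
  show "absv (cay (of_nat q * x)) = 1" unfolding cay_def absv_divide u1 u2 by simp
  show "N (cay (of_nat q * x)) = 1" unfolding cay_def normK_def
    using bx unit_nonzero[OF u1] unit_nonzero[OF u2] by (simp add: mult.commute)
  have "cay (of_nat q * x) - 1 = 2 * (of_nat q ^ 1 * x * \<theta>) / (1 - of_nat q * x * \<theta>)"
    unfolding cay_def using unit_nonzero[OF u1] by (simp add: field_simps)
  moreover have "dv 1 (of_nat q ^ 1 * x * \<theta>)"
    by (intro dv_mult_right[OF dv_mult_right[OF dv_p_power] dv_theta] Zp_dv[OF assms])
  ultimately show "dv 1 (cay (of_nat q * x) - 1)" using u1 by (simp only: dv_divide_unit_iff dv_mult_unit_iff(1)[OF absv_two])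
qed

text \<open>With z = om * cay (q c) the norm condition holds exactly and may be dropped: the classes
  of z near \<open>om\<close> with norm congruent to - w^2 are parametrised by c modulo
  \<open>q^m1\<close>.\<close>

lemma Esum_eq:
  "Esum = (\<Sum>b\<in>zreps m1. \<Sum>c\<in>zreps m1. lam (of_nat q * b + \<theta>) / lam (of_nat q * b + (1 + om * cay (of_nat q * c)) * \<theta>))"
  unfolding Esum_def
proof (rule sum.cong[OF refl])
  fix b assume "b \<in> zreps m1"
  then have b: "b \<in> Zp" by (rule zreps_Zp)
  define g where "g z = (if dv 1 (z - om) then trm b z else 0)" for z
  define \<tau> where "\<tau> c = om * cay (of_nat q * c)" for c
  have nz: "om \<noteq> 0" using absv_om by auto
  have "(\<Sum>z\<in>oreps m. g z) = (\<Sum>c\<in>zreps m1. g (\<tau> c))"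
  proof (rule sum_class_reindex[OF zreps_rep_system oreps_rep_system, where \<tau>=\<tau> and g=g, symmetric])
    show "\<tau> x \<in> OK" if "x \<in> Zp" for x
      unfolding \<tau>_def using cay_norm(2)[OF that] absv_om by (simp add: dv_mult_unit_iff unit_dv_0)
    have iff: "dv m (\<tau> x - \<tau> y) \<longleftrightarrow> dv m1 (x - y)" if "x \<in> Zp" "y \<in> Zp" for x y
    proof -
      note u = one_minus_q_unit[OF that(1)] one_minus_q_unit[OF that(2)]
      have "\<tau> x - \<tau> y = om * (2 * \<theta> * (of_nat q ^ 1 * (x - y)) / ((1 - of_nat q * x * \<theta>) * (1 - of_nat q * y * \<theta>)))"
        unfolding \<tau>_def right_diff_distrib[symmetric] cay_diff[OF unit_nonzero[OF u(1)] unit_nonzero[OF u(2)]] by simp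
      then have "dv m (\<tau> x - \<tau> y) \<longleftrightarrow> dv m (of_nat q ^ 1 * (x - y))"
        using u absv_om by (simp add: dv_mult_unit_iff dv_divide_unit_iff absv_mult)
      moreover have "m = 1 + m1" using m_eq(1) by arith
      ultimately have "dv m (\<tau> x - \<tau> y) \<longleftrightarrow> dv (1 + m1) (of_nat q ^ 1 * (x - y))" by metis
      then show ?thesis by (simp only: dv_p_mult_iff)
    qed
    show "dv m (\<tau> x - \<tau> y)" if "x \<in> Zp" "y \<in> Zp" "dv m1 (x - y)" for x y using iff that by blast
    show "dv m1 (x - y)" if "x \<in> Zp" "y \<in> Zp" "dv m (\<tau> x - \<tau> y)" for x y using iff that by blast
    show "\<exists>x\<in>Zp. dv m (\<tau> x - y)" if "y \<in> OK" "g y \<noteq> 0" for y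
    proof -
      have y: "dv 1 (y - om)" "dv m (N y + w\<^sup>2)" using that(2) by (auto simp: g_def trm_def split: if_splits)
      have "y / om - 1 = (y - om) / om" using nz by (simp add: field_simps)
      then have 1: "dv 1 (y / om - 1)" using y absv_om by (simp add: dv_divide_unit_iff)
      have "N (y / om) - 1 = (N y + w\<^sup>2) / (- (w\<^sup>2))"
      proof -
        have "N (y / om) = N y / N om" by (simp add: normK_def)
        then show ?thesis unfolding norm_om by (simp add: field_simps)
      qed
      then have 2: "dv m (N (y / om) - 1)" using y w by (simp add: dv_divide_unit_iff absv_power)
      obtain x where x: "x \<in> Zp" "dv m (cay (of_nat q * x) - y / om)" using cay_surj[OF 1 2] by blast
      have "\<tau> x - y = om * (cay (of_nat q * x) - y / om)" unfolding \<tau>_def using nz by (simp add: field_simps)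
      then have "dv m (\<tau> x - y)" using x(2) absv_om by (simp only: dv_mult_unit_iff)
      then show ?thesis using x(1) by blast
    qed
    show "g x = g y" if "x \<in> OK" "y \<in> OK" "dv m (x - y)" for x y
    proof -
      have "dv 1 (x - y)" using that(3) m_ge_2 by (elim dv_mono) simp
      then have "dv 1 ((x - om) - (y - om))" by simp
      note * = dv_iff_cong[OF this]
      show ?thesis unfolding g_def * using trm_cong_right[of x y b] that by simp
    qed
  qed
  also have "\<dots> = (\<Sum>c\<in>zreps m1. lam (of_nat q * b + \<theta>) / lam (of_nat q * b + (1 + om * cay (of_nat q * c)) * \<theta>))"
  proof (intro sum.cong refl)
    fix c assume "c \<in> zreps m1"
    then have c: "c \<in> Zp" by (rule zreps_Zp)
    have "\<tau> c - om = om * (cay (of_nat q * c) - 1)" unfolding \<tau>_def by (simp add: algebra_simps)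
    then have d1: "dv 1 (\<tau> c - om)" using cay_norm(3)[OF c] absv_om by (simp add: dv_mult_unit_iff)
    have n0: "N (\<tau> c) + w\<^sup>2 = 0"
    proof -
      have "N (\<tau> c) = N om * N (cay (of_nat q * c))" unfolding \<tau>_def by (simp add: normK_def)
      then show ?thesis unfolding norm_om cay_norm(1)[OF c] by simp
    qed
    have W: "absv (of_nat q * b + \<theta> + \<tau> c * \<theta>) = 1"
    proof (rule unit_cong[of "(1 + om) * \<theta>" 0])
      show "absv ((1 + om) * \<theta>) = 1" using absv_one_plus_om by (simp add: absv_mult)
      have "(1 + om) * \<theta> - (of_nat q * b + \<theta> + \<tau> c * \<theta>) = - (of_nat q ^ 1 * b + (\<tau> c - om) * \<theta>)" by (simp add: algebra_simps)
      moreover have "dv 1 (of_nat q ^ 1 * b + (\<tau> c - om) * \<theta>)"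
        by (rule dv_add[OF dv_mult_right[OF dv_p_power Zp_dv[OF b]] dv_mult_right[OF d1 dv_theta]])
      ultimately show "dv (Suc 0) ((1 + om) * \<theta> - (of_nat q * b + \<theta> + \<tau> c * \<theta>))" by (simp only: dv_minus_iff One_nat_def)
    qed
    have e: "of_nat q * b + (1 + om * cay (of_nat q * c)) * \<theta> = of_nat q * b + \<theta> + \<tau> c * \<theta>"
      unfolding \<tau>_def by (simp add: algebra_simps)
    show "g (\<tau> c) = lam (of_nat q * b + \<theta>) / lam (of_nat q * b + (1 + om * cay (of_nat q * c)) * \<theta>)"
      unfolding g_def trm_def e using d1 n0 W by simp
  qed
  finally show "(\<Sum>z\<in>oreps m. if dv 1 (z - om) then trm b z else 0) =
    (\<Sum>c\<in>zreps m1. lam (of_nat q * b + \<theta>) / lam (of_nat q * b + (1 + om * cay (of_nat q * c)) * \<theta>))"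
    unfolding g_def .
qed

end

context unram_quad
begin

text \<open>Integrality is built in, so that congruences of polynomial expressions follow
  mechanically from those of their arguments.\<close>

definition cng :: "nat \<Rightarrow> 'k \<Rightarrow> 'k \<Rightarrow> bool"
  where "cng e x y \<longleftrightarrow> dv 0 x \<and> dv 0 y \<and> dv e (x - y)"

lemma cng_refl: "dv 0 x \<Longrightarrow> cng e x x"
  by (simp add: cng_def)

lemma cng_add: "cng e x x' \<Longrightarrow> cng e y y' \<Longrightarrow> cng e (x + y) (x' + y')"
  unfolding cng_def using dv_add[of e "x - x'" "y - y'"] by (auto intro: dv_add simp: algebra_simps)

lemma cng_diff: "cng e x x' \<Longrightarrow> cng e y y' \<Longrightarrow> cng e (x - y) (x' - y')"
  unfolding cng_def using dv_diff[of e "x - x'" "y - y'"] by (auto intro: dv_diff simp: algebra_simps)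

lemma cng_mult: 
  assumes "cng e x x'" "cng e y y'"
  shows "cng e (x * y) (x' * y')"
proof -
  have "x * y - x' * y' = (x - x') * y + x' * (y - y')" by (simp add: algebra_simps)
  moreover have "dv e ((x - x') * y + x' * (y - y'))"
    using assms unfolding cng_def by (intro dv_add dv_mult_left[of x'] dv_mult_right[of _ "x - x'"]) auto
  ultimately show ?thesis using assms unfolding cng_def by (auto intro: dv_mult_left)
qed

lemma cng_power: "cng e x x' \<Longrightarrow> cng e (x ^ n) (x' ^ n)"
  by (induction n) (auto intro: cng_mult simp: cng_refl)

lemmas cng_intros = cng_add cng_diff cng_mult cng_power

end

section \<open>The phase around the critical point\<close>

context period_setup
begin

text \<open>The ratio om \<theta> / (1 + om), which happens to lie in \<open>Qp\<close>; see
  \<open>om_theta\<close>. Because of it, 1 + om splits off the denominator in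
  \<open>stationary_value\<close> and the remaining factor no longer involves om.\<close>

definition kk :: 'k where "kk = w / u"

lemma kk: "kk \<in> Qp" "absv kk = 1" "dv 0 kk" "kk \<in> Zp"
proof -
  show 1: "kk \<in> Qp" "absv kk = 1" unfolding kk_def using u w by (auto simp: absv_divide)
  then show "dv 0 kk" "kk \<in> Zp" by (auto simp: Zp_iff unit_dv_0)
qed

text \<open>In the coordinates \<open>x = b - c\<close>, \<open>y = c\<close> around the critical point, the summand is a constant times
  \<open>\<lambda>(RR + II \<theta>)\<close>, where \<open>RR\<close> is a unit and \<open>II\<close> is \<open>- kk (x\<^sup>2 + y\<^sup>2)\<close> up to terms of degree four.\<close>

definition PP :: "'k \<Rightarrow> 'k \<Rightarrow> 'k" where "PP x y = 1 - (x + y) * y * \<theta>\<^sup>2"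

definition RR :: "'k \<Rightarrow> 'k \<Rightarrow> 'k"
  where "RR x y = PP x y * (PP x y + (y - x) * kk) - \<theta>\<^sup>2 * x * (x + (x + y) * y * kk)"

definition II :: "'k \<Rightarrow> 'k \<Rightarrow> 'k"
  where "II x y = kk * ((x + y)\<^sup>2 * y\<^sup>2 * \<theta>\<^sup>2 - (x\<^sup>2 + y\<^sup>2))"

definition LL :: "'k \<Rightarrow> 'k \<Rightarrow> complex" where "LL x y = lam (RR x y + II x y * \<theta>)"

lemma dv_theta_sq: "dv 0 (\<theta>\<^sup>2)"
  by (simp add: dv_0_power)

lemma RR_cong: "cng e x x' \<Longrightarrow> cng e y y' \<Longrightarrow> cng e (RR x y) (RR x' y')"
  unfolding RR_def PP_def by (intro cng_intros) (auto intro: cng_refl kk(3) dv_theta_sq)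

lemma II_cong: "cng e x x' \<Longrightarrow> cng e y y' \<Longrightarrow> cng e (II x y) (II x' y')"
  unfolding II_def by (intro cng_intros) (auto intro: cng_refl kk(3) dv_theta_sq)

lemma RR_II_Qp: "x \<in> Qp \<Longrightarrow> y \<in> Qp \<Longrightarrow> RR x y \<in> Qp" "x \<in> Qp \<Longrightarrow> y \<in> Qp \<Longrightarrow> II x y \<in> Qp"
  unfolding RR_def PP_def II_def 
  by (intro Qp_add Qp_diff Qp_mult theta_sq_Qp Qp_power Qp_1 kk(1); assumption)+

lemma RR_unit:
  assumes "dv 1 x" "dv 1 y"
  shows "absv (RR x y) = 1" "dv 1 (RR x y - 1)"
proof -
  have "cng 1 x 0" "cng 1 y 0" using assms by (auto simp: cng_def intro: dv_mono)
  from RR_cong[OF this] have "dv 1 (RR x y - RR 0 0)" unfolding cng_def by blast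
  then show 1: "dv 1 (RR x y - 1)" by (simp add: RR_def PP_def)
  then have "dv (Suc 0) (1 - RR x y)" by (simp only: One_nat_def dv_diff_commute)
  then show "absv (RR x y) = 1" by (rule unit_cong[OF absv_one])
qed

lemma dv_II: "dv i x \<Longrightarrow> dv i y \<Longrightarrow> dv (2 * i) (II x y)"
proof -
  assume a: "dv i x" "dv i y"
  have 0: "dv 0 x" "dv 0 y" using a dv_mono by blast+
  have sq: "dv (2 * i) (x\<^sup>2)" "dv (2 * i) (y\<^sup>2)" using dv_power[of i x 2] dv_power[of i y 2] a by (simp_all add: mult.commute)
  show ?thesis unfolding II_def
    using dv_mult_left[OF kk(3) dv_diff[OF dv_mult_right[OF dv_mult_left[OF dv_0_power[OF dv_add[OF 0]] sq(2)] dv_theta_sq] dv_add[OF sq]]] .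
qed

lemma LL_unit:
  assumes "dv 1 x" "dv 1 y"
  shows "absv (RR x y + II x y * \<theta>) = 1"
proof (rule unit_cong[OF RR_unit(1)[OF assms], of 0])
  have "dv 1 (II x y * \<theta>)" using dv_mult_right[OF dv_mono[OF dv_II[OF assms]] dv_theta] by simp
  then show "dv (Suc 0) (RR x y - (RR x y + II x y * \<theta>))" by (simp add: One_nat_def)
qed

lemma LL_cong:
  assumes "dv 1 x" "dv 1 y" "cng m x x'" "cng m y y'"
  shows "LL x y = LL x' y'"
  unfolding LL_def
proof (rule lam_cong[OF LL_unit[OF assms(1,2)]])
  have "cng m (RR x y + II x y * \<theta>) (RR x' y' + II x' y' * \<theta>)"
    by (intro cng_add cng_mult RR_cong II_cong assms cng_refl dv_theta)
  then show "dv m (RR x y + II x y * \<theta> - (RR x' y' + II x' y' * \<theta>))" by (simp add: cng_def)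
qed

lemma om_theta: "om * \<theta> = (1 + om) * kk"
proof -
  have "om = w * (w + u * \<theta>)" unfolding om_def by (simp add: algebra_simps power2_eq_square)
  then show ?thesis unfolding one_plus_om kk_def by simp
qed

text \<open>The numerator is \<theta> A / (1 - Y \<theta>) and the denominator \<theta> (1 + om) D /
  (1 - Y \<theta>), so the quotient reduces to A and D. Since 1 / lam D = lam (bar D), it is
  \<open>lam\<close> of the polynomial A * bar D, and no logarithm has to be expanded. Writing b as
  \<theta>^2 X makes the numerator \<theta> (1 + X \<theta>).\<close>

lemma stationary_value:
  assumes X: "X \<in> Qp" "dv 1 X" and Y: "Y \<in> Qp" "dv 1 Y"
  shows "lam (\<theta>\<^sup>2 * X + \<theta>) / lam (\<theta>\<^sup>2 * X + (1 + om * cay Y) * \<theta>) = LL (X - Y) Y / lam (1 + om)"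
proof -
  have bX: "bar X = X" "bar Y = Y" "bar kk = kk" using X Y kk by (auto simp: bar_Qp)
  have X0: "dv 0 X" "dv 0 Y" using X(2) Y(2) dv_mono by blast+
  define A where "A = (1 + X * \<theta>) * (1 - Y * \<theta>)"
  define D where "D = A + kk * (2 * Y - X + X * Y * \<theta>)"
  have u1: "absv (1 + X * \<theta>) = 1" using one_plus_theta_unit[of X] X X0 by (simp add: Zp_iff)
  have u2: "absv (1 - Y * \<theta>) = 1" using one_plus_theta_unit[of "- Y"] Y X0 by (simp add: Zp_iff Qp_minus)
  have uA: "absv A = 1" unfolding A_def absv_mult u1 u2 by simp
  have uD: "absv D = 1"
  proof (rule unit_cong[OF uA, of 0])
    have "dv 1 (2 * Y - X + X * Y * \<theta>)"
      by (rule dv_add[OF dv_diff[OF dv_mult_left[OF _ Y(2)] X(2)] dv_mult_right[OF dv_mult_right[OF X(2) X0(2)] dv_theta]]) simp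
    then have "dv 1 (kk * (2 * Y - X + X * Y * \<theta>))" by (rule dv_mult_left[OF kk(3)])
    then show "dv (Suc 0) (A - D)" unfolding D_def by (simp add: One_nat_def)
  qed
  note nz = unit_nonzero[OF u1] unit_nonzero[OF u2] unit_nonzero[OF uA] unit_nonzero[OF uD] unit_nonzero[OF absv_one_plus_om]
  have "(1 + om) * D - (A + om * (1 + Y * \<theta>)) =
      om * (X * \<theta> - 2 * Y * \<theta> - X * Y * \<theta>\<^sup>2) + ((1 + om) * kk) * (2 * Y - X + X * Y * \<theta>)"
    unfolding D_def A_def by (simp add: algebra_simps power2_eq_square)
  also have "\<dots> = 0" unfolding om_theta[symmetric] by (simp add: algebra_simps power2_eq_square)
  finally have DA: "A + om * (1 + Y * \<theta>) = (1 + om) * D" by simp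
  have W: "\<theta>\<^sup>2 * X + (1 + om * cay Y) * \<theta> = \<theta> * ((1 + om) * D) / (1 - Y * \<theta>)"
  proof -
    have "\<theta>\<^sup>2 * X + (1 + om * cay Y) * \<theta> = \<theta> * (A + om * (1 + Y * \<theta>)) / (1 - Y * \<theta>)"
      unfolding cay_def A_def using nz(2) by (simp add: field_simps power2_eq_square)
    then show ?thesis unfolding DA .
  qed
  have T: "\<theta>\<^sup>2 * X + \<theta> = \<theta> * A / (1 - Y * \<theta>)"
  proof -
    have "\<theta> * A / (1 - Y * \<theta>) = \<theta> * (1 + X * \<theta>)" unfolding A_def using nz(2) by simp
    also have "\<dots> = \<theta>\<^sup>2 * X + \<theta>" by (simp add: algebra_simps power2_eq_square)
    finally show ?thesis by (rule sym)
  qed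
  have "lam (\<theta>\<^sup>2 * X + \<theta>) / lam (\<theta>\<^sup>2 * X + (1 + om * cay Y) * \<theta>) = lam A / (lam (1 + om) * lam D)"
    unfolding W T using nz by (simp add: lam_divide lam_mult lam_nonzero)
  also have "\<dots> = lam A * lam (bar D) / lam (1 + om)" unfolding lam_bar(1)[OF uD] by (simp add: field_simps)
  also have "lam A * lam (bar D) = lam (A * bar D)" using nz by (simp add: lam_mult)
  also have "A * bar D = RR (X - Y) Y + II (X - Y) Y * \<theta>"
    unfolding D_def A_def RR_def II_def PP_def by (simp add: bX algebra_simps power2_eq_square)
  finally show ?thesis unfolding LL_def .
qed

text \<open>The part of the phase sum with both coordinates divisible by \<open>q^i\<close>, which
  \<open>DD_step\<close> shows to be independent of i as long as 2 i is at most m.\<close>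

definition DD :: "nat \<Rightarrow> complex"
  where "DD i = (\<Sum>x\<in>zreps (m - i). \<Sum>y\<in>zreps (m - i). LL (of_nat q ^ i * x) (of_nat q ^ i * y))"

lemma dv_q_power: "x \<in> Zp \<Longrightarrow> dv i (of_nat q ^ i * x)"
  by (rule dv_mult_right[OF dv_p_power Zp_dv])

lemma dv_1_q_power: "x \<in> Zp \<Longrightarrow> i \<ge> 1 \<Longrightarrow> dv 1 (of_nat q ^ i * x)"
  by (rule dv_mono[OF dv_q_power])

lemma cng_q_power:
  assumes "x \<in> Zp" "y \<in> Zp" "dv (m - i) (x - y)" "i \<le> m"
  shows "cng m (of_nat q ^ i * x) (of_nat q ^ i * y)"
proof -
  have "dv (i + (m - i)) (of_nat q ^ i * (x - y))" using assms(3) by (simp only: dv_p_mult_iff)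
  then have "dv m (of_nat q ^ i * x - of_nat q ^ i * y)" using assms(4) by (simp add: right_diff_distrib)
  then show ?thesis using dv_mono[OF dv_q_power] assms(1,2) by (auto simp: cng_def)
qed

lemma LL_level:
  assumes "x \<in> Zp" "y \<in> Zp" "x' \<in> Zp" "y' \<in> Zp" "dv (m - i) (x - x')" "dv (m - i) (y - y')" "1 \<le> i" "i \<le> m"
  shows "LL (of_nat q ^ i * x) (of_nat q ^ i * y) = LL (of_nat q ^ i * x') (of_nat q ^ i * y')"
  using assms by (intro LL_cong dv_1_q_power cng_q_power) auto

text \<open>Two permutations of the residues b: scaling by \<theta>^2 fits
  \<open>stationary_value\<close>, and the shift by c passes to the coordinates b - c and c.\<close>

lemma Esum_DD: "Esum = DD 1 / lam (1 + om)"
proof -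
  have m1m: "m - 1 = m1" "1 \<le> m" using m_eq by arith+
  define g where "g b c = lam (of_nat q * b + \<theta>) / lam (of_nat q * b + (1 + om * cay (of_nat q * c)) * \<theta>)" for b c
  have q1: "dv 1 (of_nat q * x)" "of_nat q * x \<in> Qp" "of_nat q * x \<in> Zp" if "x \<in> Zp" for x :: 'k
    using dv_q_power[OF that, of 1] that Zp_Qp[OF qb_Zp[OF that]] qb_Zp[OF that] by simp_all
  have val: "g (\<theta>\<^sup>2 * b) c = LL (of_nat q ^ 1 * (b - c)) (of_nat q ^ 1 * c) / lam (1 + om)" if "b \<in> Zp" "c \<in> Zp" for b c
  proof -
    have e: "of_nat q * (\<theta>\<^sup>2 * b) = \<theta>\<^sup>2 * (of_nat q * b)" by simp
    show ?thesis unfolding g_def e power_one_right right_diff_distrib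
      by (rule stationary_value[OF q1(2,1) q1(2,1)]) (rule that)+
  qed
  have th: "b / \<theta>\<^sup>2 \<in> Zp" if "b \<in> Zp" for b :: 'k
    using that by (auto simp: Zp_iff dv_divide_unit_iff intro!: Qp_divide)
  have gc: "g b c = g b' c" if h: "b \<in> Zp" "b' \<in> Zp" "dv m1 (b - b')" "c \<in> Zp" for b b' c
  proof -
    have 1: "b = \<theta>\<^sup>2 * (b / \<theta>\<^sup>2)" "b' = \<theta>\<^sup>2 * (b' / \<theta>\<^sup>2)" by simp_all
    have "dv m1 ((b - b') / \<theta>\<^sup>2)" using h(3) by (simp add: dv_divide_unit_iff)
    then have "dv (m - 1) ((b / \<theta>\<^sup>2 - c) - (b' / \<theta>\<^sup>2 - c))" unfolding m1m by (simp add: diff_divide_distrib)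
    then have "LL (of_nat q ^ 1 * (b / \<theta>\<^sup>2 - c)) (of_nat q ^ 1 * c) = LL (of_nat q ^ 1 * (b' / \<theta>\<^sup>2 - c)) (of_nat q ^ 1 * c)"
      using h th m1m by (intro LL_level) (auto intro: Zp_diff)
    then show ?thesis using val[OF th[OF h(1)] h(4)] val[OF th[OF h(2)] h(4)] 1 by simp
  qed
  have "Esum = (\<Sum>b\<in>zreps m1. \<Sum>c\<in>zreps m1. g b c)" unfolding Esum_eq g_def ..
  also have "\<dots> = (\<Sum>b\<in>zreps m1. \<Sum>c\<in>zreps m1. g (\<theta>\<^sup>2 * b) c)"
  proof (rule sum_isometry_reindex[OF zreps_rep_system, where \<tau>="\<lambda>b. \<theta>\<^sup>2 * b" and g="\<lambda>b. \<Sum>c\<in>zreps m1. g b c", symmetric])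
    show "\<theta>\<^sup>2 * x \<in> Zp" if "x \<in> Zp" for x using that by (intro Zp_mult Zp_theta_sq)
    show "dv m1 (x - y)" if "dv m1 (\<theta>\<^sup>2 * x - \<theta>\<^sup>2 * y)" for x y
      using that by (simp add: right_diff_distrib[symmetric] dv_mult_unit_iff)
    show "(\<Sum>c\<in>zreps m1. g x c) = (\<Sum>c\<in>zreps m1. g y c)" if "x \<in> Zp" "y \<in> Zp" "dv m1 (x - y)" for x y
      by (rule sum.cong[OF refl]) (rule gc[OF that zreps_Zp])
  qed
  also have "\<dots> = (\<Sum>b\<in>zreps m1. \<Sum>c\<in>zreps m1. LL (of_nat q ^ 1 * (b - c)) (of_nat q ^ 1 * c) / lam (1 + om))"
    by (intro sum.cong refl val zreps_Zp)
  also have "\<dots> = (\<Sum>c\<in>zreps m1. \<Sum>b\<in>zreps m1. LL (of_nat q ^ 1 * (b - c)) (of_nat q ^ 1 * c)) / lam (1 + om)"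
    unfolding sum_divide_distrib by (rule sum.swap)
  also have "(\<Sum>c\<in>zreps m1. \<Sum>b\<in>zreps m1. LL (of_nat q ^ 1 * (b - c)) (of_nat q ^ 1 * c)) =
      (\<Sum>c\<in>zreps m1. \<Sum>b\<in>zreps m1. LL (of_nat q ^ 1 * b) (of_nat q ^ 1 * c))"
  proof (rule sum.cong[OF refl])
    fix c assume "c \<in> zreps m1"
    then have c: "c \<in> Zp" by (rule zreps_Zp)
    show "(\<Sum>b\<in>zreps m1. LL (of_nat q ^ 1 * (b - c)) (of_nat q ^ 1 * c)) = (\<Sum>b\<in>zreps m1. LL (of_nat q ^ 1 * b) (of_nat q ^ 1 * c))"
    proof (rule sum_isometry_reindex[OF zreps_rep_system, where \<tau>="\<lambda>b. b - c" and g="\<lambda>b. LL (of_nat q ^ 1 * b) (of_nat q ^ 1 * c)"])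
      show "x - c \<in> Zp" if "x \<in> Zp" for x using that c by (rule Zp_diff)
      show "dv m1 (x - y)" if "dv m1 ((x - c) - (y - c))" for x y using that by simp
      show "LL (of_nat q ^ 1 * x) (of_nat q ^ 1 * c) = LL (of_nat q ^ 1 * y) (of_nat q ^ 1 * c)"
        if "x \<in> Zp" "y \<in> Zp" "dv m1 (x - y)" for x y
        using that c m1m by (intro LL_level) auto
    qed
  qed
  also have "\<dots> = DD 1" unfolding DD_def m1m by (rule sum.swap)
  finally show ?thesis .
qed

lemma lam_RR: "x \<in> Qp \<Longrightarrow> y \<in> Qp \<Longrightarrow> dv 1 x \<Longrightarrow> dv 1 y \<Longrightarrow> lam (RR x y) = 1"
  by (intro lam_Qp_unit RR_II_Qp RR_unit)

text \<open>The shift has size q^s with s = m - 1 - i. The linear part of the change of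
  \<open>II\<close> is then exactly of size \<open>q^m1\<close>; the quadratic part has q^(2s), and
  2 s is at least m since 2 i + 2 is at most m. The quartic part of \<open>II\<close> changes by a
  multiple of q^(4i + r), which also vanishes modulo q^m.\<close>

lemma LL_shift:
  assumes i: "i \<ge> 1" "2 * i + 2 \<le> m" and Z: "x \<in> Zp" "y \<in> Zp" "\<delta> \<in> Zp" "\<epsilon> \<in> Zp"
  defines "r \<equiv> m - 1 - 2 * i"
  shows "LL (of_nat q ^ i * (x + of_nat q ^ r * \<delta>)) (of_nat q ^ i * (y + of_nat q ^ r * \<epsilon>)) =
    LL (of_nat q ^ i * x) (of_nat q ^ i * y) * (psi1 (- (2 * kk * x) * \<delta>) * psi1 (- (2 * kk * y) * \<epsilon>))"
proof -
  define s where "s = i + r"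
  have s: "s + i = m1" "m \<le> 2 * s" "i + r = s" "m \<le> 4 * i + r" "m \<le> 2 * i + s" "1 \<le> s"
    using i m_eq(1) unfolding s_def r_def by arith+
  let ?Q = "of_nat q :: 'k"
  define x' y' where "x' = x + ?Q ^ r * \<delta>" and "y' = y + ?Q ^ r * \<epsilon>"
  define X Y X' Y' where "X = ?Q ^ i * x" and "Y = ?Q ^ i * y" and "X' = ?Q ^ i * x'" and "Y' = ?Q ^ i * y'"
  have Z': "x' \<in> Zp" "y' \<in> Zp" unfolding x'_def y'_def using Z by (auto intro!: Zp_intros)
  have d1: "dv 1 X" "dv 1 Y" "dv 1 X'" "dv 1 Y'"
    unfolding X_def Y_def X'_def Y'_def using Z Z' i(1) dv_1_q_power by auto
  have Qs: "X \<in> Qp" "Y \<in> Qp" "X' \<in> Qp" "Y' \<in> Qp"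
    unfolding X_def Y_def X'_def Y'_def using Z[THEN Zp_Qp] Z'[THEN Zp_Qp] by (auto intro!: Qp_mult Qp_power)
  have dz: "dv 0 x" "dv 0 y" "dv 0 \<delta>" "dv 0 \<epsilon>" "dv 0 x'" "dv 0 y'" using Z Z' by (auto intro: Zp_dv)
  have XX: "X' = X + ?Q ^ s * \<delta>" "Y' = Y + ?Q ^ s * \<epsilon>"
    unfolding X'_def X_def x'_def Y'_def Y_def y'_def s_def by (simp_all add: power_add algebra_simps)
  have cX: "cng s X' X" "cng s Y' Y"
    unfolding XX cng_def using dv_mult_right[OF dv_p_power dz(3), of s] dv_mult_right[OF dv_p_power dz(4), of s]
      dv_mono[OF d1(1), of 0] dv_mono[OF d1(2), of 0] dv_mono[OF d1(3), of 0] dv_mono[OF d1(4), of 0] by (auto simp: XX)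
  define R R' I I' where "R = RR X Y" and "R' = RR X' Y'" and "I = II X Y" and "I' = II X' Y'"
  define v where "v = - (2 * kk * x) * \<delta> + - (2 * kk * y) * \<epsilon>"
  have v1: "dv 0 (- (2 * kk * x) * \<delta>)" "dv 0 (- (2 * kk * y) * \<epsilon>)"
    using Z kk(4) by (auto intro!: Zp_dv Zp_intros)
  have v0: "dv 0 v" unfolding v_def by (rule dv_add[OF v1])
  have vZ: "v \<in> Qp" unfolding v_def using Z[THEN Zp_Qp] kk(1) by (intro Qp_add Qp_mult Qp_minus Qp_numeral)
  have Ru: "absv R = 1" "absv R' = 1" "dv 1 (R' - 1)" unfolding R_def R'_def using RR_unit d1 by auto
  have R0: "dv 0 R" "dv 0 R'" using Ru by (auto intro: unit_dv_0)
  have RR': "dv s (R' - R)" unfolding R_def R'_def using RR_cong[OF cX] by (simp add: cng_def)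
  have I2: "dv (2 * i) I" unfolding I_def X_def Y_def using dv_q_power Z by (intro dv_II) auto
  have I0: "dv 0 I" "dv 1 I" using I2 i(1) by (auto elim!: dv_mono)
  have Idiff: "dv m (I' - I - ?Q ^ m1 * v)"
  proof -
    define T T' where "T = (x + y)\<^sup>2 * y\<^sup>2 * \<theta>\<^sup>2" and "T' = (x' + y')\<^sup>2 * y'\<^sup>2 * \<theta>\<^sup>2"
    have q2s: "?Q ^ (2 * s) = ?Q ^ s * ?Q ^ s" by (simp add: mult_2 power_add)
    have qm1: "?Q ^ m1 = ?Q ^ s * ?Q ^ i" unfolding s(1)[symmetric] power_add ..
    have "(X + Y)\<^sup>2 * Y\<^sup>2 * \<theta>\<^sup>2 = ?Q ^ (4 * i) * T"
      unfolding X_def Y_def T_def by (simp add: algebra_simps power2_eq_square power_mult power4_eq_xxxx power_mult_distrib mult.commute[of 4])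
    moreover have "(X' + Y')\<^sup>2 * Y'\<^sup>2 * \<theta>\<^sup>2 = ?Q ^ (4 * i) * T'"
      unfolding X'_def Y'_def T'_def by (simp add: algebra_simps power2_eq_square power_mult power4_eq_xxxx power_mult_distrib mult.commute[of 4])
    ultimately have "I' - I = kk * (?Q ^ (4 * i) * T' - ?Q ^ (4 * i) * T - (X'\<^sup>2 - X\<^sup>2) - (Y'\<^sup>2 - Y\<^sup>2))"
      unfolding I_def I'_def II_def by (simp add: algebra_simps)
    also have "X'\<^sup>2 - X\<^sup>2 = 2 * (?Q ^ m1 * (x * \<delta>)) + ?Q ^ (2 * s) * \<delta>\<^sup>2"
      unfolding XX(1) qm1 q2s X_def by (simp add: algebra_simps power2_eq_square)
    also have "Y'\<^sup>2 - Y\<^sup>2 = 2 * (?Q ^ m1 * (y * \<epsilon>)) + ?Q ^ (2 * s) * \<epsilon>\<^sup>2"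
      unfolding XX(2) qm1 q2s Y_def by (simp add: algebra_simps power2_eq_square)
    finally have e: "I' - I - ?Q ^ m1 * v = kk * (?Q ^ (4 * i) * (T' - T) - ?Q ^ (2 * s) * (\<delta>\<^sup>2 + \<epsilon>\<^sup>2))"
      unfolding v_def by (simp add: algebra_simps)
    have cx: "cng r x' x" "cng r y' y" unfolding cng_def using dz dv_mult_right[OF dv_p_power dz(3), of r]
        dv_mult_right[OF dv_p_power dz(4), of r] by (auto simp: x'_def y'_def)
    have "cng r T' T" unfolding T_def T'_def by (intro cng_mult cng_power cng_add cx cng_refl dv_theta_sq dv_theta)
    then have "dv (4 * i + r) (?Q ^ (4 * i) * (T' - T))" unfolding cng_def by (intro dv_mult dv_p_power) auto
    then have "dv m (?Q ^ (4 * i) * (T' - T))" using s(4) by (rule dv_mono)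
    moreover have "dv (2 * s) (?Q ^ (2 * s) * (\<delta>\<^sup>2 + \<epsilon>\<^sup>2))"
      using dz by (intro dv_mult_right dv_p_power dv_add dv_0_power)
    then have "dv m (?Q ^ (2 * s) * (\<delta>\<^sup>2 + \<epsilon>\<^sup>2))" using s(2) by (rule dv_mono)
    ultimately show ?thesis unfolding e by (intro dv_mult_left[OF kk(3)] dv_diff)
  qed
  define F F' where "F = R + I * \<theta>" and "F' = R' + I' * \<theta>"
  have Fu: "absv F = 1" "absv F' = 1"
    unfolding F_def F'_def R_def R'_def I_def I'_def using LL_unit d1 by auto
  have Eu: "absv (1 + ?Q ^ m1 * (v * \<theta>)) = 1" using v0 by (intro unit_one_plus_m1 dv_mult_right) auto
  have lr: "lam R = 1" "lam R' = 1" unfolding R_def R'_def using lam_RR Qs d1 by auto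
  \<comment> \<open>\<open>RR\<close> is a unit of \<open>Qp\<close> and invisible to
    \<open>lam\<close>, so cross-multiplying with R and R' compares both values without a
    division.\<close>
  have "lam F' = lam (R * F')" using lr unit_nonzero[OF Ru(1)] unit_nonzero[OF Fu(2)] by (simp add: lam_mult)
  also have "\<dots> = lam (R' * F * (1 + ?Q ^ m1 * (v * \<theta>)))"
  proof (rule lam_cong)
    show "absv (R * F') = 1" using Ru Fu by (simp add: absv_mult)
    have "R * F' - R' * F * (1 + ?Q ^ m1 * (v * \<theta>)) =
        \<theta> * (R * (I' - I - ?Q ^ m1 * v) - (?Q ^ m1 * v * R) * (R' - 1) - I * (R' - R)) - (?Q ^ m1 * v * I) * (R' * \<theta>\<^sup>2)"
      unfolding F_def F'_def by (simp add: algebra_simps power2_eq_square)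
    moreover have "dv m (R * (I' - I - ?Q ^ m1 * v))" using R0(1) Idiff by (rule dv_mult_left)
    moreover have "dv m ((?Q ^ m1 * v * R) * (R' - 1))"
    proof -
      have "dv (m1 + 1) ((?Q ^ m1 * v * R) * (R' - 1))" using v0 R0 Ru(3) by (intro dv_mult dv_mult_right dv_p_power)
      then show ?thesis using m_eq(1) by (metis Suc_eq_plus1)
    qed
    moreover have "dv m (I * (R' - R))" using dv_mono[OF dv_mult[OF I2 RR'] s(5)] .
    moreover have "dv m ((?Q ^ m1 * v * I) * (R' * \<theta>\<^sup>2))"
    proof -
      have "dv (m1 + 1) ((?Q ^ m1 * v) * I)" using v0 I0(2) by (intro dv_mult dv_mult_right dv_p_power)
      then have "dv m (?Q ^ m1 * v * I)" using m_eq(1) by (metis Suc_eq_plus1)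
      then show ?thesis by (rule dv_mult_right[OF _ dv_mult_right[OF R0(2) dv_theta_sq]])
    qed
    ultimately show "dv m (R * F' - R' * F * (1 + ?Q ^ m1 * (v * \<theta>)))"
      by (metis dv_diff dv_mult_left[OF dv_theta])
  qed
  also have "\<dots> = lam F * lam (1 + ?Q ^ m1 * (v * \<theta>))"
    using lr unit_nonzero[OF Ru(2)] unit_nonzero[OF Fu(1)] unit_nonzero[OF Eu] by (simp add: lam_mult)
  also have "lam (1 + ?Q ^ m1 * (v * \<theta>)) = psi1 v"
  proof -
    have "im (v * \<theta>) = v" using im_mult_Qp[OF vZ, of \<theta>] by (simp add: im_theta)
    then show ?thesis using lam_one_plus[OF dv_mult_right[OF v0 dv_theta]] by simp
  qed
  also have "psi1 v = psi1 (- (2 * kk * x) * \<delta>) * psi1 (- (2 * kk * y) * \<epsilon>)"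
    unfolding v_def using v1 by (rule psi1_add)
  finally show ?thesis
    unfolding LL_def F_def F'_def R_def R'_def I_def I'_def X_def Y_def X'_def Y'_def x'_def y'_def .
qed

end

section \<open>Gauss sums and the stationary value\<close>

context weil_setup
begin

definition gs :: "'k \<Rightarrow> complex"
  where "gs k = (\<Sum>x\<in>zreps 1. psi1 (- k * x\<^sup>2))"

lemma gs_term_dv: "k \<in> Zp \<Longrightarrow> x \<in> Zp \<Longrightarrow> dv 0 (- k * x\<^sup>2)"
  by (intro Zp_dv Zp_intros)

lemma gs_cong:
  assumes "k \<in> Zp" "k' \<in> Zp" "dv 1 (k - k')"
  shows "gs k = gs k'"
  unfolding gs_def
proof (intro sum.cong refl psi1_cong gs_term_dv assms zreps_Zp)
  fix x assume "x \<in> zreps 1"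
  then have "dv 0 (x\<^sup>2)" by (intro Zp_dv Zp_power zreps_Zp)
  then have "dv 1 ((k - k') * x\<^sup>2)" by (rule dv_mult_right[OF assms(3)])
  moreover have "- k * x\<^sup>2 - (- k' * x\<^sup>2) = - ((k - k') * x\<^sup>2)" by (simp add: algebra_simps)
  ultimately show "dv 1 (- k * x\<^sup>2 - (- k' * x\<^sup>2))" by (simp only: dv_minus_iff)
qed

text \<open>The classical computation: after x -> x + y in the double sum the exponent is linear in
  y, and the sum over y forces x = 0.\<close>

lemma gs_abs_sq:
  assumes k: "k \<in> Zp" "absv k = 1"
  shows "gs k * cnj (gs k) = of_nat q"
proof -
  have sq: "psi1 (- k * x\<^sup>2) * cnj (psi1 (- k * y\<^sup>2)) = psi1 (- k * (x\<^sup>2 - y\<^sup>2))" if "x \<in> Zp" "y \<in> Zp" for x y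
  proof -
    have e: "- k * (x\<^sup>2 - y\<^sup>2) = - k * x\<^sup>2 + - (- k * y\<^sup>2)" by (simp add: algebra_simps)
    have "dv 0 (- (- k * y\<^sup>2))" unfolding dv_minus_iff by (rule gs_term_dv[OF k(1) that(2)])
    then show ?thesis unfolding e psi1_cnj[OF gs_term_dv[OF k(1) that(2)]] by (rule psi1_add[OF gs_term_dv[OF k(1) that(1)], symmetric])
  qed
  have "gs k * cnj (gs k) = (\<Sum>x\<in>zreps 1. \<Sum>y\<in>zreps 1. psi1 (- k * x\<^sup>2) * cnj (psi1 (- k * y\<^sup>2)))"
    unfolding gs_def cnj_sum by (rule sum_product)
  also have "\<dots> = (\<Sum>x\<in>zreps 1. \<Sum>y\<in>zreps 1. psi1 (- k * (x\<^sup>2 - y\<^sup>2)))"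
    by (intro sum.cong refl sq zreps_Zp)
  also have "\<dots> = (\<Sum>y\<in>zreps 1. \<Sum>x\<in>zreps 1. psi1 (- k * (x\<^sup>2 - y\<^sup>2)))" by (rule sum.swap)
  also have "\<dots> = (\<Sum>y\<in>zreps 1. \<Sum>x\<in>zreps 1. psi1 (- k * ((x + y)\<^sup>2 - y\<^sup>2)))"
  proof (rule sum.cong[OF refl])
    fix y assume "y \<in> zreps 1"
    then have y: "y \<in> Zp" by (rule zreps_Zp)
    show "(\<Sum>x\<in>zreps 1. psi1 (- k * (x\<^sup>2 - y\<^sup>2))) = (\<Sum>x\<in>zreps 1. psi1 (- k * ((x + y)\<^sup>2 - y\<^sup>2)))"
    proof (rule sum_isometry_reindex[OF zreps_rep_system, where \<tau>="\<lambda>x. x + y" and g="\<lambda>x. psi1 (- k * (x\<^sup>2 - y\<^sup>2))", symmetric])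
      show "x + y \<in> Zp" if "x \<in> Zp" for x using that y by (rule Zp_add)
      show "dv 1 (a - b)" if "dv 1 (a + y - (b + y))" for a b using that by simp
      fix a b assume h: "a \<in> Zp" "b \<in> Zp" "dv 1 (a - b)"
      show "psi1 (- k * (a\<^sup>2 - y\<^sup>2)) = psi1 (- k * (b\<^sup>2 - y\<^sup>2))"
      proof (rule psi1_cong)
        show "dv 0 (- k * (a\<^sup>2 - y\<^sup>2))" using k h y by (intro Zp_dv Zp_intros)
        have "- k * (a\<^sup>2 - y\<^sup>2) - - k * (b\<^sup>2 - y\<^sup>2) = (a - b) * (- k * (a + b))" by (simp add: algebra_simps power2_eq_square)
        moreover have "dv 0 (- k * (a + b))" using k h by (intro Zp_dv Zp_intros)
        ultimately show "dv 1 (- k * (a\<^sup>2 - y\<^sup>2) - - k * (b\<^sup>2 - y\<^sup>2))" using dv_mult_right[OF h(3)] by (simp only:)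
      qed
    qed
  qed
  also have "\<dots> = (\<Sum>y\<in>zreps 1. \<Sum>x\<in>zreps 1. psi1 (- k * x\<^sup>2) * psi1 ((- 2 * k * x) * y))"
  proof (intro sum.cong refl)
    fix x y assume "y \<in> zreps 1" "x \<in> zreps 1"
    then have xy: "x \<in> Zp" "y \<in> Zp" by (auto intro: zreps_Zp)
    have e: "- k * ((x + y)\<^sup>2 - y\<^sup>2) = - k * x\<^sup>2 + (- 2 * k * x) * y" by (simp add: algebra_simps power2_eq_square)
    have "- 2 * k * x * y \<in> Zp" using Zp_minus[OF Zp_mult[OF Zp_mult[OF Zp_mult[OF Zp_numeral k(1)] xy(1)] xy(2)]] by simp
    then show "psi1 (- k * ((x + y)\<^sup>2 - y\<^sup>2)) = psi1 (- k * x\<^sup>2) * psi1 ((- 2 * k * x) * y)"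
      unfolding e by (intro psi1_add gs_term_dv k xy Zp_dv)
  qed
  also have "\<dots> = (\<Sum>x\<in>zreps 1. psi1 (- k * x\<^sup>2) * (\<Sum>y\<in>zreps 1. psi1 ((- 2 * k * x) * y)))"
    unfolding sum_distrib_left by (rule sum.swap)
  also have "\<dots> = (\<Sum>x\<in>zreps 1. if x = 0 then of_nat q else 0)"
  proof (intro sum.cong refl)
    fix x assume xr: "x \<in> zreps 1"
    then have x: "x \<in> Zp" by (rule zreps_Zp)
    have Z: "- 2 * k * x \<in> Zp" using Zp_minus[OF Zp_mult[OF Zp_mult[OF Zp_numeral k(1)] x]] by simp
    have "absv (- 2 * k) = 1" using k by (simp add: absv_mult)
    then have "dv 1 (- 2 * k * x) \<longleftrightarrow> dv 1 (x - 0)" by (simp only: dv_mult_unit_iff diff_0_right)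
    also have "\<dots> \<longleftrightarrow> x = 0" using zreps_rep_system[of 1] zero_in_zreps[of 1] xr unfolding rep_system_def by auto
    finally show "psi1 (- k * x\<^sup>2) * (\<Sum>y\<in>zreps 1. psi1 ((- 2 * k * x) * y)) = (if x = 0 then of_nat q else 0)"
      unfolding psi1_sum[OF Z] by simp
  qed
  also have "\<dots> = of_nat q" using zero_in_zreps[of 1] by simp
  finally show ?thesis .
qed

text \<open>The value of \<open>DD 1\<close> divided by \<open>q^m\<close>. For odd m the reduction
  stops one level early, with a quadratic phase modulo q in each of two variables, hence the square
  of a Gauss sum.\<close>

definition gfac :: "'k \<Rightarrow> complex"
  where "gfac k = (if even m then 1 else (gs k)\<^sup>2 / of_nat q)"

lemma gfac_abs: "k \<in> Zp \<Longrightarrow> absv k = 1 \<Longrightarrow> gfac k * cnj (gfac k) = 1"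
  using gs_abs_sq[of k] unfolding gfac_def by (simp add: power2_eq_square mult.commute mult.left_commute)

text \<open>The number y of the overview. It is defined for free u and w, outside the locale that
  fixes them, so that two choices can be compared. The denominator is \<open>lam (1 + om)\<close>,
  as 1 + om = u \<theta> (w + u \<theta>) and \<open>lam u = 1\<close>.\<close>

definition stat_value :: "'k \<Rightarrow> 'k \<Rightarrow> complex"
  where "stat_value u w = (-1) ^ m * gfac (w / u) / (lam \<theta> * lam (w + u * \<theta>))"

end

context period_setup
begin

text \<open>The shifts of \<open>LL_shift\<close> twist the terms by characters in 2 kk x and 2 kk
  y; both are trivial only if q divides x and y.\<close>

lemma DD_step:
  assumes i: "i \<ge> 1" "2 * i + 2 \<le> m"
  shows "DD i = DD (Suc i)"
proof -
  define n where "n = m - i"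
  define r where "r = m - 1 - 2 * i"
  have n: "n = 1 + (m - Suc i)" "m - i = n" "i \<le> m" "1 \<le> i" using i unfolding n_def by arith+
  let ?Q = "of_nat q :: 'k"
  let ?I = "zreps n \<times> zreps n"
  define L where "L x y = LL (?Q ^ i * x) (?Q ^ i * y)" for x y
  have Lc: "L x y = L x' y'" if "x \<in> Zp" "y \<in> Zp" "x' \<in> Zp" "y' \<in> Zp" "dv n (x - x')" "dv n (y - y')" for x y x' y'
    unfolding L_def by (intro LL_level that n(3,4)) (use that n_def in auto)
  have shift: "(\<Sum>p\<in>?I. L (fst p) (snd p)) =
      (\<Sum>p\<in>?I. L (fst p) (snd p) * (psi1 (- (2 * kk * fst p) * e) * psi1 (- (2 * kk * snd p) * c)))"
    if ec: "e \<in> zreps 1" "c \<in> zreps 1" for e c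
  proof -
    have eZ: "e \<in> Zp" "c \<in> Zp" using ec zreps_Zp by auto
    have rZ: "x + ?Q ^ r * e \<in> Zp" "x + ?Q ^ r * c \<in> Zp" if "x \<in> Zp" for x using that eZ by (auto intro!: Zp_intros)
    have "(\<Sum>x\<in>zreps n. \<Sum>y\<in>zreps n. L x y) = (\<Sum>x\<in>zreps n. \<Sum>y\<in>zreps n. L (x + ?Q ^ r * e) y)"
    proof (rule sum_isometry_reindex[OF zreps_rep_system, where \<tau>="\<lambda>x. x + ?Q ^ r * e" and g="\<lambda>x. \<Sum>y\<in>zreps n. L x y", symmetric])
      show "x + ?Q ^ r * e \<in> Zp" if "x \<in> Zp" for x by (rule rZ[OF that])
      show "(\<Sum>y\<in>zreps n. L x y) = (\<Sum>y\<in>zreps n. L x' y)" if "x \<in> Zp" "x' \<in> Zp" "dv n (x - x')" for x x'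
        by (intro sum.cong refl Lc that zreps_Zp) simp_all
    qed simp
    also have "\<dots> = (\<Sum>x\<in>zreps n. \<Sum>y\<in>zreps n. L (x + ?Q ^ r * e) (y + ?Q ^ r * c))"
    proof (rule sum.cong[OF refl])
      fix x assume "x \<in> zreps n"
      then have x: "x + ?Q ^ r * e \<in> Zp" by (intro rZ zreps_Zp)
      show "(\<Sum>y\<in>zreps n. L (x + ?Q ^ r * e) y) = (\<Sum>y\<in>zreps n. L (x + ?Q ^ r * e) (y + ?Q ^ r * c))"
      proof (rule sum_isometry_reindex[OF zreps_rep_system, where \<tau>="\<lambda>x. x + ?Q ^ r * c" and g="\<lambda>y. L (x + ?Q ^ r * e) y", symmetric])
        show "L (x + ?Q ^ r * e) a = L (x + ?Q ^ r * e) b" if "a \<in> Zp" "b \<in> Zp" "dv n (a - b)" for a b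
          by (intro Lc x that) simp
        show "y + ?Q ^ r * c \<in> Zp" if "y \<in> Zp" for y by (rule rZ[OF that])
      qed simp
    qed
    also have "\<dots> = (\<Sum>x\<in>zreps n. \<Sum>y\<in>zreps n. L x y * (psi1 (- (2 * kk * x) * e) * psi1 (- (2 * kk * y) * c)))"
      unfolding L_def r_def by (intro sum.cong refl LL_shift i eZ zreps_Zp)
    finally show ?thesis by (simp add: sum.cartesian_product case_prod_beta)
  qed
  have "(\<Sum>p\<in>?I. L (fst p) (snd p)) =
      (\<Sum>p\<in>?I. if dv 1 (- (2 * kk * fst p)) \<and> dv 1 (- (2 * kk * snd p)) then L (fst p) (snd p) else 0)"
  proof (rule two_char_average[OF _ shift])
    fix p assume "p \<in> ?I"
    then have "fst p \<in> Zp" "snd p \<in> Zp" using zreps_Zp by auto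
    then show "- (2 * kk * fst p) \<in> Zp \<and> - (2 * kk * snd p) \<in> Zp" using kk(4) by (auto intro!: Zp_minus Zp_mult)
  qed simp_all
  also have "\<dots> = (\<Sum>p\<in>?I. if dv 1 (fst p) then if dv 1 (snd p) then L (fst p) (snd p) else 0 else 0)"
    using kk(2) by (intro sum.cong refl) (simp add: dv_mult_unit_iff absv_mult)
  finally have "(\<Sum>x\<in>zreps n. \<Sum>y\<in>zreps n. L x y) =
      (\<Sum>x\<in>zreps n. \<Sum>y\<in>zreps n. if dv 1 x then if dv 1 y then L x y else 0 else 0)"
    by (simp add: sum.cartesian_product case_prod_beta)
  also have "\<dots> = (\<Sum>x\<in>zreps (1 + (m - Suc i)). if dv 1 x then \<Sum>y\<in>zreps (1 + (m - Suc i)). if dv 1 y then L x y else 0 else 0)"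
    unfolding n(1)[symmetric] by (intro sum.cong refl) simp
  also have "\<dots> = (\<Sum>x\<in>zreps (m - Suc i). \<Sum>y\<in>zreps (1 + (m - Suc i)). if dv 1 y then L (?Q ^ 1 * x) y else 0)"
  proof (rule sum_zreps_dv)
    show "(\<Sum>y\<in>zreps (1 + (m - Suc i)). if dv 1 y then L x y else 0) = (\<Sum>y\<in>zreps (1 + (m - Suc i)). if dv 1 y then L x' y else 0)"
      if "x \<in> Zp" "x' \<in> Zp" "dv (1 + (m - Suc i)) (x - x')" for x x'
      using that unfolding n(1)[symmetric] by (intro sum.cong refl if_cong Lc) (auto intro: zreps_Zp)
  qed
  also have "\<dots> = (\<Sum>x\<in>zreps (m - Suc i). \<Sum>y\<in>zreps (m - Suc i). L (?Q ^ 1 * x) (?Q ^ 1 * y))"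
  proof (rule sum.cong[OF refl], rule sum_zreps_dv)
    fix x a b assume "x \<in> zreps (m - Suc i)" "a \<in> Zp" "b \<in> Zp" "dv (1 + (m - Suc i)) (a - b)"
    then show "L (?Q ^ 1 * x) a = L (?Q ^ 1 * x) b"
      unfolding n(1)[symmetric] using qb_Zp[OF zreps_Zp] by (intro Lc) simp_all
  qed
  also have "\<dots> = DD (Suc i)" unfolding DD_def L_def by (simp add: mult.assoc mult.left_commute)
  finally show ?thesis unfolding DD_def L_def n(2) .
qed

lemma DD_reduce: "1 \<le> h \<Longrightarrow> 2 * h \<le> m \<Longrightarrow> DD 1 = DD h"
proof (induction h rule: dec_induct)
  case (step i)
  then show ?case using DD_step[of i] by simp
qed simp

text \<open>Now \<open>II\<close> is divisible by q^(2h) = q^m, so each term is \<open>lam\<close>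
  of a unit of \<open>Qp\<close>, which is 1.\<close>

lemma DD_even:
  assumes "m = 2 * h"
  shows "DD h = of_nat q ^ m"
proof -
  have h: "1 \<le> h" "m - h = h" using assms m_ge_2 by arith+
  have L1: "LL (of_nat q ^ h * x) (of_nat q ^ h * y) = 1" if "x \<in> Zp" "y \<in> Zp" for x y
  proof -
    let ?x = "of_nat q ^ h * x" and ?y = "of_nat q ^ h * y"
    note d = dv_1_q_power[OF that(1) h(1)] dv_1_q_power[OF that(2) h(1)]
    have "dv m (II ?x ?y)" unfolding assms by (intro dv_II dv_q_power that)
    then have "dv m ((RR ?x ?y + II ?x ?y * \<theta>) - RR ?x ?y)" using dv_mult_right[OF _ dv_theta] by simp
    then have "LL ?x ?y = lam (RR ?x ?y)" unfolding LL_def by (rule lam_cong[OF LL_unit[OF d]])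
    also have "\<dots> = 1" using that by (intro lam_RR d Qp_mult Qp_power Qp_of_nat Zp_Qp)
    finally show ?thesis .
  qed
  have "DD h = (\<Sum>x\<in>zreps h. \<Sum>y\<in>zreps h. 1)"
    unfolding DD_def h(2) by (intro sum.cong refl L1 zreps_Zp)
  also have "\<dots> = of_nat q ^ m" unfolding assms by (simp add: power_add mult_2)
  finally show ?thesis .
qed

text \<open>Here \<open>II\<close> has exactly the factor q^(2h) = q^m1, so \<open>lam\<close>
  becomes \<open>psi1\<close> of - kk (x^2 + y^2); the quartic part and the deviation of
  \<open>RR\<close> from 1 are divisible by q and do not matter.\<close>

lemma DD_odd:
  assumes "m = 2 * h + 1"
  shows "DD h = of_nat q ^ m * ((gs kk)\<^sup>2 / of_nat q)"
proof -
  have h: "1 \<le> h" "m - h = 1 + h" "m1 = 2 * h" using assms m_ge_2 m_eq(1) by arith+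
  let ?Q = "of_nat q :: 'k"
  have L1: "LL (?Q ^ h * x) (?Q ^ h * y) = psi1 (- kk * x\<^sup>2) * psi1 (- kk * y\<^sup>2)" if Z: "x \<in> Zp" "y \<in> Zp" for x y
  proof -
    define X Y where "X = ?Q ^ h * x" and "Y = ?Q ^ h * y"
    have d: "dv 1 X" "dv 1 Y" unfolding X_def Y_def using dv_1_q_power[OF Z(1) h(1)] dv_1_q_power[OF Z(2) h(1)] by auto
    have XQ: "X \<in> Qp" "Y \<in> Qp" unfolding X_def Y_def using Z by (auto intro!: Qp_mult Qp_power Zp_Qp[of x] Zp_Qp[of y])
    define R where "R = RR X Y"
    have R: "R \<in> Qp" "absv R = 1" "dv 1 (R - 1)" "lam R = 1" unfolding R_def using RR_II_Qp(1)[OF XQ] RR_unit[OF d] lam_RR[OF XQ d] by auto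
    define v where "v = - kk * x\<^sup>2 + - kk * y\<^sup>2"
    define v' where "v' = v + ?Q ^ (2 * h) * (kk * ((x + y)\<^sup>2 * y\<^sup>2 * \<theta>\<^sup>2))"
    have tZ: "kk * ((x + y)\<^sup>2 * y\<^sup>2 * \<theta>\<^sup>2) \<in> Zp" using Z kk(4) by (intro Zp_mult Zp_theta_sq Zp_power Zp_add)
    have vZ: "v \<in> Zp" unfolding v_def using Z kk(4) by (intro Zp_add Zp_minus Zp_mult Zp_power)
    have v'Z: "v' \<in> Zp" unfolding v'_def by (rule Zp_lift_closed(1)[OF vZ tZ])
    have e: "II X Y = ?Q ^ m1 * v'"
    proof -
      have "?Q ^ (2 * h) = ?Q ^ h * ?Q ^ h" by (simp add: mult_2 power_add)
      then show ?thesis unfolding v'_def v_def II_def X_def Y_def h(3) by (simp add: algebra_simps power2_eq_square)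
    qed
    have "LL X Y = lam (R + ?Q ^ m1 * (v' * \<theta>))" unfolding LL_def R_def e by (simp only: mult.assoc)
    also have "\<dots> = lam R * psi1 (im (v' * \<theta> / R))"
      by (rule lam_quot_psi1(1)[OF R(2) dv_mult_right[OF Zp_dv[OF v'Z] dv_theta] refl])
    also have "im (v' * \<theta> / R) = v' / R"
    proof -
      have "v' * \<theta> / R = (v' / R) * \<theta>" by simp
      then show ?thesis using im_mult_Qp[OF Qp_divide[OF Zp_Qp[OF v'Z] R(1)], of \<theta>] by (simp add: im_theta)
    qed
    also have "psi1 (v' / R) = psi1 v"
    proof (rule psi1_cong)
      show "dv 0 (v' / R)" using R(2) v'Z by (simp add: dv_divide_unit_iff Zp_dv)
      have "v' / R - v = (?Q ^ (2 * h) * (kk * ((x + y)\<^sup>2 * y\<^sup>2 * \<theta>\<^sup>2)) - v * (R - 1)) / R"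
        unfolding v'_def using unit_nonzero[OF R(2)] by (simp add: field_simps)
      moreover have "dv 1 (?Q ^ (2 * h) * (kk * ((x + y)\<^sup>2 * y\<^sup>2 * \<theta>\<^sup>2)))" using h(1) by (intro dv_1_q_power tZ) simp
      ultimately show "dv 1 (v' / R - v)"
        using dv_diff[OF _ dv_mult_left[OF Zp_dv[OF vZ] R(3)]] R(2) by (simp only: dv_divide_unit_iff)
    qed
    also have "psi1 v = psi1 (- kk * x\<^sup>2) * psi1 (- kk * y\<^sup>2)" unfolding v_def by (intro psi1_add gs_term_dv kk Z)
    finally show ?thesis unfolding X_def Y_def R(4) by simp
  qed
  have lev: "(\<Sum>x\<in>zreps (1 + h). psi1 (- kk * x\<^sup>2)) = of_nat q ^ h * gs kk"
    unfolding gs_def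
  proof (rule sum_zreps_level)
    fix x y assume xy: "x \<in> Zp" "y \<in> Zp" "dv 1 (x - y)"
    have "- kk * x\<^sup>2 - - kk * y\<^sup>2 = (x - y) * (- kk * (x + y))" by (simp add: algebra_simps power2_eq_square)
    moreover have "dv 0 (- kk * (x + y))" using kk(4) xy by (intro Zp_dv Zp_intros)
    ultimately have "dv 1 (- kk * x\<^sup>2 - - kk * y\<^sup>2)" using dv_mult_right[OF xy(3)] by (simp only:)
    then show "psi1 (- kk * x\<^sup>2) = psi1 (- kk * y\<^sup>2)" by (rule psi1_cong[OF gs_term_dv[OF kk(4) xy(1)]])
  qed
  have "DD h = (\<Sum>x\<in>zreps (1 + h). \<Sum>y\<in>zreps (1 + h). psi1 (- kk * x\<^sup>2) * psi1 (- kk * y\<^sup>2))"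
    unfolding DD_def h(2) by (intro sum.cong refl L1 zreps_Zp)
  also have "\<dots> = (of_nat q ^ h * gs kk) * (of_nat q ^ h * gs kk)"
    unfolding lev[symmetric] by (rule sum_product[symmetric])
  also have "\<dots> = of_nat q ^ m * ((gs kk)\<^sup>2 / of_nat q)"
    unfolding assms by (simp add: power_add mult_2 power2_eq_square)
  finally show ?thesis .
qed

lemma Esum_value: "Esum = of_nat q ^ m * (gfac kk / lam (1 + om))"
proof -
  have "1 \<le> m div 2" "2 * (m div 2) \<le> m" using m_ge_2 by arith+
  then have D: "DD 1 = DD (m div 2)" by (rule DD_reduce)
  have "DD (m div 2) = of_nat q ^ m * gfac kk"
  proof (cases "even m")
    case True
    then have "m = 2 * (m div 2)" by simp
    from DD_even[OF this] show ?thesis using True by (simp add: gfac_def)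
  next
    case False
    then have "m = 2 * (m div 2) + 1" by (rule odd_two_times_div_two_succ[symmetric])
    from DD_odd[OF this] show ?thesis using False by (simp add: gfac_def)
  qed
  then show ?thesis unfolding Esum_DD D by simp
qed

lemma wu_unit: "absv (w + u * \<theta>) = 1"
  using unit_re_im[of w u] u w by simp

lemma Esum_stat: "(-1) ^ m * Esum = of_nat q ^ m * stat_value u w"
proof -
  have u0: "lam u = 1" using u by (intro lam_Qp_unit)
  have "lam (1 + om) = lam \<theta> * lam (w + u * \<theta>)"
    unfolding one_plus_om using unit_nonzero[OF wu_unit] u0 by (simp add: lam_mult)
  then show ?thesis unfolding Esum_value stat_value_def kk_def by simp
qed

lemma stat_value_abs: "stat_value u w * cnj (stat_value u w) = 1"
proof -
  have l: "lam x * cnj (lam x) = 1" if "absv x = 1" for x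
    using lam_bar[OF that] lam_nonzero[OF unit_nonzero[OF that]] by (metis right_inverse)
  have "stat_value u w * cnj (stat_value u w) =
      ((-1) ^ m * (-1) ^ m) * (gfac kk * cnj (gfac kk)) / ((lam \<theta> * cnj (lam \<theta>)) * (lam (w + u * \<theta>) * cnj (lam (w + u * \<theta>))))"
    unfolding stat_value_def kk_def by (simp add: ac_simps)
  also have "(-1) ^ m * (-1) ^ m = (1::complex)" by (simp flip: power_add)
  finally show ?thesis unfolding l[OF absv_theta] l[OF wu_unit] gfac_abs[OF kk(4,2)] by simp
qed

lemma gamma_value:
  assumes "torus_haar \<nu>"
  defines "y \<equiv> stat_value u w"
  shows "(of_nat q ^ 2 - 1) * gamma_period q m bar \<psi> \<mu> B \<nu> f \<theta> u = of_nat q / of_nat q ^ m1 * ((1 + y) * (1 + cnj y))"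
proof -
  define c :: complex where "c = of_nat q / (of_nat q - 1)"
  have q0: "of_nat q \<noteq> (0::complex)" "of_nat q - 1 \<noteq> (0::complex)" "of_nat q + 1 \<noteq> (0::complex)"
    using q_ge_3 by (auto simp: complex_eq_iff add_eq_0_iff)
  have "(\<Sum>b\<in>zreps m1. Phi (of_nat q * b + \<theta>)) = (\<Sum>b\<in>zreps m1. ((-1) ^ m / of_nat q ^ m * c) * (\<Sum>z\<in>oreps m. trm b z))"
    unfolding c_def by (intro sum.cong refl Phi_qb zreps_Zp)
  also have "\<dots> = ((-1) ^ m / of_nat q ^ m * c) * (Esum + cnj Esum)"
    unfolding sum_trm[symmetric] by (rule sum_distrib_left[symmetric])
  also have "\<dots> = c / of_nat q ^ m * ((-1) ^ m * Esum + cnj ((-1) ^ m * Esum))"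
    by (simp add: algebra_simps add_divide_distrib)
  also have "\<dots> = c * (y + cnj y)"
    unfolding Esum_stat y_def using q0(1) by (simp add: algebra_simps)
  finally have "(\<Sum>t\<in>treps. Phi t) = c * 2 + c * (y + cnj y)"
    unfolding sum_treps sum_Phi_one_plus c_def by simp
  also have "\<dots> = c * (2 + (y + cnj y))" by (simp add: algebra_simps)
  also have "2 + (y + cnj y) = (1 + y) * (1 + cnj y)"
    using stat_value_abs unfolding y_def by (simp add: algebra_simps)
  finally have S: "(\<Sum>t\<in>treps. Phi t) = c * ((1 + y) * (1 + cnj y))" .
  have card: "of_nat (card treps) = of_nat q ^ m1 * (of_nat q + 1 :: complex)"
    unfolding card_treps power_m by (simp add: algebra_simps)
  have "(of_nat q ^ 2 - 1) * (c * ((1 + y) * (1 + cnj y)) / (of_nat q ^ m1 * (of_nat q + 1))) =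
      of_nat q / of_nat q ^ m1 * ((1 + y) * (1 + cnj y))"
  proof -
    have "(of_nat q ^ 2 - 1 :: complex) = (of_nat q - 1) * (of_nat q + 1)" by (simp add: algebra_simps power2_eq_square)
    moreover have "(of_nat q - 1) * (of_nat q + 1) * (c * E / (P * (of_nat q + 1))) = of_nat q / P * E" for E P :: complex
      unfolding c_def using q0 by (simp add: divide_simps)
    ultimately show ?thesis by simp
  qed
  then show ?thesis unfolding gamma_formula[OF assms(1)] S card .
qed

end

section \<open>Algebraicity and integrality\<close>

interpretation qvs: vector_space "\<lambda>(r::rat) (z::complex). of_rat r * z"
  by standard (simp_all add: algebra_simps of_rat_add of_rat_mult)

text \<open>The powers of x up to the size of \<open>t\<close> are one too many to be independent
  over the rationals. Coinciding powers are treated separately, since dependence of a set does not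
  see repetitions.\<close>

lemma algebraic_if_powers_span:
  fixes x :: complex
  assumes t: "finite t" and x: "\<And>n. x ^ n \<in> qvs.span t"
  shows "algebraic x"
proof (cases "inj_on (\<lambda>n. x ^ n) {..card t}")
  case False
  then obtain i j where ij: "x ^ i = x ^ j" "i \<noteq> j" by (auto simp: inj_on_def)
  define p :: "complex poly" where "p = monom 1 i - monom 1 j"
  have "coeff p i \<noteq> 0" using ij(2) by (simp add: p_def)
  then have "p \<noteq> 0" by auto
  moreover have "poly p x = 0" using ij(1) by (simp add: p_def poly_monom)
  moreover have "coeff p k \<in> \<int>" for k by (simp add: p_def)
  ultimately show ?thesis by (intro algebraicI)
next
  case True
  define S where "S = (\<lambda>n. x ^ n) ` {..card t}"
  have fS: "finite S" "card S = Suc (card t)" "S \<subseteq> qvs.span t"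
    using True x by (auto simp: S_def card_image)
  have "qvs.dependent S"
    using qvs.independent_span_bound[OF t _ fS(3)] fS(2) by auto
  then obtain c where c: "\<exists>v\<in>S. c v \<noteq> 0" "(\<Sum>v\<in>S. of_rat (c v) * v) = 0"
    using qvs.dependent_finite[OF fS(1)] by blast
  define p :: "complex poly" where "p = (\<Sum>n\<le>card t. monom (of_rat (c (x ^ n))) n)"
  have cf: "coeff p k = (if k \<le> card t then of_rat (c (x ^ k)) else 0)" for k
    by (simp add: p_def coeff_sum)
  obtain k where "k \<le> card t" "c (x ^ k) \<noteq> 0" using c(1) by (auto simp: S_def)
  then have "coeff p k \<noteq> 0" by (simp add: cf)
  then have "p \<noteq> 0" by auto
  moreover have "poly p x = (\<Sum>v\<in>S. of_rat (c v) * v)"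
    unfolding p_def poly_sum S_def sum.reindex[OF True] by (simp add: poly_monom)
  then have "poly p x = 0" using c(2) by simp
  ultimately show ?thesis by (intro algebraicI'[of p]) (auto simp: cf)
qed

lemma qspan_roots_mult:
  assumes "a \<in> qvs.span {r. r ^ M = 1}" "b \<in> qvs.span {r. r ^ M = 1}"
  shows "a * b \<in> qvs.span {r. r ^ M = 1}"
proof -
  let ?S = "qvs.span {r. r ^ M = 1}"
  have 1: "r * b \<in> ?S" if r: "r ^ M = 1" for r
    using assms(2)
  proof (induction rule: qvs.span_induct)
    case base
    show ?case
    proof (rule qvs.subspaceI)
      show "of_rat c * x \<in> {b. r * b \<in> ?S}" if "x \<in> {b. r * b \<in> ?S}" for c x
        using qvs.span_scale[of "r * x" _ c] that by (simp only: mem_Collect_eq mult.left_commute)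
    qed (simp_all add: qvs.span_zero distrib_left qvs.span_add)
  next
    case (step s)
    then show ?case using r by (intro qvs.span_base) (simp add: power_mult_distrib)
  qed
  show ?thesis
    using assms(1)
  proof (induction rule: qvs.span_induct)
    case base
    show ?case
    proof (rule qvs.subspaceI)
      show "of_rat c * x \<in> {a. a * b \<in> ?S}" if "x \<in> {a. a * b \<in> ?S}" for c x
        using qvs.span_scale[of "x * b" _ c] that by (simp only: mem_Collect_eq mult.assoc)
    qed (simp_all add: qvs.span_zero distrib_right qvs.span_add)
  next
    case (step s)
    then show ?case using 1 by simp
  qed
qed

lemma algebraic_qspan_roots:
  assumes "M > 0" "z \<in> qvs.span {r. r ^ M = 1}"
  shows "algebraic z"
proof (rule algebraic_if_powers_span)
  show "finite {r::complex. r ^ M = 1}" using assms(1) by (intro finite_roots_unity) simp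
  show "z ^ n \<in> qvs.span {r. r ^ M = 1}" for n
    by (induction n) (auto intro: qvs.span_base qspan_roots_mult assms(2))
qed

text \<open>The ring generated over the integers by all roots of unity and 1/q. It is closed under
  conjugation, consists of algebraic numbers, and lands in the l-adic integers for l different from
  q.\<close>

inductive_set cyc :: "nat \<Rightarrow> complex set" for q :: nat where
  root: "z ^ n = 1 \<Longrightarrow> n > 0 \<Longrightarrow> z \<in> cyc q"
| inv: "1 / of_nat q \<in> cyc q"
| add: "x \<in> cyc q \<Longrightarrow> y \<in> cyc q \<Longrightarrow> x + y \<in> cyc q"
| mult: "x \<in> cyc q \<Longrightarrow> y \<in> cyc q \<Longrightarrow> x * y \<in> cyc q"

lemma cyc_span: "z \<in> cyc q \<Longrightarrow> \<exists>M>0. z \<in> qvs.span {r. r ^ M = 1}"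
proof (induction rule: cyc.induct)
  case (root z n)
  then show ?case by (intro exI[of _ n]) (auto intro: qvs.span_base)
next
  case inv
  have "of_rat (1 / of_nat q) * 1 \<in> qvs.span {r::complex. r ^ 1 = 1}"
    by (intro qvs.span_scale qvs.span_base) simp
  then show ?case by (intro exI[of _ 1]) (simp add: of_rat_divide)
next
  case (add x y)
  then obtain M M' where M: "M > 0" "x \<in> qvs.span {r. r ^ M = 1}" "M' > 0" "y \<in> qvs.span {r. r ^ M' = 1}" by auto
  have "{r::complex. r ^ M = 1} \<subseteq> {r. r ^ (M * M') = 1}" "{r::complex. r ^ M' = 1} \<subseteq> {r. r ^ (M * M') = 1}"
    by (auto simp: power_mult) (metis mult.commute power_mult power_one)
  from this[THEN qvs.span_mono] show ?case using M by (intro exI[of _ "M * M'"]) (auto intro: qvs.span_add)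
next
  case (mult x y)
  then obtain M M' where M: "M > 0" "x \<in> qvs.span {r. r ^ M = 1}" "M' > 0" "y \<in> qvs.span {r. r ^ M' = 1}" by auto
  have "{r::complex. r ^ M = 1} \<subseteq> {r. r ^ (M * M') = 1}" "{r::complex. r ^ M' = 1} \<subseteq> {r. r ^ (M * M') = 1}"
    by (auto simp: power_mult) (metis mult.commute power_mult power_one)
  from this[THEN qvs.span_mono] show ?case using M by (intro exI[of _ "M * M'"]) (auto intro: qspan_roots_mult)
qed

lemma algebraic_cyc: "z \<in> cyc q \<Longrightarrow> algebraic z"
  using cyc_span algebraic_qspan_roots by blast

lemma algebraic_cyc_scale: "z \<in> cyc q \<Longrightarrow> algebraic (of_rat r * z)"
  using cyc_span[of z q] algebraic_qspan_roots qvs.span_scale by blast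

lemma cyc_1: "1 \<in> cyc q" and cyc_neg_1: "- 1 \<in> cyc q"
  by (auto intro: cyc.root[of _ 2])

lemma cyc_minus: "z \<in> cyc q \<Longrightarrow> - z \<in> cyc q"
  using cyc.mult[OF cyc_neg_1] by fastforce

lemma cyc_0: "0 \<in> cyc q"
  using cyc.add[OF cyc_1 cyc_neg_1] by simp

lemma cyc_power: "z \<in> cyc q \<Longrightarrow> z ^ n \<in> cyc q"
  by (induction n) (auto intro: cyc_1 cyc.mult)

lemma cyc_sum: "(\<And>i. i \<in> I \<Longrightarrow> g i \<in> cyc q) \<Longrightarrow> sum g I \<in> cyc q"
  by (induction I rule: infinite_finite_induct) (auto intro: cyc_0 cyc.add)

lemma cyc_of_nat: "of_nat n \<in> cyc q"
  by (induction n) (auto intro: cyc_0 cyc.add cyc_1)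

lemma cyc_cnj: "z \<in> cyc q \<Longrightarrow> cnj z \<in> cyc q"
proof (induction rule: cyc.induct)
  case (root z n)
  have "cnj z ^ n = 1" using root(1) by (metis complex_cnj_one complex_cnj_power)
  then show ?case using root(2) by (rule cyc.root)
qed (auto intro: cyc.intros)

text \<open>The embedding is a ring map on algebraic numbers only, and elements of
  \<open>cyc q\<close> are algebraic. The bound is an induction: roots of unity have absolute value
  1, and so has 1/q because p does not divide q.\<close>

lemma (in padic_abs) embedding_bounds:
  fixes e :: "complex \<Rightarrow> 'a"
  assumes e: "algebraic_embedding e" and q: "prime q" "q \<noteq> p"
  shows "x \<in> cyc q \<Longrightarrow> y \<in> cyc q \<Longrightarrow> e (x + y) = e x + e y"
    and "x \<in> cyc q \<Longrightarrow> y \<in> cyc q \<Longrightarrow> e (x * y) = e x * e y"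
    and "absv (e (of_nat q)) = 1" and "x \<in> cyc q \<Longrightarrow> absv (e x) \<le> 1"
proof -
  show ad: "e (x + y) = e x + e y" and mu: "e (x * y) = e x * e y" if "x \<in> cyc q" "y \<in> cyc q" for x y
    using e algebraic_cyc[OF that(1)] algebraic_cyc[OF that(2)] unfolding algebraic_embedding_def by blast+
  have e1: "e 1 = 1" using e unfolding algebraic_embedding_def by blast
  have e0: "e 0 = 0" using ad[OF cyc_0 cyc_0] by simp
  have en: "e (of_nat n) = of_nat n" for n
    by (induction n) (simp_all add: e0 e1 ad[OF cyc_1 cyc_of_nat])
  have "\<not> int p dvd int q" using q prime_p by (simp add: primes_dvd_imp_eq) (metis primes_dvd_imp_eq)
  from absv_of_int_coprime[OF this] show eq: "absv (e (of_nat q)) = 1" by (simp add: en)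
  show "absv (e x) \<le> 1" if "x \<in> cyc q" for x
    using that
  proof (induction rule: cyc.induct)
    case (root z n)
    have "e (z ^ k) = e z ^ k" for k
      by (induction k) (simp_all add: e1 mu[OF cyc.root[OF root] cyc_power[OF cyc.root[OF root]]])
    then have "absv (e z) ^ n = 1" using root(1) e1 absv_power[of "e z" n] by (metis absv_one)
    then show ?case using root(2) by (metis absv_nonneg power_one power_eq_iff_eq_base zero_le_one order_refl)
  next
    case inv
    have "q \<noteq> 0" using q(1) by auto
    then have "e (1 / of_nat q) * e (of_nat q) = 1" using mu[OF cyc.inv cyc_of_nat, of q] e1 by simp
    then have "absv (e (1 / of_nat q)) * absv (e (of_nat q)) = 1" by (metis absv_mult absv_one)
    then show ?case using eq by simp
  next
    case (add x y)
    then show ?case using absv_add[of "e x" "e y"] by (simp add: ad)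
  next
    case (mult x y)
    then show ?case by (simp add: mu absv_mult mult_le_one)
  qed
qed

text \<open>1 - z divides q inside \<open>cyc q\<close>: the sum over j < q of 1 - z^j equals q,
  since the q-th roots z^j add up to 0, and each of its terms is a multiple of 1 - z.\<close>

lemma (in padic_abs) one_minus_root_unit:
  fixes e :: "complex \<Rightarrow> 'a"
  assumes e: "algebraic_embedding e" and q: "prime q" "q \<noteq> p" and z: "z ^ q = 1" "z \<noteq> 1"
  shows "absv (e (1 - z)) = 1"
proof -
  note eb = embedding_bounds[OF e q]
  have q0: "q > 0" using q(1) by (simp add: prime_gt_0_nat)
  have zc: "z \<in> cyc q" using z(1) q0 by (rule cyc.root)
  define s where "s = (\<Sum>j<q. \<Sum>i<j. z ^ i)"
  have sc: "s \<in> cyc q" unfolding s_def by (intro cyc_sum cyc_power zc)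
  have oz: "1 - z \<in> cyc q" using cyc.add[OF cyc_1 cyc_minus[OF zc]] by simp
  have "(1 - z) * s = (\<Sum>j<q. 1 - z ^ j)"
    unfolding s_def sum_distrib_left[of _ _ "{..<q}"] one_diff_power_eq ..
  also have "\<dots> = of_nat q - (\<Sum>j<q. z ^ j)" by (simp add: sum_subtractf)
  also have "(\<Sum>j<q. z ^ j) = 0" using z one_diff_power_eq[of z q] by simp
  finally have "(1 - z) * s = of_nat q" by simp
  then have "absv (e (1 - z)) * absv (e s) = 1" using eb(2)[OF oz sc] eb(3) by (metis absv_mult)
  moreover have "absv (e (1 - z)) \<le> 1" "absv (e s) \<le> 1" using eb(4) oz sc by auto
  ultimately show ?thesis using mult_left_le[of "absv (e s)" "absv (e (1 - z))"] by simp
qed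

context unram_quad
begin

text \<open>Pairs (u, w) correspond to the elements w + u \<theta> of norm -1 with both coordinates
  units. Norm-one elements act on them by multiplication, which is how new choices of u are
  produced.\<close>

definition adm :: "'k \<Rightarrow> 'k \<Rightarrow> bool"
  where "adm u w \<longleftrightarrow> u \<in> Qp \<and> absv u = 1 \<and> w \<in> Qp \<and> absv w = 1 \<and> u\<^sup>2 * \<theta>\<^sup>2 - 1 = w\<^sup>2"

text \<open>The real part is automatically a unit: minus its square is the norm of 1 + im \<epsilon>
  \<theta>, which is a unit.\<close>

lemma adm_of_norm:
  assumes "normK bar \<epsilon> = - 1" "absv (im \<epsilon>) = 1"
  shows "adm (im \<epsilon>) (re \<epsilon>)"
proof -
  have e: "(im \<epsilon>)\<^sup>2 * \<theta>\<^sup>2 - 1 = (re \<epsilon>)\<^sup>2" using assms(1) unfolding normK_re_im by (simp add: algebra_simps)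
  have "absv (1 + im \<epsilon> * \<theta>) = 1" using assms(2) by (simp add: absv_re_im[of "1 + im \<epsilon> * \<theta>"])
  then have "absv (normK bar (1 + im \<epsilon> * \<theta>)) = 1" by simp
  also have "normK bar (1 + im \<epsilon> * \<theta>) = - ((re \<epsilon>)\<^sup>2)" unfolding e[symmetric] normK_Qp_theta[OF Qp_1 re_im_in_Qp(2)] by (simp add: algebra_simps)
  finally have "(absv (re \<epsilon>))\<^sup>2 = 1" by (simp add: absv_power)
  then have "absv (re \<epsilon>) = 1" using power2_eq_iff_nonneg[of "absv (re \<epsilon>)" 1] by simp
  then show ?thesis using e assms(2) by (simp add: adm_def)
qed

text \<open>Some unit has norm -1. If its imaginary part is divisible by q, multiplication by the
  norm-one element (1 + \<theta>)/(1 - \<theta>) gives one congruent modulo q to 2 re \<epsilon> /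
  (1 - \<theta>^2), a unit.\<close>

lemma adm_exists: "\<exists>u w. adm u w"
proof -
  obtain \<epsilon> where n: "absv \<epsilon> = 1" "normK bar \<epsilon> = - 1" using normK_surj_unit[of "- 1"] by (metis Qp_1 Qp_minus absv_minus absv_one)
  show ?thesis
  proof (cases "absv (im \<epsilon>) = 1")
    case True
    then show ?thesis using adm_of_norm[OF n(2)] by blast
  next
    case False
    have ar: "absv (re \<epsilon>) = 1" using n(1) False by (auto simp: absv_re_im[of \<epsilon>] max_def split: if_splits)
    have "dv 0 \<epsilon>" using n(1) by (simp add: dv_def)
    then have di: "dv 1 (im \<epsilon>)" using False absv_eq_1_or_dv dv_im by blast
    define d where "d = 1 - \<theta>\<^sup>2"
    have dQ: "d \<in> Qp" unfolding d_def by (intro Qp_diff theta_sq_Qp Qp_1)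
    have t1: "absv (1 + 1 * \<theta>) = 1" "absv (1 - \<theta>) = 1"
      using absv_re_im[of "1 + 1 * \<theta>"] absv_re_im[of "1 + (- 1) * \<theta>"] re_im_Qp[of 1 1] re_im_Qp[of 1 "- 1"] Qp_minus[OF Qp_1] by auto
    have dn: "d = (1 + \<theta>) * (1 - \<theta>)" unfolding d_def by (simp add: algebra_simps power2_eq_square)
    have du: "absv d = 1" unfolding dn absv_mult using t1 by simp
    have nz: "1 + \<theta> \<noteq> 0" "1 - \<theta> \<noteq> 0" "d \<noteq> 0" using t1 du by auto
    define \<epsilon>' where "\<epsilon>' = \<epsilon> * ((1 + \<theta>) / (1 - \<theta>))"
    have "normK bar \<epsilon>' = - 1" unfolding \<epsilon>'_def normK_mult n(2) using nz by (simp add: normK_def mult.commute)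
    moreover have "absv (im \<epsilon>') = 1"
    proof -
      have "\<epsilon>' = (1 / d) * (\<epsilon> * ((1 + \<theta>\<^sup>2) + 2 * \<theta>))"
      proof -
        have "(1 + \<theta>) / (1 - \<theta>) = (1 + \<theta>) * (1 + \<theta>) / d" unfolding dn using nz by simp
        then show ?thesis unfolding \<epsilon>'_def by (simp add: algebra_simps power2_eq_square add_divide_distrib)
      qed
      also have "\<epsilon> * ((1 + \<theta>\<^sup>2) + 2 * \<theta>) = (re \<epsilon> + im \<epsilon> * \<theta>) * ((1 + \<theta>\<^sup>2) + 2 * \<theta>)" using re_im[of \<epsilon>] by simp
      also have "\<dots> = (re \<epsilon> * (1 + \<theta>\<^sup>2) + 2 * \<theta>\<^sup>2 * im \<epsilon>) + (2 * re \<epsilon> + im \<epsilon> * (1 + \<theta>\<^sup>2)) * \<theta>"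
        by (simp add: algebra_simps power2_eq_square)
      finally have e: "\<epsilon>' = 1 / d * ((re \<epsilon> * (1 + \<theta>\<^sup>2) + 2 * \<theta>\<^sup>2 * im \<epsilon>) + (2 * re \<epsilon> + im \<epsilon> * (1 + \<theta>\<^sup>2)) * \<theta>)" .
      have Q: "re \<epsilon> * (1 + \<theta>\<^sup>2) + 2 * \<theta>\<^sup>2 * im \<epsilon> \<in> Qp" "2 * re \<epsilon> + im \<epsilon> * (1 + \<theta>\<^sup>2) \<in> Qp"
        by (intro Qp_add Qp_mult theta_sq_Qp Qp_1 Qp_numeral re_im_in_Qp)+
      have im': "im \<epsilon>' = 1 / d * (2 * re \<epsilon> + im \<epsilon> * (1 + \<theta>\<^sup>2))"
        unfolding e im_mult_Qp[OF Qp_divide[OF Qp_1 dQ]] re_im_Qp(2)[OF Q] ..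
      have "absv (2 * re \<epsilon> + im \<epsilon> * (1 + \<theta>\<^sup>2)) = 1"
      proof (rule unit_cong[of "2 * re \<epsilon>" 0])
        show "absv (2 * re \<epsilon>) = 1" using ar by (simp add: absv_mult)
        have "dv 0 (1 + \<theta>\<^sup>2)" by (intro dv_add dv_0_power dv_theta dv_one)
        then have "dv 1 (im \<epsilon> * (1 + \<theta>\<^sup>2))" by (rule dv_mult_right[OF di])
        then show "dv (Suc 0) (2 * re \<epsilon> - (2 * re \<epsilon> + im \<epsilon> * (1 + \<theta>\<^sup>2)))" by (simp add: One_nat_def)
      qed
      then show ?thesis unfolding im' absv_mult absv_divide du by simp
    qed
    ultimately show ?thesis using adm_of_norm by blast
  qed
qed

lemma adm_admissible: "adm u w \<Longrightarrow> admissible_u \<theta> u"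
  by (auto simp: adm_def admissible_u_def Zp_units_def)

lemma adm_unit: "adm u w \<Longrightarrow> absv (w + u * \<theta>) = 1"
  by (auto simp: adm_def absv_re_im[of "w + u * \<theta>"])

end

context weil_setup
begin

lemma adm_quot: "adm u w \<Longrightarrow> w / u \<in> Zp"
  by (auto simp: adm_def Zp_iff dv_def absv_divide)

lemma stat_value_cyc:
  assumes "adm u w"
  shows "stat_value u w \<in> cyc q"
proof -
  have gs: "gs (w / u) \<in> cyc q" unfolding gs_def
  proof (rule cyc_sum)
    fix x assume "x \<in> zreps 1"
    then have "dv 0 (- (w / u) * x\<^sup>2)" by (intro gs_term_dv[OF adm_quot[OF assms]] zreps_Zp)
    then show "psi1 (- (w / u) * x\<^sup>2) \<in> cyc q" using psi1_unit_root by (blast intro: cyc.root)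
  qed
  have "(gs (w / u))\<^sup>2 * (1 / of_nat q) \<in> cyc q" by (intro cyc.mult cyc.inv cyc_power gs)
  then have gf: "gfac (w / u) \<in> cyc q" by (simp add: gfac_def cyc_1)
  have li: "1 / lam x \<in> cyc q" if x: "absv x = 1" for x
  proof -
    obtain n where "n > 0" "lam x ^ n = 1" using lam_unit_root[OF x] by blast
    then show ?thesis by (intro cyc.root[of _ n]) (simp_all add: power_one_over)
  qed
  have "(-1) ^ m * gfac (w / u) * (1 / lam \<theta> * (1 / lam (w + u * \<theta>))) \<in> cyc q"
    by (intro cyc.mult cyc_power cyc_neg_1 gf li absv_theta adm_unit[OF assms])
  then show ?thesis by (simp add: stat_value_def)
qed

text \<open>Multiplying \<open>w + u \<theta>\<close> by a norm-one unit congruent to \<open>1\<close> modulo \<open>q^(m-1)\<close> leaves the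
  Gauss sum unchanged and moves the stationary value by a nontrivial \<open>q\<close>-th root of unity.\<close>

lemma adm_shift:
  assumes a: "adm u w"
  obtains u' w' where "adm u' w'" "stat_value u w = stat_value u' w' * psi1 2"
proof -
  define A where "A = (of_nat q ^ m1 :: 'k)"
  define \<epsilon> where "\<epsilon> = w + u * \<theta>"
  define \<kappa> where "\<kappa> = (1 + A * \<theta>) / (1 - A * \<theta>)"
  define \<epsilon>' where "\<epsilon>' = \<epsilon> * \<kappa>"
  have u: "u \<in> Qp" "absv u = 1" "w \<in> Qp" "absv w = 1" "u\<^sup>2 * \<theta>\<^sup>2 - 1 = w\<^sup>2" using a by (auto simp: adm_def)
  have ri: "re \<epsilon> = w" "im \<epsilon> = u" unfolding \<epsilon>_def using u by simp_all
  have eu: "absv \<epsilon> = 1" unfolding \<epsilon>_def by (rule adm_unit[OF a])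
  have ne: "normK bar \<epsilon> = - 1" unfolding normK_re_im ri using u(5) by (simp add: algebra_simps)
  have A1: "absv (1 + A * \<theta>) = 1" "absv (1 - A * \<theta>) = 1"
    using unit_one_plus_m1[of \<theta>] unit_one_plus_m1[of "- \<theta>"] by (simp_all add: A_def)
  note nz = unit_nonzero[OF A1(1)] unit_nonzero[OF A1(2)]
  have bA: "bar A = A" by (simp add: A_def)
  have nk: "normK bar \<kappa> = 1" unfolding \<kappa>_def normK_def using nz bA by (simp add: mult.commute)
  have ku: "absv \<kappa> = 1" unfolding \<kappa>_def absv_divide A1 by simp
  have ne': "normK bar \<epsilon>' = - 1" unfolding \<epsilon>'_def normK_mult ne nk by simp
  have kd: "dv 1 (\<kappa> - 1)"
  proof -
    have e: "\<kappa> - 1 = 2 * (A * \<theta>) / (1 - A * \<theta>)" unfolding \<kappa>_def using nz by (simp add: field_simps)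
    have "dv 1 (A * \<theta>)" using dv_mono[OF dv_m1[OF dv_theta] m_eq(2)] unfolding A_def .
    then show ?thesis unfolding e using A1 by (simp add: dv_divide_unit_iff dv_mult_unit_iff)
  qed
  have ed: "dv 1 (\<epsilon>' - \<epsilon>)"
  proof -
    have e: "\<epsilon>' - \<epsilon> = \<epsilon> * (\<kappa> - 1)" unfolding \<epsilon>'_def by (simp add: algebra_simps)
    show ?thesis unfolding e using kd eu by (simp only: dv_mult_unit_iff)
  qed
  have du: "dv 1 (u - im \<epsilon>')" "dv 1 (w - re \<epsilon>')"
    using dv_im[OF ed] dv_re[OF ed] unfolding im_diff re_diff ri by (simp_all only: dv_diff_commute)
  have iu: "absv (im \<epsilon>') = 1" using unit_cong[OF u(2), of 0] du(1) by (simp only: One_nat_def)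
  have a': "adm (im \<epsilon>') (re \<epsilon>')" by (rule adm_of_norm[OF ne' iu])
  \<comment> \<open>The Gauss sum depends on w / u modulo q only, and u and w change by multiples of
    q.\<close>
  have k: "gfac (re \<epsilon>' / im \<epsilon>') = gfac (w / u)"
  proof -
    have u0: "u \<noteq> 0" "im \<epsilon>' \<noteq> 0" using u(2) iu by auto
    have e: "re \<epsilon>' / im \<epsilon>' - w / u = (w * (u - im \<epsilon>') - u * (w - re \<epsilon>')) / (im \<epsilon>' * u)" using u0 by (simp add: field_simps)
    have "dv 1 (w * (u - im \<epsilon>') - u * (w - re \<epsilon>'))"
      using du u by (intro dv_diff) (simp_all only: dv_mult_unit_iff)
    then have "dv 1 (re \<epsilon>' / im \<epsilon>' - w / u)" unfolding e using u iu by (simp add: dv_divide_unit_iff absv_mult)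
    then show ?thesis unfolding gfac_def using gs_cong[OF adm_quot[OF a'] adm_quot[OF a]] by simp
  qed
  have lk: "lam \<kappa> = psi1 2"
  proof -
    have p: "lam (1 + A * \<theta>) = psi1 1" "lam (1 - A * \<theta>) = psi1 (- 1)" unfolding psi1_def A_def by simp_all
    have "lam \<kappa> = psi1 1 / psi1 (- 1)" unfolding \<kappa>_def using nz by (simp add: lam_divide p)
    also have "\<dots> = psi1 (1 + 1)" using psi1_add[of 1 1] psi1_minus[of 1] by (simp add: divide_inverse)
    finally show ?thesis by simp
  qed
  have l: "lam (re \<epsilon>' + im \<epsilon>' * \<theta>) = lam (w + u * \<theta>) * psi1 2"
    unfolding re_im[symmetric] lk[symmetric] \<epsilon>'_def \<epsilon>_def[symmetric] using unit_nonzero[OF eu] unit_nonzero[OF ku] by (rule lam_mult)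
  have "psi1 2 \<noteq> 0" using lk lam_nonzero[OF unit_nonzero[OF ku]] by simp
  then have "stat_value u w = stat_value (im \<epsilon>') (re \<epsilon>') * psi1 2"
    unfolding stat_value_def k l by simp
  then show ?thesis by (rule that[OF a'])
qed

lemma psi1_2_power: "psi1 2 ^ q = 1"
proof -
  have "psi1 2 ^ q = psi1 (of_nat q * 2)" by (rule psi1_of_nat[symmetric]) simp
  also have "\<dots> = psi1 0" by (rule psi1_cong) (use dv_mult_right[OF dv_p_power[of 1] dv_numeral] in \<open>simp_all add: dv_mult_left\<close>)
  finally show ?thesis by simp
qed

end

context newform_setup
begin

text \<open>The computation of the period took place in a locale that fixes u and w; restating it
  for arbitrary admissible pairs allows two of them to be used together.\<close>

lemma gamma_adm:
  assumes "torus_haar \<nu>" "adm u w"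
  shows "(of_nat q ^ 2 - 1) * gamma_period q m bar \<psi> \<mu> B \<nu> f \<theta> u =
    of_nat q / of_nat q ^ m1 * ((1 + stat_value u w) * (1 + cnj (stat_value u w)))"
    and "stat_value u w * cnj (stat_value u w) = 1"
proof -
  interpret period_setup q T bar \<theta> \<mu> lam \<psi> m f B u w
    using assms(2) by unfold_locales (auto simp: adm_def)
  show "(of_nat q ^ 2 - 1) * gamma_period q m bar \<psi> \<mu> B \<nu> f \<theta> u =
      of_nat q / of_nat q ^ m1 * ((1 + stat_value u w) * (1 + cnj (stat_value u w)))"
    by (rule gamma_value[OF assms(1)])
  show "stat_value u w * cnj (stat_value u w) = 1" by (rule stat_value_abs)
qed

text \<open>If y = -1 for both pairs related by \<open>adm_shift\<close>, their quotient
  \<open>psi1 2\<close> would be 1.\<close>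

lemma period_nonzero:
  assumes "torus_haar \<nu>"
  shows "\<exists>u. admissible_u \<theta> u \<and> gamma_period q m bar \<psi> \<mu> B \<nu> f \<theta> u \<noteq> 0"
proof -
  obtain u w where a: "adm u w" using adm_exists by blast
  obtain u' w' where a': "adm u' w'" "stat_value u w = stat_value u' w' * psi1 2" using adm_shift[OF a] .
  have nz: "gamma_period q m bar \<psi> \<mu> B \<nu> f \<theta> u \<noteq> 0" if "adm u w" "1 + stat_value u w \<noteq> 0" for u w
  proof -
    have "cnj (1 + stat_value u w) \<noteq> 0" using that(2) by (simp only: complex_cnj_zero_iff not_False_eq_True)
    then have "1 + cnj (stat_value u w) \<noteq> 0" by simp
    then show ?thesis using gamma_adm(1)[OF assms that(1)] that(2) by auto
  qed
  have "1 + stat_value u w \<noteq> 0 \<or> 1 + stat_value u' w' \<noteq> 0"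
  proof (rule ccontr)
    assume "\<not> ?thesis"
    then have "stat_value u w = - 1" "stat_value u' w' = - 1" by (auto simp: add_eq_0_iff)
    then show False using a'(2) psi1_2 by simp
  qed
  then show ?thesis using nz a a'(1) adm_admissible by blast
qed

text \<open>For two pairs with y = y' z the combination (1 + y) - z (1 + y') is 1 - z, an l-adic
  unit. So 1 + y and 1 + y' cannot both be non-units.\<close>

lemma period_unit:
  fixes e :: "complex \<Rightarrow> 'l::{field_char_0,alg_closed_field,complete_space}"
  assumes tor: "torus_haar \<nu>" and l: "prime l" "l \<noteq> q" "complex_padic l TYPE('l)" and e: "algebraic_embedding e"
  shows "\<exists>u. admissible_u \<theta> u \<and> algebraic (gamma_period q m bar \<psi> \<mu> B \<nu> f \<theta> u) \<and>
    padic_val l (e ((of_nat q ^ 2 - 1) * gamma_period q m bar \<psi> \<mu> B \<nu> f \<theta> u)) = 0"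
proof -
  interpret L: padic_abs l "TYPE('l)" using l(1,3) by unfold_locales (auto simp: complex_padic_def)
  note eb = L.embedding_bounds[OF e prime_p l(2)[symmetric]]
  have core: "admissible_u \<theta> u \<and> algebraic (gamma_period q m bar \<psi> \<mu> B \<nu> f \<theta> u) \<and>
      padic_val l (e ((of_nat q ^ 2 - 1) * gamma_period q m bar \<psi> \<mu> B \<nu> f \<theta> u)) = 0"
    if a: "adm u w" and h: "\<not> absv (e (1 + stat_value u w)) < 1" for u w
  proof -
    define y where "y = stat_value u w"
    have yc: "y \<in> cyc q" "cnj y \<in> cyc q" unfolding y_def using stat_value_cyc[OF a] cyc_cnj by auto
    have y1: "1 + y \<in> cyc q" using yc by (intro cyc.add cyc_1)
    have h1: "absv (e (1 + y)) = 1" using h eb(4)[OF y1] by (simp add: y_def)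
    have yy: "y * cnj y = 1" unfolding y_def by (rule gamma_adm(2)[OF tor a])
    have e1: "e 1 = 1" using e by (simp add: algebraic_embedding_def)
    have "absv (e y) * absv (e (cnj y)) = 1" using eb(2)[OF yc] yy e1 by (metis L.absv_mult L.absv_one)
    moreover have "absv (e y) \<le> 1" "absv (e (cnj y)) \<le> 1" using eb(4) yc by auto
    ultimately have cy: "absv (e (cnj y)) = 1"
      using mult_left_le_one_le[of "absv (e (cnj y))" "absv (e y)"] by simp
    \<comment> \<open>The prefactor q / q^m1, written with powers of 1/q so that it visibly lies in
      \<open>cyc q\<close>; it is a unit at l.\<close>
    define P :: complex where "P = of_nat q * (1 / of_nat q) ^ m1"
    have Pc: "P \<in> cyc q" unfolding P_def by (intro cyc.mult cyc_of_nat cyc_power cyc.inv)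
    have q0: "of_nat q \<noteq> (0::complex)" by simp
    have "P * of_nat q ^ m1 = of_nat q" unfolding P_def by (simp add: power_one_over)
    have eP: "absv (e P) = 1"
    proof -
      have qp: "absv (e (of_nat q ^ k)) = 1" for k
        by (induction k) (simp_all add: e1 eb(3) L.absv_mult eb(2)[OF cyc_of_nat cyc_power[OF cyc_of_nat]])
      have "e P * e (of_nat q ^ m1) = e (of_nat q)"
        using eb(2)[OF Pc cyc_power[OF cyc_of_nat]] \<open>P * of_nat q ^ m1 = of_nat q\<close> by metis
      then have "absv (e P) * absv (e (of_nat q ^ m1)) = absv (e (of_nat q))" by (metis L.absv_mult)
      then show ?thesis unfolding qp eb(3) by simp
    qed
    have yc1: "cnj y * (1 + y) \<in> cyc q" "(1 + y) * (cnj y * (1 + y)) \<in> cyc q" using yc y1 by (auto intro: cyc.mult)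
    have "1 + cnj y = cnj y * (1 + y)" using yy by (simp add: algebra_simps)
    then have g: "(of_nat q ^ 2 - 1) * gamma_period q m bar \<psi> \<mu> B \<nu> f \<theta> u = P * ((1 + y) * (cnj y * (1 + y)))" (is "?G = ?V")
      using gamma_adm(1)[OF tor a] unfolding y_def[symmetric] P_def by (simp add: power_one_over)
    have Vc: "?V \<in> cyc q" by (rule cyc.mult[OF Pc yc1(2)])
    have "absv (e ?V) = 1"
      by (simp add: eb(2)[OF Pc yc1(2)] eb(2)[OF y1 yc1(1)] eb(2)[OF yc(2) y1] L.absv_mult eP h1 cy)
    then have "padic_val l (e ?G) = 0" unfolding g padic_val_def by auto
    moreover have "algebraic (gamma_period q m bar \<psi> \<mu> B \<nu> f \<theta> u)"
    proof -
      have q1: "of_nat q ^ 2 - 1 \<noteq> (0::complex)"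
      proof
        assume "of_nat q ^ 2 - 1 = (0::complex)"
        then have "of_nat (q ^ 2) = (of_nat 1 :: complex)" by simp
        then have "q ^ 2 = 1" by (simp only: of_nat_eq_iff)
        moreover have "3 * 3 \<le> q * q" using q_ge_3 by (intro mult_le_mono)
        ultimately show False by (simp add: power2_eq_square)
      qed
      then have "gamma_period q m bar \<psi> \<mu> B \<nu> f \<theta> u = 1 / (of_nat q ^ 2 - 1) * ?G" by simp
      \<comment> \<open>Dividing by q^2 - 1 may lead out of \<open>cyc q\<close>, but stays in the
        rational span of roots of unity, where algebraicity is still known.\<close>
      also have "1 / (of_nat q ^ 2 - 1) = (of_rat (1 / (of_nat q ^ 2 - 1)) :: complex)"
        by (simp add: of_rat_divide of_rat_diff of_rat_power)
      finally have "gamma_period q m bar \<psi> \<mu> B \<nu> f \<theta> u = of_rat (1 / (of_nat q ^ 2 - 1)) * ?V" unfolding g .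
      then show ?thesis using algebraic_cyc_scale[OF Vc] by metis
    qed
    ultimately show ?thesis using adm_admissible[OF a] by blast
  qed
  obtain u w where a: "adm u w" using adm_exists by blast
  obtain u' w' where a': "adm u' w'" "stat_value u w = stat_value u' w' * psi1 2" using adm_shift[OF a] .
  define z where "z = psi1 2"
  have zc: "z \<in> cyc q" using psi1_2_power p_gt_0(2) unfolding z_def by (rule cyc.root)
  have "\<not> (absv (e (1 + stat_value u w)) < 1 \<and> absv (e (1 + stat_value u' w')) < 1)"
  proof
    assume lt: "absv (e (1 + stat_value u w)) < 1 \<and> absv (e (1 + stat_value u' w')) < 1"
    have c: "1 + stat_value u w \<in> cyc q" "1 + stat_value u' w' \<in> cyc q"
      using stat_value_cyc a a'(1) by (auto intro: cyc.add cyc_1)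
    have "1 - z = (1 + stat_value u w) + (- z) * (1 + stat_value u' w')" unfolding a'(2) z_def by (simp add: algebra_simps)
    then have "e (1 - z) = e (1 + stat_value u w) + e (- z) * e (1 + stat_value u' w')"
      using eb(1)[OF c(1) cyc.mult[OF cyc_minus[OF zc] c(2)]] eb(2)[OF cyc_minus[OF zc] c(2)] by (simp only:)
    moreover have "absv (e (- z) * e (1 + stat_value u' w')) < 1"
    proof -
      have "absv (e (- z)) * absv (e (1 + stat_value u' w')) \<le> 1 * absv (e (1 + stat_value u' w'))"
        using eb(4)[OF cyc_minus[OF zc]] by (intro mult_right_mono) auto
      then show ?thesis using lt by (simp add: L.absv_mult)
    qed
    ultimately have "absv (e (1 - z)) < 1"
      using L.absv_add[of "e (1 + stat_value u w)" "e (- z) * e (1 + stat_value u' w')"] lt by auto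
    moreover have "absv (e (1 - z)) = 1"
      using L.one_minus_root_unit[OF e prime_p l(2)[symmetric]] psi1_2_power psi1_2 unfolding z_def by blast
    ultimately show False by simp
  qed
  then show ?thesis using core[OF a] core[OF a'(1)] by blast
qed

end

theorem theorem1p11:
  fixes q m :: nat
    and bar :: "'k::{field_char_0,complete_space} \<Rightarrow> 'k"
    and lam \<psi> :: "'k \<Rightarrow> complex"
    and \<mu> :: "'k measure"
    and \<nu> :: "'k set measure"
    and B :: "('k \<Rightarrow> 'k \<Rightarrow> complex) \<Rightarrow> ('k \<Rightarrow> 'k \<Rightarrow> complex) \<Rightarrow> complex"
    and f :: "'k \<Rightarrow> 'k \<Rightarrow> complex"
    and \<theta> :: 'k
  assumes "prime q" and "odd q"
    and "unramified_quadratic q bar"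
    and "mult_character lam"
    and "exp_conductor q lam = m" and "m \<ge> 2"
    and "\<forall>x\<in>Qp - {0}. lam x = eta bar x"
    and "unramified_add_character q \<psi>"
    and "normalized_add_haar \<mu>"
    and "newform q (2 * m) bar \<psi> \<mu> lam f"
    and "invariant_hermitian bar \<psi> \<mu> lam B"
    and "torus_haar \<nu>"
    and "absv \<theta> = 1" and "bar \<theta> = - \<theta>"
  shows "(\<exists>u. admissible_u \<theta> u \<and> gamma_period q m bar \<psi> \<mu> B \<nu> f \<theta> u \<noteq> 0) \<and>
    (\<forall>(l::nat) (e :: complex \<Rightarrow> 'l::{field_char_0,alg_closed_field,complete_space}).
       prime l \<longrightarrow> l \<noteq> q \<longrightarrow> (odd m \<longrightarrow> log (real l) (real q + 1) \<ge> 5) \<longrightarrow>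
       complex_padic l TYPE('l) \<longrightarrow> algebraic_embedding e \<longrightarrow>
       (\<exists>u. admissible_u \<theta> u \<and>
            algebraic (gamma_period q m bar \<psi> \<mu> B \<nu> f \<theta> u) \<and>
            padic_val l (e ((of_nat q ^ 2 - 1) * gamma_period q m bar \<psi> \<mu> B \<nu> f \<theta> u)) = 0))"
proof -
  interpret newform_setup q "TYPE('k)" bar \<theta> \<mu> lam \<psi> m f B
    using assms by unfold_locales (auto simp: unramified_quadratic_def)
  show ?thesis
    using period_nonzero[OF \<open>torus_haar \<nu>\<close>] period_unit[OF \<open>torus_haar \<nu>\<close>] by blast
qed

end
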